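(* There is a randomized distributed algorithm that, given a $k$-edge-connected weighted $n$-vertex graph $G$ of diameter $D=O(1)$, with $k=\Omega(\log n)$, such that the nodes know an $O(\log n)$-approximation of $k$, computes a minimum spanning tree of $G$ in $\widetilde{O}\left(\min\left\{\sqrt{n/k}+n^{D/(2D+1)},\ n/k\right\}\right)$ rounds with high probability.
   Context: Distributed algorithms are in the standard CONGEST model: the input graph $G$ (simple, edge-weighted) is the communication network; each node has a processor with a unique ID of $O(\log n)$ bits; execution proceeds in synchronous rounds, and in every round each node can send a message of $O(\log n)$ bits to each of its neighbors. The diameter $D$ is the unweighted (hop) diameter. $\widetilde{O}$ hides factors polylogarithmic in $n$. "With high probability" means with probability at least $1-1/n^c$ for some constant $c$. Computing a minimum spanning tree (MST) means that each node learns which of its incident edges belong to the MST.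
   Formalization: Edge weights are assumed to be integers of absolute value at most n^b for an arbitrary constant b (O(log n) bits, the usual CONGEST convention); for arbitrarily large weights, comparing two weights with O(log n)-bit messages cannot be done within the stated round bound. *)

theory Defs
  imports "HOL-Probability.Product_PMF"
begin

section \<open>Weighted simple graphs\<close>

text \<open>
  A vertex is identified with its unique ID, so the vertex set is a set of natural numbers;
  an edge is a two-element set of vertices. Only the values of \<open>weight\<close> on \<open>edges\<close> matter.
\<close>

record wgraph =
  nodes :: "nat set"
  edges :: "nat set set"
  weight :: "nat set \<Rightarrow> int"

definition simple_graph :: "wgraph \<Rightarrow> bool" where
  "simple_graph G \<longleftrightarrow> finite (nodes G) \<and> (\<forall>e \<in> edges G. e \<subseteq> nodes G \<and> card e = 2)"

abbreviation size_of :: "wgraph \<Rightarrow> nat" where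
  "size_of G \<equiv> card (nodes G)"

definition adjacency :: "nat set set \<Rightarrow> nat rel" where
  "adjacency F = {(u, v). {u, v} \<in> F}"

definition connects :: "nat set set \<Rightarrow> nat set \<Rightarrow> bool" where
  "connects F V \<longleftrightarrow> V \<noteq> {} \<and> (\<forall>u \<in> V. \<forall>v \<in> V. (u, v) \<in> (adjacency F)\<^sup>*)"

definition edge_connected :: "nat \<Rightarrow> wgraph \<Rightarrow> bool" where
  "edge_connected k G \<longleftrightarrow> size_of G \<ge> 2 \<and>
     (\<forall>F \<subseteq> edges G. card F < k \<longrightarrow> connects (edges G - F) (nodes G))"

text \<open>The hop distance and diameter are only meaningful in connected graphs.\<close>

definition hop_dist :: "wgraph \<Rightarrow> nat \<Rightarrow> nat \<Rightarrow> nat" where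
  "hop_dist G u v = (LEAST l. (u, v) \<in> adjacency (edges G) ^^ l)"

definition hop_diameter :: "wgraph \<Rightarrow> nat" where
  "hop_diameter G = Max ((\<lambda>(u, v). hop_dist G u v) ` (nodes G \<times> nodes G))"

definition is_cycle :: "nat set set \<Rightarrow> nat list \<Rightarrow> bool" where
  "is_cycle F p \<longleftrightarrow> length p \<ge> 3 \<and> distinct p \<and>
     (\<forall>i < length p. {p ! i, p ! (Suc i mod length p)} \<in> F)"

definition is_spanning_tree :: "wgraph \<Rightarrow> nat set set \<Rightarrow> bool" where
  "is_spanning_tree G T \<longleftrightarrow> T \<subseteq> edges G \<and> connects T (nodes G) \<and> (\<nexists>p. is_cycle T p)"

definition is_mst :: "wgraph \<Rightarrow> nat set set \<Rightarrow> bool" where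
  "is_mst G T \<longleftrightarrow> is_spanning_tree G T \<and>
     (\<forall>T'. is_spanning_tree G T' \<longrightarrow> sum (weight G) T \<le> sum (weight G) T')"

text \<open>IDs and edge weights have \<open>O(log n)\<close> bits: they are bounded by a polynomial in \<open>n\<close>.\<close>

definition poly_bounded :: "nat \<Rightarrow> wgraph \<Rightarrow> bool" where
  "poly_bounded b G \<longleftrightarrow> (\<forall>v \<in> nodes G. v \<le> size_of G ^ b) \<and>
     (\<forall>e \<in> edges G. \<bar>weight G e\<bar> \<le> int (size_of G) ^ b)"

section \<open>The CONGEST model\<close>

type_synonym message = "bool list"

text \<open>
  Initially a node knows its own ID, the IDs of its neighbours with the weights of the
  corresponding edges (\<open>incident u\<close> is \<open>None\<close> if \<open>u\<close> is not a neighbour), and a number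
  \<open>advice\<close> common to all nodes, here an approximation of the edge connectivity.
  It knows neither \<open>n\<close> nor \<open>D\<close>.
\<close>

record local_input =
  own_id :: nat
  incident :: "nat \<Rightarrow> int option"
  advice :: nat

text \<open>
  A history lists, for every past round, the outcome of the node's private coin and the messages
  received, indexed by the sender. The empty message stands for no message.
  Local computation is unrestricted, so instead of a state, which would require a fixed state
  type, the algorithm reacts to the entire history.
\<close>

type_synonym history = "(nat \<times> (nat \<Rightarrow> message)) list"

text \<open>
  In every round a node draws a coin from the distribution \<open>coin\<close> and sends to each
  neighbour \<open>u\<close> the message \<open>send i h r u\<close>, where \<open>r\<close> is that coin. When \<open>result\<close>
  is no longer \<open>None\<close>, the node has terminated with this result, the set of those of its
  incident edges that it selects.
\<close>

record congest_algorithm =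
  coin :: "local_input \<Rightarrow> history \<Rightarrow> nat pmf"
  send :: "local_input \<Rightarrow> history \<Rightarrow> nat \<Rightarrow> nat \<Rightarrow> message"
  result :: "local_input \<Rightarrow> history \<Rightarrow> nat set set option"

definition input_of :: "wgraph \<Rightarrow> nat \<Rightarrow> nat \<Rightarrow> local_input" where
  "input_of G a v = \<lparr>own_id = v,
     incident = (\<lambda>u. if {u, v} \<in> edges G then Some (weight G {u, v}) else None),
     advice = a\<rparr>"

definition halted :: "congest_algorithm \<Rightarrow> wgraph \<Rightarrow> nat \<Rightarrow> (nat \<Rightarrow> history) \<Rightarrow> nat \<Rightarrow> bool" where
  "halted A G a H v \<longleftrightarrow> result A (input_of G a v) (H v) \<noteq> None"

definition inbox ::
  "congest_algorithm \<Rightarrow> wgraph \<Rightarrow> nat \<Rightarrow> (nat \<Rightarrow> history) \<Rightarrow> (nat \<Rightarrow> nat) \<Rightarrow> nat \<Rightarrow> nat \<Rightarrow> message"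
where
  "inbox A G a H R v u =
     (if {u, v} \<in> edges G \<and> \<not> halted A G a H u
      then send A (input_of G a u) (H u) (R u) v else [])"

text \<open>
  One synchronous round, from the histories \<open>H\<close> and with the coins \<open>R\<close>. Terminated nodes
  are silent and frozen, so that outputs are irrevocable.
\<close>

definition next_round ::
  "congest_algorithm \<Rightarrow> wgraph \<Rightarrow> nat \<Rightarrow> (nat \<Rightarrow> history) \<Rightarrow> (nat \<Rightarrow> nat) \<Rightarrow> nat \<Rightarrow> history"
where
  "next_round A G a H R v =
     (if v \<in> nodes G \<and> \<not> halted A G a H v then H v @ [(R v, inbox A G a H R v)] else H v)"

text \<open>The joint distribution of the histories after a number of rounds; coins are independent.\<close>

primrec run :: "congest_algorithm \<Rightarrow> wgraph \<Rightarrow> nat \<Rightarrow> nat \<Rightarrow> (nat \<Rightarrow> history) pmf" where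
  "run A G a 0 = return_pmf (\<lambda>_. [])"
| "run A G a (Suc t) = bind_pmf (run A G a t) (\<lambda>H.
     map_pmf (next_round A G a H) (Pi_pmf (nodes G) 0 (\<lambda>v. coin A (input_of G a v) (H v))))"

text \<open>In every possible execution, every message has at most \<open>B * log n\<close> bits.\<close>

definition respects_bandwidth :: "real \<Rightarrow> congest_algorithm \<Rightarrow> wgraph \<Rightarrow> nat \<Rightarrow> bool" where
  "respects_bandwidth B A G a \<longleftrightarrow>
     (\<forall>t. \<forall>H \<in> set_pmf (run A G a t). \<forall>v \<in> nodes G. \<forall>(r, received) \<in> set (H v). \<forall>u.
        real (length (received u)) \<le> B * log 2 (size_of G))"

text \<open>
  All nodes have terminated, and each one outputs exactly its incident edges in a common
  minimum spanning tree (which need not be unique, as weights may coincide).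
\<close>

definition mst_computed :: "congest_algorithm \<Rightarrow> wgraph \<Rightarrow> nat \<Rightarrow> (nat \<Rightarrow> history) \<Rightarrow> bool" where
  "mst_computed A G a H \<longleftrightarrow> (\<exists>T. is_mst G T \<and>
     (\<forall>v \<in> nodes G. result A (input_of G a v) (H v) = Some {e \<in> T. v \<in> e}))"

definition computes_mst_within ::
  "congest_algorithm \<Rightarrow> wgraph \<Rightarrow> nat \<Rightarrow> real \<Rightarrow> real \<Rightarrow> bool"
where
  "computes_mst_within A G a rounds q \<longleftrightarrow>
     (\<exists>t. real t \<le> rounds \<and> measure_pmf.prob (run A G a t) {H. mst_computed A G a H} \<ge> q)"

definition approximates :: "real \<Rightarrow> nat \<Rightarrow> nat \<Rightarrow> bool" where
  "approximates f a k \<longleftrightarrow> real a \<le> f * real k \<and> real k \<le> f * real a"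

end

theory Submission
  imports Defs "HOL-Library.List_Lexorder" "HOL-Library.Nat_Bijection"
begin

text \<open>
  Every edge receives one of \<open>K\<close> colours at random. With high probability all colour classes
  contain connected spanning subgraphs of small radius \<open>d\<close>: sampling the edges in \<open>O(log n)\<close>
  rounds, the components of a class double in every round, since at least \<open>k\<close> edges leave each of
  them. Once the class is connected, the minimum degree \<open>k\<close> makes its balls double until they have
  about \<open>k\<close> nodes, which bounds \<open>d\<close> by \<open>n / K\<close>; climbing down a breadth-first tree of height
  \<open>D\<close> level by level bounds \<open>d\<close> by \<open>K ^ D\<close>, in both cases up to logarithmic factors.

  Minimum spanning forest fragments are grown by Boruvka steps inside the fragments until they have
  more than \<open>S\<close> nodes, in about \<open>S\<close> rounds. The remaining Boruvka steps are simulated by every node: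
  the lightest edges leaving the at most \<open>n / S\<close> fragments are distributed evenly among the colours
  and flooded through the colour classes, in about \<open>n / (K * S) + d\<close> rounds.

  Up to logarithmic factors, \<open>K = k\<close>, \<open>S = 0\<close> gives \<open>n / k\<close> rounds, and the smaller of \<open>k\<close> and
  \<open>n powr (1 / (2 * D + 1))\<close> for \<open>K\<close> with \<open>S = sqrt (n / K)\<close> gives the other bound. The nodes test
  whether the radii are small, so that bad luck affects only the running time.
\<close>

subsection \<open>Connectivity\<close>

text \<open>With \<open>K\<close> colours and fragments of more than \<open>S\<close> nodes the cost
  is about S + n / (K * S) + d, where d is at most about K ^ D. The choice S = sqrt (n / K) balances
  the first two terms, and sqrt (n / K) = K ^ D holds exactly for K = n powr (1 / (2 * D + 1)); this
  is the origin of the exponent D / (2 * D + 1). The obstacle is that nodes know neither n nor D,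
  and k only up to a logarithmic factor. So no node decides between the two bounds: the nodes elect
  a leader by guessing a radius, measure n and the eccentricity of the leader, and minimise an
  explicit cost over all admissible parameters. The analysis then exhibits one good pair of
  parameters for each bound, and the eccentricity, being at most D, may stand in for D. Only the
  colours are random; symmetry between fragments is broken by identifier bits. Since local
  computation is free and ties between weights are broken consistently, nodes that hold the same
  data compute the same Boruvka step without further communication.\<close>

abbreviation linked :: "nat set set \<Rightarrow> nat \<Rightarrow> nat \<Rightarrow> bool" where
  "linked F u v \<equiv> (u, v) \<in> (adjacency F)\<^sup>*"

lemma sym_adjacency: "sym (adjacency F)"
  by (auto simp: adjacency_def sym_def insert_commute)

lemma linked_sym: "linked F u v \<Longrightarrow> linked F v u"
  using sym_adjacency sym_rtrancl symD by metis

lemma linked_trans [trans]: "linked F u v \<Longrightarrow> linked F v w \<Longrightarrow> linked F u w"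
  by simp

lemma linked_edge: "{u, v} \<in> F \<Longrightarrow> linked F u v"
  by (auto simp: adjacency_def)

lemma linked_mono: "F \<subseteq> F' \<Longrightarrow> linked F u v \<Longrightarrow> linked F' u v"
  by (rule subsetD[OF rtrancl_mono]) (auto simp: adjacency_def)

lemma linked_induct [consumes 1, case_names refl step]:
  assumes "linked F u v" "P u" "\<And>x y. linked F u x \<Longrightarrow> {x, y} \<in> F \<Longrightarrow> P x \<Longrightarrow> P y"
  shows "P v"
  using assms by (induction rule: rtrancl_induct) (auto simp: adjacency_def)

lemma linked_subst:
  assumes "linked F u v" "\<And>x y. {x, y} \<in> F \<Longrightarrow> linked F' x y"
  shows "linked F' u v"
  using assms(1) by (induction rule: linked_induct) (auto dest: assms(2))

lemma linked_invariant:
  assumes "linked F u v" "\<And>x y. {x, y} \<in> F \<Longrightarrow> f x = f y"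
  shows "f u = f v"
  using assms(1) by (induction rule: linked_induct) (auto dest: assms(2))

lemma linked_empty: "linked {} u v \<longleftrightarrow> u = v"
  by (auto elim: linked_induct)

lemma linked_crossing:
  assumes "linked F u v" "u \<in> U" "v \<notin> U"
  shows "\<exists>x y. {x, y} \<in> F \<and> x \<in> U \<and> y \<notin> U"
  using linked_invariant[OF assms(1), of "\<lambda>x. x \<in> U"] assms(2,3) by (metis insert_commute)

text \<open>A walk over the new edge can be cut at the first and the last use of it, which leaves
  walks in \<open>H\<close>; the last two cases are the directions in which the edge is crossed.
  Both the growth of forests and the edge exchange rest on this.\<close>

lemma linked_insert:
  assumes "linked (insert {x, y} H) a b"
  shows "linked H a b \<or> linked H a x \<and> linked H y b \<or> linked H a y \<and> linked H x b"
  using assms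
proof (induction rule: linked_induct)
  case (step p q)
  then consider "{p, q} = {x, y}" | "{p, q} \<in> H" by blast
  then show ?case
  proof cases
    case 1
    then have "p = x \<and> q = y \<or> p = y \<and> q = x" by (auto simp: doubleton_eq_iff)
    then show ?thesis using step.IH linked_sym linked_trans by blast
  next
    case 2
    then show ?thesis using step.IH linked_edge linked_trans by metis
  qed
qed auto

definition component :: "nat set set \<Rightarrow> nat \<Rightarrow> nat set" where
  "component F v = {u. linked F v u}"

lemma component_self [simp]: "v \<in> component F v"
  by (simp add: component_def)

lemma component_eq: "u \<in> component F v \<Longrightarrow> component F u = component F v"
  unfolding component_def using linked_sym linked_trans by blast

lemma component_mono: "F \<subseteq> F' \<Longrightarrow> component F v \<subseteq> component F' v"
  unfolding component_def using linked_mono by blast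

section \<open>Balls in hop distance\<close>

primrec hop_ball :: "nat set set \<Rightarrow> nat \<Rightarrow> nat \<Rightarrow> nat set" where
  "hop_ball F 0 v = {v}"
| "hop_ball F (Suc t) v = hop_ball F t v \<union> {u. \<exists>w \<in> hop_ball F t v. {w, u} \<in> F}"

lemma hop_ball_self [simp]: "v \<in> hop_ball F t v"
  by (induction t) auto

lemma hop_ball_mono: "s \<le> t \<Longrightarrow> hop_ball F s v \<subseteq> hop_ball F t v"
  by (rule lift_Suc_mono_le[of "\<lambda>t. hop_ball F t v"]) auto

lemma hop_ball_mono_edges: "F \<subseteq> F' \<Longrightarrow> hop_ball F t v \<subseteq> hop_ball F' t v"
  by (induction t) auto

lemma hop_ball_linked: "u \<in> hop_ball F t v \<Longrightarrow> linked F v u"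
proof (induction t arbitrary: u)
  case (Suc t)
  show ?case
  proof (cases "u \<in> hop_ball F t v")
    case False
    then obtain w where "w \<in> hop_ball F t v" "{w, u} \<in> F" using Suc.prems by auto
    then show ?thesis using Suc.IH linked_edge linked_trans by blast
  qed (rule Suc.IH)
qed auto

lemma hop_ball_trans: "w \<in> hop_ball F s v \<Longrightarrow> u \<in> hop_ball F t w \<Longrightarrow> u \<in> hop_ball F (s + t) v"
  by (induction t arbitrary: u) auto

lemma hop_ball_edge: "{v, u} \<in> F \<Longrightarrow> u \<in> hop_ball F 1 v"
  by auto

lemma hop_ball_sym: "u \<in> hop_ball F t v \<Longrightarrow> v \<in> hop_ball F t u"
proof (induction t arbitrary: u)
  case (Suc t)
  show ?case
  proof (cases "u \<in> hop_ball F t v")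
    case True
    then show ?thesis using Suc.IH hop_ball_mono[of t "Suc t"] by auto
  next
    case False
    then obtain w where w: "w \<in> hop_ball F t v" "{w, u} \<in> F" using Suc.prems by auto
    have "w \<in> hop_ball F 1 u" using w(2) by (intro hop_ball_edge) (simp add: insert_commute)
    then show ?thesis using hop_ball_trans[of w F 1 u v t] Suc.IH[OF w(1)] by simp
  qed
qed auto

text \<open>The ball is unrolled at its centre instead of its boundary. This is the form that
  flooding needs: in one round a node combines what its neighbours have collected from their own
  balls of radius \<open>t\<close>.\<close>

lemma hop_ball_Suc': "hop_ball F (Suc t) v = (\<Union>w \<in> hop_ball F 1 v. hop_ball F t w)"
proof
  show "hop_ball F (Suc t) v \<subseteq> (\<Union>w \<in> hop_ball F 1 v. hop_ball F t w)"
  proof (induction t)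
    case (Suc t)
    then show ?case by (subst hop_ball.simps) (auto 4 3)
  qed auto
  show "(\<Union>w \<in> hop_ball F 1 v. hop_ball F t w) \<subseteq> hop_ball F (Suc t) v"
    using hop_ball_trans[of _ F 1 v _ t] by auto
qed

lemma linked_hop_ball: "linked F v u \<Longrightarrow> \<exists>t. u \<in> hop_ball F t v"
proof (induction rule: linked_induct)
  case refl
  then show ?case by (intro exI[of _ 0]) simp
next
  case (step x y)
  then obtain t where "x \<in> hop_ball F t v" by blast
  then have "y \<in> hop_ball F (Suc t) v" using step by auto
  then show ?case by blast
qed

lemma hop_ball_subset_nodes:
  assumes "\<And>e. e \<in> F \<Longrightarrow> e \<subseteq> V" "v \<in> V"
  shows "hop_ball F t v \<subseteq> V"
proof (induction t)
  case (Suc t)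
  then show ?case using assms(1) by auto
qed (use assms in auto)

lemma component_subset_nodes:
  assumes "\<And>e. e \<in> F \<Longrightarrow> e \<subseteq> V" "v \<in> V"
  shows "component F v \<subseteq> V"
  using linked_hop_ball hop_ball_subset_nodes[OF assms] unfolding component_def by blast

lemma hop_ball_fixed: "hop_ball F (Suc t) v = hop_ball F t v \<Longrightarrow> component F v \<subseteq> hop_ball F t v"
  unfolding component_def
proof safe
  fix u assume eq: "hop_ball F (Suc t) v = hop_ball F t v" and "linked F v u"
  from this(2) show "u \<in> hop_ball F t v"
  proof (induction rule: linked_induct)
    case (step x y)
    then have "y \<in> hop_ball F (Suc t) v" by auto
    then show ?case unfolding eq .
  qed auto
qed

text \<open>A ball that stops growing is the whole component, so until then every step adds a node.
  Thus a fragment that reaches farther than \<open>S\<close> from its centre has more than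
  \<open>S\<close> nodes.\<close>

lemma hop_ball_growth:
  assumes "finite (component F v)"
  shows "component F v \<subseteq> hop_ball F t v \<or> t < card (hop_ball F t v)"
proof (induction t)
  case (Suc t)
  have fin: "finite (hop_ball F (Suc t) v)"
    by (rule finite_subset[OF _ assms]) (auto simp: component_def dest: hop_ball_linked simp del: hop_ball.simps)
  show ?case
  proof (cases "component F v \<subseteq> hop_ball F t v")
    case True
    then show ?thesis using hop_ball_mono[of t "Suc t" F v] by auto
  next
    case False
    then have "hop_ball F t v \<noteq> hop_ball F (Suc t) v" using hop_ball_fixed by blast
    then have "hop_ball F t v \<subset> hop_ball F (Suc t) v" using hop_ball_mono[of t "Suc t" F v] by auto
    then have "card (hop_ball F t v) < card (hop_ball F (Suc t) v)" using fin psubset_card_mono by blast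
    then show ?thesis using Suc.IH False by auto
  qed
qed simp

lemma hop_ball_eq_component: "component F v \<subseteq> hop_ball F t v \<Longrightarrow> hop_ball F t v = component F v"
  using hop_ball_linked by (auto simp: component_def)

section \<open>Doubling of components and labels for components\<close>

definition grown :: "nat set \<Rightarrow> nat set set \<Rightarrow> nat \<Rightarrow> bool" where
  "grown V F m \<longleftrightarrow> (\<forall>v \<in> V. component F v = V \<or> m \<le> card (component F v))"

text \<open>Boruvka's argument: the crossing edge leads to a disjoint component, and both have at
  least \<open>m\<close> nodes. Where the crossing edges come from is left open, because the lemma
  serves the deterministic merging of fragments as well as the random sampling of edges.\<close>

lemma grown_double:
  assumes V: "finite V" "\<And>e. e \<in> F' \<Longrightarrow> e \<subseteq> V" and "F \<subseteq> F'" "grown V F m"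
    and crossing: "\<And>v. v \<in> V \<Longrightarrow> component F v \<noteq> V \<Longrightarrow>
      \<exists>x y. {x, y} \<in> F' \<and> x \<in> component F v \<and> y \<notin> component F v"
  shows "grown V F' (2 * m)"
  unfolding grown_def
proof (intro ballI, cases)
  fix v assume v: "v \<in> V" and "component F v = V"
  then have "component F' v = V"
    using component_mono[OF \<open>F \<subseteq> F'\<close>, of v] component_subset_nodes[OF V(2) v] by auto
  then show "component F' v = V \<or> 2 * m \<le> card (component F' v)" ..
next
  fix v assume v: "v \<in> V" and ne: "component F v \<noteq> V"
  then obtain x y where xy: "{x, y} \<in> F'" "x \<in> component F v" "y \<notin> component F v" using crossing by blast
  have "y \<in> V" using V(2)[OF xy(1)] by auto
  have disj: "component F v \<inter> component F y = {}"
    using xy(3) component_eq[of _ F v] component_eq[of _ F y] component_self[of y F] by blast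
  have "y \<in> component F' v"
    using linked_trans[OF linked_mono[OF \<open>F \<subseteq> F'\<close>] linked_edge[OF xy(1)]] xy(2) by (simp add: component_def)
  then have sub: "component F v \<union> component F y \<subseteq> component F' v"
    using component_mono[OF \<open>F \<subseteq> F'\<close>] component_eq by blast
  have "component F y \<noteq> V" using disj component_self[of v F] v by blast
  then have "m \<le> card (component F v)" "m \<le> card (component F y)"
    using \<open>grown V F m\<close> v \<open>y \<in> V\<close> ne by (auto simp: grown_def)
  moreover have fin: "finite (component F' v)" using component_subset_nodes[OF V(2) v] V(1) finite_subset by blast
  then have "finite (component F v)" "finite (component F y)" using sub finite_subset by auto
  then have "card (component F v \<union> component F y) = card (component F v) + card (component F y)"
    using disj by (intro card_Un_disjoint)
  ultimately have "2 * m \<le> card (component F' v)" using card_mono[OF fin sub] by linarith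
  then show "component F' v = V \<or> 2 * m \<le> card (component F' v)" ..
qed

definition labels :: "nat set \<Rightarrow> nat set set \<Rightarrow> (nat \<Rightarrow> nat) \<Rightarrow> bool" where
  "labels V F c \<longleftrightarrow> (\<forall>u \<in> V. \<forall>v \<in> V. c u = c v \<longleftrightarrow> linked F u v)"

text \<open>The map \<open>g\<close> renames the labels after the edges \<open>D\<close> have been
  added. By \<open>inv\<close> it never separates what \<open>D\<close> joins; by \<open>con\<close>
  it identifies only labels that are connected in the quotient graph, whose vertices are the old
  labels.\<close>

lemma labels_merge:
  assumes "labels V F c" "\<And>e. e \<in> F \<union> D \<Longrightarrow> e \<subseteq> V"
    and inv: "\<And>u v. {u, v} \<in> D \<Longrightarrow> g (c u) = g (c v)"
    and con: "\<And>u v. u \<in> V \<Longrightarrow> v \<in> V \<Longrightarrow> g (c u) = g (c v) \<Longrightarrow>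
      (c u, c v) \<in> {(c a, c b) |a b. {a, b} \<in> D}\<^sup>*"
  shows "labels V (F \<union> D) (\<lambda>v. g (c v))"
  unfolding labels_def
proof (intro ballI iffI)
  fix u v assume uv: "u \<in> V" "v \<in> V" "linked (F \<union> D) u v"
  show "g (c u) = g (c v)"
    using uv(3)
  proof (rule linked_invariant[where f = "\<lambda>v. g (c v)"])
    fix x y assume xy: "{x, y} \<in> F \<union> D"
    then have "x \<in> V" "y \<in> V" using assms(2) by auto
    then show "g (c x) = g (c y)"
      using xy inv linked_edge assms(1) unfolding labels_def by (metis Un_iff)
  qed
next
  fix u v assume uv: "u \<in> V" "v \<in> V" "g (c u) = g (c v)"
  \<comment> \<open>Induction along a path of labels. The claim covers all vertices with the current
    label, because consecutive edges of the quotient graph need not share a vertex.\<close>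
  have "\<forall>v \<in> V. y = c v \<longrightarrow> linked (F \<union> D) u v" if "(c u, y) \<in> {(c a, c b) |a b. {a, b} \<in> D}\<^sup>*" for y
    using that
  proof (induction rule: rtrancl_induct)
    case base
    then show ?case using assms(1) uv linked_mono[of F "F \<union> D"] unfolding labels_def by auto
  next
    case (step y z)
    then obtain a b where ab: "y = c a" "z = c b" "{a, b} \<in> D" by auto
    then have "a \<in> V" "b \<in> V" using assms(2) by auto
    then have "linked (F \<union> D) u a" using step.IH ab by auto
    also have "linked (F \<union> D) a b" using ab by (intro linked_edge) auto
    finally have ub: "linked (F \<union> D) u b" .
    show ?case
    proof (intro ballI impI)
      fix w assume "w \<in> V" "z = c w"
      then have "linked F b w" using assms(1) ab \<open>b \<in> V\<close> unfolding labels_def by metis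
      then show "linked (F \<union> D) u w" using ub linked_mono[of F "F \<union> D" b w] linked_trans by blast
    qed
  qed
  then show "linked (F \<union> D) u v" using con uv by blast
qed

subsection \<open>Minimum spanning trees\<close>

definition forest :: "nat set set \<Rightarrow> bool" where
  "forest F \<longleftrightarrow> (\<forall>u v. {u, v} \<in> F \<longrightarrow> \<not> linked (F - {{u, v}}) u v)"

lemma forest_subset: "forest F \<Longrightarrow> F' \<subseteq> F \<Longrightarrow> forest F'"
  unfolding forest_def by (meson Diff_mono linked_mono order_refl subsetD)

lemma forest_insert:
  assumes "forest H" "\<not> linked H u v"
  shows "forest (insert {u, v} H)"
  unfolding forest_def
proof (intro allI impI notI)
  fix a b assume ab: "{a, b} \<in> insert {u, v} H" "linked (insert {u, v} H - {{a, b}}) a b"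
  show False
  proof (cases "{a, b} = {u, v}")
    case True
    then have "linked H a b" using ab(2) linked_mono[of "insert {u, v} H - {{a, b}}" H] by auto
    moreover have "a = u \<and> b = v \<or> a = v \<and> b = u" using True by (auto simp: doubleton_eq_iff)
    ultimately show False using assms(2) linked_sym by blast
  next
    case False
    then have H: "{a, b} \<in> H" using ab by auto
    have "insert {u, v} H - {{a, b}} = insert {u, v} (H - {{a, b}})" using False by auto
    then have "linked (insert {u, v} (H - {{a, b}})) a b" using ab(2) by simp
    moreover have "\<not> linked (H - {{a, b}}) a b" using assms(1) H unfolding forest_def by blast
    ultimately have "linked (H - {{a, b}}) a u \<and> linked (H - {{a, b}}) v b \<or>
        linked (H - {{a, b}}) a v \<and> linked (H - {{a, b}}) u b"
      using linked_insert by blast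
    then have "linked H a u \<and> linked H v b \<or> linked H a v \<and> linked H u b"
      using linked_mono[of "H - {{a, b}}" H] by blast
    then show False using linked_edge[OF H] linked_sym linked_trans assms(2) by metis
  qed
qed

text \<open>A simple path results from cutting the path back whenever the next vertex already lies
  on it. Distinctness matters because the cycles of the specification have distinct
  vertices.\<close>

lemma linked_path:
  assumes "linked F u v"
  shows "\<exists>p. p \<noteq> [] \<and> hd p = u \<and> last p = v \<and> distinct p \<and>
    (\<forall>i. Suc i < length p \<longrightarrow> {p ! i, p ! Suc i} \<in> F)"
  using assms
proof (induction rule: linked_induct)
  case refl
  show ?case by (intro exI[of _ "[u]"]) auto
next
  case (step x y)
  then obtain p where p: "p \<noteq> []" "hd p = u" "last p = x" "distinct p"
    "\<forall>i. Suc i < length p \<longrightarrow> {p ! i, p ! Suc i} \<in> F" by blast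
  show ?case
  proof (cases "y \<in> set p")
    case True
    then obtain j where j: "j < length p" "p ! j = y" by (auto simp: in_set_conv_nth)
    let ?q = "take (Suc j) p"
    have "last ?q = y" using j by (simp add: take_Suc_conv_app_nth)
    moreover have "hd ?q = u" using p by (cases p) auto
    ultimately show ?thesis using p j by (intro exI[of _ ?q]) auto
  next
    case False
    have "{(p @ [y]) ! i, (p @ [y]) ! Suc i} \<in> F" if "Suc i < length (p @ [y])" for i
    proof (cases "Suc i < length p")
      case True
      then show ?thesis using p(5) by (auto simp: nth_append)
    next
      case False
      then have "i = length p - 1" "i < length p" using that p(1) by auto
      then show ?thesis using step.hyps p by (auto simp: nth_append last_conv_nth)
    qed
    then show ?thesis using p False by (intro exI[of _ "p @ [y]"]) auto
  qed
qed

text \<open>\<open>forest\<close> says that every edge is a bridge, which is convenient for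
  insertions and exchanges; here it is translated into the cycles of the specification. Without its
  closing edge a cycle is still a path between the ends of that edge, and conversely a simple path
  around an edge closes up to a cycle.\<close>

lemma forest_iff_no_cycle:
  assumes "\<And>e. e \<in> F \<Longrightarrow> card e = 2"
  shows "forest F \<longleftrightarrow> (\<nexists>p. is_cycle F p)"
proof (intro iffI notI)
  assume F: "forest F" and "\<exists>p. is_cycle F p"
  then obtain p where p: "3 \<le> length p" "distinct p"
    "\<And>i. i < length p \<Longrightarrow> {p ! i, p ! (Suc i mod length p)} \<in> F"
    by (auto simp: is_cycle_def)
  define m where "m = length p - 1"
  let ?e = "{p ! m, p ! 0}"
  have "m < length p" "Suc m = length p" using p(1) by (auto simp: m_def)
  then have e: "?e \<in> F" using p(3)[of m] by simp
  have "linked (F - {?e}) (p ! 0) (p ! i)" if "i \<le> m" for i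
    using that
  proof (induction i)
    case (Suc i)
    then have "{p ! i, p ! Suc i} \<in> F" using p(3)[of i] by (simp add: m_def)
    moreover have "{p ! i, p ! Suc i} \<noteq> ?e"
      using p(1) Suc.prems \<open>m < length p\<close> \<open>Suc m = length p\<close>
        nth_eq_iff_index_eq[OF p(2), of i 0] nth_eq_iff_index_eq[OF p(2), of i m]
        nth_eq_iff_index_eq[OF p(2), of "Suc i" m]
      by (cases "length p") (auto simp: doubleton_eq_iff)
    ultimately have "linked (F - {?e}) (p ! i) (p ! Suc i)" by (intro linked_edge) auto
    then show ?case using Suc linked_trans Suc_leD by blast
  qed auto
  then have "linked (F - {?e}) (p ! m) (p ! 0)" using linked_sym by blast
  then show False using F e unfolding forest_def by blast
next
  assume nc: "\<nexists>p. is_cycle F p"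
  show "forest F"
    unfolding forest_def
  proof (intro allI impI notI)
    fix u v assume uv: "{u, v} \<in> F" and "linked (F - {{u, v}}) u v"
    then obtain p where p: "p \<noteq> []" "hd p = u" "last p = v" "distinct p"
      "\<forall>i. Suc i < length p \<longrightarrow> {p ! i, p ! Suc i} \<in> F - {{u, v}}"
      using linked_path by blast
    have "u \<noteq> v" using assms[OF uv] by auto
    have p0: "p ! 0 = u" "p ! (length p - 1) = v" using p by (auto simp: hd_conv_nth last_conv_nth)
    \<comment> \<open>One vertex would make the edge a loop, and two vertices would make the path
      consist of the very edge that was removed.\<close>
    have "length p \<noteq> 1" using p0 \<open>u \<noteq> v\<close> by auto
    moreover have "length p \<noteq> 2" using p0 p(5)[rule_format, of 0] by auto
    moreover have "length p \<noteq> 0" using p by auto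
    ultimately have len: "3 \<le> length p" by linarith
    have "{p ! i, p ! (Suc i mod length p)} \<in> F" if "i < length p" for i
    proof (cases "Suc i < length p")
      case False
      then have "Suc i = length p" using that by simp
      then have "i = length p - 1" "Suc i mod length p = 0" by auto
      then show ?thesis using p0 uv by (auto simp: insert_commute)
    qed (use p(5) in auto)
    then have "is_cycle F p" using len p(4) by (simp add: is_cycle_def)
    then show False using nc by blast
  qed
qed

section \<open>The minimum spanning tree and its optimality\<close>

lemma simple_graph_edge:
  assumes "simple_graph G" "e \<in> edges G"
  obtains u v where "e = {u, v}" "u < v" "u \<in> nodes G" "v \<in> nodes G"
proof -
  have "card e = 2" "e \<subseteq> nodes G" using assms by (auto simp: simple_graph_def)
  then obtain x y where "e = {x, y}" "x \<noteq> y" by (auto simp: card_2_iff)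
  then show ?thesis using that[of x y] that[of y x] \<open>e \<subseteq> nodes G\<close>
    by (cases "x < y") (auto simp: insert_commute)
qed

lemma finite_edges: "simple_graph G \<Longrightarrow> finite (edges G)"
  by (rule finite_subset[of _ "Pow (nodes G)"]) (auto simp: simple_graph_def)

lemma edge_irrefl: "simple_graph G \<Longrightarrow> {u, v} \<in> edges G \<Longrightarrow> u \<noteq> v"
  by (auto simp: simple_graph_def)

lemma edge_nodes: "simple_graph G \<Longrightarrow> {u, v} \<in> edges G \<Longrightarrow> u \<in> nodes G \<and> v \<in> nodes G"
  by (auto simp: simple_graph_def)

text \<open>Ordering the edges by weight, with ties broken by the end points, makes the minimum
  spanning tree unique.\<close>

definition edge_key :: "wgraph \<Rightarrow> nat set \<Rightarrow> int list" where
  "edge_key G e = [weight G e, int (Min e), int (Max e)]"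

lemma edge_key_doubleton: "edge_key G {u, v} = [weight G {u, v}, int (min u v), int (max u v)]"
  by (simp add: edge_key_def)

lemma edge_key_inj:
  assumes "simple_graph G" "e \<in> edges G" "f \<in> edges G" "edge_key G e = edge_key G f"
  shows "e = f"
proof -
  obtain u v where e: "e = {u, v}" "u < v" by (rule simple_graph_edge[OF assms(1,2)])
  obtain x y where f: "f = {x, y}" "x < y" by (rule simple_graph_edge[OF assms(1,3)])
  show ?thesis using assms(4) e f by (simp add: edge_key_doubleton)
qed

lemma edge_key_le_weight: "edge_key G e \<le> edge_key G f \<Longrightarrow> weight G e \<le> weight G f"
  by (auto simp: edge_key_def)

definition lighter :: "wgraph \<Rightarrow> nat set \<Rightarrow> nat set set" where
  "lighter G e = {f \<in> edges G. edge_key G f < edge_key G e}"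

text \<open>Kruskal's criterion: an edge is kept unless lighter edges already join its ends. It
  involves no order of processing, so membership of an edge can be established from a single
  cut.\<close>

definition mst_edges :: "wgraph \<Rightarrow> nat set set" where
  "mst_edges G = {e \<in> edges G. \<forall>u v. e = {u, v} \<longrightarrow> \<not> linked (lighter G e) u v}"

lemma mst_edges_subset: "mst_edges G \<subseteq> edges G"
  by (auto simp: mst_edges_def)

lemma lightest_crossing_in_mst_edges:
  assumes "{a, b} \<in> edges G" "a \<in> U" "b \<notin> U"
    and least: "\<And>x y. {x, y} \<in> edges G \<Longrightarrow> x \<in> U \<Longrightarrow> y \<notin> U \<Longrightarrow> edge_key G {a, b} \<le> edge_key G {x, y}"
  shows "{a, b} \<in> mst_edges G"
proof -
  have "\<not> linked (lighter G {a, b}) a b"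
  proof
    assume "linked (lighter G {a, b}) a b"
    then obtain x y where "{x, y} \<in> lighter G {a, b}" "x \<in> U" "y \<notin> U"
      using linked_crossing assms(2,3) by blast
    then show False using least[of x y] by (auto simp: lighter_def)
  qed
  moreover have "\<not> linked (lighter G {a, b}) b a" using calculation linked_sym by blast
  ultimately show ?thesis
    using assms(1) by (auto simp: mst_edges_def doubleton_eq_iff insert_commute)
qed

text \<open>The order of the keys is not well-founded on all integer lists, so the induction runs
  over the number of elements of \<open>A\<close> below \<open>x\<close>.\<close>

lemma finite_measure_induct:
  fixes f :: "'a \<Rightarrow> 'b :: linorder"
  assumes "finite A" "x \<in> A"
    and "\<And>x. x \<in> A \<Longrightarrow> (\<And>y. y \<in> A \<Longrightarrow> f y < f x \<Longrightarrow> P y) \<Longrightarrow> P x"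
  shows "P x"
  using assms(2)
proof (induction "card {y \<in> A. f y < f x}" arbitrary: x rule: less_induct)
  case less
  show ?case
  proof (rule assms(3)[OF less.prems])
    fix y assume y: "y \<in> A" "f y < f x"
    then have "{z \<in> A. f z < f y} \<subset> {z \<in> A. f z < f x}" by auto
    then show "P y" using less.hyps y assms(1) by (simp add: psubset_card_mono)
  qed
qed

text \<open>The bottleneck property: tree edges that are not heavier join the ends of any edge. An
  edge outside the tree is bypassed by lighter edges, to which the induction on the keys
  applies.\<close>

lemma mst_edges_linked:
  assumes "simple_graph G" "{u, v} \<in> edges G"
  shows "linked {e \<in> mst_edges G. edge_key G e \<le> edge_key G {u, v}} u v"
proof -
  have "\<forall>u v. e = {u, v} \<longrightarrow> linked {f \<in> mst_edges G. edge_key G f \<le> edge_key G e} u v"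
    if "e \<in> edges G" for e
  proof (rule finite_measure_induct[where f = "edge_key G", OF finite_edges[OF assms(1)] that], intro allI impI)
    fix e u v assume e: "e \<in> edges G" "e = {u, v}"
      and IH: "\<And>f. f \<in> edges G \<Longrightarrow> edge_key G f < edge_key G e \<Longrightarrow>
        \<forall>u v. f = {u, v} \<longrightarrow> linked {h \<in> mst_edges G. edge_key G h \<le> edge_key G f} u v"
    show "linked {f \<in> mst_edges G. edge_key G f \<le> edge_key G e} u v"
    proof (cases "e \<in> mst_edges G")
      case True
      then show ?thesis using e by (intro linked_edge) auto
    next
      case False
      then obtain a b where ab: "e = {a, b}" "linked (lighter G e) a b"
        using e(1) unfolding mst_edges_def by blast
      have "linked {f \<in> mst_edges G. edge_key G f \<le> edge_key G e} a b"
        using ab(2)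
      proof (rule linked_subst)
        fix x y assume "{x, y} \<in> lighter G e"
        then have "{x, y} \<in> edges G" "edge_key G {x, y} < edge_key G e" by (auto simp: lighter_def)
        then show "linked {f \<in> mst_edges G. edge_key G f \<le> edge_key G e} x y"
          using IH[of "{x, y}"] linked_mono[of "{f \<in> mst_edges G. edge_key G f \<le> edge_key G {x, y}}"
            "{f \<in> mst_edges G. edge_key G f \<le> edge_key G e}" x y] by fastforce
      qed
      moreover have "a = u \<and> b = v \<or> a = v \<and> b = u" using ab(1) e(2) by (auto simp: doubleton_eq_iff)
      ultimately show ?thesis using linked_sym by blast
    qed
  qed
  then show ?thesis using assms(2) by blast
qed

text \<open>The heaviest edge of a set of tree edges cannot close a cycle with the others: these are
  lighter, and lighter edges do not join its ends. Taking it away gives the induction.\<close>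

lemma forest_mst_edges:
  assumes "simple_graph G"
  shows "forest (mst_edges G)"
proof -
  have fin: "finite (mst_edges G)" using finite_edges[OF assms] mst_edges_subset finite_subset by blast
  have "forest A" if "A \<subseteq> mst_edges G" "\<And>e f. e \<in> A \<Longrightarrow> f \<in> mst_edges G \<Longrightarrow> edge_key G f < edge_key G e \<Longrightarrow> f \<in> A" for A
    using finite_subset[OF that(1) fin] that
  proof (induction "card A" arbitrary: A)
    case 0
    then show ?case by (simp add: forest_def)
  next
    case (Suc n)
    then have "finite (edge_key G ` A)" "edge_key G ` A \<noteq> {}" by auto
    then obtain e where e: "e \<in> A" "edge_key G e = Max (edge_key G ` A)"
      using Max_in by (metis imageE)
    then have e_max: "edge_key G f \<le> edge_key G e" if "f \<in> A" for f
      using \<open>finite (edge_key G ` A)\<close> that by simp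
    have sub: "A - {e} \<subseteq> lighter G e"
    proof
      fix f assume f: "f \<in> A - {e}"
      then have "f \<in> edges G" "e \<in> edges G" using Suc.prems(2) e(1) mst_edges_subset by auto
      then have "edge_key G f \<noteq> edge_key G e" using edge_key_inj[OF assms] f by blast
      then show "f \<in> lighter G e" using e_max f \<open>f \<in> edges G\<close> by (auto simp: lighter_def less_le)
    qed
    have "e \<in> mst_edges G" using e Suc.prems by auto
    then obtain u v where uv: "e = {u, v}" using simple_graph_edge[OF assms] mst_edges_subset by blast
    have "\<not> linked (lighter G e) u v" using \<open>e \<in> mst_edges G\<close> uv by (auto simp: mst_edges_def)
    then have nl: "\<not> linked (A - {e}) u v" using sub linked_mono by blast
    have "forest (A - {e})"
    proof (rule Suc.hyps(1))
      show "n = card (A - {e})" using Suc.hyps(2) e(1) Suc.prems(1) by simp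
      show "A - {e} \<subseteq> mst_edges G" "finite (A - {e})" using Suc.prems by auto
      show "g \<in> A - {e}" if "f \<in> A - {e}" "g \<in> mst_edges G" "edge_key G g < edge_key G f" for f g
        using Suc.prems(3)[of f g] that e_max[of f] by auto
    qed
    from forest_insert[OF this nl] show ?case using uv e(1) by (simp add: insert_absorb)
  qed
  from this[of "mst_edges G"] show ?thesis by auto
qed

lemma linked_mst_edges:
  assumes "simple_graph G" "linked (edges G) u v"
  shows "linked (mst_edges G) u v"
  using assms(2)
proof (rule linked_subst)
  show "linked (mst_edges G) x y" if "{x, y} \<in> edges G" for x y
    using linked_mono[OF _ mst_edges_linked[OF assms(1) that], of "mst_edges G"] by auto
qed

text \<open>A further edge of the forest would have ends that are already joined in
  \<open>T\<close>. Hence a growing part of the tree is complete as soon as it is connected.\<close>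

lemma forest_connected_eq:
  assumes "forest F" "T \<subseteq> F" "\<And>e. e \<in> F \<Longrightarrow> \<exists>u v. e = {u, v} \<and> u \<in> V \<and> v \<in> V" "connects T V"
  shows "T = F"
proof (rule ccontr)
  assume "T \<noteq> F"
  then obtain e where e: "e \<in> F" "e \<notin> T" using assms(2) by blast
  then obtain u v where uv: "e = {u, v}" "u \<in> V" "v \<in> V" using assms(3) by blast
  then have "linked T u v" using assms(4) by (auto simp: connects_def)
  then have "linked (F - {{u, v}}) u v" using e uv assms(2) by (auto intro: linked_mono[rotated])
  then show False using assms(1) e uv unfolding forest_def by blast
qed

text \<open>Without {x, y} the tree \<open>T\<close> falls into two sides. The connection from x to
  y in \<open>S\<close> must leave the side of x somewhere, and the edge that it uses there
  reconnects the sides.\<close>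

lemma exchange_edge:
  assumes "forest T" "connects T V" "{x, y} \<in> T" "\<And>e. e \<in> T \<Longrightarrow> e \<subseteq> V" "{x, y} \<notin> S" "linked S x y"
  shows "\<exists>u v. {u, v} \<in> S \<and> {u, v} \<notin> T \<and> (u \<in> V \<longrightarrow> v \<in> V \<longrightarrow>
    forest (insert {u, v} (T - {{x, y}})) \<and> connects (insert {u, v} (T - {{x, y}})) V)"
proof -
  let ?T = "T - {{x, y}}"
  have nxy: "\<not> linked ?T x y" using assms(1,3) unfolding forest_def by blast
  then obtain u v where uv: "{u, v} \<in> S" "u \<in> component ?T x" "v \<notin> component ?T x"
    using linked_crossing[OF assms(6), of "component ?T x"] unfolding component_def by blast
  have nuv: "\<not> linked ?T u v" using uv(2,3) linked_trans[of x u ?T v] by (auto simp: component_def)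
  then have "{u, v} \<notin> ?T" using linked_edge[of u v ?T] by blast
  then have nT: "{u, v} \<notin> T" using uv(1) assms(5) by auto
  have "connects (insert {u, v} ?T) V" if "u \<in> V" "v \<in> V"
  proof -
    let ?T' = "insert {u, v} ?T"
    have T: "T = insert {x, y} ?T" using assms(3) by auto
    have "linked T u v" using assms(2) that by (auto simp: connects_def)
    then have "linked ?T u x \<and> linked ?T y v \<or> linked ?T u y \<and> linked ?T x v"
      using linked_insert nuv by (subst (asm) T) blast
    then have "linked ?T y v" using uv(3) by (auto simp: component_def)
    have xu: "linked ?T' x u" using uv(2) linked_mono[of ?T ?T'] by (auto simp: component_def)
    have "linked ?T' u v" by (intro linked_edge) auto
    moreover have "linked ?T' v y"
      using linked_sym[OF \<open>linked ?T y v\<close>] linked_mono[of ?T ?T'] by auto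
    ultimately have xy: "linked ?T' x y" using xu linked_trans by blast
    have "linked ?T' p q" if "{p, q} \<in> T" for p q
    proof (cases "{p, q} = {x, y}")
      case True
      then have "p = x \<and> q = y \<or> p = y \<and> q = x" by (auto simp: doubleton_eq_iff)
      then show ?thesis using xy linked_sym by blast
    next
      case False
      then show ?thesis using that by (intro linked_edge) auto
    qed
    then have "linked ?T' p q" if "linked T p q" for p q using linked_subst[OF that] by blast
    then show ?thesis using assms(2) unfolding connects_def by blast
  qed
  moreover have "forest (insert {u, v} ?T)"
    using forest_insert[OF forest_subset[OF assms(1)] nuv] by blast
  ultimately show ?thesis using uv(1) nT by blast
qed

text \<open>An edge of \<open>T\<close> outside \<open>mst_edges\<close> is exchanged for an edge of
  \<open>mst_edges\<close> that is not heavier, as the bottleneck property provides. The number of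
  foreign edges drops each time, and without foreign edges the two trees coincide.\<close>

lemma mst_edges_minimal:
  assumes G: "simple_graph G"
    and T: "T \<subseteq> edges G" "forest T" "connects T (nodes G)"
  shows "sum (weight G) (mst_edges G) \<le> sum (weight G) T"
  using T
proof (induction "card (T - mst_edges G)" arbitrary: T)
  case 0
  have "finite (T - mst_edges G)" using 0 finite_edges[OF G] finite_subset by blast
  then have "T \<subseteq> mst_edges G" using 0 by auto
  then have "T = mst_edges G"
    using forest_connected_eq[OF forest_mst_edges[OF G] _ _ 0(4)] simple_graph_edge[OF G] mst_edges_subset
    by (metis subsetD)
  then show ?case by simp
next
  case (Suc n)
  have fin: "finite T" using Suc finite_edges[OF G] finite_subset by blast
  obtain f where f: "f \<in> T" "f \<notin> mst_edges G" using Suc.hyps(2) by (metis Diff_eq_empty_iff card.empty nat.distinct(1) subsetI)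
  then obtain x y where xy: "f = {x, y}" using simple_graph_edge[OF G] Suc.prems(1) by blast
  let ?S = "{e \<in> mst_edges G. edge_key G e \<le> edge_key G f}"
  have "linked ?S x y" using mst_edges_linked[OF G, of x y] f(1) xy Suc.prems(1) by auto
  moreover have "\<And>e. e \<in> T \<Longrightarrow> e \<subseteq> nodes G" using Suc.prems(1) G by (auto simp: simple_graph_def)
  moreover have "{x, y} \<notin> ?S" using f xy by auto
  ultimately obtain u v where uv: "{u, v} \<in> ?S" "{u, v} \<notin> T" "u \<in> nodes G \<longrightarrow> v \<in> nodes G \<longrightarrow>
      forest (insert {u, v} (T - {{x, y}})) \<and> connects (insert {u, v} (T - {{x, y}})) (nodes G)"
    using exchange_edge[OF Suc.prems(2,3), of x y ?S] f xy by auto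
  let ?T = "insert {u, v} (T - {{x, y}})"
  have E: "{u, v} \<in> edges G" using uv mst_edges_subset by auto
  then have T': "forest ?T" "connects ?T (nodes G)" using uv edge_nodes[OF G] by auto
  have "?T - mst_edges G = (T - mst_edges G) - {f}" using uv xy by auto
  then have "n = card (?T - mst_edges G)" using Suc.hyps(2) f fin by simp
  moreover have "?T \<subseteq> edges G" using E Suc.prems by auto
  ultimately have "sum (weight G) (mst_edges G) \<le> sum (weight G) ?T" using Suc.hyps(1) T' by blast
  also have "\<dots> = weight G {u, v} + (sum (weight G) T - weight G f)"
    using uv(2) fin f xy by (subst sum.insert) (auto simp: sum_diff1)
  also have "\<dots> \<le> sum (weight G) T" using edge_key_le_weight[of G "{u, v}" f] uv by auto
  finally show ?case .
qed

lemma is_mst_mst_edges: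
  assumes G: "simple_graph G" "connects (edges G) (nodes G)"
  shows "is_mst G (mst_edges G)"
  unfolding is_mst_def
proof (intro conjI allI impI)
  have card2: "\<And>e. e \<in> F \<Longrightarrow> card e = 2" if "F \<subseteq> edges G" for F
    using that G by (auto simp: simple_graph_def)
  show "is_spanning_tree G (mst_edges G)"
    unfolding is_spanning_tree_def
    using mst_edges_subset linked_mst_edges[OF G(1)] G(2) forest_mst_edges[OF G(1)]
      forest_iff_no_cycle[OF card2[OF mst_edges_subset]]
    by (auto simp: connects_def)
  fix T' assume "is_spanning_tree G T'"
  then show "sum (weight G) (mst_edges G) \<le> sum (weight G) T'"
    using mst_edges_minimal[OF G(1)] forest_iff_no_cycle[OF card2] by (auto simp: is_spanning_tree_def)
qed

lemma connects_subset_mst_edges: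
  assumes "simple_graph G" "T \<subseteq> mst_edges G" "connects T (nodes G)"
  shows "T = mst_edges G"
  using forest_connected_eq[OF forest_mst_edges[OF assms(1)] assms(2) _ assms(3)]
    simple_graph_edge[OF assms(1)] mst_edges_subset by (metis subsetD)

subsection \<open>Synchronous programs\<close>

text \<open>The free monad over one communication round: messages to the neighbours, then a
  continuation for the replies. Rounds are part of the syntax, so they can be counted and composed
  without reference to histories.\<close>

datatype 'a prog = Ret 'a | Comm "nat \<Rightarrow> int list" "(nat \<Rightarrow> int list) \<Rightarrow> 'a prog"

primrec bind_prog :: "'a prog \<Rightarrow> ('a \<Rightarrow> 'b prog) \<Rightarrow> 'b prog" (infixl "\<rhd>" 54) where
  "Ret x \<rhd> k = k x"
| "Comm s f \<rhd> k = Comm s (\<lambda>r. f r \<rhd> k)"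

definition exch :: "(nat \<Rightarrow> int list) \<Rightarrow> (nat \<Rightarrow> int list) prog" where
  "exch s = Comm s Ret"

primrec iter :: "nat \<Rightarrow> ('s \<Rightarrow> 's prog) \<Rightarrow> 's \<Rightarrow> 's prog" where
  "iter 0 f s = Ret s"
| "iter (Suc t) f s = f s \<rhd> iter t f"

definition received :: "wgraph \<Rightarrow> (nat \<Rightarrow> nat \<Rightarrow> int list) \<Rightarrow> nat \<Rightarrow> nat \<Rightarrow> int list" where
  "received G s v u = (if {u, v} \<in> edges G then s u v else [])"

text \<open>The bound 8 is room for a candidate edge: a leading flag, the three entries of its key
  and a tag of at most four entries. With \<open>X\<close> polynomial in n, such a message has
  \<open>O(log n)\<close> bits.\<close>

definition short :: "int \<Rightarrow> int list \<Rightarrow> bool" where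
  "short X m \<longleftrightarrow> length m \<le> 8 \<and> (\<forall>x \<in> set m. \<bar>x\<bar> \<le> X)"

text \<open>All nodes execute their programs in lockstep for exactly \<open>t\<close> rounds, sending short messages
  only, and then return the values \<open>y\<close>.\<close>

primrec runs :: "wgraph \<Rightarrow> int \<Rightarrow> nat \<Rightarrow> (nat \<Rightarrow> 'a prog) \<Rightarrow> (nat \<Rightarrow> 'a) \<Rightarrow> bool" where
  "runs G X 0 P y \<longleftrightarrow> (\<forall>v \<in> nodes G. P v = Ret (y v))"
| "runs G X (Suc t) P y \<longleftrightarrow> (\<exists>s k.
     (\<forall>v \<in> nodes G. P v = Comm (s v) (k v) \<and> (\<forall>u. {u, v} \<in> edges G \<longrightarrow> short X (s v u))) \<and>
     runs G X t (\<lambda>v. k v (received G s v)) y)"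

lemma runs_cong:
  assumes "runs G X t P y" "\<And>v. v \<in> nodes G \<Longrightarrow> P v = P' v" "\<And>v. v \<in> nodes G \<Longrightarrow> y v = y' v"
  shows "runs G X t P' y'"
  using assms
proof (induction t arbitrary: P P')
  case (Suc t)
  then obtain s k where sk: "\<forall>v \<in> nodes G. P v = Comm (s v) (k v) \<and> (\<forall>u. {u, v} \<in> edges G \<longrightarrow> short X (s v u))"
    "runs G X t (\<lambda>v. k v (received G s v)) y" by auto
  have "runs G X t (\<lambda>v. k v (received G s v)) y'"
    by (rule Suc.IH[OF sk(2)]) (simp_all add: Suc.prems(3))
  then show ?case using sk(1) Suc.prems(2) by (auto intro!: exI[of _ s] exI[of _ k])
qed auto

lemma runs_bind:
  assumes "runs G X t P y" "runs G X t' (\<lambda>v. K v (y v)) z"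
  shows "runs G X (t + t') (\<lambda>v. P v \<rhd> K v) z"
  using assms(1)
proof (induction t arbitrary: P)
  case 0
  then show ?case using assms(2) by (auto intro: runs_cong)
next
  case (Suc t)
  then obtain s k where sk: "\<forall>v \<in> nodes G. P v = Comm (s v) (k v) \<and> (\<forall>u. {u, v} \<in> edges G \<longrightarrow> short X (s v u))"
    "runs G X t (\<lambda>v. k v (received G s v)) y" by auto
  from Suc.IH[OF sk(2)] sk(1) show ?case
    by (auto intro!: exI[of _ s] exI[of _ "\<lambda>v r. k v r \<rhd> K v"])
qed

lemma runs_bind_eq:
  assumes "runs G X t P y" "runs G X t' (\<lambda>v. K v (y v)) z" "T = t + t'"
  shows "runs G X T (\<lambda>v. P v \<rhd> K v) z"
  unfolding assms(3) by (rule runs_bind) (fact assms)+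

lemma runs_bind_Ret:
  assumes "runs G X t P y" "\<And>v. v \<in> nodes G \<Longrightarrow> K v (y v) = Ret (z v)"
  shows "runs G X t (\<lambda>v. P v \<rhd> K v) z"
  by (rule runs_bind_eq[where t' = 0], rule assms) (simp_all add: assms)

lemma runs_exch:
  assumes "\<And>u v. {u, v} \<in> edges G \<Longrightarrow> v \<in> nodes G \<Longrightarrow> short X (s v u)"
  shows "runs G X 1 (\<lambda>v. exch (s v)) (received G s)"
  using assms by (auto simp: exch_def intro!: exI[of _ s] exI[of _ "\<lambda>v. Ret"])

lemma runs_iter:
  assumes "\<And>i. i < t \<Longrightarrow> runs G X \<tau> (\<lambda>v. f v (\<sigma> i v)) (\<sigma> (Suc i))"
  shows "runs G X (t * \<tau>) (\<lambda>v. iter t (f v) (\<sigma> 0 v)) (\<sigma> t)"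
  using assms
proof (induction t arbitrary: \<sigma>)
  case (Suc t)
  have "runs G X (t * \<tau>) (\<lambda>v. iter t (f v) (\<sigma> (Suc 0) v)) (\<sigma> (Suc t))"
    using Suc.IH[of "\<lambda>i. \<sigma> (Suc i)"] Suc.prems by simp
  with Suc.prems[of 0] show ?case by (auto intro: runs_bind)
qed simp

text \<open>In contrast to \<open>runs_iter\<close> the states are not given in advance: each
  iteration only promises some successor that satisfies the invariant. The growth of fragments is
  known in this form only.\<close>

lemma runs_iter_inv:
  assumes "I 0 \<sigma>" "\<And>i \<sigma>. i < t \<Longrightarrow> I i \<sigma> \<Longrightarrow> \<exists>\<sigma>'. runs G X \<tau> (\<lambda>v. f v (\<sigma> v)) \<sigma>' \<and> I (Suc i) \<sigma>'"
  shows "\<exists>\<sigma>'. runs G X (t * \<tau>) (\<lambda>v. iter t (f v) (\<sigma> v)) \<sigma>' \<and> I t \<sigma>'"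
  using assms
proof (induction t arbitrary: \<sigma> I)
  case (Suc t)
  obtain \<sigma>1 where 1: "runs G X \<tau> (\<lambda>v. f v (\<sigma> v)) \<sigma>1" "I (Suc 0) \<sigma>1"
    using Suc.prems by blast
  obtain \<sigma>' where 2: "runs G X (t * \<tau>) (\<lambda>v. iter t (f v) (\<sigma>1 v)) \<sigma>'" "I (Suc t) \<sigma>'"
    using Suc.IH[of "\<lambda>i. I (Suc i)" \<sigma>1] 1(2) Suc.prems(2) by auto
  from 1(1) 2(1) have "runs G X (Suc t * \<tau>) (\<lambda>v. iter (Suc t) (f v) (\<sigma> v)) \<sigma>'"
    by (auto intro: runs_bind)
  with 2(2) show ?case by auto
qed auto

section \<open>Encoding messages as bit strings\<close>

fun enc_nat :: "nat \<Rightarrow> bool list" where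
  "enc_nat n = (if n = 0 then [False] else True # odd n # enc_nat (n div 2))"

declare enc_nat.simps [simp del]

text \<open>The code is self-delimiting: \<open>True\<close> announces another binary digit and
  \<open>False\<close> ends the number. So concatenated codes, and thereby whole lists, can be
  decoded.\<close>

lemma enc_nat_inj: "enc_nat m @ xs = enc_nat n @ ys \<Longrightarrow> m = n \<and> xs = ys"
proof (induction m arbitrary: n rule: enc_nat.induct)
  case (1 m)
  show ?case
  proof (cases "m = 0 \<or> n = 0")
    case True
    then show ?thesis using "1.prems" enc_nat.simps[of m] enc_nat.simps[of n]
      by (auto split: if_splits)
  next
    case False
    then have *: "odd m = odd n" "enc_nat (m div 2) @ xs = enc_nat (n div 2) @ ys"
      using "1.prems" by (subst (asm) (1 2) enc_nat.simps, simp)+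
    then have "m div 2 = n div 2 \<and> xs = ys" using "1.IH" False by blast
    then show ?thesis using *(1) by (metis div_mult_mod_eq odd_iff_mod_2_eq_one not_mod_2_eq_1_eq_0)
  qed
qed

lemma length_enc_nat: "n < 2 ^ k \<Longrightarrow> length (enc_nat n) \<le> 2 * k + 1"
proof (induction k arbitrary: n)
  case 0
  then show ?case by (simp add: enc_nat.simps)
next
  case (Suc k)
  then have "n div 2 < 2 ^ k" by auto
  then show ?case using Suc.IH[of "n div 2"] by (subst enc_nat.simps) auto
qed

definition enc :: "int list \<Rightarrow> message" where
  "enc xs = concat (map (\<lambda>x. enc_nat (int_encode x)) xs)"

definition dec :: "message \<Rightarrow> int list" where
  "dec = inv enc"

lemma enc_nat_neq_Nil [simp]: "enc_nat n \<noteq> []"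
  by (subst enc_nat.simps) auto

lemma inj_enc: "inj enc"
proof (rule injI)
  show "xs = ys" if "enc xs = enc ys" for xs ys
    using that
  proof (induction xs arbitrary: ys)
    case Nil
    then show ?case by (cases ys) (auto simp: enc_def)
  next
    case (Cons x xs)
    then obtain y ys' where ys: "ys = y # ys'" by (cases ys) (auto simp: enc_def)
    have "enc_nat (int_encode x) @ enc xs = enc_nat (int_encode y) @ enc ys'"
      using Cons.prems ys by (simp add: enc_def)
    then have "int_encode x = int_encode y" "enc xs = enc ys'" using enc_nat_inj by blast+
    then show ?case using Cons.IH[of ys'] ys by (auto simp: inj_eq[OF inj_int_encode])
  qed
qed

lemma dec_enc [simp]: "dec (enc xs) = xs"
  by (simp add: dec_def inj_enc)

lemma enc_Nil [simp]: "enc [] = []"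
  by (simp add: enc_def)

text \<open>\<open>int_encode\<close> maps x to 2 * x or - 2 * x - 1, which stays below 2 * X + 2;
  the code spends two bits on each binary digit and one on the end mark.\<close>

lemma length_enc:
  assumes "short X m" "2 * X + 2 \<le> 2 ^ k"
  shows "length (enc m) \<le> 8 * (2 * k + 1)"
proof -
  have "length (enc_nat (int_encode x)) \<le> 2 * k + 1" if "x \<in> set m" for x
  proof (rule length_enc_nat)
    have "\<bar>x\<bar> \<le> X" using assms(1) that by (auto simp: short_def)
    moreover have "int (int_encode x) = (if 0 \<le> x then 2 * x else - 2 * x - 1)"
      by (auto simp: int_encode_def sum_encode_def)
    ultimately have "int (int_encode x) < 2 ^ k" using assms(2) by (simp only: split: if_split) arith
    then show "int_encode x < 2 ^ k" by (metis of_nat_less_iff of_nat_numeral of_nat_power)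
  qed
  then have "length (enc m) \<le> length m * (2 * k + 1)"
    unfolding enc_def
  proof (induction m)
    case (Cons y m)
    then have "length (enc_nat (int_encode y)) \<le> 2 * k + 1" by simp
    with Cons show ?case by fastforce
  qed simp
  also have "\<dots> \<le> 8 * (2 * k + 1)" using assms(1) by (intro mult_right_mono) (auto simp: short_def)
  finally show ?thesis .
qed

subsection \<open>From programs to CONGEST algorithms\<close>

text \<open>A node runs \<open>search d\<close> for \<open>d = 0, 1, ...\<close> until it succeeds, draws a single coin, and then runs
  \<open>work\<close>. All nodes need the same number of rounds for each search and succeed at the same \<open>d\<close>,
  so they stay synchronous although they know neither \<open>n\<close> nor \<open>D\<close>.\<close>

datatype 'i stage = Searching nat "'i option prog" | Ready 'i | Working "nat set set prog"

primrec resume :: "'a prog \<Rightarrow> (nat \<Rightarrow> int list) \<Rightarrow> 'a prog" where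
  "resume (Ret x) r = Ret x"
| "resume (Comm s f) r = f r"

primrec outgoing :: "'a prog \<Rightarrow> nat \<Rightarrow> int list" where
  "outgoing (Ret x) = (\<lambda>_. [])"
| "outgoing (Comm s f) = s"

locale three_stage =
  fixes search :: "local_input \<Rightarrow> nat \<Rightarrow> 'i option prog"
    and seed :: "local_input \<Rightarrow> 'i \<Rightarrow> nat pmf"
    and work :: "local_input \<Rightarrow> 'i \<Rightarrow> nat \<Rightarrow> nat set set prog"
begin

text \<open>A finished search passes to the next stage at once, so that no round is idle. One such
  transition is enough, because every search takes at least one round and the next one therefore
  starts with a communication.\<close>

fun settle :: "local_input \<Rightarrow> 'i stage \<Rightarrow> 'i stage" where
  "settle i (Searching d (Ret None)) = Searching (Suc d) (search i (Suc d))"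
| "settle i (Searching d (Ret (Some x))) = Ready x"
| "settle i st = st"

fun advance :: "local_input \<Rightarrow> 'i stage \<Rightarrow> nat \<times> (nat \<Rightarrow> message) \<Rightarrow> 'i stage" where
  "advance i (Searching d p) (c, r) = settle i (Searching d (resume p (\<lambda>u. dec (r u))))"
| "advance i (Ready x) (c, r) = Working (work i x c)"
| "advance i (Working p) (c, r) = Working (resume p (\<lambda>u. dec (r u)))"

definition stage_of :: "local_input \<Rightarrow> history \<Rightarrow> 'i stage" where
  "stage_of i h = foldl (advance i) (settle i (Searching 0 (search i 0))) h"

primrec stage_out :: "'i stage \<Rightarrow> nat \<Rightarrow> int list" where
  "stage_out (Searching d p) = outgoing p"
| "stage_out (Ready x) = (\<lambda>_. [])"
| "stage_out (Working p) = outgoing p"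

primrec stage_coin :: "local_input \<Rightarrow> 'i stage \<Rightarrow> nat pmf" where
  "stage_coin i (Searching d p) = return_pmf 0"
| "stage_coin i (Ready x) = seed i x"
| "stage_coin i (Working p) = return_pmf 0"

fun stage_result :: "'i stage \<Rightarrow> nat set set option" where
  "stage_result (Working (Ret y)) = Some y"
| "stage_result st = None"

definition algorithm :: congest_algorithm where
  "algorithm = \<lparr>coin = (\<lambda>i h. stage_coin i (stage_of i h)),
     send = (\<lambda>i h r u. enc (stage_out (stage_of i h) u)),
     result = (\<lambda>i h. stage_result (stage_of i h))\<rparr>"

lemma algorithm_simps [simp]:
  "coin algorithm i h = stage_coin i (stage_of i h)"
  "send algorithm i h r u = enc (stage_out (stage_of i h) u)"
  "result algorithm i h = stage_result (stage_of i h)"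
  by (simp_all add: algorithm_def)

lemma stage_of_snoc: "stage_of i (h @ [x]) = advance i (stage_of i h) x"
  by (simp add: stage_of_def)

end

text \<open>In contrast to \<open>run\<close>, the start is an arbitrary family of histories, so
  that an execution can be cut into stages by \<open>evolve_add\<close>.\<close>

primrec evolve :: "congest_algorithm \<Rightarrow> wgraph \<Rightarrow> nat \<Rightarrow> nat \<Rightarrow> (nat \<Rightarrow> history) \<Rightarrow> (nat \<Rightarrow> history) pmf" where
  "evolve A G a 0 H = return_pmf H"
| "evolve A G a (Suc t) H = bind_pmf (evolve A G a t H) (\<lambda>H.
     map_pmf (next_round A G a H) (Pi_pmf (nodes G) 0 (\<lambda>v. coin A (input_of G a v) (H v))))"

lemma run_eq_evolve: "run A G a t = evolve A G a t (\<lambda>_. [])"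
  by (induction t) auto

lemma evolve_add: "evolve A G a (s + t) H = bind_pmf (evolve A G a s H) (evolve A G a t)"
  by (induction t) (simp_all add: bind_return_pmf' bind_assoc_pmf)

lemma evolve_extends: "H' \<in> set_pmf (evolve A G a t H) \<Longrightarrow> set (H v) \<subseteq> set (H' v)"
proof (induction t arbitrary: H')
  case (Suc t)
  then obtain H1 R where "H1 \<in> set_pmf (evolve A G a t H)" "H' = next_round A G a H1 R" by auto
  then show ?case using Suc.IH[of H1] by (auto simp: next_round_def)
qed auto

lemma evolve_halted:
  assumes "\<And>v. v \<in> nodes G \<Longrightarrow> halted A G a H v"
  shows "evolve A G a t H = return_pmf H"
proof (induction t)
  case (Suc t)
  have "next_round A G a H R = H" for R using assms by (auto simp: next_round_def)
  then have "next_round A G a H = (\<lambda>_. H)" by blast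
  then show ?case using Suc by (simp add: bind_return_pmf)
qed simp

lemma prob_bind_ge:
  assumes "\<And>x. x \<in> set_pmf p \<Longrightarrow> x \<in> S \<Longrightarrow> set_pmf (f x) \<subseteq> Q"
  shows "measure_pmf.prob p S \<le> measure_pmf.prob (bind_pmf p f) Q"
proof -
  have "emeasure (measure_pmf p) S = (\<integral>\<^sup>+x. indicator S x \<partial>measure_pmf p)" by simp
  also have "\<dots> \<le> (\<integral>\<^sup>+x. emeasure (measure_pmf (f x)) Q \<partial>measure_pmf p)"
  proof (rule nn_integral_mono_AE, unfold AE_measure_pmf_iff, intro ballI)
    fix x assume x: "x \<in> set_pmf p"
    show "indicator S x \<le> emeasure (measure_pmf (f x)) Q"
    proof (cases "x \<in> S")
      case True
      then have "measure_pmf.prob (f x) Q = 1"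
        using assms[OF x] measure_pmf.prob_eq_1[of Q "f x"] by (auto simp: AE_measure_pmf_iff)
      then show ?thesis using True by (simp add: measure_pmf.emeasure_eq_measure)
    qed simp
  qed
  also have "\<dots> = emeasure (measure_pmf (bind_pmf p f)) Q" by simp
  finally show ?thesis by (simp add: measure_pmf.emeasure_eq_measure)
qed

text \<open>The time \<open>t2\<close> depends on the drawn numbers, since a failed test of the
  colour classes leads to a slower computation; \<open>t2max\<close> is a moment by which every
  execution of \<open>work\<close> has ended.\<close>

locale three_stage_run = three_stage search seed work
  for search :: "local_input \<Rightarrow> nat \<Rightarrow> 'i option prog"
    and seed :: "local_input \<Rightarrow> 'i \<Rightarrow> nat pmf"
    and work :: "local_input \<Rightarrow> 'i \<Rightarrow> nat \<Rightarrow> nat set set prog" +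
  fixes G :: wgraph and a :: nat and X :: int and k :: nat
    and d1 :: nat and t1 :: "nat \<Rightarrow> nat" and info :: "nat \<Rightarrow> 'i"
    and t2 :: "(nat \<Rightarrow> nat) \<Rightarrow> nat" and t2max :: nat
  assumes graph: "simple_graph G" "connects (edges G) (nodes G)"
    and X: "2 * X + 2 \<le> 2 ^ k"
    and t1: "\<And>d. 0 < t1 d"
    and search_fails: "\<And>d. d < d1 \<Longrightarrow> runs G X (t1 d) (\<lambda>v. search (input_of G a v) d) (\<lambda>_. None)"
    and search_succeeds: "runs G X (t1 d1) (\<lambda>v. search (input_of G a v) d1) (\<lambda>v. Some (info v))"
    and work_runs: "\<And>\<omega>. (\<And>v. v \<in> nodes G \<Longrightarrow> \<omega> v \<in> set_pmf (seed (input_of G a v) (info v))) \<Longrightarrow>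
      runs G X (t2 \<omega>) (\<lambda>v. work (input_of G a v) (info v) (\<omega> v)) (\<lambda>v. {e \<in> mst_edges G. v \<in> e})"
    and t2max: "\<And>\<omega>. (\<And>v. v \<in> nodes G \<Longrightarrow> \<omega> v \<in> set_pmf (seed (input_of G a v) (info v))) \<Longrightarrow> t2 \<omega> \<le> t2max"
begin

abbreviation inp :: "nat \<Rightarrow> local_input" where
  "inp \<equiv> input_of G a"

abbreviation conf :: "(nat \<Rightarrow> history) \<Rightarrow> nat \<Rightarrow> 'i stage" where
  "conf H v \<equiv> stage_of (inp v) (H v)"

definition within_bandwidth :: "(nat \<Rightarrow> history) \<Rightarrow> bool" where
  "within_bandwidth H \<longleftrightarrow> (\<forall>v \<in> nodes G. \<forall>(r, received) \<in> set (H v). \<forall>u.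
     length (received u) \<le> 8 * (2 * k + 1))"

definition seeds :: "(nat \<Rightarrow> nat) pmf" where
  "seeds = Pi_pmf (nodes G) 0 (\<lambda>v. seed (inp v) (info v))"

lemma finite_nodes: "finite (nodes G)"
  using graph by (auto simp: simple_graph_def)

lemma seeds_component: "\<omega> \<in> set_pmf seeds \<Longrightarrow> v \<in> nodes G \<Longrightarrow> \<omega> v \<in> set_pmf (seed (inp v) (info v))"
  using finite_nodes by (auto simp: seeds_def set_Pi_pmf PiE_dflt_def)

lemma next_round_conf:
  assumes "v \<in> nodes G" "\<And>u. u \<in> nodes G \<Longrightarrow> stage_result (conf H u) = None"
  shows "next_round algorithm G a H R v = H v @ [(R v, inbox algorithm G a H R v)]"
    and "inbox algorithm G a H R v = (\<lambda>u. enc (received G (\<lambda>u. stage_out (conf H u)) v u))"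
  using assms edge_nodes[OF graph(1)]
  by (auto simp: next_round_def halted_def inbox_def received_def fun_eq_iff)

lemma next_round_bandwidth:
  assumes "within_bandwidth H" "\<And>u. u \<in> nodes G \<Longrightarrow> stage_result (conf H u) = None"
    "\<And>u v. {u, v} \<in> edges G \<Longrightarrow> short X (stage_out (conf H u) v)"
  shows "within_bandwidth (next_round algorithm G a H R)"
  unfolding within_bandwidth_def
proof (intro ballI allI, unfold case_prod_unfold, intro allI)
  fix v x u assume v: "v \<in> nodes G" and x: "x \<in> set (next_round algorithm G a H R v)"
  then consider "x \<in> set (H v)" | "x = (R v, inbox algorithm G a H R v)"
    using next_round_conf(1)[OF v assms(2), of R] by auto
  then show "length (snd x u) \<le> 8 * (2 * k + 1)"
  proof cases
    case 1
    obtain r m where "x = (r, m)" by fastforce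
    then show ?thesis using 1 assms(1) v by (fastforce simp: within_bandwidth_def)
  next
    case 2
    then have "snd x u = enc (received G (\<lambda>u. stage_out (conf H u)) v u)"
      using next_round_conf(2)[OF v assms(2)] by simp
    then show ?thesis using length_enc[OF assms(3) X] by (auto simp: received_def)
  qed
qed

text \<open>The parameter \<open>w\<close> embeds a program into a stage, so that searching and
  working share the argument. The coins are constant while a program runs, hence the distribution of
  the histories stays concentrated on a single point.\<close>

lemma evolve_runs:
  assumes w: "\<And>v s f c r. v \<in> nodes G \<Longrightarrow>
      advance (inp v) (w v (Comm s f)) (c, r) = w v (f (\<lambda>u. dec (r u))) \<and>
      stage_coin (inp v) (w v (Comm s f)) = return_pmf 0 \<and>
      stage_out (w v (Comm s f)) = s \<and> stage_result (w v (Comm s f)) = None"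
    and "runs G X t P y" "\<And>v. v \<in> nodes G \<Longrightarrow> conf H v = w v (P v)" "within_bandwidth H"
  shows "\<exists>H'. evolve algorithm G a t H = return_pmf H' \<and>
    (\<forall>v \<in> nodes G. conf H' v = w v (Ret (y v))) \<and> within_bandwidth H'"
  using assms(2-)
proof (induction t arbitrary: P H)
  case 0
  then show ?case by auto
next
  case (Suc t)
  obtain s f where sf: "\<And>v. v \<in> nodes G \<Longrightarrow> P v = Comm (s v) (f v)"
    "\<And>u v. u \<in> nodes G \<Longrightarrow> {v, u} \<in> edges G \<Longrightarrow> short X (s u v)"
    "runs G X t (\<lambda>v. f v (received G s v)) y"
    using Suc.prems(1) by auto
  define H1 where "H1 = next_round algorithm G a H (\<lambda>_. 0)"
  have coin: "coin algorithm (inp v) (H v) = return_pmf 0" if "v \<in> nodes G" for v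
    using w[OF that] sf(1)[OF that] Suc.prems(2)[OF that] by simp
  have "Pi_pmf (nodes G) 0 (\<lambda>v. coin algorithm (inp v) (H v)) = Pi_pmf (nodes G) 0 (\<lambda>v. return_pmf 0)"
    using coin by (intro Pi_pmf_cong) auto
  also have "\<dots> = return_pmf (\<lambda>_. 0)" using finite_nodes by simp
  finally have "evolve algorithm G a (Suc 0) H = return_pmf H1" by (simp add: H1_def bind_return_pmf)
  then have ev: "evolve algorithm G a (Suc t) H = evolve algorithm G a t H1"
    using evolve_add[of algorithm G a "Suc 0" t H] by (simp add: bind_return_pmf)
  have active: "stage_result (conf H u) = None" if "u \<in> nodes G" for u
    using w[OF that] sf(1)[OF that] Suc.prems(2)[OF that] by simp
  have out: "stage_out (conf H u) = s u" if "u \<in> nodes G" for u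
    using w[OF that] sf(1)[OF that] Suc.prems(2)[OF that] by simp
  have rec: "received G (\<lambda>u. stage_out (conf H u)) v = received G s v" for v
    using edge_nodes[OF graph(1)] out by (auto simp: received_def fun_eq_iff)
  have "conf H1 v = w v (f v (received G s v))" if v: "v \<in> nodes G" for v
    using next_round_conf[OF v active] w[OF v] sf(1)[OF v] Suc.prems(2)[OF v]
    by (simp add: H1_def stage_of_snoc rec)
  moreover have "within_bandwidth H1"
    unfolding H1_def using Suc.prems(3) active
  proof (rule next_round_bandwidth)
    show "short X (stage_out (conf H u) v)" if "{u, v} \<in> edges G" for u v
      using that edge_nodes[OF graph(1) that] out sf(2)[of u v] by (auto simp: insert_commute)
  qed auto
  ultimately show ?case using Suc.IH[OF sf(3), of H1] ev by auto
qed

lemma runs_imp_Comm: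
  assumes "runs G X t P y" "0 < t" "v \<in> nodes G"
  shows "\<exists>s f. P v = Comm s f"
  using assms by (cases t) auto

lemma evolve_search:
  assumes "d \<le> d1"
  shows "\<exists>H. evolve algorithm G a (\<Sum>i<d. t1 i) (\<lambda>_. []) = return_pmf H \<and>
    (\<forall>v \<in> nodes G. conf H v = settle (inp v) (Searching d (search (inp v) d))) \<and> within_bandwidth H"
  using assms
proof (induction d)
  case 0
  then show ?case by (simp add: within_bandwidth_def stage_of_def)
next
  case (Suc d)
  then obtain H where H: "evolve algorithm G a (\<Sum>i<d. t1 i) (\<lambda>_. []) = return_pmf H"
    "\<And>v. v \<in> nodes G \<Longrightarrow> conf H v = settle (inp v) (Searching d (search (inp v) d))" "within_bandwidth H"
    by auto
  have "\<exists>H'. evolve algorithm G a (t1 d) H = return_pmf H' \<and>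
    (\<forall>v \<in> nodes G. conf H' v = settle (inp v) (Searching d (Ret None))) \<and> within_bandwidth H'"
    by (rule evolve_runs[OF _ search_fails]) (use H Suc.prems in auto)
  then obtain H' where H': "evolve algorithm G a (t1 d) H = return_pmf H'"
    "\<And>v. v \<in> nodes G \<Longrightarrow> conf H' v = settle (inp v) (Searching d (Ret None))" "within_bandwidth H'"
    by blast
  have "\<exists>s f. search (inp v) (Suc d) = Comm s f" if v: "v \<in> nodes G" for v
  proof (cases "Suc d = d1")
    case True
    then show ?thesis using runs_imp_Comm[OF search_succeeds t1 v] by simp
  next
    case False
    then show ?thesis using runs_imp_Comm[OF search_fails t1 v] Suc.prems by simp
  qed
  then have "settle (inp v) (Searching (Suc d) (search (inp v) (Suc d))) = Searching (Suc d) (search (inp v) (Suc d))"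
    if "v \<in> nodes G" for v using that by fastforce
  then show ?case
    using H' evolve_add[of algorithm G a "\<Sum>i<d. t1 i" "t1 d" "\<lambda>_. []"] H(1)
    by (auto simp: bind_return_pmf)
qed

definition t_search :: nat where
  "t_search = (\<Sum>i\<le>d1. t1 i)"

lemma evolve_ready:
  "\<exists>H. evolve algorithm G a t_search (\<lambda>_. []) = return_pmf H \<and>
    (\<forall>v \<in> nodes G. conf H v = Ready (info v)) \<and> within_bandwidth H"
proof -
  obtain H where H: "evolve algorithm G a (\<Sum>i<d1. t1 i) (\<lambda>_. []) = return_pmf H"
    "\<And>v. v \<in> nodes G \<Longrightarrow> conf H v = settle (inp v) (Searching d1 (search (inp v) d1))" "within_bandwidth H"
    using evolve_search[of d1] by auto
  have "\<exists>H'. evolve algorithm G a (t1 d1) H = return_pmf H' \<and>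
    (\<forall>v \<in> nodes G. conf H' v = settle (inp v) (Searching d1 (Ret (Some (info v))))) \<and> within_bandwidth H'"
    by (rule evolve_runs[OF _ search_succeeds]) (use H in auto)
  moreover have "t_search = (\<Sum>i<d1. t1 i) + t1 d1" by (simp add: t_search_def lessThan_Suc_atMost[symmetric])
  ultimately show ?thesis
    using evolve_add[of algorithm G a "\<Sum>i<d1. t1 i" "t1 d1" "\<lambda>_. []"] H(1)
    by (auto simp: bind_return_pmf)
qed

text \<open>The round spent in stage \<open>Ready\<close> is the only random one. Everything after
  it is a function of the drawn \<open>\<omega>\<close>, and once all nodes have halted the
  histories no longer change.\<close>

lemma evolve_work:
  obtains H1 where
    "evolve algorithm G a (Suc t_search) (\<lambda>_. []) = map_pmf H1 seeds"
    "\<And>\<omega>. \<omega> \<in> set_pmf seeds \<Longrightarrow> \<exists>H'. (\<forall>t \<ge> t2 \<omega>. evolve algorithm G a t (H1 \<omega>) = return_pmf H') \<and>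
      within_bandwidth H' \<and> mst_computed algorithm G a H'"
proof -
  obtain H where H: "evolve algorithm G a t_search (\<lambda>_. []) = return_pmf H"
    "\<And>v. v \<in> nodes G \<Longrightarrow> conf H v = Ready (info v)" "within_bandwidth H"
    using evolve_ready by blast
  define H1 where "H1 = next_round algorithm G a H"
  show ?thesis
  proof (rule that[of H1])
    have "Pi_pmf (nodes G) 0 (\<lambda>v. coin algorithm (inp v) (H v)) = seeds"
      unfolding seeds_def using H(2) by (intro Pi_pmf_cong) auto
    then show "evolve algorithm G a (Suc t_search) (\<lambda>_. []) = map_pmf H1 seeds"
      using H(1) by (simp add: bind_return_pmf H1_def)
    fix \<omega> assume "\<omega> \<in> set_pmf seeds"
    then have \<omega>: "\<And>v. v \<in> nodes G \<Longrightarrow> \<omega> v \<in> set_pmf (seed (inp v) (info v))"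
      using seeds_component by blast
    have active: "stage_result (conf H u) = None" if "u \<in> nodes G" for u using H(2) that by simp
    have "conf (H1 \<omega>) v = Working (work (inp v) (info v) (\<omega> v))" if v: "v \<in> nodes G" for v
      using next_round_conf[OF v active] H(2)[OF v] by (simp add: H1_def stage_of_snoc)
    moreover have "within_bandwidth (H1 \<omega>)"
      unfolding H1_def using H(3) active
    proof (rule next_round_bandwidth)
      show "short X (stage_out (conf H u) v)" if "{u, v} \<in> edges G" for u v
        using H(2)[of u] edge_nodes[OF graph(1) that] by (simp add: short_def)
    qed auto
    ultimately have "\<exists>H'. evolve algorithm G a (t2 \<omega>) (H1 \<omega>) = return_pmf H' \<and>
        (\<forall>v \<in> nodes G. conf H' v = Working (Ret {e \<in> mst_edges G. v \<in> e})) \<and> within_bandwidth H'"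
      by (intro evolve_runs[OF _ work_runs]) (auto intro: \<omega>)
    then obtain H' where H': "evolve algorithm G a (t2 \<omega>) (H1 \<omega>) = return_pmf H'"
      "\<And>v. v \<in> nodes G \<Longrightarrow> conf H' v = Working (Ret {e \<in> mst_edges G. v \<in> e})" "within_bandwidth H'"
      by blast
    have "evolve algorithm G a t (H1 \<omega>) = return_pmf H'" if "t2 \<omega> \<le> t" for t
      using evolve_add[of algorithm G a "t2 \<omega>" "t - t2 \<omega>" "H1 \<omega>"] that H'(1,2)
        evolve_halted[of G algorithm a H' "t - t2 \<omega>"]
      by (simp add: bind_return_pmf halted_def)
    moreover have "mst_computed algorithm G a H'"
      using H'(2) is_mst_mst_edges[OF graph] by (auto simp: mst_computed_def)
    ultimately show "\<exists>H'. (\<forall>t \<ge> t2 \<omega>. evolve algorithm G a t (H1 \<omega>) = return_pmf H') \<and>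
      within_bandwidth H' \<and> mst_computed algorithm G a H'" using H'(3) by blast
  qed
qed

text \<open>The bandwidth is known for late histories, when every node has halted. Since histories
  only grow, an intermediate one is contained in a late one, which extends the bound to all
  times.\<close>

lemma run_within_bandwidth:
  assumes "H \<in> set_pmf (run algorithm G a t)"
  shows "within_bandwidth H"
proof -
  obtain H1 where H1: "evolve algorithm G a (Suc t_search) (\<lambda>_. []) = map_pmf H1 seeds"
    "\<And>\<omega>. \<omega> \<in> set_pmf seeds \<Longrightarrow> \<exists>H'. (\<forall>t \<ge> t2 \<omega>. evolve algorithm G a t (H1 \<omega>) = return_pmf H') \<and>
      within_bandwidth H' \<and> mst_computed algorithm G a H'"
    using evolve_work by blast
  have late: "within_bandwidth H" if H: "H \<in> set_pmf (run algorithm G a (Suc t_search + (t2max + s)))" for H s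
  proof -
    obtain \<omega> where \<omega>: "\<omega> \<in> set_pmf seeds" "H \<in> set_pmf (evolve algorithm G a (t2max + s) (H1 \<omega>))"
      using H unfolding run_eq_evolve evolve_add H1(1) by auto
    have "t2 \<omega> \<le> t2max" by (rule t2max) (rule seeds_component[OF \<omega>(1)])
    then show ?thesis using H1(2)[OF \<omega>(1)] \<omega>(2) trans_le_add1 by fastforce
  qed
  obtain H' where H': "H' \<in> set_pmf (evolve algorithm G a (Suc t_search + t2max) H)"
    using set_pmf_not_empty by fast
  have "H' \<in> set_pmf (run algorithm G a (t + (Suc t_search + t2max)))"
    using assms H' unfolding run_eq_evolve evolve_add[of _ _ _ t] by auto
  then have "within_bandwidth H'" using late[of H' t] by (simp add: ac_simps)
  then show ?thesis using evolve_extends[OF H'] by (fastforce simp: within_bandwidth_def)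
qed

lemma prob_mst_computed:
  assumes "\<And>\<omega>. \<omega> \<in> set_pmf seeds \<Longrightarrow> \<omega> \<in> S \<Longrightarrow> t2 \<omega> \<le> t"
  shows "measure_pmf.prob seeds S \<le>
    measure_pmf.prob (run algorithm G a (Suc t_search + t)) {H. mst_computed algorithm G a H}"
proof -
  obtain H1 where H1: "evolve algorithm G a (Suc t_search) (\<lambda>_. []) = map_pmf H1 seeds"
    "\<And>\<omega>. \<omega> \<in> set_pmf seeds \<Longrightarrow> \<exists>H'. (\<forall>t \<ge> t2 \<omega>. evolve algorithm G a t (H1 \<omega>) = return_pmf H') \<and>
      within_bandwidth H' \<and> mst_computed algorithm G a H'"
    using evolve_work by blast
  have "run algorithm G a (Suc t_search + t) = bind_pmf seeds (\<lambda>\<omega>. evolve algorithm G a t (H1 \<omega>))"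
    unfolding run_eq_evolve evolve_add H1(1) by (simp add: bind_map_pmf)
  then show ?thesis
    using H1(2) assms by (auto intro!: prob_bind_ge) fastforce
qed

end

declare if_image_distrib [simp del]

subsection \<open>Minima and elections\<close>

definition min_step :: "nat set \<Rightarrow> int list \<Rightarrow> int list prog" where
  "min_step S x = exch (\<lambda>_. x) \<rhd> (\<lambda>r. Ret (Min (insert x (r ` S))))"

text \<open>Flooding minima is the basic means of aggregation. As lists are compared
  lexicographically, the flags [0] and [1] turn it into a disjunction, and data with a leading 0
  prevail over [1], which stands for nothing to report.\<close>

definition fmin :: "nat \<Rightarrow> nat set \<Rightarrow> int list \<Rightarrow> int list prog" where
  "fmin t S = iter t (min_step S)"

definition nbrs :: "wgraph \<Rightarrow> nat \<Rightarrow> nat set" where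
  "nbrs G v = {u. {u, v} \<in> edges G}"

lemma Min_UNION:
  fixes x :: "'a \<Rightarrow> 'b :: linorder"
  assumes "finite A" "A \<noteq> {}" "\<And>w. w \<in> A \<Longrightarrow> finite (B w)" "\<And>w. w \<in> A \<Longrightarrow> B w \<noteq> {}"
  shows "Min ((\<lambda>w. Min (x ` B w)) ` A) = Min (x ` (\<Union>w \<in> A. B w))"
proof (rule antisym)
  have fin: "finite (\<Union>w \<in> A. B w)" "(\<Union>w \<in> A. B w) \<noteq> {}" using assms by auto
  then have "Min (x ` (\<Union>w \<in> A. B w)) \<in> x ` (\<Union>w \<in> A. B w)" by (intro Min_in) auto
  then obtain b where b: "Min (x ` (\<Union>w \<in> A. B w)) = x b" "b \<in> (\<Union>w \<in> A. B w)" by (rule imageE)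
  then obtain w where w: "w \<in> A" "b \<in> B w" by blast
  have "Min ((\<lambda>w. Min (x ` B w)) ` A) \<le> Min (x ` B w)" using w(1) assms(1) by (intro Min_le) auto
  also have "\<dots> \<le> x b" using w assms by simp
  finally show "Min ((\<lambda>w. Min (x ` B w)) ` A) \<le> Min (x ` (\<Union>w \<in> A. B w))" using b by simp
  show "Min (x ` (\<Union>w \<in> A. B w)) \<le> Min ((\<lambda>w. Min (x ` B w)) ` A)"
  proof (rule Min.boundedI)
    fix y assume "y \<in> (\<lambda>w. Min (x ` B w)) ` A"
    then obtain w where w: "w \<in> A" "y = Min (x ` B w)" by blast
    moreover have "Min (x ` (\<Union>w \<in> A. B w)) \<le> Min (x ` B w)"
      using w(1) assms(3,4) fin(1) by (intro Min_antimono) blast+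
    ultimately show "Min (x ` (\<Union>w \<in> A. B w)) \<le> y" by simp
  qed (use assms in auto)
qed

lemma hop_ball_nonempty [simp]: "hop_ball F t v \<noteq> {}"
  using hop_ball_self by blast

text \<open>A state consists of the known items and of those already sent, each with its colour.
  Some known item that has not been sent is chosen, the same for all edges of its colour; the empty
  list says that there is none.\<close>

definition offer :: "(nat \<times> int list) set \<times> (nat \<times> int list) set \<Rightarrow> nat \<Rightarrow> int list" where
  "offer \<sigma> j = (if \<exists>x. (j, x) \<in> fst \<sigma> - snd \<sigma> then SOME x. (j, x) \<in> fst \<sigma> - snd \<sigma> else [])"

definition gossip_update ::
  "nat set \<Rightarrow> (nat \<Rightarrow> nat) \<Rightarrow> (nat \<Rightarrow> int list) \<Rightarrow> (nat \<times> int list) set \<times> (nat \<times> int list) set \<Rightarrow>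
    (nat \<times> int list) set \<times> (nat \<times> int list) set"
where
  "gossip_update N col r \<sigma> =
    (fst \<sigma> \<union> {(col u, r u) |u. u \<in> N \<and> r u \<noteq> []}, snd \<sigma> \<union> {(j, offer \<sigma> j) |j. offer \<sigma> j \<noteq> []})"

definition gossip ::
  "nat \<Rightarrow> nat set \<Rightarrow> (nat \<Rightarrow> nat) \<Rightarrow> (nat \<times> int list) set \<Rightarrow> (nat \<times> int list) set prog"
where
  "gossip t N col I = iter t (\<lambda>\<sigma>. exch (\<lambda>u. offer \<sigma> (col u)) \<rhd> (\<lambda>r. Ret (gossip_update N col r \<sigma>)))
     (I, {}) \<rhd> (\<lambda>\<sigma>. Ret (fst \<sigma>))"

locale network =
  fixes G :: wgraph and X :: int
  assumes graph: "simple_graph G" "connects (edges G) (nodes G)"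
    and X_nodes: "\<And>v. v \<in> nodes G \<Longrightarrow> int v \<le> X"
    and X_card: "int (size_of G) \<le> X"
    and X_weight: "\<And>e. e \<in> edges G \<Longrightarrow> \<bar>weight G e\<bar> \<le> X"
begin

lemma finite_nodes: "finite (nodes G)"
  using graph(1) by (auto simp: simple_graph_def)

lemma nodes_nonempty: "nodes G \<noteq> {}"
  using graph(2) by (auto simp: connects_def)

lemma X_ge_1: "1 \<le> X"
  using X_card finite_nodes nodes_nonempty card_gt_0_iff[of "nodes G"] by linarith

lemma X_nonneg [simp]: "0 \<le> X"
  using X_ge_1 by simp

lemma edge_subset_nodes: "e \<in> edges G \<Longrightarrow> e \<subseteq> nodes G"
  using graph(1) by (auto simp: simple_graph_def)

lemma nbrs_subset: "nbrs G v \<subseteq> nodes G"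
  using edge_nodes[OF graph(1)] by (auto simp: nbrs_def)

lemma finite_nbrs: "finite (nbrs G v)"
  using nbrs_subset finite_nodes finite_subset by blast

lemma nbrs_sym: "u \<in> nbrs G v \<longleftrightarrow> v \<in> nbrs G u"
  by (auto simp: nbrs_def insert_commute)

lemma received_nbr: "u \<in> nbrs G v \<Longrightarrow> received G s v u = s u v"
  by (simp add: received_def nbrs_def)

lemma hop_ball_nodes:
  assumes "F \<subseteq> edges G" "v \<in> nodes G"
  shows "hop_ball F t v \<subseteq> nodes G" "finite (hop_ball F t v)"
proof -
  show "hop_ball F t v \<subseteq> nodes G" using assms edge_subset_nodes by (intro hop_ball_subset_nodes) auto
  then show "finite (hop_ball F t v)" using finite_nodes finite_subset by blast
qed

lemma component_nodes:
  assumes "F \<subseteq> edges G" "v \<in> nodes G"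
  shows "component F v \<subseteq> nodes G" "finite (component F v)"
proof -
  show "component F v \<subseteq> nodes G" using assms edge_subset_nodes by (intro component_subset_nodes) auto
  then show "finite (component F v)" using finite_nodes finite_subset by blast
qed

lemma short_bit [simp]: "short X [0]" "short X [1]"
  using X_ge_1 by (auto simp: short_def)

lemma runs_bcast:
  assumes "\<And>v. v \<in> nodes G \<Longrightarrow> short X (x v)"
  shows "runs G X 1 (\<lambda>v. exch (\<lambda>_. x v)) (received G (\<lambda>v _. x v))"
  using assms edge_nodes[OF graph(1)] by (intro runs_exch) (auto simp: insert_commute)

lemma runs_fmin:
  assumes F: "F \<subseteq> edges G" "\<And>v. v \<in> nodes G \<Longrightarrow> S v = {u. {u, v} \<in> F}"
    and x: "\<And>v. v \<in> nodes G \<Longrightarrow> short X (x v)"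
  shows "runs G X t (\<lambda>v. fmin t (S v) (x v)) (\<lambda>v. Min (x ` hop_ball F t v))"
proof -
  define \<sigma> where "\<sigma> i v = Min (x ` hop_ball F i v)" for i v
  have "runs G X 1 (\<lambda>v. min_step (S v) (\<sigma> i v)) (\<sigma> (Suc i))" for i
    unfolding min_step_def
  proof (rule runs_bind_Ret, rule runs_bcast)
    fix v assume v: "v \<in> nodes G"
    note fin = hop_ball_nodes[OF F(1)]
    have "Min (x ` hop_ball F i v) \<in> x ` hop_ball F i v" using fin(2)[OF v] by (intro Min_in) auto
    then show "short X (\<sigma> i v)" using x fin(1)[OF v] unfolding \<sigma>_def by fastforce
    have "received G (\<lambda>v _. \<sigma> i v) v ` S v = \<sigma> i ` S v"
      using F v by (intro image_cong) (auto simp: received_def)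
    moreover have "hop_ball F 1 v = insert v (S v)"
      using F(2)[OF v] by (auto simp: insert_commute)
    ultimately have "insert (\<sigma> i v) (received G (\<lambda>v _. \<sigma> i v) v ` S v) = \<sigma> i ` hop_ball F 1 v" by simp
    moreover have "Min (\<sigma> i ` hop_ball F 1 v) = Min (x ` (\<Union>w \<in> hop_ball F 1 v. hop_ball F i w))"
      unfolding \<sigma>_def
    proof (rule Min_UNION)
      show "hop_ball F i w \<noteq> {}" for w using hop_ball_self by blast
      show "hop_ball F 1 v \<noteq> {}" using hop_ball_self by blast
      show "finite (hop_ball F i w)" if "w \<in> hop_ball F 1 v" for w
        using fin(1)[OF v] fin(2) that by blast
    qed (rule fin(2)[OF v])
    ultimately show "Ret (Min (insert (\<sigma> i v) (received G (\<lambda>v _. \<sigma> i v) v ` S v))) = Ret (\<sigma> (Suc i) v)"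
      unfolding \<sigma>_def hop_ball_Suc' by simp
  qed
  then have "runs G X (t * 1) (\<lambda>v. iter t (min_step (S v)) (\<sigma> 0 v)) (\<sigma> t)"
    by (intro runs_iter[where f = "\<lambda>v. min_step (S v)"]) auto
  then show ?thesis unfolding fmin_def by (simp add: \<sigma>_def[abs_def])
qed

lemma runs_fmin_nbrs:
  assumes "\<And>v. v \<in> nodes G \<Longrightarrow> short X (x v)"
  shows "runs G X t (\<lambda>v. fmin t (nbrs G v) (x v)) (\<lambda>v. Min (x ` hop_ball (edges G) t v))"
  by (rule runs_fmin) (auto simp: nbrs_def assms)

lemma Min_hop_ball_flag:
  assumes "F \<subseteq> edges G" "v \<in> nodes G"
  shows "Min ((\<lambda>u. if P u then [0] else [1 :: int]) ` hop_ball F t v) =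
    (if \<exists>u \<in> hop_ball F t v. P u then [0] else [1])"
proof -
  let ?A = "(\<lambda>u. if P u then [0] else [1 :: int]) ` hop_ball F t v"
  have fin: "finite ?A" using hop_ball_nodes[OF assms] by simp
  show ?thesis
  proof (cases "\<exists>u \<in> hop_ball F t v. P u")
    case True
    then have "[0] \<in> ?A" by (auto intro!: image_eqI)
    then have "Min ?A = [0]" using fin by (intro Min_eqI) auto
    then show ?thesis using True by simp
  next
    case False
    then have "?A = (\<lambda>_. [1]) ` hop_ball F t v" by (intro image_cong) auto
    also have "\<dots> = {[1]}" by (simp add: image_constant_conv)
    finally have "?A = {[1]}" .
    then have "Min ?A = [1]" by simp
    then show ?thesis using False by (simp only: if_False)
  qed
qed

definition leader :: nat where
  "leader = Min (nodes G)"

lemma leader_node: "leader \<in> nodes G"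
  unfolding leader_def using finite_nodes nodes_nonempty by simp

lemma leader_le: "v \<in> nodes G \<Longrightarrow> leader \<le> v"
  unfolding leader_def using finite_nodes by simp

end

definition elect :: "nat \<Rightarrow> nat set \<Rightarrow> nat \<Rightarrow> nat option prog" where
  "elect v N d = fmin d N [int v] \<rhd> (\<lambda>m. exch (\<lambda>_. m) \<rhd> (\<lambda>r.
     fmin d N (if \<exists>u \<in> N. r u \<noteq> m then [0] else [1]) \<rhd> (\<lambda>z.
     fmin d N (if m = [int v] \<and> z = [1] then [0] else [1]) \<rhd> (\<lambda>g.
     Ret (if g = [0] then Some (nat (hd m)) else None)))))"

context network
begin

text \<open>The search must not stop before the balls of radius \<open>d\<close> cover the graph.
  Let v see its own identifier as the minimum and no disagreement between neighbours in its ball.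
  Then all nodes within distance d + 1 have the minimum v, so v lies in their balls and they in that
  of v. The ball of v has thus stopped growing and is the whole graph.\<close>

lemma runs_elect:
  "runs G X (3 * d + 1) (\<lambda>v. elect v (nbrs G v) d)
     (\<lambda>v. if nodes G \<subseteq> hop_ball (edges G) d leader then Some leader else None)"
proof -
  let ?B = "\<lambda>v. hop_ball (edges G) d v"
  define m where "m v = Min ((\<lambda>v. [int v]) ` ?B v)" for v
  define alarm where "alarm v \<longleftrightarrow> (\<exists>u \<in> nbrs G v. m u \<noteq> m v)" for v
  define z where "z v = (if \<exists>u \<in> ?B v. alarm u then [0] else [1 :: int])" for v
  define go where "go v \<longleftrightarrow> m v = [int v] \<and> z v = [1]" for v
  note B = hop_ball_nodes[OF order_refl]
  have m_eq: "m v = [int (Min (?B v))]" if "v \<in> nodes G" for v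
  proof -
    have "mono (\<lambda>v. [int v])" by (auto simp: mono_def)
    then show ?thesis unfolding m_def
      using mono_Min_commute[of "\<lambda>v. [int v]" "?B v"] B(2)[OF that] by auto
  qed
  have m_short: "short X (m v)" if "v \<in> nodes G" for v
  proof -
    have "Min (?B v) \<in> nodes G" using B[OF that] hop_ball_self[of v "edges G" d] Min_in[of "?B v"] by blast
    then show ?thesis using X_nodes m_eq[OF that] by (simp add: short_def)
  qed
  have go_imp: "v = leader \<and> nodes G \<subseteq> ?B leader" if v: "v \<in> nodes G" "go v" for v
  proof -
    have Mv: "Min (?B v) = v" using v m_eq by (simp add: go_def)
    have no_alarm: "\<not> alarm u" if "u \<in> ?B v" for u using v that by (auto simp: go_def z_def split: if_splits)
    \<comment> \<open>Agreement extends to distance d + 1, because a node at distance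
      \<open>d\<close> also compares itself with the neighbours beyond.\<close>
    have agree: "m u = m v" if "u \<in> hop_ball (edges G) i v" "i \<le> Suc d" for u i
      using that
    proof (induction i arbitrary: u)
      case (Suc i)
      show ?case
      proof (cases "u \<in> hop_ball (edges G) i v")
        case False
        then obtain w where w: "w \<in> hop_ball (edges G) i v" "{w, u} \<in> edges G" using Suc.prems by auto
        then have "w \<in> ?B v" using hop_ball_mono[of i d] Suc.prems(2) by auto
        then have "m u = m w" using no_alarm w(2) by (auto simp: alarm_def nbrs_def insert_commute)
        then show ?thesis using Suc.IH[OF w(1)] Suc.prems(2) by simp
      next
        case True
        then show ?thesis using Suc.IH[OF True] Suc.prems(2) by simp
      qed
    qed auto
    have "hop_ball (edges G) (Suc d) v \<subseteq> ?B v"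
    proof
      fix u assume u: "u \<in> hop_ball (edges G) (Suc d) v"
      then have un: "u \<in> nodes G" using B(1)[OF v(1)] by blast
      then have "Min (?B u) = v" using agree[OF u] m_eq v(1) Mv by simp
      then have "v \<in> ?B u" using B(2)[OF un] hop_ball_self[of u "edges G" d] by (metis Min_in empty_iff)
      then show "u \<in> ?B v" by (rule hop_ball_sym)
    qed
    then have "hop_ball (edges G) (Suc d) v = ?B v" using hop_ball_mono[of d "Suc d"] by auto
    then have "component (edges G) v \<subseteq> ?B v" by (rule hop_ball_fixed)
    then have all: "nodes G \<subseteq> ?B v" using graph(2) v(1) by (auto simp: connects_def component_def)
    then have "?B v = nodes G" using B(1)[OF v(1)] by auto
    then show ?thesis using Mv all by (simp add: leader_def)
  qed
  have go_if: "go leader" if all: "nodes G \<subseteq> ?B leader"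
  proof -
    have "Min (?B v) = leader" if v: "v \<in> nodes G" for v
    proof (rule Min_eqI)
      show "leader \<in> ?B v" using all v hop_ball_sym by blast
    qed (use B[OF v] leader_le in auto)
    then have m: "m v = [int leader]" if "v \<in> nodes G" for v using m_eq that by simp
    then have "\<not> alarm u" if "u \<in> nodes G" for u using that nbrs_subset[of u] by (auto simp: alarm_def)
    then show ?thesis
      using m leader_node B(1)[OF leader_node] by (auto simp: go_def z_def)
  qed
  have go: "(\<exists>u \<in> ?B v. go u) \<longleftrightarrow> nodes G \<subseteq> ?B leader" if v: "v \<in> nodes G" for v
    using go_imp go_if v hop_ball_sym B(1)[OF v] by blast
  have res: "nat (hd (m v)) = leader" if v: "v \<in> nodes G" and all: "nodes G \<subseteq> ?B leader" for v
  proof -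
    have "Min (?B v) = leader"
    proof (rule Min_eqI)
      show "leader \<in> ?B v" using all v hop_ball_sym by blast
    qed (use B[OF v] leader_le in auto)
    then show ?thesis using m_eq[OF v] by simp
  qed
  show ?thesis
    unfolding elect_def
  proof (rule runs_bind_eq[where t' = "2 * d + 1", OF runs_fmin_nbrs], goal_cases)
    case 2
    show ?case
    proof (rule runs_bind_eq[where t' = "2 * d", OF runs_bcast], goal_cases)
      case (1 v)
      then show ?case using m_short by (simp add: m_def)
    next
      case 2
      have "(\<exists>u \<in> nbrs G v. received G (\<lambda>v _. m v) v u \<noteq> m v) \<longleftrightarrow> alarm v" for v
        by (auto simp: alarm_def received_nbr)
      note 3 = this[unfolded m_def]
      show ?case unfolding 3
      proof (rule runs_bind_eq[where t' = d, OF runs_fmin_nbrs], goal_cases)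
        case 2
        have "runs G X (d + 0) (\<lambda>v. fmin d (nbrs G v) (if go v then [0] else [1]) \<rhd>
              (\<lambda>g. Ret (if g = [0] then Some (nat (hd (m v))) else None)))
            (\<lambda>v. if nodes G \<subseteq> ?B leader then Some leader else None)"
          by (rule runs_bind[OF runs_fmin_nbrs]) (auto simp: Min_hop_ball_flag go res)
        then show ?case
          unfolding add_0_right
        proof (rule runs_cong)
          fix v assume v: "v \<in> nodes G"
          have z: "Min ((\<lambda>v. if alarm v then [0] else [1]) ` ?B v) = z v"
            using v by (simp add: Min_hop_ball_flag z_def)
          have z': "Min ((\<lambda>v. [int v]) ` ?B v) = m v" by (simp add: m_def)
          show "fmin d (nbrs G v) (if go v then [0] else [1]) \<rhd>
              (\<lambda>g. Ret (if g = [0] then Some (nat (hd (m v))) else None)) =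
            fmin d (nbrs G v) (if Min ((\<lambda>v. [int v]) ` ?B v) = [int v] \<and>
               Min ((\<lambda>v. if alarm v then [0] else [1]) ` ?B v) = [1 :: int] then [0] else [1]) \<rhd>
              (\<lambda>g. Ret (if g = [0] then Some (nat (hd (Min ((\<lambda>v. [int v]) ` ?B v)))) else None))"
            by (simp only: z z' go_def)
        qed simp
      qed auto
    qed simp
  qed (use X_nodes in \<open>auto simp: short_def\<close>)
qed

end

subsection \<open>Sums and ranks in a breadth-first tree\<close>

record place =
  me :: nat
  nb :: "nat set"
  tree_root :: nat
  height :: nat
  parent :: nat
  children :: "nat set"

definition bfs_update :: "nat set \<Rightarrow> (nat \<Rightarrow> int list) \<Rightarrow> nat option \<Rightarrow> nat option" where
  "bfs_update N r p = (if p \<noteq> None then p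
     else if \<exists>u \<in> N. r u = [1] then Some (Min {u \<in> N. r u = [1]}) else None)"

text \<open>Nodes at depth i adopt a parent in the i-th iteration, the smallest neighbour that has
  been reached; the root counts as its own parent. The additional round tells the parents who their
  children are.\<close>

definition find_place :: "nat \<Rightarrow> nat set \<Rightarrow> nat \<Rightarrow> nat \<Rightarrow> place prog" where
  "find_place v N l h =
     iter h (\<lambda>p. exch (\<lambda>_. if p = None then [0] else [1]) \<rhd> (\<lambda>r. Ret (bfs_update N r p)))
       (if v = l then Some l else None) \<rhd> (\<lambda>p.
     exch (\<lambda>u. if p = Some u then [1] else [0]) \<rhd> (\<lambda>r.
     Ret \<lparr>me = v, nb = N, tree_root = l, height = h, parent = the p, children = {u \<in> N. r u = [1]}\<rparr>))"

text \<open>There is no waiting for the leaves: every node recomputes its sum in each round, and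
  after \<open>height P\<close> rounds all sums are final. In this way all nodes use the same number
  of rounds.\<close>

definition subtree_sum :: "place \<Rightarrow> int \<Rightarrow> int prog" where
  "subtree_sum P x = iter (height P)
     (\<lambda>s. exch (\<lambda>_. [s]) \<rhd> (\<lambda>r. Ret (x + (\<Sum>u \<in> children P. hd (r u))))) x"

definition total :: "place \<Rightarrow> int \<Rightarrow> int prog" where
  "total P x = subtree_sum P x \<rhd> (\<lambda>s.
     fmin (height P) (nb P) (if me P = tree_root P then [0, s] else [1]) \<rhd> (\<lambda>z. Ret (z ! 1)))"

text \<open>The rank of a node with \<open>x = 1\<close> is its position in a depth-first order of these nodes.\<close>

definition rank :: "place \<Rightarrow> int \<Rightarrow> int prog" where
  "rank P x = subtree_sum P x \<rhd> (\<lambda>s. exch (\<lambda>_. [s]) \<rhd> (\<lambda>r.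
     iter (height P) (\<lambda>q.
       exch (\<lambda>u. [q + x + (\<Sum>w \<in> {w \<in> children P. w < u}. hd (r w))]) \<rhd> (\<lambda>r'.
       Ret (if me P = tree_root P then 0 else hd (r' (parent P))))) 0))"

context network
begin

definition depth :: "nat \<Rightarrow> nat" where
  "depth v = (LEAST i. v \<in> hop_ball (edges G) i leader)"

lemma depth_le: "v \<in> hop_ball (edges G) i leader \<Longrightarrow> depth v \<le> i"
  unfolding depth_def by (rule Least_le)

definition placed :: "nat \<Rightarrow> (nat \<Rightarrow> place) \<Rightarrow> bool" where
  "placed h pl \<longleftrightarrow> nodes G \<subseteq> hop_ball (edges G) h leader \<and> (\<forall>v \<in> nodes G.
     me (pl v) = v \<and> nb (pl v) = nbrs G v \<and> tree_root (pl v) = leader \<and> height (pl v) = h \<and>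
     children (pl v) = {u \<in> nodes G - {leader}. parent (pl u) = v} \<and>
     (v \<noteq> leader \<longrightarrow> parent (pl v) \<in> nbrs G v \<and> depth (parent (pl v)) < depth v))"

primrec bfs_state :: "nat \<Rightarrow> nat \<Rightarrow> nat option" where
  "bfs_state 0 v = (if v = leader then Some leader else None)"
| "bfs_state (Suc i) v = bfs_update (nbrs G v) (\<lambda>u. if bfs_state i u = None then [0] else [1]) (bfs_state i v)"

lemma bfs_state_reached: "bfs_state i v \<noteq> None \<longleftrightarrow> v \<in> hop_ball (edges G) i leader"
proof (induction i arbitrary: v)
  case (Suc i)
  have "bfs_state (Suc i) v \<noteq> None \<longleftrightarrow> bfs_state i v \<noteq> None \<or> (\<exists>u \<in> nbrs G v. bfs_state i u \<noteq> None)"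
    by (auto simp: bfs_update_def)
  then show ?case using Suc.IH by (auto simp: nbrs_def)
qed simp

text \<open>A node adopts a parent at the first possible moment. The parent was reached at least one
  step earlier, so its depth is smaller, and later steps keep the choice.\<close>

lemma bfs_state_parent:
  assumes "bfs_state i v = Some u" "v \<noteq> leader"
  shows "u \<in> nbrs G v \<and> depth u < depth v"
  using assms(1)
proof (induction i)
  case 0
  then show ?case using assms(2) by simp
next
  case (Suc i)
  show ?case
  proof (cases "bfs_state i v")
    case None
    let ?U = "{u \<in> nbrs G v. bfs_state i u \<noteq> None}"
    have "{u \<in> nbrs G v. (if bfs_state i u = None then [0] else [1 :: int]) = [1]} = ?U" by auto
    then have "?U \<noteq> {}" "u = Min ?U"
      using None Suc.prems by (auto simp only: bfs_state.simps bfs_update_def split: if_splits)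
    then have u: "u \<in> ?U" using finite_nbrs Min_in[of ?U] by simp
    then have "depth u \<le> i" using bfs_state_reached depth_le by blast
    moreover have "i < depth v"
    proof (rule ccontr)
      assume "\<not> i < depth v"
      have "v \<in> hop_ball (edges G) (Suc i) leader" using Suc.prems bfs_state_reached by blast
      then have "v \<in> hop_ball (edges G) (depth v) leader" unfolding depth_def by (rule LeastI)
      then have "v \<in> hop_ball (edges G) i leader"
        using \<open>\<not> i < depth v\<close> hop_ball_mono[of "depth v" i] by auto
      then show False using None bfs_state_reached by blast
    qed
    ultimately show ?thesis using u by auto
  next
    case (Some w)
    then show ?thesis using Suc by (simp add: bfs_update_def)
  qed
qed

lemma runs_find_place:
  assumes cover: "nodes G \<subseteq> hop_ball (edges G) h leader"
  shows "\<exists>pl. runs G X (h + 1) (\<lambda>v. find_place v (nbrs G v) leader h) pl \<and> placed h pl"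
proof -
  define par where "par v = the (bfs_state h v)" for v
  define pl where "pl v = \<lparr>me = v, nb = nbrs G v, tree_root = leader, height = h, parent = par v,
    children = {u \<in> nbrs G v. bfs_state h u = Some v}\<rparr>" for v
  have par: "bfs_state h v = Some (par v)" if "v \<in> nodes G" for v
    using bfs_state_reached[of h v] that cover by (auto simp: par_def)
  have "runs G X (h * 1) (\<lambda>v. iter h (\<lambda>p. exch (\<lambda>_. if p = None then [0] else [1]) \<rhd>
      (\<lambda>r. Ret (bfs_update (nbrs G v) r p))) (bfs_state 0 v)) (bfs_state h)"
  proof (rule runs_iter)
    fix i
    show "runs G X 1 (\<lambda>v. exch (\<lambda>_. if bfs_state i v = None then [0] else [1]) \<rhd>
      (\<lambda>r. Ret (bfs_update (nbrs G v) r (bfs_state i v)))) (bfs_state (Suc i))"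
    proof (rule runs_bind_Ret[OF runs_bcast])
      fix v
      have "(received G (\<lambda>v _. if bfs_state i v = None then [0] else [1]) v u = [1]) =
          ((if bfs_state i u = None then [0] else [1 :: int]) = [1])" if "u \<in> nbrs G v" for u
        using that by (simp add: received_nbr)
      then have "bfs_update (nbrs G v) (received G (\<lambda>v _. if bfs_state i v = None then [0] else [1]) v) (bfs_state i v) =
          bfs_state (Suc i) v" by (simp add: bfs_update_def cong: conj_cong bex_cong)
      then show "Ret (bfs_update (nbrs G v) (received G (\<lambda>v _. if bfs_state i v = None then [0] else [1]) v) (bfs_state i v)) =
          Ret (bfs_state (Suc i) v)" by simp
    qed auto
  qed
  then have bfs: "runs G X h (\<lambda>v. iter h (\<lambda>p. exch (\<lambda>_. if p = None then [0] else [1]) \<rhd>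
      (\<lambda>r. Ret (bfs_update (nbrs G v) r p))) (if v = leader then Some leader else None)) (bfs_state h)"
    by simp
  have "runs G X (h + 1) (\<lambda>v. find_place v (nbrs G v) leader h) pl"
    unfolding find_place_def
  proof (rule runs_bind[OF bfs], rule runs_bind_Ret[OF runs_exch])
    fix v
    have "{u \<in> nbrs G v. received G (\<lambda>v u. if bfs_state h v = Some u then [1] else [0]) v u = [1]} =
      {u \<in> nbrs G v. bfs_state h u = Some v}"
      by (auto simp: received_nbr split: if_splits)
    then show "Ret \<lparr>me = v, nb = nbrs G v, tree_root = leader, height = h, parent = the (bfs_state h v),
        children = {u \<in> nbrs G v. received G (\<lambda>v u. if bfs_state h v = Some u then [1] else [0]) v u = [1]}\<rparr> = Ret (pl v)"
      by (simp add: pl_def par_def)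
  qed auto
  moreover have "placed h pl"
    unfolding placed_def
  proof (intro conjI ballI cover)
    fix v assume v: "v \<in> nodes G"
    have "bfs_state h leader = Some leader"
    proof -
      have "bfs_state i leader = Some leader" for i by (induction i) (auto simp: bfs_update_def)
      then show ?thesis .
    qed
    moreover have "leader \<notin> nbrs G leader" using edge_irrefl[OF graph(1), of leader leader] by (auto simp: nbrs_def)
    ultimately show "children (pl v) = {u \<in> nodes G - {leader}. parent (pl u) = v}"
      using par bfs_state_parent nbrs_subset[of v] by (auto simp: pl_def nbrs_sym)
    show "v \<noteq> leader \<longrightarrow> parent (pl v) \<in> nbrs G v \<and> depth (parent (pl v)) < depth v"
      using bfs_state_parent[OF par[OF v]] by (simp add: pl_def)
  qed (simp_all add: pl_def)
  ultimately show ?thesis by blast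
qed

end

text \<open>Intervals of lengths \<open>S u\<close>, laid end to end in increasing order of u, cover
  the range from 0 to the total. This selects the child below which a prescribed rank is
  found.\<close>

lemma prefix_interval:
  fixes S :: "nat \<Rightarrow> int"
  assumes "finite A" "0 \<le> z" "z < sum S A"
  shows "\<exists>u \<in> A. sum S {w \<in> A. w < u} \<le> z \<and> z < sum S {w \<in> A. w < u} + S u"
  using assms
proof (induction A rule: finite_linorder_max_induct)
  case (insert b A)
  have b: "b \<notin> A" using insert.hyps by auto
  have eq: "{w \<in> insert b A. w < u} = {w \<in> A. w < u}" if "u \<in> A" for u using insert.hyps that by fastforce
  show ?case
  proof (cases "z < sum S A")
    case True
    then show ?thesis using insert eq by force
  next
    case False
    moreover have "{w \<in> insert b A. w < b} = A" using insert.hyps by auto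
    ultimately show ?thesis using insert b by (intro bexI[of _ b]) auto
  qed
qed simp

locale tree_network = network +
  fixes h :: nat and pl :: "nat \<Rightarrow> place"
  assumes placed: "placed h pl"
begin

lemma cover: "nodes G \<subseteq> hop_ball (edges G) h leader"
  using placed by (simp add: placed_def)

lemma place_simps:
  assumes "v \<in> nodes G"
  shows "me (pl v) = v" "nb (pl v) = nbrs G v" "tree_root (pl v) = leader" "height (pl v) = h"
    "children (pl v) = {u \<in> nodes G - {leader}. parent (pl u) = v}"
  using placed assms by (auto simp: placed_def)

lemma parent:
  assumes "v \<in> nodes G" "v \<noteq> leader"
  shows "parent (pl v) \<in> nbrs G v" "parent (pl v) \<in> nodes G" "depth (parent (pl v)) < depth v"
  using placed assms nbrs_subset[of v] by (auto simp: placed_def)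

lemma depth_le_h: "v \<in> nodes G \<Longrightarrow> depth v \<le> h"
  using cover by (intro depth_le) auto

lemma cover2: "v \<in> nodes G \<Longrightarrow> nodes G \<subseteq> hop_ball (edges G) (2 * h) v"
  using cover hop_ball_trans[of leader "edges G" h v] hop_ball_sym by (fastforce simp: mult_2)

abbreviation kids :: "nat \<Rightarrow> nat set" where
  "kids v \<equiv> {u \<in> nodes G - {leader}. parent (pl u) = v}"

lemma finite_kids: "finite (kids v)"
  using finite_nodes by simp

lemma kids_nbrs: "kids v \<subseteq> nbrs G v"
  using parent(1) nbrs_sym by blast

primrec subsum :: "(nat \<Rightarrow> int) \<Rightarrow> nat \<Rightarrow> nat \<Rightarrow> int" where
  "subsum x 0 v = x v"
| "subsum x (Suc i) v = x v + (\<Sum>u \<in> kids v. subsum x i u)"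

text \<open>The limit is the sum of \<open>x\<close> over the nodes before \<open>v\<close> in the
  depth-first preorder with siblings sorted by identifier: the prefix of the parent, the parent
  itself and the subtrees of smaller siblings.\<close>

primrec offset :: "(nat \<Rightarrow> int) \<Rightarrow> nat \<Rightarrow> nat \<Rightarrow> int" where
  "offset x 0 v = 0"
| "offset x (Suc i) v = (if v = leader then 0 else
     offset x i (parent (pl v)) + x (parent (pl v)) +
     (\<Sum>w \<in> {w \<in> kids (parent (pl v)). w < v}. subsum x h w))"

text \<open>Depth grows strictly from parent to child and is at most \<open>h\<close>, so below
  \<open>v\<close> there are at most h - depth v further levels, and the sum is final after as many
  steps.\<close>

lemma subsum_stable:
  assumes "v \<in> nodes G" "h - depth v \<le> i"
  shows "subsum x (Suc i) v = subsum x i v"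
  using assms
proof (induction i arbitrary: v)
  case 0
  have "kids v = {}"
  proof (rule ccontr)
    assume "kids v \<noteq> {}"
    then obtain u where "u \<in> kids v" by blast
    then show False using parent(3)[of u] depth_le_h[of u] 0 by auto
  qed
  then show ?case by (simp only: subsum.simps sum.empty)
next
  case (Suc i)
  have "subsum x (Suc i) u = subsum x i u" if "u \<in> kids v" for u
    using that parent(3)[of u] Suc by auto
  then have "(\<Sum>u \<in> kids v. subsum x (Suc i) u) = (\<Sum>u \<in> kids v. subsum x i u)"
    by (intro sum.cong refl)
  then show ?case by (simp only: subsum.simps(2)[of x "Suc i" v] subsum.simps(2)[of x i v])
qed

lemma subsum_eq: "v \<in> nodes G \<Longrightarrow> subsum x h v = x v + (\<Sum>u \<in> kids v. subsum x h u)"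
  using subsum_stable[of v h x] by simp

lemma offset_stable:
  assumes "v \<in> nodes G" "depth v \<le> i"
  shows "offset x (Suc i) v = offset x i v"
  using assms
proof (induction i arbitrary: v)
  case 0
  then show ?case using parent(3)[of v] by auto
next
  case (Suc i)
  have "offset x (Suc i) (parent (pl v)) = offset x i (parent (pl v))" if "v \<noteq> leader"
    using that parent(2,3)[of v] Suc by auto
  then show ?case by (simp del: offset.simps add: offset.simps(2)[of x "Suc i" v] offset.simps(2)[of x i v])
qed

lemma offset_eq:
  assumes "v \<in> nodes G" "v \<noteq> leader"
  shows "offset x h v = offset x h (parent (pl v)) + x (parent (pl v)) +
    (\<Sum>w \<in> {w \<in> kids (parent (pl v)). w < v}. subsum x h w)"
  using offset_stable[OF assms(1) depth_le_h[OF assms(1)], of x] assms(2) by simp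

lemma offset_leader: "offset x i leader = 0"
  by (cases i) auto

text \<open>Summing the recurrence over all nodes cancels every subtree sum except that of the root,
  because each other node is a child of exactly one node. No explicit description of subtrees is
  involved.\<close>

lemma subsum_leader: "subsum x h leader = sum x (nodes G)"
proof -
  have "(\<Sum>v \<in> nodes G. subsum x h v) = (\<Sum>v \<in> nodes G. x v + (\<Sum>u \<in> kids v. subsum x h u))"
    using subsum_eq by (intro sum.cong) auto
  also have "\<dots> = sum x (nodes G) + (\<Sum>v \<in> nodes G. \<Sum>u \<in> kids v. subsum x h u)"
    by (rule sum.distrib)
  also have "(\<Sum>v \<in> nodes G. \<Sum>u \<in> kids v. subsum x h u) = (\<Sum>u \<in> nodes G - {leader}. subsum x h u)"
    using parent(2) finite_nodes by (intro sum.group) auto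
  also have "(\<Sum>v \<in> nodes G. subsum x h v) = subsum x h leader + (\<Sum>u \<in> nodes G - {leader}. subsum x h u)"
    using leader_node finite_nodes by (intro sum.remove)
  finally show ?thesis by simp
qed

context
  fixes x :: "nat \<Rightarrow> int"
  assumes x: "\<And>v. v \<in> nodes G \<Longrightarrow> 0 \<le> x v" "sum x (nodes G) \<le> X"
begin

lemma subsum_nonneg: "v \<in> nodes G \<Longrightarrow> 0 \<le> subsum x i v"
  by (induction i arbitrary: v) (auto intro!: add_nonneg_nonneg sum_nonneg x(1))

lemma subsum_incr: "v \<in> nodes G \<Longrightarrow> subsum x i v \<le> subsum x (Suc i) v"
proof (induction i arbitrary: v)
  case 0
  then show ?case using x(1) by (auto intro!: sum_nonneg)
next
  case (Suc i)
  have "(\<Sum>u \<in> kids v. subsum x i u) \<le> (\<Sum>u \<in> kids v. subsum x (Suc i) u)"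
    using Suc by (intro sum_mono) auto
  then show ?case by simp
qed

text \<open>Each node owns the interval that starts at its offset and has the length of its subtree
  sum. It lies inside the interval of the parent, hence inside that of the root, which bounds all
  numbers sent.\<close>

lemma offset_subsum_le: "v \<in> nodes G \<Longrightarrow> 0 \<le> offset x h v \<and> offset x h v + subsum x h v \<le> sum x (nodes G)"
proof (induction "depth v" arbitrary: v rule: less_induct)
  case less
  show ?case
  proof (cases "v = leader")
    case True
    then show ?thesis by (simp add: offset_leader subsum_leader)
  next
    case False
    let ?p = "parent (pl v)"
    note p = parent[OF less.prems False]
    have IH: "0 \<le> offset x h ?p" "offset x h ?p + subsum x h ?p \<le> sum x (nodes G)"
      using less.hyps[OF p(3,2)] by auto
    have "v \<in> kids ?p" using less.prems False by simp
    have "(\<Sum>w \<in> {w \<in> kids ?p. w < v}. subsum x h w) + subsum x h v =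
      (\<Sum>w \<in> insert v {w \<in> kids ?p. w < v}. subsum x h w)"
      using finite_nodes by simp
    also have "\<dots> \<le> (\<Sum>w \<in> kids ?p. subsum x h w)"
      using \<open>v \<in> kids ?p\<close> finite_kids subsum_nonneg by (intro sum_mono2) auto
    finally have "offset x h v + subsum x h v \<le> offset x h ?p + subsum x h ?p"
      using offset_eq[OF less.prems False, of x] subsum_eq[OF p(2), of x] by simp
    moreover have "0 \<le> (\<Sum>w \<in> {w \<in> kids ?p. w < v}. subsum x h w)"
      using subsum_nonneg by (intro sum_nonneg) auto
    ultimately show ?thesis using IH x(1)[OF p(2)] offset_eq[OF less.prems False, of x] by simp
  qed
qed

lemma subsum_le:
  assumes "v \<in> nodes G" "i \<le> h"
  shows "0 \<le> subsum x i v" "subsum x i v \<le> subsum x h v" "subsum x i v \<le> X"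
proof -
  show "0 \<le> subsum x i v" using assms subsum_nonneg by blast
  show "subsum x i v \<le> subsum x h v"
    by (rule lift_Suc_mono_le[of "\<lambda>i. subsum x i v"]) (use assms subsum_incr in auto)
  then show "subsum x i v \<le> X" using offset_subsum_le[OF assms(1)] x(2) by linarith
qed

lemma offset_incr: "v \<in> nodes G \<Longrightarrow> offset x i v \<le> offset x (Suc i) v"
proof (induction i arbitrary: v)
  case 0
  have "0 \<le> (\<Sum>w \<in> {w \<in> kids (parent (pl v)). w < v}. subsum x h w)"
    using subsum_nonneg by (intro sum_nonneg) auto
  then show ?case using x(1) parent(2)[OF 0] by auto
next
  case (Suc i)
  show ?case
  proof (cases "v = leader")
    case True
    then show ?thesis by (simp only: offset_leader)
  next
    case False
    then show ?thesis using Suc.IH[OF parent(2)[OF Suc.prems False]]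
      by (simp only: offset.simps(2)[of x "Suc i" v] offset.simps(2)[of x i v] if_False)
  qed
qed

lemma offset_le: "v \<in> nodes G \<Longrightarrow> i \<le> h \<Longrightarrow> 0 \<le> offset x i v \<and> offset x i v \<le> offset x h v"
proof
  assume v: "v \<in> nodes G" "i \<le> h"
  show "offset x i v \<le> offset x h v"
    by (rule lift_Suc_mono_le[of "\<lambda>i. offset x i v"]) (use v offset_incr in auto)
  have "offset x 0 v \<le> offset x i v"
    by (rule lift_Suc_mono_le[of "\<lambda>i. offset x i v"]) (use v offset_incr in auto)
  then show "0 \<le> offset x i v" by simp
qed

lemma runs_subtree_sum: "runs G X h (\<lambda>v. subtree_sum (pl v) (x v)) (subsum x h)"
proof -
  have "runs G X (h * 1) (\<lambda>v. iter h (\<lambda>s. exch (\<lambda>_. [s]) \<rhd>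
      (\<lambda>r. Ret (x v + (\<Sum>u \<in> kids v. hd (r u))))) (subsum x 0 v)) (subsum x h)"
  proof (rule runs_iter)
    fix i assume i: "i < h"
    show "runs G X 1 (\<lambda>v. exch (\<lambda>_. [subsum x i v]) \<rhd> (\<lambda>r. Ret (x v + (\<Sum>u \<in> kids v. hd (r u)))))
       (subsum x (Suc i))"
    proof (rule runs_bind_Ret[OF runs_bcast])
      show "short X [subsum x i v]" if "v \<in> nodes G" for v
        using subsum_le[OF that, of i] i by (simp add: short_def)
      fix v
      have "(\<Sum>u \<in> kids v. hd (received G (\<lambda>v _. [subsum x i v]) v u)) = (\<Sum>u \<in> kids v. subsum x i u)"
        using kids_nbrs[of v] by (intro sum.cong) (auto simp: received_nbr subset_iff)
      then show "Ret (x v + (\<Sum>u \<in> kids v. hd (received G (\<lambda>v _. [subsum x i v]) v u))) = Ret (subsum x (Suc i) v)"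
        by simp
    qed
  qed
  then have "runs G X h (\<lambda>v. iter h (\<lambda>s. exch (\<lambda>_. [s]) \<rhd>
      (\<lambda>r. Ret (x v + (\<Sum>u \<in> kids v. hd (r u))))) (x v)) (subsum x h)" by simp
  then show ?thesis
    by (rule runs_cong) (simp_all add: subtree_sum_def place_simps)
qed

lemma runs_total: "runs G X (2 * h) (\<lambda>v. total (pl v) (x v)) (\<lambda>_. sum x (nodes G))"
  unfolding total_def
proof (rule runs_bind_eq[where t' = h, OF runs_subtree_sum])
  let ?y = "\<lambda>v. if v = leader then [0, subsum x h v] else [1]"
  have "runs G X h (\<lambda>v. fmin h (nbrs G v) (?y v) \<rhd> (\<lambda>z. Ret (z ! 1))) (\<lambda>_. sum x (nodes G))"
  proof (rule runs_bind_Ret[OF runs_fmin_nbrs])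
    show "short X (?y v)" if "v \<in> nodes G" for v
      using subsum_le[OF that order_refl] X_ge_1 by (auto simp: short_def)
    fix v assume v: "v \<in> nodes G"
    have "leader \<in> hop_ball (edges G) h v" using cover v hop_ball_sym by blast
    then have "Min (?y ` hop_ball (edges G) h v) = [0, subsum x h leader]"
      using hop_ball_nodes(2)[OF order_refl v] by (intro Min_eqI) (auto intro!: image_eqI)
    then show "Ret (Min (?y ` hop_ball (edges G) h v) ! 1) = Ret (sum x (nodes G))"
      by (simp add: subsum_leader)
  qed
  then show "runs G X h (\<lambda>v. fmin (height (pl v)) (nb (pl v))
      (if me (pl v) = tree_root (pl v) then [0, subsum x h v] else [1]) \<rhd> (\<lambda>z. Ret (z ! 1)))
      (\<lambda>_. sum x (nodes G))"
    by (rule runs_cong) (simp_all add: place_simps)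
qed simp

lemma runs_rank: "runs G X (2 * h + 1) (\<lambda>v. rank (pl v) (x v)) (offset x h)"
  unfolding rank_def
proof (rule runs_bind_eq[where t' = "h + 1", OF runs_subtree_sum])
  let ?m = "\<lambda>i v u. [offset x i v + x v + (\<Sum>w \<in> {w \<in> kids v. w < u}. subsum x h w)]"
  let ?f = "\<lambda>v q. exch (\<lambda>u. [q + x v + (\<Sum>w \<in> {w \<in> kids v. w < u}. subsum x h w)]) \<rhd>
    (\<lambda>r'. Ret (if v = leader then 0 else hd (r' (parent (pl v)))))"
  have loop: "runs G X (h * 1) (\<lambda>v. iter h (?f v) (offset x 0 v)) (offset x h)"
  proof (rule runs_iter)
    fix i assume i: "i < h"
    show "runs G X 1 (\<lambda>v. ?f v (offset x i v)) (offset x (Suc i))"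
    proof (rule runs_bind_Ret[OF runs_exch])
      fix u v assume v: "v \<in> nodes G"
      have "0 \<le> (\<Sum>w \<in> {w \<in> kids v. w < u}. subsum x h w)" using subsum_nonneg by (intro sum_nonneg) auto
      moreover have "(\<Sum>w \<in> {w \<in> kids v. w < u}. subsum x h w) \<le> (\<Sum>w \<in> kids v. subsum x h w)"
        using finite_kids subsum_nonneg by (intro sum_mono2) auto
      ultimately show "short X (?m i v u)"
        using offset_le[OF v, of i] offset_subsum_le[OF v] subsum_eq[OF v, of x] x(1)[OF v] x(2) i
        by (simp add: short_def)
    next
      fix v assume v: "v \<in> nodes G"
      then show "Ret (if v = leader then 0 else hd (received G (?m i) v (parent (pl v)))) = Ret (offset x (Suc i) v)"
        using parent(1)[OF v] by (simp add: received_nbr)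
    qed
  qed
  have "runs G X (1 + h) (\<lambda>v. exch (\<lambda>_. [subsum x h v]) \<rhd> (\<lambda>r.
     iter h (\<lambda>q. exch (\<lambda>u. [q + x v + (\<Sum>w \<in> {w \<in> kids v. w < u}. hd (r w))]) \<rhd> (\<lambda>r'.
       Ret (if v = leader then 0 else hd (r' (parent (pl v)))))) 0)) (offset x h)"
  proof (rule runs_bind[OF runs_bcast])
    show "short X [subsum x h v]" if "v \<in> nodes G" for v
      using subsum_le[OF that order_refl] by (simp add: short_def)
    have "(\<Sum>w \<in> {w \<in> kids v. w < u}. hd (received G (\<lambda>v _. [subsum x h v]) v w)) =
        (\<Sum>w \<in> {w \<in> kids v. w < u}. subsum x h w)" for u v
      using kids_nbrs[of v] by (intro sum.cong) (auto simp: received_nbr subset_iff)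
    then show "runs G X h (\<lambda>v. iter h (\<lambda>q. exch (\<lambda>u. [q + x v +
        (\<Sum>w \<in> {w \<in> kids v. w < u}. hd (received G (\<lambda>v _. [subsum x h v]) v w))]) \<rhd> (\<lambda>r'.
       Ret (if v = leader then 0 else hd (r' (parent (pl v)))))) 0) (offset x h)"
      using loop by simp
  qed
  then show "runs G X (h + 1) (\<lambda>v. exch (\<lambda>_. [subsum x h v]) \<rhd> (\<lambda>r.
     iter (height (pl v)) (\<lambda>q.
       exch (\<lambda>u. [q + x v + (\<Sum>w \<in> {w \<in> children (pl v). w < u}. hd (r w))]) \<rhd> (\<lambda>r'.
       Ret (if me (pl v) = tree_root (pl v) then 0 else hd (r' (parent (pl v)))))) 0)) (offset x h)"
    unfolding add.commute[of 1 h]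
    by (rule runs_cong) (simp_all add: place_simps)
qed simp

text \<open>A value in the interval of \<open>v\<close> belongs either to \<open>v\<close> itself,
  whose share has length at most 1, or to the interval of one of its children, where the search
  continues.\<close>

lemma offset_surj:
  assumes "\<And>v. v \<in> nodes G \<Longrightarrow> x v \<le> 1"
    and "v \<in> nodes G" "offset x h v \<le> y" "y < offset x h v + subsum x h v"
  shows "\<exists>w \<in> nodes G. x w = 1 \<and> offset x h w = y"
  using assms(2-)
proof (induction "h - depth v" arbitrary: v rule: less_induct)
  case less
  show ?case
  proof (cases "y < offset x h v + x v")
    case True
    then show ?thesis using less.prems assms(1) by (intro bexI[of _ v]) force+
  next
    case False
    let ?z = "y - offset x h v - x v"
    have "0 \<le> ?z" "?z < (\<Sum>u \<in> kids v. subsum x h u)"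
      using False less.prems subsum_eq[OF less.prems(1), of x] by auto
    from prefix_interval[OF finite_kids this] obtain u where u: "u \<in> kids v"
      "sum (subsum x h) {w \<in> kids v. w < u} \<le> ?z"
      "?z < sum (subsum x h) {w \<in> kids v. w < u} + subsum x h u" by blast
    then have uv: "u \<in> nodes G" "u \<noteq> leader" "parent (pl u) = v" by auto
    have "h - depth u < h - depth v" using parent(3)[OF uv(1,2)] depth_le_h[OF uv(1)] uv(3) by auto
    moreover have "offset x h u \<le> y" "y < offset x h u + subsum x h u"
      using u(2,3) offset_eq[OF uv(1,2), of x] uv(3) by auto
    ultimately show ?thesis using less.hyps uv(1) by blast
  qed
qed

end

text \<open>Surjectivity onto an interval of the right length makes the ranks injective.\<close>

lemma offset_indicator:
  fixes A :: "nat set" and ind :: "nat \<Rightarrow> int"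
  defines "ind \<equiv> (\<lambda>v. if v \<in> A then 1 else 0)"
  assumes "A \<subseteq> nodes G"
  shows "sum ind (nodes G) = int (card A)" "inj_on (offset ind h) A"
    "offset ind h ` A = {0..<int (card A)}"
proof -
  have fin: "finite A" using assms finite_nodes finite_subset by blast
  show sum: "sum ind (nodes G) = int (card A)"
    using assms finite_nodes by (simp add: ind_def sum.If_cases Int_absorb1)
  have "card A \<le> size_of G" using assms finite_nodes card_mono by blast
  then have le: "sum ind (nodes G) \<le> X" using sum X_card by simp
  have pos: "\<And>v. 0 \<le> ind v" by (simp add: ind_def)
  have "{0..<int (card A)} \<subseteq> offset ind h ` A"
  proof
    fix y assume "y \<in> {0..<int (card A)}"
    then have "\<exists>w \<in> nodes G. ind w = 1 \<and> offset ind h w = y"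
      by (intro offset_surj[OF pos le _ leader_node])
        (simp_all add: offset_leader subsum_leader sum, simp add: ind_def)
    then show "y \<in> offset ind h ` A" by (auto simp: ind_def split: if_splits)
  qed
  then show "offset ind h ` A = {0..<int (card A)}"
    using card_seteq[of "offset ind h ` A" "{0..<int (card A)}"] fin card_image_le[OF fin, of "offset ind h"]
    by simp
  then show "inj_on (offset ind h) A" using fin by (intro eq_card_imp_inj_on) auto
qed

end

subsection \<open>Flooding colour classes\<close>

locale gossiping = network +
  fixes colour :: "nat set \<Rightarrow> nat" and items :: "nat \<Rightarrow> (nat \<times> int list) set"
  assumes short_items: "\<And>v j x. v \<in> nodes G \<Longrightarrow> (j, x) \<in> items v \<Longrightarrow> short X x \<and> x \<noteq> []"
begin

abbreviation all_items :: "(nat \<times> int list) set" where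
  "all_items \<equiv> \<Union>v \<in> nodes G. items v"

abbreviation items_of :: "nat \<Rightarrow> int list set" where
  "items_of j \<equiv> {x. (j, x) \<in> all_items}"

definition colour_class :: "nat \<Rightarrow> nat set set" where
  "colour_class j = {e \<in> edges G. colour e = j}"

primrec gstate :: "nat \<Rightarrow> nat \<Rightarrow> (nat \<times> int list) set \<times> (nat \<times> int list) set" where
  "gstate 0 v = (items v, {})"
| "gstate (Suc i) v = gossip_update (nbrs G v) (\<lambda>u. colour {u, v})
     (\<lambda>u. offer (gstate i u) (colour {u, v})) (gstate i v)"

definition known :: "nat \<Rightarrow> nat \<Rightarrow> (nat \<times> int list) set" where
  "known i v = fst (gstate i v)"

definition sent :: "nat \<Rightarrow> nat \<Rightarrow> (nat \<times> int list) set" where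
  "sent i v = snd (gstate i v)"

lemma offer_known: "offer (gstate i v) j \<noteq> [] \<Longrightarrow> (j, offer (gstate i v) j) \<in> known i v - sent i v"
proof -
  assume "offer (gstate i v) j \<noteq> []"
  then have ex: "\<exists>x. (j, x) \<in> fst (gstate i v) - snd (gstate i v)" by (auto simp: offer_def split: if_splits)
  then have "offer (gstate i v) j = (SOME x. (j, x) \<in> fst (gstate i v) - snd (gstate i v))"
    unfolding offer_def by (rule if_P)
  then show ?thesis using someI_ex[OF ex] by (simp only: known_def sent_def)
qed

lemma known_Suc: "known (Suc i) v =
    known i v \<union> {(colour {u, v}, offer (gstate i u) (colour {u, v})) |u. u \<in> nbrs G v \<and> offer (gstate i u) (colour {u, v}) \<noteq> []}"
  by (simp add: known_def gossip_update_def)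

lemma sent_Suc: "sent (Suc i) v = sent i v \<union> {(j, offer (gstate i v) j) |j. offer (gstate i v) j \<noteq> []}"
  by (simp add: sent_def gossip_update_def)

text \<open>In i rounds an item travels over at most i edges, all of its own colour. This is why the
  arrival of a token certifies the radius of a colour class.\<close>

lemma known_sound:
  "v \<in> nodes G \<Longrightarrow> (j, x) \<in> known i v \<Longrightarrow>
    \<exists>w \<in> nodes G. (j, x) \<in> items w \<and> v \<in> hop_ball (colour_class j) i w"
proof (induction i arbitrary: v)
  case 0
  then show ?case by (auto simp: known_def)
next
  case (Suc i)
  then consider "(j, x) \<in> known i v"
    | u where "u \<in> nbrs G v" "j = colour {u, v}" "x = offer (gstate i u) j" "x \<noteq> []"
    by (auto simp: known_Suc)
  then show ?case
  proof cases
    case 1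
    then show ?thesis using Suc.IH[OF Suc.prems(1)] by auto
  next
    case 2
    then have "(j, x) \<in> known i u" using offer_known[of i u j] by auto
    then obtain w where "w \<in> nodes G" "(j, x) \<in> items w" "u \<in> hop_ball (colour_class j) i w"
      using Suc.IH[of u] 2(1) nbrs_subset by blast
    moreover have "{u, v} \<in> colour_class j" using 2(1,2) by (simp add: nbrs_def colour_class_def)
    ultimately show ?thesis by auto
  qed
qed

lemma known_subset: "v \<in> nodes G \<Longrightarrow> known i v \<subseteq> all_items"
  using known_sound by fast

lemma offer_short:
  assumes "v \<in> nodes G" shows "short X (offer (gstate i v) j)"
proof (cases "offer (gstate i v) j = []")
  case False
  then have "(j, offer (gstate i v) j) \<in> all_items"
    using offer_known[OF False] known_subset[OF assms] by blast
  then show ?thesis using short_items by blast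
qed (simp add: short_def)

lemma sent_subset: "v \<in> nodes G \<Longrightarrow> sent i v \<subseteq> known i v"
proof (induction i)
  case (Suc i)
  then show ?case using offer_known[of i v] by (auto simp: known_Suc sent_Suc)
qed (simp add: sent_def)

lemma sent_imp_known: "v \<in> nodes G \<Longrightarrow> {u, v} \<in> colour_class j \<Longrightarrow> (j, x) \<in> sent i u \<Longrightarrow> (j, x) \<in> known i v"
proof (induction i)
  case (Suc i)
  then show ?case by (auto simp: sent_Suc known_Suc colour_class_def nbrs_def)
qed (simp add: sent_def)

lemma known_mono: "i \<le> i' \<Longrightarrow> known i v \<subseteq> known i' v"
  by (rule lift_Suc_mono_le[of "\<lambda>i. known i v"]) (auto simp: known_Suc)

lemma finite_items_of:
  assumes "finite (items_of j)" "v \<in> nodes G"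
  shows "finite {x. (j, x) \<in> known i v}" "finite {x. (j, x) \<in> sent i v}"
proof -
  have "{x. (j, x) \<in> known i v} \<subseteq> items_of j" using known_subset[OF assms(2)] by auto
  then show *: "finite {x. (j, x) \<in> known i v}" using assms(1) finite_subset by blast
  have "{x. (j, x) \<in> sent i v} \<subseteq> {x. (j, x) \<in> known i v}" using sent_subset[OF assms(2)] by auto
  then show "finite {x. (j, x) \<in> sent i v}" using * finite_subset by blast
qed

text \<open>The number of items a node knows makes up for the time lost waiting for a particular item.\<close>

lemma known_progress:
  assumes fin: "finite (items_of j)" and x: "(j, x) \<in> items w" "w \<in> nodes G"
  shows "v \<in> hop_ball (colour_class j) l w \<Longrightarrow>
    (j, x) \<in> known t v \<or> t \<le> card {y. (j, y) \<in> known t v} + l"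
proof (induction l arbitrary: v t)
  case 0
  then have "(j, x) \<in> known 0 v" using x by (simp add: known_def)
  then show ?case using known_mono[of 0 t v] by auto
next
  case (Suc l)
  note IH = Suc.IH
  have sub: "colour_class j \<subseteq> edges G" by (auto simp: colour_class_def)
  note v = Suc.prems
  have vn: "v \<in> nodes G" using hop_ball_nodes(1)[OF sub x(2)] v by blast
  show ?case
  proof (cases "v \<in> hop_ball (colour_class j) l w")
    case True
    then show ?thesis using Suc.IH[of v t] by auto
  next
    case False
    then obtain u where u: "u \<in> hop_ball (colour_class j) l w" "{u, v} \<in> colour_class j" using v by auto
    have un: "u \<in> nodes G" using hop_ball_nodes(1)[OF sub x(2)] u(1) by blast
    note fin_u = finite_items_of[OF fin un] and fin_v = finite_items_of[OF fin vn]
    \<comment> \<open>An inner induction on the time for the sender \<open>u\<close>: either it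
      sends something new in the colour, or it has sent all the items it knows, whose number the
      outer hypothesis bounds from below.\<close>
    have "(j, x) \<in> sent t u \<or> t \<le> card {y. (j, y) \<in> sent t u} + Suc l"
    proof (induction t)
      case (Suc t)
      show ?case
      proof (cases "offer (gstate t u) j = []")
        case True
        then have "known t u \<inter> {j} \<times> UNIV \<subseteq> sent t u"
          using short_items known_subset[OF un, of t] someI[of "\<lambda>x. (j, x) \<in> known t u - sent t u"]
          unfolding offer_def known_def[symmetric] sent_def[symmetric]
          by (auto split: if_splits) blast
        then have eq: "{y. (j, y) \<in> known t u} = {y. (j, y) \<in> sent t u}" using sent_subset[OF un] by auto
        have mono: "sent t u \<subseteq> sent (Suc t) u" by (auto simp: sent_Suc)
        have "card {y. (j, y) \<in> sent t u} \<le> card {y. (j, y) \<in> sent (Suc t) u}"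
          using mono fin_u by (intro card_mono) auto
        then show ?thesis using IH[OF u(1), of t] eq mono by auto
      next
        case False
        let ?y = "offer (gstate t u) j"
        have new: "(j, ?y) \<notin> sent t u" using offer_known[OF False] by auto
        have "insert ?y {y. (j, y) \<in> sent t u} \<subseteq> {y. (j, y) \<in> sent (Suc t) u}"
          using False by (auto simp: sent_Suc)
        then have "card (insert ?y {y. (j, y) \<in> sent t u}) \<le> card {y. (j, y) \<in> sent (Suc t) u}"
          using fin_u by (intro card_mono) auto
        then have "Suc (card {y. (j, y) \<in> sent t u}) \<le> card {y. (j, y) \<in> sent (Suc t) u}"
          using new fin_u by simp
        moreover have "sent t u \<subseteq> sent (Suc t) u" by (auto simp: sent_Suc)
        ultimately show ?thesis using Suc.IH by auto
      qed
    qed simp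
    moreover have "{y. (j, y) \<in> sent t u} \<subseteq> {y. (j, y) \<in> known t v}"
      using sent_imp_known[OF vn u(2)] by auto
    then have "card {y. (j, y) \<in> sent t u} \<le> card {y. (j, y) \<in> known t v}"
      using fin_v by (intro card_mono) auto
    ultimately show ?thesis using sent_imp_known[OF vn u(2)] by fastforce
  qed
qed

text \<open>If \<open>x\<close> were missing after m + d rounds, the node would already know at
  least m items of the colour by \<open>known_progress\<close>; together with \<open>x\<close> these
  would be more than exist.\<close>

lemma known_complete:
  assumes fin: "finite (items_of j)" and m: "card (items_of j) \<le> m" and t: "m + d \<le> t"
    and x: "(j, x) \<in> items w" "w \<in> nodes G" and v: "v \<in> hop_ball (colour_class j) d w"
  shows "(j, x) \<in> known t v"
proof (rule ccontr)
  assume nk: "(j, x) \<notin> known t v"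
  have vn: "v \<in> nodes G" using hop_ball_nodes(1)[of "colour_class j" w d] v x by (auto simp: colour_class_def)
  have "{y. (j, y) \<in> known t v} \<subset> items_of j"
    using known_subset[OF vn, of t] nk x by auto
  then have "card {y. (j, y) \<in> known t v} < card (items_of j)" using fin psubset_card_mono by blast
  then show False using known_progress[OF fin x v, of t] nk m t by linarith
qed

lemma runs_gossip:
  assumes "\<And>u v. v \<in> nodes G \<Longrightarrow> u \<in> nbrs G v \<Longrightarrow> col v u = colour {u, v}"
  shows "runs G X t (\<lambda>v. gossip t (nbrs G v) (col v) (items v)) (known t)"
  unfolding gossip_def
proof (rule runs_bind_Ret)
  have "runs G X (t * 1) (\<lambda>v. iter t (\<lambda>\<sigma>. exch (\<lambda>u. offer \<sigma> (col v u)) \<rhd>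
    (\<lambda>r. Ret (gossip_update (nbrs G v) (col v) r \<sigma>))) (gstate 0 v)) (gstate t)"
  proof (rule runs_iter)
    fix i
    show "runs G X 1 (\<lambda>v. exch (\<lambda>u. offer (gstate i v) (col v u)) \<rhd>
      (\<lambda>r. Ret (gossip_update (nbrs G v) (col v) r (gstate i v)))) (gstate (Suc i))"
    proof (rule runs_bind_Ret[OF runs_exch])
      fix v assume v: "v \<in> nodes G"
      have r: "received G (\<lambda>v u. offer (gstate i v) (col v u)) v u = offer (gstate i u) (colour {u, v}) \<and>
          col v u = colour {u, v}" if "u \<in> nbrs G v" for u
        using that assms[of u v] assms[OF v that] nbrs_subset[of v] nbrs_sym[of u v]
        by (auto simp: received_nbr insert_commute)
      have "gossip_update (nbrs G v) (col v) (received G (\<lambda>v u. offer (gstate i v) (col v u)) v) (gstate i v) =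
        gstate (Suc i) v"
      proof -
        let ?r = "received G (\<lambda>v u. offer (gstate i v) (col v u)) v"
        have "{(col v u, ?r u) |u. u \<in> nbrs G v \<and> ?r u \<noteq> []} = (\<lambda>u. (col v u, ?r u)) ` {u \<in> nbrs G v. ?r u \<noteq> []}"
          by auto
        also have "\<dots> = (\<lambda>u. (colour {u, v}, offer (gstate i u) (colour {u, v}))) `
            {u \<in> nbrs G v. offer (gstate i u) (colour {u, v}) \<noteq> []}"
          using r by (intro image_cong) auto
        also have "\<dots> = {(colour {u, v}, offer (gstate i u) (colour {u, v})) |u.
            u \<in> nbrs G v \<and> offer (gstate i u) (colour {u, v}) \<noteq> []}" by auto
        finally show ?thesis by (simp only: gossip_update_def gstate.simps)
      qed
      then show "Ret (gossip_update (nbrs G v) (col v) (received G (\<lambda>v u. offer (gstate i v) (col v u)) v) (gstate i v)) =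
        Ret (gstate (Suc i) v)" by simp
    qed (use offer_short in auto)
  qed
  then show "runs G X t (\<lambda>v. iter t (\<lambda>\<sigma>. exch (\<lambda>u. offer \<sigma> (col v u)) \<rhd>
    (\<lambda>r. Ret (gossip_update (nbrs G v) (col v) r \<sigma>))) (items v, {})) (gstate t)" by simp
qed (simp add: known_def)

end

subsection \<open>Growing fragments\<close>

definition candidate :: "place \<Rightarrow> (nat \<Rightarrow> int) \<Rightarrow> (nat \<Rightarrow> bool) \<Rightarrow> (nat \<Rightarrow> int list) \<Rightarrow> int list" where
  "candidate P w out tag = Min (insert [1] ((\<lambda>u. [0, w u, int (min u (me P)), int (max u (me P))] @ tag u) `
     {u \<in> nb P. out u}))"

definition end_points :: "int list \<Rightarrow> nat set" where
  "end_points m = {nat (m ! 2), nat (m ! 3)}"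

context network
begin

definition cand :: "(nat \<Rightarrow> nat \<Rightarrow> bool) \<Rightarrow> (nat \<Rightarrow> nat \<Rightarrow> int list) \<Rightarrow> nat \<Rightarrow> int list" where
  "cand out tag v = Min (insert [1] ((\<lambda>u. 0 # edge_key G {u, v} @ tag v u) ` {u \<in> nbrs G v. out v u}))"

lemma candidate_eq:
  assumes "me P = v" "nb P = nbrs G v" "\<And>u. u \<in> nbrs G v \<Longrightarrow> w u = weight G {u, v}"
    and "\<And>u. u \<in> nbrs G v \<Longrightarrow> out' u = out v u" "\<And>u. u \<in> nbrs G v \<Longrightarrow> tag' u = tag v u"
  shows "candidate P w out' tag' = cand out tag v"
proof -
  have "(\<lambda>u. [0, w u, int (min u (me P)), int (max u (me P))] @ tag' u) ` {u \<in> nb P. out' u} =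
    (\<lambda>u. 0 # edge_key G {u, v} @ tag v u) ` {u \<in> nbrs G v. out v u}"
    using assms by (intro image_cong) (auto simp: edge_key_doubleton)
  then show ?thesis by (simp only: candidate_def cand_def)
qed

lemma cand_cases:
  obtains "cand out tag v = [1]" "\<And>u. u \<in> nbrs G v \<Longrightarrow> \<not> out v u"
  | u where "u \<in> nbrs G v" "out v u" "cand out tag v = 0 # edge_key G {u, v} @ tag v u"
proof (cases "{u \<in> nbrs G v. out v u} = {}")
  case True
  then have "cand out tag v = [1]" unfolding cand_def True by simp
  then show ?thesis using that(1) True by blast
next
  case False
  let ?A = "(\<lambda>u. 0 # edge_key G {u, v} @ tag v u) ` {u \<in> nbrs G v. out v u}"
  have fin: "finite ?A" "?A \<noteq> {}" using finite_nbrs False by auto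
  then have "Min ?A \<in> ?A" by (rule Min_in)
  then obtain u where u: "u \<in> nbrs G v" "out v u" "Min ?A = 0 # edge_key G {u, v} @ tag v u" by auto
  have "cand out tag v = min [1] (Min ?A)" unfolding cand_def by (rule Min_insert[OF fin])
  also have "\<dots> = Min ?A" unfolding u(3) by (simp add: min_def)
  finally show ?thesis using that(2) u by metis
qed

lemma cand_le:
  assumes "u \<in> nbrs G v" "out v u"
  shows "cand out tag v \<le> 0 # edge_key G {u, v} @ tag v u"
  unfolding cand_def using finite_nbrs assms by (intro Min_le) auto

lemma short_edge_key:
  assumes "{u, v} \<in> edges G" "length t \<le> 4" "\<forall>x \<in> set t. \<bar>x\<bar> \<le> X"
  shows "short X (0 # edge_key G {u, v} @ t)"
  using assms X_weight[OF assms(1)] edge_nodes[OF graph(1) assms(1)] X_nodes[of u] X_nodes[of v]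
  by (auto simp: short_def edge_key_doubleton min_def max_def)

lemma short_cand:
  assumes "\<And>u. u \<in> nbrs G v \<Longrightarrow> length (tag v u) \<le> 4 \<and> (\<forall>x \<in> set (tag v u). \<bar>x\<bar> \<le> X)"
  shows "short X (cand out tag v)"
  using assms by (cases rule: cand_cases[of out tag v]) (auto intro!: short_edge_key simp: nbrs_def)

text \<open>Every edge candidate starts with 0 and so precedes [1]; the key stands before the tag,
  so the minimum is the lightest edge leaving \<open>U\<close>, and the cut rule puts it into the
  tree. If the minimum is [1], no edge leaves \<open>U\<close>, and connectedness makes
  \<open>U\<close> the whole graph.\<close>

lemma Min_cand:
  fixes tag :: "nat \<Rightarrow> nat \<Rightarrow> int list"
  assumes U: "U \<subseteq> nodes G" "U \<noteq> {}"
    and out: "\<And>u v. v \<in> U \<Longrightarrow> u \<in> nbrs G v \<Longrightarrow> out v u \<longleftrightarrow> u \<notin> U"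
  defines "m \<equiv> Min (cand out tag ` U)"
  shows "m = [1] \<and> U = nodes G \<or>
    (\<exists>a b. a \<in> U \<and> b \<in> nodes G - U \<and> {a, b} \<in> mst_edges G \<and> m = 0 # edge_key G {a, b} @ tag a b)"
proof -
  have fin: "finite (cand out tag ` U)" using U finite_nodes finite_subset by blast
  have "m \<in> cand out tag ` U" unfolding m_def using fin U by (intro Min_in) auto
  then obtain a where a: "a \<in> U" "m = cand out tag a" by blast
  have le: "m \<le> 0 # edge_key G {u, v} @ tag v u" if "v \<in> U" "u \<in> nbrs G v" "u \<notin> U" for u v
    using Min_le[OF fin, of "cand out tag v"] cand_le[of u v out tag] that out[OF that(1,2)]
    unfolding m_def by force
  show ?thesis
  proof (cases rule: cand_cases[of out tag a])
    case 1
    have "component (edges G) a \<subseteq> U"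
    proof (rule ccontr)
      assume "\<not> component (edges G) a \<subseteq> U"
      then obtain x y where xy: "{x, y} \<in> edges G" "x \<in> U" "y \<notin> U"
        using linked_crossing a(1) unfolding component_def by blast
      then have "[1] \<le> 0 # edge_key G {y, x} @ tag x y"
        using le[of x y] 1(1) a(2) by (simp add: nbrs_def insert_commute)
      then show False by simp
    qed
    moreover have "component (edges G) a = nodes G"
    proof -
      have "a \<in> nodes G" using a(1) U(1) by blast
      then show ?thesis
        using graph(2) component_nodes(1)[OF order_refl, of a] by (auto simp: connects_def component_def)
    qed
    ultimately show ?thesis using 1(1) a U by auto
  next
    case (2 b)
    then have b: "b \<notin> U" "b \<in> nodes G" "{a, b} \<in> edges G"
      using out[OF a(1) 2(1)] nbrs_subset by (auto simp: nbrs_def insert_commute)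
    have "{a, b} \<in> mst_edges G"
    proof (rule lightest_crossing_in_mst_edges[OF b(3) a(1) b(1)])
      fix x y assume xy: "{x, y} \<in> edges G" "x \<in> U" "y \<notin> U"
      have "0 # edge_key G {b, a} @ tag a b \<le> 0 # edge_key G {y, x} @ tag x y"
        using le[of x y] xy 2(3) a(2) by (simp add: nbrs_def insert_commute)
      then show "edge_key G {a, b} \<le> edge_key G {x, y}"
        by (auto simp: edge_key_def insert_commute)
    qed
    moreover have "m = 0 # edge_key G {a, b} @ tag a b" using 2(3) a(2) by (simp add: insert_commute)
    ultimately show ?thesis using a(1) b by blast
  qed
qed

lemma end_points_cand: "end_points (0 # edge_key G {a, b} @ t) = {a, b}"
  by (auto simp: end_points_def edge_key_doubleton min_def max_def)

end

primrec collect :: "(nat \<Rightarrow> int prog) \<Rightarrow> nat \<Rightarrow> (nat \<Rightarrow> int) prog" where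
  "collect f 0 = Ret (\<lambda>_. 0)"
| "collect f (Suc k) = collect f k \<rhd> (\<lambda>g. f k \<rhd> (\<lambda>x. Ret (g(k := x))))"

lemma runs_collect:
  assumes "\<And>j. j < k \<Longrightarrow> runs G X \<tau> (\<lambda>v. f v j) (\<lambda>_. y j)"
  shows "runs G X (k * \<tau>) (\<lambda>v. collect (f v) k) (\<lambda>_ j. if j < k then y j else 0)"
  using assms
proof (induction k)
  case (Suc k)
  have "runs G X (k * \<tau> + \<tau>) (\<lambda>v. collect (f v) k \<rhd> (\<lambda>g. f v k \<rhd> (\<lambda>x. Ret (g(k := x)))))
    (\<lambda>_ j. if j < Suc k then y j else 0)"
    by (rule runs_bind[OF Suc.IH], simp add: Suc.prems, rule runs_bind_Ret[OF Suc.prems])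
      (auto simp: fun_eq_iff)
  then show ?case by (simp add: add.commute)
qed simp

record fragment =
  centre :: nat
  branches :: "nat set"
  frozen :: bool

text \<open>The fragments whose bit \<open>j div 2\<close> is the parity of \<open>j\<close> join fragments with the opposite bit, so
  that merging is along stars and adds at most \<open>2 * S + 1\<close> to the radius. The best of the
  \<open>2 * Q\<close> values of \<open>j\<close> serves at least the fraction \<open>1 / (2 * Q)\<close> of the fragments; this replaces
  the usual coin flips.\<close>

definition picks :: "nat \<Rightarrow> nat \<Rightarrow> nat \<Rightarrow> bool" where
  "picks j x y \<longleftrightarrow> odd (x div 2 ^ (j div 2)) = odd j \<and> odd (y div 2 ^ (j div 2)) \<noteq> odd j"

lemma picks_exists:
  assumes "x \<noteq> y" "x < 2 ^ Q" "y < 2 ^ Q"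
  shows "\<exists>j < 2 * Q. picks j x y"
proof -
  have "\<exists>i. odd (x div 2 ^ i) \<noteq> odd (y div 2 ^ i)"
    using assms(1) bit_eqI[of x y] by (auto simp: bit_iff_odd)
  then obtain i where i: "odd (x div 2 ^ i) \<noteq> odd (y div 2 ^ i)" by blast
  have "i < Q"
  proof (rule ccontr)
    assume "\<not> i < Q"
    then have "(2 :: nat) ^ Q \<le> 2 ^ i" by (intro power_increasing) auto
    then have "x < 2 ^ i" "y < 2 ^ i" using assms(2,3) by linarith+
    then have "x div 2 ^ i = 0" "y div 2 ^ i = 0" by auto
    then show False using i by simp
  qed
  then show ?thesis
    using i by (intro exI[of _ "2 * i + of_bool (odd (x div 2 ^ i))"]) (auto simp: picks_def)
qed

text \<open>All nodes evaluate this on the same totals, so they agree on the choice without further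
  messages.\<close>

definition argmax :: "nat \<Rightarrow> (nat \<Rightarrow> int) \<Rightarrow> nat" where
  "argmax k g = (SOME j. j < k \<and> (\<forall>i < k. g i \<le> g j))"

lemma argmax:
  assumes "0 < k"
  shows "argmax k g < k" "i < k \<Longrightarrow> g i \<le> g (argmax k g)"
proof -
  have "Max (g ` {..<k}) \<in> g ` {..<k}" using assms by (intro Min_in Max_in) auto
  then obtain j where "j < k" "g j = Max (g ` {..<k})" by auto
  then have "\<exists>j. j < k \<and> (\<forall>i < k. g i \<le> g j)" by (intro exI[of _ j]) auto
  then have "argmax k g < k \<and> (\<forall>i < k. g i \<le> g (argmax k g))" unfolding argmax_def by (rule someI_ex)
  then show "argmax k g < k" "i < k \<Longrightarrow> g i \<le> g (argmax k g)" by auto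
qed

text \<open>The intermediate values mean the following: \<open>r\<close> is [0] if the centre is
  within \<open>S\<close> hops; \<open>z\<close> is [1] if this holds throughout the fragment and it
  is not frozen; \<open>m\<close> is the lightest edge leaving the fragment, with the centre of the
  fragment on the other side as tag; \<open>g j\<close> counts the fragments that the value j would
  let join. In the last exchange the far end of a chosen edge learns that the edge has become a
  branch.\<close>

definition local_phase :: "place \<Rightarrow> (nat \<Rightarrow> int) \<Rightarrow> nat \<Rightarrow> nat \<Rightarrow> nat \<Rightarrow> fragment \<Rightarrow> fragment prog" where
  "local_phase P w S T Q st =
     fmin S (branches st) (if centre st = me P then [0] else [1]) \<rhd> (\<lambda>r.
     fmin T (branches st) (if r = [1] \<or> centre st = me P \<and> frozen st then [0] else [1]) \<rhd> (\<lambda>z.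
     exch (\<lambda>_. [int (centre st)]) \<rhd> (\<lambda>cs.
     fmin T (branches st) (candidate P w (\<lambda>u. cs u \<noteq> [int (centre st)]) cs) \<rhd> (\<lambda>m.
     collect (\<lambda>j. total P (if centre st = me P \<and> z = [1] \<and> m \<noteq> [1] \<and> picks j (me P) (nat (m ! 4)) then 1 else 0))
       (2 * Q) \<rhd> (\<lambda>g.
     let tail = z = [1] \<and> m \<noteq> [1] \<and> picks (argmax (2 * Q) g) (centre st) (nat (m ! 4)) in
     exch (\<lambda>u. if tail \<and> {me P, u} = end_points m then [1] else [0]) \<rhd> (\<lambda>r'.
     Ret \<lparr>centre = if tail then nat (m ! 4) else centre st,
       branches = branches st \<union> {u \<in> nb P. tail \<and> {me P, u} = end_points m \<or> r' u = [1]},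
       frozen = frozen st \<or> z \<noteq> [1]\<rparr>))))))"

section \<open>Invariants of the growing fragments\<close>

locale local_stage = tree_network +
  fixes S Q :: nat
  assumes Q: "0 < Q" "\<And>v. v \<in> nodes G \<Longrightarrow> v < 2 ^ Q"
begin

definition unfinished :: "(nat \<Rightarrow> fragment) \<Rightarrow> nat set" where
  "unfinished st = {z \<in> nodes G. centre (st z) = z \<and> \<not> frozen (st z) \<and> \<not> (\<forall>v \<in> nodes G. centre (st v) = z)}"

text \<open>A fragment freezes when it is seen to reach farther than \<open>S\<close> from its
  centre, which makes it large. One that joins another still lies within \<open>S\<close> of its
  centre, but its target may be joined again in every phase; hence the radius bound is linear in
  \<open>p\<close>. The last clause measures progress only through fragments that are neither frozen
  nor spanning.\<close>

definition fragments :: "nat \<Rightarrow> nat set set \<Rightarrow> (nat \<Rightarrow> fragment) \<Rightarrow> bool" where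
  "fragments p F st \<longleftrightarrow> F \<subseteq> mst_edges G \<and>
     (\<forall>v \<in> nodes G. branches (st v) = {u. {u, v} \<in> F}) \<and>
     labels (nodes G) F (\<lambda>v. centre (st v)) \<and>
     (\<forall>v \<in> nodes G. centre (st v) \<in> hop_ball F (p * (2 * S + 1)) v) \<and>
     (\<forall>z \<in> nodes G. centre (st z) = z \<and> frozen (st z) \<longrightarrow> S < card {v \<in> nodes G. centre (st v) = z}) \<and>
     real (card (unfinished st)) \<le> real (size_of G) * (1 - 1 / real (2 * Q)) ^ p"

lemma fragments_init:
  "fragments 0 {} (\<lambda>v. \<lparr>centre = v, branches = {}, frozen = False\<rparr>)"
  using finite_nodes by (auto simp: fragments_def labels_def linked_empty unfinished_def intro!: card_mono)

context
  fixes p F st T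
  assumes frag: "fragments p F st" and T: "2 * (p * (2 * S + 1)) \<le> T"
begin

private abbreviation c where "c v \<equiv> centre (st v)"

lemma F_edges: "F \<subseteq> edges G"
  using frag mst_edges_subset by (auto simp: fragments_def)

lemma branches: "v \<in> nodes G \<Longrightarrow> branches (st v) = {u. {u, v} \<in> F}"
  using frag by (simp add: fragments_def)

lemma c_iff: "u \<in> nodes G \<Longrightarrow> v \<in> nodes G \<Longrightarrow> c u = c v \<longleftrightarrow> linked F u v"
  using frag by (simp add: fragments_def labels_def)

lemma c_ball: "v \<in> nodes G \<Longrightarrow> c v \<in> hop_ball F (p * (2 * S + 1)) v"
  using frag by (simp add: fragments_def)

lemma c_node: "v \<in> nodes G \<Longrightarrow> c v \<in> nodes G"
  using c_ball hop_ball_nodes(1)[OF F_edges] by blast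

lemma component_eq_c: "v \<in> nodes G \<Longrightarrow> component F v = {u \<in> nodes G. c u = c v}"
  using component_nodes(1)[OF F_edges, of v] c_iff linked_sym by (fastforce simp: component_def)

lemma c_component: "v \<in> nodes G \<Longrightarrow> c v \<in> component F v"
  using hop_ball_linked[OF c_ball] by (simp add: component_def)

lemma c_idem: "v \<in> nodes G \<Longrightarrow> c (c v) = c v"
  using c_component component_eq_c by blast

text \<open>Any two nodes of a fragment are connected through its centre; this is the factor 2 in
  the lower bound on \<open>T\<close>.\<close>

lemma ball_T: "v \<in> nodes G \<Longrightarrow> hop_ball F T v = component F v"
proof (rule hop_ball_eq_component, rule subsetI)
  fix u assume v: "v \<in> nodes G" and "u \<in> component F v"
  then have u: "u \<in> nodes G" "c u = c v" using component_eq_c by auto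
  have "u \<in> hop_ball F (p * (2 * S + 1)) (c v)" using hop_ball_sym[OF c_ball[OF u(1)]] u(2) by simp
  then have "u \<in> hop_ball F (p * (2 * S + 1) + p * (2 * S + 1)) v"
    using hop_ball_trans[OF c_ball[OF v]] by blast
  moreover have "p * (2 * S + 1) + p * (2 * S + 1) \<le> T" using T by (simp only: mult_2)
  ultimately show "u \<in> hop_ball F T v" using hop_ball_mono by blast
qed

definition near where "near v \<longleftrightarrow> c v \<in> hop_ball F S v"

definition active where
  "active v \<longleftrightarrow> (\<forall>u \<in> component F v. near u) \<and> \<not> frozen (st (c v))"

definition moe where
  "moe v = Min (cand (\<lambda>v u. c u \<noteq> c v) (\<lambda>v u. [int (c u)]) ` component F v)"

definition target where "target v = nat (moe v ! 4)"

definition tail where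
  "tail j v \<longleftrightarrow> active v \<and> moe v \<noteq> [1] \<and> picks j (c v) (target v)"

lemma const:
  assumes "u \<in> nodes G" "v \<in> nodes G" "c u = c v"
  shows "active u = active v" "moe u = moe v" "target u = target v" "tail j u = tail j v"
proof -
  have "component F u = component F v" using component_eq_c assms by simp
  then show "active u = active v" "moe u = moe v" using assms by (simp_all add: active_def moe_def)
  then show "target u = target v" "tail j u = tail j v" using assms by (simp_all add: target_def tail_def)
qed

lemma moe_cases:
  assumes v: "v \<in> nodes G"
  obtains "moe v = [1]" "\<And>u. u \<in> nodes G \<Longrightarrow> c u = c v"
  | a b where "moe v \<noteq> [1]" "a \<in> nodes G" "b \<in> nodes G" "c a = c v" "c b \<noteq> c v" "{a, b} \<in> mst_edges G"
    "moe v = 0 # edge_key G {a, b} @ [int (c b)]" "end_points (moe v) = {a, b}" "target v = c b"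
proof -
  have "component F v \<noteq> {}" using component_self by blast
  from Min_cand[OF component_nodes(1)[OF F_edges v] this, of "\<lambda>v u. c u \<noteq> c v" "\<lambda>v u. [int (c u)]"]
  have "moe v = [1] \<and> component F v = nodes G \<or>
    (\<exists>a b. a \<in> component F v \<and> b \<in> nodes G - component F v \<and> {a, b} \<in> mst_edges G \<and>
      moe v = 0 # edge_key G {a, b} @ [int (c b)])"
    using component_eq_c[OF v] nbrs_subset unfolding moe_def by fastforce
  then show ?thesis
  proof (elim disjE exE conjE)
    assume "moe v = [1]" "component F v = nodes G"
    then show ?thesis using that(1) component_eq_c[OF v] by auto
  next
    fix a b assume ab: "a \<in> component F v" "b \<in> nodes G - component F v" "{a, b} \<in> mst_edges G"
      and m: "moe v = 0 # edge_key G {a, b} @ [int (c b)]"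
    have "a \<in> nodes G" "b \<in> nodes G" "c a = c v" "c b \<noteq> c v" using ab component_eq_c[OF v] by auto
    moreover have "moe v \<noteq> [1]" "target v = c b" by (simp_all add: m target_def edge_key_def)
    moreover have "end_points (moe v) = {a, b}" unfolding m by (rule end_points_cand)
    ultimately show ?thesis using that(2)[of a b] ab(3) m by blast
  qed
qed

text \<open>\<open>picks j\<close> demands opposite bits of the two fragments, so the target of a
  joining fragment stays where it is. This makes the merges stars.\<close>

lemma target_not_tail:
  assumes "v \<in> nodes G" "tail j v" "b \<in> nodes G" "c b = target v"
  shows "\<not> tail j b"
  using assms by (auto simp: tail_def picks_def)

definition joins where "joins j = {end_points (moe v) |v. v \<in> nodes G \<and> tail j v}"

definition next_frag where
  "next_frag j v = \<lparr>centre = if tail j v then target v else c v,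
     branches = {u. {u, v} \<in> F \<union> joins j}, frozen = frozen (st v) \<or> \<not> active v\<rparr>"

lemma joins_cases:
  assumes "e \<in> joins j"
  obtains w a b where "w \<in> nodes G" "tail j w" "a \<in> nodes G" "b \<in> nodes G" "c a = c w" "c b = target w"
    "{a, b} \<in> mst_edges G" "e = {a, b}" "end_points (moe w) = {a, b}"
proof -
  obtain w where w: "w \<in> nodes G" "tail j w" "e = end_points (moe w)" using assms by (auto simp: joins_def)
  then have "moe w \<noteq> [1]" by (simp add: tail_def)
  then show ?thesis
  proof (cases rule: moe_cases[OF w(1)])
    case (2 a b)
    then show ?thesis using that[of w a b] w by auto
  qed simp
qed

lemma joins_iff:
  assumes "v \<in> nodes G" "u \<in> nbrs G v"
  shows "{u, v} \<in> joins j \<longleftrightarrow> tail j v \<and> {v, u} = end_points (moe v) \<or> tail j u \<and> {u, v} = end_points (moe u)"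
proof
  assume "{u, v} \<in> joins j"
  then obtain w a b where w: "w \<in> nodes G" "tail j w" "a \<in> nodes G" "c a = c w" "{u, v} = {a, b}"
    "end_points (moe w) = {a, b}" by (auto elim!: joins_cases)
  then have a: "tail j a" "end_points (moe a) = {a, b}" using const[of a w] by auto
  have "a = u \<and> b = v \<or> a = v \<and> b = u" using w(5) by (auto simp: doubleton_eq_iff)
  then show "tail j v \<and> {v, u} = end_points (moe v) \<or> tail j u \<and> {u, v} = end_points (moe u)"
    using a by auto
next
  assume "tail j v \<and> {v, u} = end_points (moe v) \<or> tail j u \<and> {u, v} = end_points (moe u)"
  then show "{u, v} \<in> joins j" using assms nbrs_subset[of v] by (auto simp: joins_def insert_commute)
qed

lemma next_centre:
  assumes "v \<in> nodes G"
  shows "centre (next_frag j v) = (if tail j (c v) then target (c v) else c v)"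
  using const[OF c_node[OF assms] assms c_idem[OF assms]] by (simp add: next_frag_def)

lemma next_centre_fixed:
  assumes z: "z \<in> nodes G" "centre (next_frag j z) = z"
  shows "c z = z" "\<not> tail j z" "\<And>v. v \<in> nodes G \<Longrightarrow> c v = z \<Longrightarrow> centre (next_frag j v) = z"
proof -
  show nt: "\<not> tail j z"
  proof
    assume t: "tail j z"
    then have "moe z \<noteq> [1]" by (simp add: tail_def)
    then show False
    proof (cases rule: moe_cases[OF z(1)])
      case (2 a b)
      have "c b = z" using z(2) t 2(9) by (simp add: next_frag_def)
      then show False using c_idem[OF 2(3)] 2(5) by simp
    qed simp
  qed
  then show cz: "c z = z" using z(2) by (simp add: next_frag_def)
  show "centre (next_frag j v) = z" if "v \<in> nodes G" "c v = z" for v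
    using const(4)[of v z] that z(1) cz nt by (simp add: next_frag_def)
qed

definition ready where "ready = {z \<in> nodes G. c z = z \<and> active z \<and> moe z \<noteq> [1]}"

lemma ready_unfinished: "ready \<subseteq> unfinished st"
proof
  fix z assume z: "z \<in> ready"
  then have "z \<in> nodes G" "moe z \<noteq> [1]" "c z = z" by (auto simp: ready_def)
  then have "\<not> (\<forall>v \<in> nodes G. c v = z)" by (cases rule: moe_cases[of z]) auto
  then show "z \<in> unfinished st" using z by (auto simp: ready_def unfinished_def active_def)
qed

lemma unfinished_next: "unfinished (next_frag j) \<subseteq> {z \<in> ready. \<not> picks j z (target z)}"
proof
  fix z assume z: "z \<in> unfinished (next_frag j)"
  then have z1: "z \<in> nodes G" "centre (next_frag j z) = z" "active z" by (auto simp: unfinished_def next_frag_def)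
  note zf = next_centre_fixed[OF z1(1,2)]
  have "moe z \<noteq> [1]"
  proof
    assume "moe z = [1]"
    then have "c v = z" if "v \<in> nodes G" for v using that zf(1) by (cases rule: moe_cases[OF z1(1)]) auto
    then show False using z zf(3) by (auto simp: unfinished_def)
  qed
  then show "z \<in> {z \<in> ready. \<not> picks j z (target z)}" using z1 zf by (auto simp: ready_def tail_def)
qed

text \<open>By \<open>picks_exists\<close> every fragment that is ready to join is served by one of
  the 2 * Q values of j, so the most popular value serves at least the average.\<close>

lemma ready_bound:
  assumes "\<And>i. i < 2 * Q \<Longrightarrow> card {z \<in> ready. picks i z (target z)} \<le> card {z \<in> ready. picks j z (target z)}"
  shows "real (card {z \<in> ready. \<not> picks j z (target z)}) \<le> real (card ready) * (1 - 1 / real (2 * Q))"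
proof -
  let ?A = "\<lambda>j. {z \<in> ready. picks j z (target z)}"
  have fin: "finite ready" using finite_nodes by (simp add: ready_def)
  have "ready \<subseteq> (\<Union>i < 2 * Q. ?A i)"
  proof
    fix z assume z: "z \<in> ready"
    then have zn: "z \<in> nodes G" "moe z \<noteq> [1]" "c z = z" by (auto simp: ready_def)
    have "z \<noteq> target z \<and> target z \<in> nodes G"
      using zn(2)
    proof (cases rule: moe_cases[OF zn(1)])
      case (2 a b)
      then show ?thesis using zn(3) c_node[of b] by auto
    qed simp
    then show "z \<in> (\<Union>i < 2 * Q. ?A i)"
      using picks_exists[of z "target z" Q] Q(2) zn(1) z by auto
  qed
  then have "card ready \<le> card (\<Union>i < 2 * Q. ?A i)" using fin by (intro card_mono) auto
  also have "\<dots> \<le> (\<Sum>i < 2 * Q. card (?A i))" by (rule card_UN_le) simp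
  also have "\<dots> \<le> (\<Sum>i < 2 * Q. card (?A j))" using assms by (intro sum_mono) auto
  also have "\<dots> = 2 * Q * card (?A j)" by simp
  finally have "real (card ready) \<le> real (2 * Q) * real (card (?A j))" by (metis of_nat_le_iff of_nat_mult)
  then have "real (card ready) / real (2 * Q) \<le> real (card (?A j))"
    using Q(1) by (simp add: divide_le_eq mult.commute)
  moreover have "card {z \<in> ready. \<not> picks j z (target z)} = card ready - card (?A j)"
  proof -
    have "{z \<in> ready. \<not> picks j z (target z)} = ready - ?A j" by auto
    then show ?thesis using fin by (simp add: card_Diff_subset)
  qed
  moreover have "card (?A j) \<le> card ready" using fin by (intro card_mono) auto
  ultimately show ?thesis by (simp add: algebra_simps of_nat_diff)
qed

lemma fragments_next:
  assumes j: "\<And>i. i < 2 * Q \<Longrightarrow> card {z \<in> ready. picks i z (target z)} \<le> card {z \<in> ready. picks j z (target z)}"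
  shows "fragments (Suc p) (F \<union> joins j) (next_frag j)"
  unfolding fragments_def
proof (intro conjI ballI impI)
  have J: "joins j \<subseteq> mst_edges G" by (auto elim: joins_cases)
  then show "F \<union> joins j \<subseteq> mst_edges G" using frag by (auto simp: fragments_def)
  show "branches (next_frag j v) = {u. {u, v} \<in> F \<union> joins j}" for v by (simp add: next_frag_def)
  \<comment> \<open>The relabelling is a single star step: the label of a joining fragment becomes
    that of its target, which itself is fixed.\<close>
  let ?g = "\<lambda>x. if tail j x then target x else x"
  have "labels (nodes G) (F \<union> joins j) (\<lambda>v. ?g (c v))"
  proof (rule labels_merge[where c = "\<lambda>v. c v" and g = ?g])
    show "labels (nodes G) F (\<lambda>v. c v)" using frag by (simp add: fragments_def)
    show "e \<subseteq> nodes G" if "e \<in> F \<union> joins j" for e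
      using that F_edges J mst_edges_subset edge_subset_nodes by blast
    have join: "c a \<in> nodes G \<and> ?g (c a) = c b \<and> ?g (c b) = c b"
      if "w \<in> nodes G" "tail j w" "a \<in> nodes G" "b \<in> nodes G" "c a = c w" "c b = target w" for w a b
    proof -
      have ca: "c a \<in> nodes G" "c (c a) = c w" using that c_node c_idem by auto
      have "\<not> tail j (c b)"
        using target_not_tail[OF that(1,2) c_node[OF that(4)]] c_idem[OF that(4)] that(6) by simp
      then show ?thesis using const[OF ca(1) that(1) ca(2)] that ca by auto
    qed
    show "?g (c u) = ?g (c v)" if uv: "{u, v} \<in> joins j" for u v
      using uv
    proof (cases rule: joins_cases)
      case (1 w a b)
      then have "u = a \<and> v = b \<or> u = b \<and> v = a" by (auto simp: doubleton_eq_iff)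
      then show ?thesis using join[OF 1(1-6)] by auto
    qed
    let ?R = "{(c a, c b) |a b. {a, b} \<in> joins j}"
    have sym: "(y, x) \<in> ?R\<^sup>*" if "(x, y) \<in> ?R\<^sup>*" for x y
    proof -
      have "sym ?R"
      proof (rule symI)
        fix x y assume "(x, y) \<in> ?R"
        then obtain a b where "x = c a" "y = c b" "{a, b} \<in> joins j" by blast
        moreover from this have "{b, a} \<in> joins j" by (simp add: insert_commute)
        ultimately show "(y, x) \<in> ?R" by blast
      qed
      from symD[OF sym_rtrancl[OF this] that] show ?thesis .
    qed
    have step: "(c v, ?g (c v)) \<in> ?R\<^sup>*" if v: "v \<in> nodes G" for v
    proof (cases "tail j (c v)")
      case True
      note cv = c_node[OF v]
      have "end_points (moe (c v)) \<in> joins j" using True cv by (auto simp: joins_def)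
      moreover have "moe (c v) \<noteq> [1]" using True by (simp add: tail_def)
      ultimately have "(c v, target (c v)) \<in> ?R"
      proof (cases rule: moe_cases[OF cv])
        case (2 a b)
        then have "{a, b} \<in> joins j" "c v = c a" "target (c v) = c b"
          using \<open>end_points (moe (c v)) \<in> joins j\<close> c_idem[OF v] by simp_all
        then show ?thesis by blast
      next
        case 1
        from \<open>moe (c v) \<noteq> [1]\<close> 1(1) show ?thesis by contradiction
      qed
      then show ?thesis using True by (simp add: r_into_rtrancl)
    qed simp
    show "(c u, c v) \<in> ?R\<^sup>*" if "u \<in> nodes G" "v \<in> nodes G" "?g (c u) = ?g (c v)" for u v
      by (rule rtrancl_trans[OF step[OF that(1)], unfolded that(3), OF sym[OF step[OF that(2)]]])
  qed
  then show "labels (nodes G) (F \<union> joins j) (\<lambda>v. centre (next_frag j v))"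
    by (simp add: labels_def next_centre)
  show "centre (next_frag j v) \<in> hop_ball (F \<union> joins j) (Suc p * (2 * S + 1)) v" if v: "v \<in> nodes G" for v
  proof (cases "tail j v")
    case False
    have "c v \<in> hop_ball (F \<union> joins j) (p * (2 * S + 1)) v"
      using c_ball[OF v] hop_ball_mono_edges[of F "F \<union> joins j"] by blast
    moreover have "p * (2 * S + 1) \<le> Suc p * (2 * S + 1)" by simp
    ultimately have "c v \<in> hop_ball (F \<union> joins j) (Suc p * (2 * S + 1)) v" using hop_ball_mono by blast
    then show ?thesis using False by (simp only: next_frag_def fragment.simps if_False)
  next
    case True
    have "end_points (moe v) \<in> joins j" using True v by (auto simp: joins_def)
    have "moe v \<noteq> [1]" using True by (simp add: tail_def)
    then show ?thesis
    proof (cases rule: moe_cases[OF v])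
      case (2 a b)
      \<comment> \<open>All nodes of a joining fragment are within \<open>S\<close> of its centre.
        So the route from v runs through the old centre to the end a in at most 2 * S hops, over the
        new edge to b, and from there to the centre of b by the old bound.\<close>
      have near: "near u" if "u \<in> nodes G" "c u = c v" for u
        using True that component_eq_c[OF v] by (auto simp: tail_def active_def)
      have "c v \<in> hop_ball F S v" using near[OF v] by (simp add: near_def)
      moreover have "a \<in> hop_ball F S (c v)" using near[OF 2(2,4)] 2(4) hop_ball_sym by (simp add: near_def)
      ultimately have "a \<in> hop_ball F (S + S) v" using hop_ball_trans by blast
      then have "a \<in> hop_ball (F \<union> joins j) (S + S) v" using hop_ball_mono_edges[of F "F \<union> joins j"] by blast
      moreover have "b \<in> hop_ball (F \<union> joins j) 1 a"
        using \<open>end_points (moe v) \<in> joins j\<close> 2(8) by (intro hop_ball_edge) auto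
      ultimately have "b \<in> hop_ball (F \<union> joins j) (S + S + 1) v" using hop_ball_trans by blast
      moreover have "c b \<in> hop_ball (F \<union> joins j) (p * (2 * S + 1)) b"
        using c_ball[OF 2(3)] hop_ball_mono_edges[of F "F \<union> joins j"] by blast
      ultimately have "c b \<in> hop_ball (F \<union> joins j) (S + S + 1 + p * (2 * S + 1)) v" using hop_ball_trans by blast
      moreover have "S + S + 1 + p * (2 * S + 1) = Suc p * (2 * S + 1)" by simp
      ultimately show ?thesis using True 2(9) by (simp only: next_frag_def fragment.simps if_True)
    qed simp
  qed
  fix z assume z: "z \<in> nodes G" "centre (next_frag j z) = z \<and> frozen (next_frag j z)"
  note zf = next_centre_fixed[OF z(1) conjunct1[OF z(2)]]
  have "{v \<in> nodes G. c v = z} \<subseteq> {v \<in> nodes G. centre (next_frag j v) = z}" using zf by auto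
  then have mono: "card {v \<in> nodes G. c v = z} \<le> card {v \<in> nodes G. centre (next_frag j v) = z}"
    using finite_nodes by (intro card_mono) auto
  show "S < card {v \<in> nodes G. centre (next_frag j v) = z}"
  proof (cases "frozen (st z)")
    case True
    then have "S < card {v \<in> nodes G. c v = z}" using frag z zf(1) by (auto simp: fragments_def)
    then show ?thesis using mono by simp
  next
    case False
    then have "\<not> active z" using z(2) by (simp add: next_frag_def)
    then obtain u where u: "u \<in> component F z" "\<not> near u" using False zf(1) by (auto simp: active_def)
    then have "c u = z" using component_eq_c[OF z(1)] zf(1) by auto
    \<comment> \<open>The fragment freezes in this phase because u is too far from the centre. Hence
      the ball of radius \<open>S\<close> around the centre misses u and has more than
      \<open>S\<close> nodes by \<open>hop_ball_growth\<close>.\<close>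
    then have "u \<notin> hop_ball F S z" using u(2) hop_ball_sym by (auto simp: near_def)
    then have "S < card (hop_ball F S z)"
      using hop_ball_growth[OF component_nodes(2)[OF F_edges z(1)], of S] u(1) by blast
    also have "\<dots> \<le> card (component F z)"
      using component_nodes(2)[OF F_edges z(1)] by (intro card_mono) (auto simp: component_def hop_ball_linked)
    also have "component F z = {v \<in> nodes G. c v = z}" using component_eq_c[OF z(1)] zf(1) by simp
    finally show ?thesis using mono by simp
  qed
next
  have fin: "finite ready" using finite_nodes by (simp add: ready_def)
  have "real (card (unfinished (next_frag j))) \<le> real (card {z \<in> ready. \<not> picks j z (target z)})"
    using unfinished_next[of j] fin by (intro of_nat_mono card_mono) auto
  also have "\<dots> \<le> real (card ready) * (1 - 1 / real (2 * Q))" by (rule ready_bound[OF j])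
  also have "\<dots> \<le> real (card (unfinished st)) * (1 - 1 / real (2 * Q))"
    using ready_unfinished finite_nodes Q(1)
    by (intro mult_right_mono of_nat_mono card_mono) (auto simp: unfinished_def)
  also have "\<dots> \<le> real (size_of G) * (1 - 1 / real (2 * Q)) ^ p * (1 - 1 / real (2 * Q))"
    using frag Q(1) by (intro mult_right_mono) (auto simp: fragments_def)
  finally show "real (card (unfinished (next_frag j))) \<le> real (size_of G) * (1 - 1 / real (2 * Q)) ^ Suc p"
    by (simp add: ac_simps)
qed

lemma runs_local_phase:
  assumes w: "\<And>u v. v \<in> nodes G \<Longrightarrow> u \<in> nbrs G v \<Longrightarrow> w v u = weight G {u, v}"
  shows "\<exists>st' F'. runs G X (S + 2 * T + 2 * Q * (2 * h) + 2) (\<lambda>v. local_phase (pl v) (w v) S T Q (st v)) st' \<and>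
    fragments (Suc p) F' st'"
proof -
  \<comment> \<open>These are the numbers that the nodes obtain as totals over all centres, so the
    value of j that they compute is the best one in the sense of
    \<open>fragments_next\<close>.\<close>
  define cnt where "cnt i = card {z \<in> ready. picks i z (target z)}" for i
  define g where "g i = (if i < 2 * Q then int (cnt i) else 0)" for i
  define j where "j = argmax (2 * Q) g"
  have "cnt i \<le> cnt j" if "i < 2 * Q" for i
    using argmax(2)[of "2 * Q" i g] argmax(1)[of "2 * Q" g] Q(1) that by (simp add: g_def j_def)
  then have next': "fragments (Suc p) (F \<union> joins j) (next_frag j)"
    by (intro fragments_next) (simp add: cnt_def)
  define r where "r v = (if near v then [0] else [1 :: int])" for v
  define z where "z v = (if active v then [1] else [0 :: int])" for v
  have c_near: "(\<exists>u \<in> hop_ball F S v. c u = u) \<longleftrightarrow> near v" if v: "v \<in> nodes G" for v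
  proof -
    have "c u = c v" if "u \<in> hop_ball F S v" for u
      using hop_ball_linked[OF that] component_eq_c[OF v] by (auto simp: component_def)
    then have "u = c v" if "u \<in> hop_ball F S v" "c u = u" for u using that by metis
    then show ?thesis using c_idem[OF v] unfolding near_def by blast
  qed
  have z_eq: "(\<exists>u \<in> component F v. r u = [1] \<or> c u = u \<and> frozen (st u)) \<longleftrightarrow> \<not> active v" if v: "v \<in> nodes G" for v
  proof -
    have "(\<exists>u \<in> component F v. c u = u \<and> frozen (st u)) \<longleftrightarrow> frozen (st (c v))"
      using component_eq_c[OF v] c_component[OF v] c_idem[OF v] by auto
    then show ?thesis by (auto simp: active_def r_def)
  qed
  have short_c: "short X [int (c v)]" if "v \<in> nodes G" for v
    using X_nodes[OF c_node[OF that]] by (simp add: short_def)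
  let ?cand = "cand (\<lambda>v u. c u \<noteq> c v) (\<lambda>v u. [int (c u)])"
  have short_cand': "short X (?cand v)" if "v \<in> nodes G" for v
    using X_nodes c_node nbrs_subset[of v] by (intro short_cand) auto
  note sub = F_edges branches
  have 1: "runs G X S (\<lambda>v. fmin S (branches (st v)) (if c v = me (pl v) then [0] else [1])) r"
    by (rule runs_cong[OF runs_fmin[OF F_edges, where x = "\<lambda>v. if c v = v then [0] else [1]"]])
      (auto simp: branches place_simps Min_hop_ball_flag[OF F_edges] c_near r_def)
  have z: "Min ((\<lambda>v. if r v = [1] \<or> c v = v \<and> frozen (st v) then [0] else [1]) ` hop_ball F T v) = z v"
    if v: "v \<in> nodes G" for v
    using z_eq[OF v] by (subst Min_hop_ball_flag[OF F_edges v]) (simp add: ball_T[OF v] z_def)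
  have 2: "runs G X T (\<lambda>v. fmin T (branches (st v)) (if r v = [1] \<or> c v = me (pl v) \<and> frozen (st v) then [0] else [1])) z"
    by (rule runs_cong[OF runs_fmin[OF F_edges, where x = "\<lambda>v. if r v = [1] \<or> c v = v \<and> frozen (st v) then [0] else [1]"]])
      (simp_all add: branches place_simps z)
  have 3: "runs G X 1 (\<lambda>v. exch (\<lambda>_. [int (c v)])) (received G (\<lambda>v _. [int (c v)]))"
    by (rule runs_bcast[OF short_c])
  have 4: "runs G X T (\<lambda>v. fmin T (branches (st v)) (candidate (pl v) (w v)
      (\<lambda>u. received G (\<lambda>v _. [int (c v)]) v u \<noteq> [int (c v)]) (received G (\<lambda>v _. [int (c v)]) v))) moe"
  proof (rule runs_cong[OF runs_fmin[OF F_edges, where x = ?cand]])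
    fix v assume v: "v \<in> nodes G"
    show "fmin T {u. {u, v} \<in> F} (?cand v) = fmin T (branches (st v)) (candidate (pl v) (w v)
      (\<lambda>u. received G (\<lambda>v _. [int (c v)]) v u \<noteq> [int (c v)]) (received G (\<lambda>v _. [int (c v)]) v))"
      using candidate_eq[of "pl v" v "w v" "\<lambda>u. received G (\<lambda>v _. [int (c v)]) v u \<noteq> [int (c v)]"
        "\<lambda>v u. c u \<noteq> c v" "received G (\<lambda>v _. [int (c v)]) v" "\<lambda>v u. [int (c u)]"] v
      by (simp add: branches place_simps w received_nbr)
    show "Min (?cand ` hop_ball F T v) = moe v" using v by (simp add: ball_T moe_def)
  qed (use short_cand' in auto)
  have 5: "runs G X (2 * Q * (2 * h)) (\<lambda>v. collect (\<lambda>i. total (pl v)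
      (if c v = me (pl v) \<and> z v = [1] \<and> moe v \<noteq> [1] \<and> picks i (me (pl v)) (nat (moe v ! 4)) then 1 else 0)) (2 * Q)) (\<lambda>_. g)"
  proof -
    have "runs G X (2 * h) (\<lambda>v. total (pl v)
      (if c v = me (pl v) \<and> z v = [1] \<and> moe v \<noteq> [1] \<and> picks i (me (pl v)) (nat (moe v ! 4)) then 1 else 0)) (\<lambda>_. int (cnt i))" for i
    proof -
      let ?A = "{z \<in> ready. picks i z (target z)}"
      have A: "?A \<subseteq> nodes G" by (auto simp: ready_def)
      have "card ?A \<le> size_of G" using A finite_nodes card_mono by blast
      then have "runs G X (2 * h) (\<lambda>v. total (pl v) (if v \<in> ?A then 1 else 0))
          (\<lambda>_. \<Sum>v \<in> nodes G. if v \<in> ?A then 1 else 0)"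
        using offset_indicator(1)[OF A] X_card by (intro runs_total) auto
      then show ?thesis
        by (rule runs_cong) (use offset_indicator(1)[OF A] in
          \<open>auto simp: ready_def place_simps z_def cnt_def target_def\<close>)
    qed
    then have "runs G X (2 * Q * (2 * h)) (\<lambda>v. collect (\<lambda>i. total (pl v)
      (if c v = me (pl v) \<and> z v = [1] \<and> moe v \<noteq> [1] \<and> picks i (me (pl v)) (nat (moe v ! 4)) then 1 else 0)) (2 * Q))
      (\<lambda>_ j. if j < 2 * Q then int (cnt j) else 0)"
      by (intro runs_collect)
    then show ?thesis by (simp only: g_def[abs_def])
  qed
  have tail: "(z v = [1] \<and> moe v \<noteq> [1] \<and> picks (argmax (2 * Q) g) (c v) (nat (moe v ! 4))) = tail j v" for v
    by (simp add: tail_def z_def j_def target_def)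
  let ?msg = "\<lambda>v u. if tail j v \<and> {me (pl v), u} = end_points (moe v) then [1] else [0 :: int]"
  have 6: "runs G X 1 (\<lambda>v. exch (?msg v) \<rhd> (\<lambda>r'.
     Ret \<lparr>centre = if tail j v then nat (moe v ! 4) else c v,
       branches = branches (st v) \<union> {u \<in> nb (pl v). tail j v \<and> {me (pl v), u} = end_points (moe v) \<or> r' u = [1]},
       frozen = frozen (st v) \<or> z v \<noteq> [1]\<rparr>)) (next_frag j)"
  proof (rule runs_bind_Ret[OF runs_exch])
    fix v assume v: "v \<in> nodes G"
    have rec: "received G ?msg v u = [1] \<longleftrightarrow> tail j u \<and> {u, v} = end_points (moe u)" if "u \<in> nbrs G v" for u
      using that nbrs_subset[of v] by (auto simp: received_nbr place_simps subset_iff)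
    have "{u \<in> nb (pl v). tail j v \<and> {me (pl v), u} = end_points (moe v) \<or> received G ?msg v u = [1]} =
      {u \<in> nbrs G v. {u, v} \<in> joins j}"
      by (rule Collect_cong) (use v rec joins_iff[OF v] in \<open>simp add: place_simps cong: conj_cong\<close>)
    also have "\<dots> = {u. {u, v} \<in> joins j}"
    proof -
      have "joins j \<subseteq> edges G" using mst_edges_subset by (auto elim!: joins_cases)
      then show ?thesis by (auto simp: nbrs_def)
    qed
    finally show "Ret \<lparr>centre = if tail j v then nat (moe v ! 4) else c v,
       branches = branches (st v) \<union> {u \<in> nb (pl v). tail j v \<and> {me (pl v), u} = end_points (moe v) \<or> received G ?msg v u = [1]},
       frozen = frozen (st v) \<or> z v \<noteq> [1]\<rparr> = Ret (next_frag j v)"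
      using branches[OF v] by (simp add: next_frag_def target_def z_def Collect_disj_eq)
  qed simp
  have "runs G X (S + 2 * T + 2 * Q * (2 * h) + 2) (\<lambda>v. local_phase (pl v) (w v) S T Q (st v)) (next_frag j)"
    unfolding local_phase_def Let_def
    apply (rule runs_bind_eq[OF 1, where t' = "2 * T + 2 * Q * (2 * h) + 2"])
     apply (rule runs_bind_eq[OF 2, where t' = "T + 2 * Q * (2 * h) + 2"])
      apply (rule runs_bind_eq[OF 3, where t' = "T + 2 * Q * (2 * h) + 1"])
       apply (rule runs_bind_eq[OF 4, where t' = "2 * Q * (2 * h) + 1"])
        apply (rule runs_bind_eq[OF 5, where t' = 1])
         apply (unfold tail, rule 6)
        apply simp_all
    done
  then show ?thesis using next' by blast
qed

end

end

text \<open>The flooding time covers the largest radius that can occur in any of the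
  \<open>p\<close> phases and is used in all of them, so that all nodes stay synchronous.\<close>

definition grow_fragments :: "place \<Rightarrow> (nat \<Rightarrow> int) \<Rightarrow> nat \<Rightarrow> nat \<Rightarrow> nat \<Rightarrow> fragment prog" where
  "grow_fragments P w S Q p = iter p (local_phase P w S (2 * (p * (2 * S + 1))) Q)
     \<lparr>centre = me P, branches = {}, frozen = False\<rparr>"

context local_stage
begin

lemma runs_grow_fragments:
  assumes w: "\<And>u v. v \<in> nodes G \<Longrightarrow> u \<in> nbrs G v \<Longrightarrow> w v u = weight G {u, v}"
  shows "\<exists>st F. runs G X (p * (S + 2 * (2 * (p * (2 * S + 1))) + 2 * Q * (2 * h) + 2))
      (\<lambda>v. grow_fragments (pl v) (w v) S Q p) st \<and> fragments p F st"
proof -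
  let ?T = "2 * (p * (2 * S + 1))"
  have "\<exists>st. runs G X (p * (S + 2 * ?T + 2 * Q * (2 * h) + 2))
      (\<lambda>v. iter p (local_phase (pl v) (w v) S ?T Q) \<lparr>centre = v, branches = {}, frozen = False\<rparr>) st \<and>
      (\<exists>F. fragments p F st)"
  proof (rule runs_iter_inv[where I = "\<lambda>i st. \<exists>F. fragments i F st"])
    show "\<exists>F. fragments 0 F (\<lambda>v. \<lparr>centre = v, branches = {}, frozen = False\<rparr>)"
      using fragments_init by blast
    fix i st assume i: "i < p" and "\<exists>F. fragments i F st"
    then obtain F where F: "fragments i F st" by blast
    have "i * (2 * S + 1) \<le> p * (2 * S + 1)" using i by (intro mult_right_mono) auto
    then show "\<exists>st'. runs G X (S + 2 * ?T + 2 * Q * (2 * h) + 2) (\<lambda>v. local_phase (pl v) (w v) S ?T Q (st v)) st' \<and>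
        (\<exists>F. fragments (Suc i) F st')"
      using runs_local_phase[OF F _ w, of ?T] by fastforce
  qed
  then obtain st F where st: "runs G X (p * (S + 2 * ?T + 2 * Q * (2 * h) + 2))
      (\<lambda>v. iter p (local_phase (pl v) (w v) S ?T Q) \<lparr>centre = v, branches = {}, frozen = False\<rparr>) st"
      "fragments p F st" by blast
  have "runs G X (p * (S + 2 * ?T + 2 * Q * (2 * h) + 2)) (\<lambda>v. grow_fragments (pl v) (w v) S Q p) st"
    by (rule runs_cong[OF st(1)]) (simp_all add: grow_fragments_def place_simps)
  then show ?thesis using st(2) by blast
qed

text \<open>The number of unfinished fragments is an integer below 1, hence 0. Then either one
  fragment spans the graph, or all fragments are frozen and have at least S + 1 nodes each.\<close>

lemma card_centres:
  assumes frag: "fragments p F st" and p: "real (size_of G) * (1 - 1 / real (2 * Q)) ^ p < 1"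
  shows "card {z \<in> nodes G. centre (st z) = z} \<le> size_of G div (S + 1) + 1"
proof -
  let ?Z = "{z \<in> nodes G. centre (st z) = z}"
  have c: "centre (st v) \<in> ?Z" if "v \<in> nodes G" for v
    using c_node[OF frag order_refl that] c_idem[OF frag order_refl that] by auto
  have "real (card (unfinished st)) < 1" using frag p by (auto simp: fragments_def)
  then have "card (unfinished st) = 0" by simp
  then have uf: "unfinished st = {}" using finite_nodes by (simp add: unfinished_def)
  show ?thesis
  proof (cases "\<exists>z \<in> ?Z. \<forall>v \<in> nodes G. centre (st v) = z")
    case True
    then obtain z where "z \<in> ?Z" "\<forall>v \<in> nodes G. centre (st v) = z" by blast
    then have "?Z = {z}" by auto
    then show ?thesis by simp
  next
    case False
    have "S + 1 \<le> card {v \<in> nodes G. centre (st v) = z}" if z: "z \<in> ?Z" for z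
    proof -
      have "\<not> (\<forall>v \<in> nodes G. centre (st v) = z)" using False z by blast
      then have "frozen (st z)" using uf z by (auto simp: unfinished_def)
      then show ?thesis using frag z by (auto simp: fragments_def Suc_le_eq)
    qed
    then have "(\<Sum>z \<in> ?Z. S + 1) \<le> (\<Sum>z \<in> ?Z. card {v \<in> nodes G. centre (st v) = z})"
      by (intro sum_mono) auto
    also have "\<dots> = (\<Sum>z \<in> ?Z. \<Sum>v \<in> {v \<in> nodes G. centre (st v) = z}. 1)" by simp
    also have "\<dots> = (\<Sum>v \<in> nodes G. 1)" using c finite_nodes by (intro sum.group) auto
    finally have "card ?Z * (S + 1) \<le> size_of G" by simp
    then have "card ?Z \<le> size_of G div (S + 1)" by (simp add: less_eq_div_iff_mult_less_eq)
    then show ?thesis by simp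
  qed
qed

end

text \<open>(1 - 1 / q) ^ q is at most 1 / e, and e exceeds 2. With q = 2 * Q this gives the number
  2 * Q * L of local phases.\<close>

lemma shrink_lt_1:
  assumes "0 < q" "n < 2 ^ L"
  shows "real n * (1 - 1 / real q) ^ (q * L) < 1"
proof -
  have "(1 - 1 / real q) ^ (q * L) \<le> exp (- 1 / real q) ^ (q * L)"
    using assms(1) exp_ge_add_one_self[of "- 1 / real q"] by (intro power_mono) auto
  also have "\<dots> = exp (- real L)"
    using assms(1) by (simp flip: exp_of_nat_mult)
  finally have "real n * (1 - 1 / real q) ^ (q * L) \<le> real n * exp (- real L)"
    by (intro mult_left_mono) auto
  also have "\<dots> < exp (real L) * exp (- real L)"
  proof (rule mult_strict_right_mono)
    have "real n < 2 ^ L" using assms(2) by (metis of_nat_less_iff of_nat_numeral of_nat_power)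
    also have "(2 :: real) ^ L \<le> exp 1 ^ L" using exp_ge_add_one_self[of 1] by (intro power_mono) auto
    also have "\<dots> = exp (real L)" by (simp flip: exp_of_nat_mult)
    finally show "real n < exp (real L)" .
  qed simp
  also have "\<dots> = 1" by (simp flip: exp_add)
  finally show ?thesis .
qed

lemma card_residue:
  "card {r. r < N \<and> r mod K = j} \<le> N div K + 1"
proof -
  have "inj_on (\<lambda>r. r div K) {r. r < N \<and> r mod K = j}"
    by (auto simp: inj_on_def) (metis div_mult_mod_eq)
  moreover have "(\<lambda>r. r div K) ` {r. r < N \<and> r mod K = j} \<subseteq> {..N div K}"
    by (auto intro: div_le_mono)
  ultimately have "card {r. r < N \<and> r mod K = j} \<le> card {..N div K}" by (intro card_inj_on_le) auto
  then show ?thesis by simp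
qed

subsection \<open>Merging all fragments\<close>

text \<open>Entries 4 and 5 of an item are the centres of the fragments at the inner and the outer
  end of its edge. The map \<open>f\<close> sends a centre to the label of the cluster that
  currently contains it.\<close>

definition lightest_items :: "(nat \<Rightarrow> nat) \<Rightarrow> int list set \<Rightarrow> int list set" where
  "lightest_items f I = {m \<in> I. \<forall>m' \<in> I. f (nat (m' ! 4)) = f (nat (m ! 4)) \<longrightarrow> m \<le> m'}"

definition merge_rel :: "(nat \<Rightarrow> nat) \<Rightarrow> int list set \<Rightarrow> nat rel" where
  "merge_rel f C = {(f (nat (m ! 4)), f (nat (m ! 5))) |m. m \<in> C} \<union> {(f (nat (m ! 5)), f (nat (m ! 4))) |m. m \<in> C}"

text \<open>All nodes hold the same items and the same map, so the least label of a class is a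
  representative on which they agree without communication.\<close>

definition merge_update :: "int list set \<Rightarrow> (nat \<Rightarrow> nat) \<times> nat set set \<Rightarrow> (nat \<Rightarrow> nat) \<times> nat set set" where
  "merge_update I \<sigma> = (let C = lightest_items (fst \<sigma>) I in
     (\<lambda>x. LEAST y. (fst \<sigma> x, y) \<in> (merge_rel (fst \<sigma>) C)\<^sup>*, snd \<sigma> \<union> end_points ` C))"

definition global_phase ::
  "place \<Rightarrow> (nat \<Rightarrow> int) \<Rightarrow> nat set \<Rightarrow> nat \<Rightarrow> nat \<Rightarrow> (nat \<Rightarrow> nat) \<Rightarrow> nat \<Rightarrow> nat \<Rightarrow> (nat \<Rightarrow> nat) \<Rightarrow>
    (nat \<Rightarrow> nat) \<times> nat set set \<Rightarrow> ((nat \<Rightarrow> nat) \<times> nat set set) prog"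
where
  "global_phase P w B T c cs j t col \<sigma> =
     fmin T B (candidate P w (\<lambda>u. fst \<sigma> (cs u) \<noteq> fst \<sigma> c) (\<lambda>u. [int c, int (cs u)])) \<rhd> (\<lambda>m.
     gossip t (nb P) col (if c = me P \<and> m \<noteq> [1] then {(j, m)} else {}) \<rhd> (\<lambda>I.
     Ret (merge_update (snd ` I) \<sigma>)))"

text \<open>The centres are numbered by \<open>rank\<close>, and each uses the colour given by its
  number modulo \<open>K\<close>. The time for one distribution is the number of fragments per
  colour, rounded up, plus the distance \<open>d\<close> within a class.\<close>

definition solve ::
  "place \<Rightarrow> (nat \<Rightarrow> int) \<Rightarrow> nat \<Rightarrow> nat \<Rightarrow> nat \<Rightarrow> nat \<Rightarrow> nat \<Rightarrow> nat \<Rightarrow> (nat \<Rightarrow> nat) \<Rightarrow> nat set set prog"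
where
  "solve P w n L Q S K d col =
     grow_fragments P w S Q (2 * Q * L) \<rhd> (\<lambda>st.
     exch (\<lambda>_. [int (centre st)]) \<rhd> (\<lambda>r.
     rank P (if centre st = me P then 1 else 0) \<rhd> (\<lambda>k.
     iter L (global_phase P w (branches st) (2 * (2 * Q * L * (2 * S + 1))) (centre st) (\<lambda>u. nat (hd (r u)))
       (nat k mod K) ((n div (S + 1) + 1) div K + 1 + d) col) (\<lambda>x. x, {}) \<rhd> (\<lambda>\<sigma>.
     Ret ({{u, me P} |u. u \<in> branches st} \<union> {e \<in> snd \<sigma>. me P \<in> e})))))"

definition solve_time :: "nat \<Rightarrow> nat \<Rightarrow> nat \<Rightarrow> nat \<Rightarrow> nat \<Rightarrow> nat \<Rightarrow> nat \<Rightarrow> nat" where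
  "solve_time h n L Q S K d = (let p = 2 * Q * L; T = 2 * (p * (2 * S + 1)) in
     p * (S + 2 * T + 2 * Q * (2 * h) + 2) + 1 + (2 * h + 1) + L * (T + ((n div (S + 1) + 1) div K + 1 + d)))"

locale global_stage = local_stage +
  fixes colour :: "nat set \<Rightarrow> nat" and K d :: nat and p :: nat and F :: "nat set set" and st :: "nat \<Rightarrow> fragment"
  assumes frag: "fragments p F st" and K: "0 < K"
    and classes: "\<And>j u v. j < K \<Longrightarrow> u \<in> nodes G \<Longrightarrow> v \<in> nodes G \<Longrightarrow>
      v \<in> hop_ball {e \<in> edges G. colour e = j} d u"
begin

abbreviation ctr where "ctr v \<equiv> centre (st v)"
abbreviation centres where "centres \<equiv> {z \<in> nodes G. ctr z = z}"

lemmas F_edges' = F_edges[OF frag order_refl] and branches' = branches[OF frag order_refl]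
  and c_node' = c_node[OF frag order_refl] and c_idem' = c_idem[OF frag order_refl]
  and component_eq_c' = component_eq_c[OF frag order_refl]

context
  fixes f M i
  assumes M: "F \<union> M \<subseteq> mst_edges G" and lab: "labels (nodes G) (F \<union> M) (\<lambda>v. f (ctr v))"
    and grown: "grown (nodes G) (F \<union> M) (2 ^ i)"
begin

definition gcand where
  "gcand = cand (\<lambda>v u. f (ctr u) \<noteq> f (ctr v)) (\<lambda>v u. [int (ctr v), int (ctr u)])"

definition item where "item v = Min (gcand ` component F v)"

definition cluster where "cluster v = {u \<in> nodes G. f (ctr u) = f (ctr v)}"

definition lightest where "lightest v = Min (gcand ` cluster v)"

lemma cluster_component: "v \<in> nodes G \<Longrightarrow> component (F \<union> M) v = cluster v"
proof -
  assume v: "v \<in> nodes G"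
  have "F \<union> M \<subseteq> edges G" using M mst_edges_subset by blast
  then have "component (F \<union> M) v \<subseteq> nodes G" using component_nodes(1) v by blast
  moreover have "u \<in> component (F \<union> M) v \<longleftrightarrow> f (ctr u) = f (ctr v)" if "u \<in> nodes G" for u
    using lab v that unfolding labels_def component_def by (metis mem_Collect_eq)
  ultimately show ?thesis unfolding cluster_def by blast
qed

lemma lightest_cases:
  assumes v: "v \<in> nodes G"
  obtains "lightest v = [1]" "cluster v = nodes G"
  | a b where "a \<in> cluster v" "b \<in> nodes G - cluster v" "{a, b} \<in> mst_edges G"
    "lightest v = 0 # edge_key G {a, b} @ [int (ctr a), int (ctr b)]"
    "end_points (lightest v) = {a, b}" "nat (lightest v ! 4) = ctr a" "nat (lightest v ! 5) = ctr b"
    "lightest v \<noteq> [1]"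
proof -
  have "cluster v \<subseteq> nodes G" "cluster v \<noteq> {}" using v by (auto simp: cluster_def)
  moreover have "f (ctr u) \<noteq> f (ctr w) \<longleftrightarrow> u \<notin> cluster v" if "w \<in> cluster v" "u \<in> nbrs G w" for u w
    using that nbrs_subset[of w] by (auto simp: cluster_def)
  ultimately have "lightest v = [1] \<and> cluster v = nodes G \<or>
    (\<exists>a b. a \<in> cluster v \<and> b \<in> nodes G - cluster v \<and> {a, b} \<in> mst_edges G \<and>
      lightest v = 0 # edge_key G {a, b} @ [int (ctr a), int (ctr b)])"
    unfolding lightest_def gcand_def by (rule Min_cand)
  then show ?thesis
  proof (elim disjE exE conjE)
    fix a b assume ab: "a \<in> cluster v" "b \<in> nodes G - cluster v" "{a, b} \<in> mst_edges G"
      and m: "lightest v = 0 # edge_key G {a, b} @ [int (ctr a), int (ctr b)]"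
    have "end_points (lightest v) = {a, b}" unfolding m by (rule end_points_cand)
    moreover have "nat (lightest v ! 4) = ctr a" "nat (lightest v ! 5) = ctr b" "lightest v \<noteq> [1]"
      by (simp_all add: m edge_key_def)
    ultimately show ?thesis using that(2)[OF ab m] by blast
  qed (rule that(1))
qed

lemma gcand_in_cluster:
  assumes "v \<in> nodes G" "u \<in> cluster v"
  shows "lightest v \<le> gcand u"
  unfolding lightest_def using assms finite_nodes by (intro Min_le) (auto simp: cluster_def)

lemma item_cases:
  assumes "v \<in> nodes G"
  obtains u where "u \<in> nodes G" "ctr u = ctr v" "item v = gcand u"
proof -
  have "finite (component F v)" using component_nodes(2)[OF F_edges' assms] .
  then have "item v \<in> gcand ` component F v" unfolding item_def by (intro Min_in) (auto intro: component_self)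
  then show ?thesis using that component_eq_c'[OF assms] by auto
qed

lemma item_label:
  assumes "v \<in> nodes G" "item v \<noteq> [1]"
  shows "nat (item v ! 4) = ctr v"
proof -
  obtain u where u: "u \<in> nodes G" "ctr u = ctr v" "item v = gcand u" by (rule item_cases[OF assms(1)])
  then show ?thesis
    using assms(2) unfolding gcand_def
    by (cases rule: cand_cases[of "\<lambda>v u. f (ctr u) \<noteq> f (ctr v)" "\<lambda>v u. [int (ctr v), int (ctr u)]" u])
      (auto simp: edge_key_def)
qed

lemma lightest_le_item:
  assumes "v \<in> nodes G" "z \<in> cluster v"
  shows "lightest v \<le> item z"
proof -
  have z: "z \<in> nodes G" using assms by (simp add: cluster_def)
  obtain u where "u \<in> nodes G" "ctr u = ctr z" "item z = gcand u" by (rule item_cases[OF z])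
  then show ?thesis using gcand_in_cluster[OF assms(1), of u] assms(2) by (simp add: cluster_def)
qed

text \<open>The lightest edge out of the cluster starts at some node a. The item of the fragment of
  a is at most the candidate of a and at least the minimum of the cluster, so it is that
  minimum.\<close>

lemma lightest_is_item:
  assumes v: "v \<in> nodes G" "lightest v \<noteq> [1]"
  shows "\<exists>z \<in> centres. f z = f (ctr v) \<and> item z = lightest v"
  using v(2)
proof (cases rule: lightest_cases[OF v(1)])
  case (2 a b)
  have an: "a \<in> nodes G" "f (ctr a) = f (ctr v)" using 2(1) by (auto simp: cluster_def)
  have "b \<in> nbrs G a" using 2(3) mst_edges_subset by (auto simp: nbrs_def insert_commute)
  then have "gcand a \<le> 0 # edge_key G {b, a} @ [int (ctr a), int (ctr b)]"
    unfolding gcand_def using 2(1,2) by (intro cand_le) (auto simp: cluster_def)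
  then have le: "gcand a \<le> lightest v" using 2(4) by (simp add: insert_commute)
  have ca: "ctr a \<in> centres" using c_node'[OF an(1)] c_idem'[OF an(1)] by simp
  have "a \<in> component F (ctr a)" using component_eq_c'[of "ctr a"] ca an by simp
  then have "item (ctr a) \<le> gcand a"
    unfolding item_def using component_nodes(2)[OF F_edges', of "ctr a"] ca by (intro Min_le) auto
  moreover have "lightest v \<le> item (ctr a)"
    using lightest_le_item[OF v(1), of "ctr a"] ca an by (simp add: cluster_def)
  ultimately show ?thesis using le ca an(2) by (intro bexI[of _ "ctr a"]) auto
qed simp

abbreviation all_lightest where
  "all_lightest \<equiv> {lightest v |v. v \<in> nodes G \<and> lightest v \<noteq> [1]}"

text \<open>The nodes only see one item per fragment. Filtering these items by cluster nevertheless
  yields exactly the lightest edges leaving the clusters, so the local simulation is a true Boruvka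
  step.\<close>

lemma lightest_items_eq:
  "lightest_items f {item z |z. z \<in> centres \<and> item z \<noteq> [1]} = all_lightest"
proof (intro equalityI subsetI)
  let ?I = "{item z |z. z \<in> centres \<and> item z \<noteq> [1]}"
  fix m assume "m \<in> lightest_items f ?I"
  then obtain z where z: "z \<in> nodes G" "ctr z = z" "m = item z" "item z \<noteq> [1]"
    and least: "\<And>m'. m' \<in> ?I \<Longrightarrow> f (nat (m' ! 4)) = f (nat (m ! 4)) \<Longrightarrow> m \<le> m'"
    unfolding lightest_items_def by auto
  obtain u where u: "u \<in> nodes G" "ctr u = ctr z" "item z = gcand u" by (rule item_cases[OF z(1)])
  have "cluster z \<noteq> nodes G"
  proof
    assume "cluster z = nodes G"
    then have "gcand u = [1]"
      unfolding gcand_def using u(1,2) nbrs_subset[of u]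
      by (cases rule: cand_cases[of "\<lambda>v u. f (ctr u) \<noteq> f (ctr v)" "\<lambda>v u. [int (ctr v), int (ctr u)]" u])
        (auto simp: cluster_def)
    then show False using u z by simp
  qed
  then have l1: "lightest z \<noteq> [1]" by (cases rule: lightest_cases[OF z(1)]) auto
  from lightest_is_item[OF z(1) this] obtain z' where
    z': "z' \<in> nodes G" "ctr z' = z'" "f z' = f (ctr z)" "item z' = lightest z" by auto
  have "lightest z \<le> m" using lightest_le_item[OF z(1), of z] z by (simp add: cluster_def)
  moreover have "m \<le> lightest z"
  proof (rule least)
    show "lightest z \<in> ?I" using z' l1 by force
    show "f (nat (lightest z ! 4)) = f (nat (m ! 4))"
      using item_label[OF z'(1)] item_label[OF z(1)] z' z l1 by simp
  qed
  ultimately show "m \<in> all_lightest" using z l1 by force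
next
  let ?I = "{item z |z. z \<in> centres \<and> item z \<noteq> [1]}"
  fix m assume "m \<in> all_lightest"
  then obtain v where v: "v \<in> nodes G" "m = lightest v" "lightest v \<noteq> [1]" by auto
  from lightest_is_item[OF v(1,3)] obtain z where
    z: "z \<in> nodes G" "ctr z = z" "f z = f (ctr v)" "item z = lightest v" by auto
  have least: "m \<le> m'" if m': "m' \<in> ?I" "f (nat (m' ! 4)) = f (nat (m ! 4))" for m'
  proof -
    obtain z' where z': "z' \<in> nodes G" "ctr z' = z'" "m' = item z'" "item z' \<noteq> [1]" using m'(1) by auto
    have "f z' = f z" using m'(2) item_label[OF z'(1,4)] item_label[OF z(1)] z' z v by simp
    then show ?thesis using lightest_le_item[OF v(1), of z'] z z' v by (simp add: cluster_def)
  qed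
  have "m \<in> ?I" using z v by (intro CollectI exI[of _ z]) simp
  then show "m \<in> lightest_items f ?I" using least unfolding lightest_items_def by blast
qed

text \<open>Each cluster contributes its lightest outgoing edge, a tree edge by the cut rule, so
  clusters at least double. The map g picks one representative of each connected component of the
  merge relation.\<close>

lemma merge_step:
  defines "C \<equiv> all_lightest"
  defines "g \<equiv> \<lambda>y. LEAST y'. (y, y') \<in> (merge_rel f C)\<^sup>*"
  defines "D \<equiv> end_points ` C"
  shows "F \<union> (M \<union> D) \<subseteq> mst_edges G" "labels (nodes G) (F \<union> (M \<union> D)) (\<lambda>v. g (f (ctr v)))"
    "grown (nodes G) (F \<union> (M \<union> D)) (2 ^ Suc i)"
proof -
  have C_edge: "\<exists>a b. end_points m = {a, b} \<and> {a, b} \<in> mst_edges G \<and> nat (m ! 4) = ctr a \<and> nat (m ! 5) = ctr b"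
    if m: "m \<in> C" for m
  proof -
    obtain v where v: "v \<in> nodes G" "m = lightest v" "lightest v \<noteq> [1]" using m by (auto simp: C_def)
    from v(3) show ?thesis by (cases rule: lightest_cases[OF v(1)]) (use v in auto)
  qed
  have D: "D \<subseteq> mst_edges G"
  proof
    fix e assume "e \<in> D"
    then obtain m where m: "m \<in> C" "e = end_points m" by (auto simp: D_def)
    from C_edge[OF m(1)] m(2) show "e \<in> mst_edges G" by metis
  qed
  then show sub: "F \<union> (M \<union> D) \<subseteq> mst_edges G" using M by blast
  then have nodes: "\<And>e. e \<in> F \<union> M \<union> D \<Longrightarrow> e \<subseteq> nodes G" using mst_edges_subset edge_subset_nodes by blast
  have symR: "sym (merge_rel f C)" by (auto simp: sym_def merge_rel_def)
  have g: "(y, g y) \<in> (merge_rel f C)\<^sup>*" for y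
    unfolding g_def by (rule LeastI[of _ y]) simp
  have "labels (nodes G) (F \<union> M \<union> D) (\<lambda>v. g (f (ctr v)))"
  proof (rule labels_merge[where c = "\<lambda>v. f (ctr v)" and g = g])
    fix u v assume "{u, v} \<in> D"
    then obtain m where m: "m \<in> C" "{u, v} = end_points m" by (auto simp: D_def)
    obtain a b where "end_points m = {a, b}" "nat (m ! 4) = ctr a" "nat (m ! 5) = ctr b"
      using C_edge[OF m(1)] by blast
    then have "(f (ctr u), f (ctr v)) = (f (nat (m ! 4)), f (nat (m ! 5))) \<or>
        (f (ctr u), f (ctr v)) = (f (nat (m ! 5)), f (nat (m ! 4)))"
      using m(2) by (auto simp: doubleton_eq_iff)
    then have "(f (ctr u), f (ctr v)) \<in> merge_rel f C" "(f (ctr v), f (ctr u)) \<in> merge_rel f C"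
      using m(1) unfolding merge_rel_def by blast+
    then have "(f (ctr u), y) \<in> (merge_rel f C)\<^sup>* \<longleftrightarrow> (f (ctr v), y) \<in> (merge_rel f C)\<^sup>*" for y
      by (meson converse_rtrancl_into_rtrancl)
    then show "g (f (ctr u)) = g (f (ctr v))" by (simp add: g_def)
  next
    fix u v assume eq: "g (f (ctr u)) = g (f (ctr v))"
    have "merge_rel f C \<subseteq> {(f (ctr a), f (ctr b)) |a b. {a, b} \<in> D}"
    proof
      fix xy assume "xy \<in> merge_rel f C"
      then obtain m where m: "m \<in> C"
        "xy = (f (nat (m ! 4)), f (nat (m ! 5))) \<or> xy = (f (nat (m ! 5)), f (nat (m ! 4)))"
        by (auto simp: merge_rel_def)
      obtain a b where ab: "end_points m = {a, b}" "nat (m ! 4) = ctr a" "nat (m ! 5) = ctr b"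
        using C_edge[OF m(1)] by blast
      then have "{a, b} \<in> D" "{b, a} \<in> D" using m(1) by (auto simp: D_def insert_commute intro!: image_eqI[of _ _ m])
      then show "xy \<in> {(f (ctr a), f (ctr b)) |a b. {a, b} \<in> D}" using m(2) ab by auto
    qed
    moreover have "(f (ctr u), f (ctr v)) \<in> (merge_rel f C)\<^sup>*"
      by (rule rtrancl_trans[OF g[of "f (ctr u)", unfolded eq] symD[OF sym_rtrancl[OF symR] g]])
    ultimately show "(f (ctr u), f (ctr v)) \<in> {(f (ctr a), f (ctr b)) |a b. {a, b} \<in> D}\<^sup>*"
      using rtrancl_mono by blast
  qed (use lab nodes in auto)
  then show "labels (nodes G) (F \<union> (M \<union> D)) (\<lambda>v. g (f (ctr v)))" by (simp only: Un_assoc)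
  have "grown (nodes G) (F \<union> (M \<union> D)) (2 * 2 ^ i)"
  proof (rule grown_double[OF finite_nodes _ _ grown])
    fix v assume v: "v \<in> nodes G" and ne: "component (F \<union> M) v \<noteq> nodes G"
    show "\<exists>x y. {x, y} \<in> F \<union> (M \<union> D) \<and> x \<in> component (F \<union> M) v \<and> y \<notin> component (F \<union> M) v"
    proof (cases rule: lightest_cases[OF v])
      case 1
      then show ?thesis using ne cluster_component[OF v] by simp
    next
      case (2 a b)
      have "lightest v \<in> C" using 2(8) v by (auto simp: C_def)
      then have "{a, b} \<in> D" using 2(5) by (force simp: D_def)
      then show ?thesis using 2(1,2) cluster_component[OF v] by blast
    qed
  qed (use nodes in auto)
  then show "grown (nodes G) (F \<union> (M \<union> D)) (2 ^ Suc i)" by simp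
qed

lemma runs_global_phase:
  assumes w: "\<And>u v. v \<in> nodes G \<Longrightarrow> u \<in> nbrs G v \<Longrightarrow> w v u = weight G {u, v}"
    and cs: "\<And>u v. v \<in> nodes G \<Longrightarrow> u \<in> nbrs G v \<Longrightarrow> cs v u = ctr u"
    and col: "\<And>u v. v \<in> nodes G \<Longrightarrow> u \<in> nbrs G v \<Longrightarrow> col v u = colour {u, v}"
    and T: "2 * (p * (2 * S + 1)) \<le> T"
    and j: "inj_on j centres" "j ` centres = {..<card centres}"
    and t: "card centres div K + 1 + d \<le> t"
  shows "runs G X (T + t) (\<lambda>v. global_phase (pl v) (w v) (branches (st v)) T (ctr v) (cs v) (j v mod K) t (col v) (f, M))
    (\<lambda>v. merge_update {item z |z. z \<in> centres \<and> item z \<noteq> [1]} (f, M))"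
proof -
  define items where "items v = (if ctr v = v \<and> item v \<noteq> [1] then {(j v mod K, item v)} else {})" for v
  have short_gcand: "short X (gcand v)" if "v \<in> nodes G" for v
    unfolding gcand_def using X_nodes c_node' nbrs_subset[of v] that by (intro short_cand) auto
  interpret gossiping G X colour items
  proof
    fix v jj x assume v: "v \<in> nodes G" "(jj, x) \<in> items v"
    then have x: "x = item v" by (auto simp: items_def split: if_splits)
    obtain u where "u \<in> nodes G" "item v = gcand u" by (rule item_cases[OF v(1)])
    moreover from this have "item v \<noteq> []" unfolding gcand_def
      by (cases rule: cand_cases[of "\<lambda>v u. f (ctr u) \<noteq> f (ctr v)" "\<lambda>v u. [int (ctr v), int (ctr u)]" u]) auto
    ultimately show "short X x \<and> x \<noteq> []" using short_gcand x by simp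
  qed
  have known: "known t v = all_items" if v: "v \<in> nodes G" for v
  proof
    show "known t v \<subseteq> all_items" by (rule known_subset[OF v])
    show "all_items \<subseteq> known t v"
    proof
      fix y assume "y \<in> all_items"
      then obtain z where z: "z \<in> centres" "y = (j z mod K, item z)" "y \<in> items z"
        by (auto simp: items_def split: if_splits)
      let ?j = "j z mod K"
      let ?Zj = "{z \<in> centres. j z mod K = ?j}"
      have sub: "items_of ?j \<subseteq> item ` ?Zj" by (auto simp: items_def split: if_splits)
      have fin: "finite centres" using finite_nodes by simp
      have finZ: "finite ?Zj" using finite_nodes by simp
      then have fin_j: "finite (item ` ?Zj)" by (rule finite_imageI)
      have "card (items_of ?j) \<le> card (item ` ?Zj)" using sub fin_j by (intro card_mono)
      also have "\<dots> \<le> card ?Zj" using finZ by (rule card_image_le)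
      also have "\<dots> = card (j ` ?Zj)" using j(1) by (intro card_image[symmetric]) (auto simp: inj_on_def)
      \<comment> \<open>The ranks of the centres are consecutive and distinct, so reduction modulo
        \<open>K\<close> spreads the items evenly over the colours.\<close>
      also have "\<dots> \<le> card {r. r < card centres \<and> r mod K = ?j}"
        using j(2) by (intro card_mono) auto
      also have "\<dots> \<le> card centres div K + 1" by (rule card_residue)
      finally have "card (items_of ?j) \<le> card centres div K + 1" .
      moreover have "finite (items_of ?j)"
        by (rule finite_subset[OF sub fin_j])
      moreover have "v \<in> hop_ball (colour_class ?j) d z"
        unfolding colour_class_def using classes[of ?j z v] K z(1) v by simp
      ultimately show "y \<in> known t v" using known_complete[of ?j _ d t "item z" z v] t z by auto
    qed
  qed
  have "snd ` all_items = {item z |z. z \<in> centres \<and> item z \<noteq> [1]}"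
    by (auto simp: items_def image_iff split: if_splits)
  then have snd_known: "snd ` known t v = {item z |z. z \<in> centres \<and> item z \<noteq> [1]}" if "v \<in> nodes G" for v
    using known[OF that] by simp
  have 1: "runs G X T (\<lambda>v. fmin T (branches (st v)) (candidate (pl v) (w v)
      (\<lambda>u. f (cs v u) \<noteq> f (ctr v)) (\<lambda>u. [int (ctr v), int (cs v u)]))) item"
  proof (rule runs_cong[OF runs_fmin[OF F_edges', where x = gcand]])
    fix v assume v: "v \<in> nodes G"
    show "fmin T {u. {u, v} \<in> F} (gcand v) = fmin T (branches (st v)) (candidate (pl v) (w v)
      (\<lambda>u. f (cs v u) \<noteq> f (ctr v)) (\<lambda>u. [int (ctr v), int (cs v u)]))"
      using candidate_eq[of "pl v" v "w v" "\<lambda>u. f (cs v u) \<noteq> f (ctr v)"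
        "\<lambda>v u. f (ctr u) \<noteq> f (ctr v)" "\<lambda>u. [int (ctr v), int (cs v u)]" "\<lambda>v u. [int (ctr v), int (ctr u)]"] v
      by (simp add: branches' place_simps w cs gcand_def)
    show "Min (gcand ` hop_ball F T v) = item v" using ball_T[OF frag T v] by (simp add: item_def)
  qed (use short_gcand in auto)
  have 2: "runs G X t (\<lambda>v. gossip t (nb (pl v)) (col v)
      (if ctr v = me (pl v) \<and> item v \<noteq> [1] then {(j v mod K, item v)} else {})) (known t)"
    by (rule runs_cong[OF runs_gossip]) (auto simp: col place_simps items_def)
  show ?thesis
    unfolding global_phase_def fst_conv
    by (rule runs_bind[OF 1], rule runs_bind_Ret[OF 2]) (simp add: snd_known)
qed

end

lemma runs_merge:
  assumes w: "\<And>u v. v \<in> nodes G \<Longrightarrow> u \<in> nbrs G v \<Longrightarrow> w v u = weight G {u, v}"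
    and cs: "\<And>u v. v \<in> nodes G \<Longrightarrow> u \<in> nbrs G v \<Longrightarrow> cs v u = ctr u"
    and col: "\<And>u v. v \<in> nodes G \<Longrightarrow> u \<in> nbrs G v \<Longrightarrow> col v u = colour {u, v}"
    and T: "2 * (p * (2 * S + 1)) \<le> T"
    and j: "inj_on j centres" "j ` centres = {..<card centres}"
    and t: "card centres div K + 1 + d \<le> t" and L: "size_of G < 2 ^ L"
  shows "\<exists>f. runs G X (L * (T + t)) (\<lambda>v. iter L (global_phase (pl v) (w v) (branches (st v)) T (ctr v) (cs v)
      (j v mod K) t (col v)) (\<lambda>x. x, {})) (\<lambda>_. f) \<and> F \<union> snd f = mst_edges G"
proof -
  \<comment> \<open>The state is required to be a constant function of the node: this expresses that
    all local simulations agree.\<close>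
  define I where "I i \<sigma> \<longleftrightarrow> (\<exists>f M. \<sigma> = (\<lambda>_ :: nat. (f, M)) \<and> F \<union> M \<subseteq> mst_edges G \<and>
    labels (nodes G) (F \<union> M) (\<lambda>v. f (ctr v)) \<and> grown (nodes G) (F \<union> M) (2 ^ i))" for i \<sigma>
  have "\<exists>\<sigma>'. runs G X (L * (T + t)) (\<lambda>v. iter L (global_phase (pl v) (w v) (branches (st v)) T (ctr v) (cs v)
      (j v mod K) t (col v)) (\<lambda>x. x, {})) \<sigma>' \<and> I L \<sigma>'"
  proof (rule runs_iter_inv[where I = I and f = "\<lambda>v. global_phase (pl v) (w v) (branches (st v)) T (ctr v) (cs v)
      (j v mod K) t (col v)"])
    have "component F v \<noteq> {}" "finite (component F v)" if "v \<in> nodes G" for v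
      using component_nodes(2)[OF F_edges' that] component_self[of v F] by blast+
    then have "grown (nodes G) F 1" by (auto simp: grown_def Suc_le_eq card_gt_0_iff)
    then show "I 0 (\<lambda>v. (\<lambda>x. x, {}))"
      using frag unfolding I_def by (intro exI[of _ "\<lambda>x. x"] exI[of _ "{}"]) (auto simp: fragments_def)
    fix i \<sigma> assume "I i \<sigma>"
    then obtain f M where I: "\<sigma> = (\<lambda>_. (f, M))" "F \<union> M \<subseteq> mst_edges G"
      "labels (nodes G) (F \<union> M) (\<lambda>v. f (ctr v))" "grown (nodes G) (F \<union> M) (2 ^ i)" by (auto simp: I_def)
    note step = merge_step[OF I(2-4)] and run = runs_global_phase[where cs = cs, OF I(2-4) w cs col T j t]
    show "\<exists>\<sigma>'. runs G X (T + t) (\<lambda>v. global_phase (pl v) (w v) (branches (st v)) T (ctr v) (cs v)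
      (j v mod K) t (col v) (\<sigma> v)) \<sigma>' \<and> I (Suc i) \<sigma>'"
    proof (intro exI conjI)
      show "runs G X (T + t) (\<lambda>v. global_phase (pl v) (w v) (branches (st v)) T (ctr v) (cs v)
        (j v mod K) t (col v) (\<sigma> v)) (\<lambda>v. merge_update
          {item f z |z. z \<in> centres \<and> item f z \<noteq> [1]} (f, M))"
        using run unfolding I(1) by blast
      show "I (Suc i) (\<lambda>v. merge_update {item f z |z. z \<in> centres \<and> item f z \<noteq> [1]} (f, M))"
        unfolding I_def merge_update_def fst_conv snd_conv Let_def lightest_items_eq[OF I(2-4)]
        using step by blast
    qed
  qed
  then obtain f M where fM: "runs G X (L * (T + t)) (\<lambda>v. iter L (global_phase (pl v) (w v) (branches (st v)) T (ctr v) (cs v)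
      (j v mod K) t (col v)) (\<lambda>x. x, {})) (\<lambda>_. (f, M))" "F \<union> M \<subseteq> mst_edges G"
      "grown (nodes G) (F \<union> M) (2 ^ L)"
    unfolding I_def by blast
  have "connects (F \<union> M) (nodes G)"
    unfolding connects_def
  proof (intro conjI ballI nodes_nonempty)
    fix u v assume uv: "u \<in> nodes G" "v \<in> nodes G"
    have sub: "F \<union> M \<subseteq> edges G" using fM(2) mst_edges_subset by blast
    have "card (component (F \<union> M) u) \<le> size_of G"
      using component_nodes(1)[OF sub uv(1)] finite_nodes by (intro card_mono)
    then have "component (F \<union> M) u = nodes G" using fM(3) uv(1) L unfolding grown_def by fastforce
    then show "linked (F \<union> M) u v" using uv(2) by (auto simp: component_def)
  qed
  then have "F \<union> M = mst_edges G" by (rule connects_subset_mst_edges[OF graph(1) fM(2)])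
  then show ?thesis using fM(1) by (intro exI[of _ "(f, M)"]) simp
qed

end

context local_stage
begin

lemma runs_solve:
  assumes w: "\<And>u v. v \<in> nodes G \<Longrightarrow> u \<in> nbrs G v \<Longrightarrow> w v u = weight G {u, v}"
    and col: "\<And>u v. v \<in> nodes G \<Longrightarrow> u \<in> nbrs G v \<Longrightarrow> col v u = colour {u, v}"
    and L: "size_of G < 2 ^ L" and K: "0 < K"
    and classes: "\<And>j u v. j < K \<Longrightarrow> u \<in> nodes G \<Longrightarrow> v \<in> nodes G \<Longrightarrow>
      v \<in> hop_ball {e \<in> edges G. colour e = j} d u"
  shows "runs G X (solve_time h (size_of G) L Q S K d)
    (\<lambda>v. solve (pl v) (w v) (size_of G) L Q S K d (col v)) (\<lambda>v. {e \<in> mst_edges G. v \<in> e})"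
proof -
  let ?p = "2 * Q * L" and ?n = "size_of G"
  let ?T = "2 * (?p * (2 * S + 1))" and ?t = "(?n div (S + 1) + 1) div K + 1 + d"
  obtain st F where st: "runs G X (?p * (S + 2 * ?T + 2 * Q * (2 * h) + 2)) (\<lambda>v. grow_fragments (pl v) (w v) S Q ?p) st"
    and frag: "fragments ?p F st"
    using runs_grow_fragments[OF w] by blast
  interpret global_stage G X h pl S Q colour K d ?p F st
    by unfold_locales (use frag K classes in auto)
  define x where "x v = (if v \<in> centres then 1 else 0 :: int)" for v
  have A: "centres \<subseteq> nodes G" by auto
  note ind = offset_indicator[OF A, folded x_def]
  have "card centres \<le> ?n" using finite_nodes by (intro card_mono) auto
  then have x: "runs G X (2 * h + 1) (\<lambda>v. rank (pl v) (x v)) (offset x h)"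
    using ind(1) X_card by (intro runs_rank) (auto simp: x_def)
  define j where "j v = nat (offset x h v)" for v
  have pos: "0 \<le> offset x h z" if "z \<in> centres" for z
    using ind(3) imageI[OF that, of "offset x h"] by simp
  have j1: "inj_on j centres"
  proof (rule inj_onI)
    fix z z' assume "z \<in> centres" "z' \<in> centres" "j z = j z'"
    then show "z = z'" using ind(2) pos[of z] pos[of z'] by (auto simp: j_def inj_on_def)
  qed
  have "j ` centres = nat ` offset x h ` centres" by (auto simp: j_def)
  also have "\<dots> = {..<card centres}" unfolding ind(3) by (auto simp: image_iff intro!: bexI[of _ "int _"])
  finally have j2: "j ` centres = {..<card centres}" .
  have "card centres \<le> ?n div (S + 1) + 1"
    using shrink_lt_1[OF _ L, of "2 * Q"] Q(1) by (intro card_centres[OF frag]) (simp add: mult.assoc)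
  then have t: "card centres div K + 1 + d \<le> ?t" by (simp add: div_le_mono)
  let ?r = "received G (\<lambda>v _. [int (ctr v)])"
  have cs: "nat (hd (?r v u)) = ctr u" if "v \<in> nodes G" "u \<in> nbrs G v" for u v
    using that by (simp add: received_nbr)
  obtain f where f: "runs G X (L * (?T + ?t)) (\<lambda>v. iter L (global_phase (pl v) (w v) (branches (st v)) ?T (ctr v)
      (\<lambda>u. nat (hd (?r v u))) (j v mod K) ?t (col v)) (\<lambda>x. x, {})) (\<lambda>_. f)" "F \<union> snd f = mst_edges G"
    using runs_merge[where cs = "\<lambda>v u. nat (hd (?r v u))", OF w cs col order_refl j1 j2 t L] by blast
  have 1: "runs G X 1 (\<lambda>v. exch (\<lambda>_. [int (ctr v)])) ?r"
    using X_nodes[OF c_node'] by (intro runs_bcast) (simp add: short_def)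
  have 2: "runs G X (2 * h + 1) (\<lambda>v. rank (pl v) (if ctr v = me (pl v) then 1 else 0)) (offset x h)"
    by (rule runs_cong[OF x]) (auto simp: x_def place_simps)
  have out: "{{u, me (pl v)} |u. u \<in> branches (st v)} \<union> {e \<in> snd f. me (pl v) \<in> e} = {e \<in> mst_edges G. v \<in> e}"
    if v: "v \<in> nodes G" for v
  proof -
    have "{{u, v} |u. {u, v} \<in> F} = {e \<in> F. v \<in> e}"
    proof safe
      fix e assume e: "e \<in> F" "v \<in> e"
      then have "e \<in> edges G" using F_edges' by auto
      then obtain a b where "e = {a, b}" by (rule simple_graph_edge[OF graph(1)])
      then show "\<exists>u. e = {u, v} \<and> {u, v} \<in> F" using e by (auto simp: insert_commute)
    qed
    then show ?thesis using v f(2) by (auto simp: place_simps branches')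
  qed
  show ?thesis
    unfolding solve_def solve_time_def Let_def
    apply (rule runs_bind_eq[OF st, where t' = "1 + (2 * h + 1) + L * (?T + ?t)"])
     apply (rule runs_bind_eq[OF 1, where t' = "(2 * h + 1) + L * (?T + ?t)"])
      apply (rule runs_bind_eq[OF 2, where t' = "L * (?T + ?t)"])
       apply (rule runs_bind_Ret[OF f(1)[unfolded j_def]])
       apply (simp only: out)
      apply simp_all
    done
qed

end

subsection \<open>The algorithm\<close>

definition bitlen :: "nat \<Rightarrow> nat" where
  "bitlen x = (LEAST q. x < 2 ^ q)"

lemma less_bitlen: "x < 2 ^ bitlen x"
  unfolding bitlen_def by (rule LeastI[of _ x]) (rule less_exp)

lemma bitlen_le: "x < 2 ^ q \<Longrightarrow> bitlen x \<le> q"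
  unfolding bitlen_def by (rule Least_le)

text \<open>Two bounds on the radius of a random colour class when \<open>K\<close> colours are used: \<open>n / K\<close> up to
  logarithmic factors, from the minimum degree, and a power of \<open>K\<close>, from a tree of height \<open>h\<close>.\<close>

definition radius_bound :: "nat \<Rightarrow> nat \<Rightarrow> nat \<Rightarrow> nat" where
  "radius_bound n h K = min (15 * bitlen n * (n div K + 1)) ((8 * K * (bitlen n + h) * bitlen n + 2) ^ h)"

text \<open>Up to logarithmic factors these are the rounds for growing the fragments, for sending
  the items of one colour, and for crossing a colour class.\<close>

definition cost :: "nat \<Rightarrow> nat \<Rightarrow> nat \<times> nat \<Rightarrow> nat" where
  "cost n h = (\<lambda>(K, S). (S + 1) + n div (K * (S + 1)) + radius_bound n h K)"

text \<open>The four logarithms: one because \<open>a\<close> is only an approximation, one for the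
  number of sampling rounds, one for the union bound, and one that outgrows every constant. If the
  quotient is 0, a single colour remains.\<close>

definition max_colours :: "nat \<Rightarrow> nat \<Rightarrow> nat" where
  "max_colours n a = max 1 (min n (a div bitlen n ^ 4))"

definition admissible :: "nat \<Rightarrow> nat \<Rightarrow> nat \<times> nat \<Rightarrow> bool" where
  "admissible n a = (\<lambda>(K, S). 1 \<le> K \<and> K \<le> max_colours n a)"

definition best_params :: "nat \<Rightarrow> nat \<Rightarrow> nat \<Rightarrow> nat \<times> nat" where
  "best_params n h a = arg_min (cost n h) (admissible n a)"

lemma best_params:
  shows "admissible n a (best_params n h a)"
    and "admissible n a p \<Longrightarrow> cost n h (best_params n h a) \<le> cost n h p"
proof -
  have "admissible n a (1, 0)" by (simp add: admissible_def max_colours_def)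
  from arg_min_nat_lemma[of "admissible n a", OF this]
  show "admissible n a (best_params n h a)"
    and "admissible n a p \<Longrightarrow> cost n h (best_params n h a) \<le> cost n h p"
    unfolding best_params_def by blast+
qed

definition num_colours :: "nat \<Rightarrow> nat \<Rightarrow> nat \<Rightarrow> nat" where
  "num_colours n h a = fst (best_params n h a)"

text \<open>The largest identifier is found as a minimum of negated ones. Its bit length, increased
  by one to be positive, tells how many bits the local phases must consider.\<close>

definition search_prog :: "local_input \<Rightarrow> nat \<Rightarrow> (place \<times> nat \<times> nat) option prog" where
  "search_prog i d = (let v = own_id i; N = {u. incident i u \<noteq> None} in
     elect v N d \<rhd> (\<lambda>r. case r of None \<Rightarrow> Ret None | Some l \<Rightarrow>
     find_place v N l d \<rhd> (\<lambda>P. total P 1 \<rhd> (\<lambda>n. fmin (2 * d) N [- int v] \<rhd> (\<lambda>m.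
     Ret (Some (P, nat n, bitlen (nat (- hd m)) + 1)))))))"

text \<open>The model grants a node one natural number as coin in each round, so all the colours
  that a node draws are packed into a single number.\<close>

definition encode_colours :: "nat set \<Rightarrow> (nat \<Rightarrow> nat) \<Rightarrow> nat" where
  "encode_colours A f = to_nat (map (\<lambda>u. (u, f u)) (sorted_list_of_set A))"

definition drawn :: "nat \<Rightarrow> nat \<Rightarrow> nat" where
  "drawn r u = the (map_of (from_nat r :: (nat \<times> nat) list) u)"

lemma drawn_encode: "finite A \<Longrightarrow> u \<in> A \<Longrightarrow> drawn (encode_colours A f) u = f u"
  by (simp add: drawn_def encode_colours_def map_of_map_restrict)

text \<open>An edge is coloured by its smaller end, which later informs the other one. Thus each
  edge has one colour although the coins are private.\<close>

definition colour_seed :: "nat \<Rightarrow> nat set \<Rightarrow> nat \<Rightarrow> nat pmf" where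
  "colour_seed v N K = map_pmf (encode_colours {u \<in> N. v < u})
     (Pi_pmf {u \<in> N. v < u} 0 (\<lambda>_. pmf_of_set {..<K}))"

definition seed_prog :: "local_input \<Rightarrow> place \<times> nat \<times> nat \<Rightarrow> nat pmf" where
  "seed_prog i = (\<lambda>(P, n, Q). colour_seed (me P) (nb P) (num_colours n (height P) (advice i)))"

text \<open>The tokens of the root reach all nodes within \<open>d + 1\<close> rounds if all colour classes have radius at
  most \<open>d\<close>. If some node misses one, the graph is treated as a single class, which is slow but
  correct.\<close>

definition work_prog :: "local_input \<Rightarrow> place \<times> nat \<times> nat \<Rightarrow> nat \<Rightarrow> nat set set prog" where
  "work_prog i = (\<lambda>(P, n, Q) c.
     let h = height P; K = num_colours n h (advice i); S = snd (best_params n h (advice i));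
       d = radius_bound n h K; L = bitlen n; w = (\<lambda>u. the (incident i u));
       tokens = (\<lambda>j. (j, [0])) ` {..<K} in
     exch (\<lambda>u. [if me P < u then int (drawn c u) else 0]) \<rhd> (\<lambda>r.
     let col = (\<lambda>u. if me P < u then drawn c u else nat (hd (r u))) in
     gossip (d + 1) (nb P) col (if me P = tree_root P then tokens else {}) \<rhd> (\<lambda>I.
     fmin (2 * h) (nb P) (if \<not> tokens \<subseteq> I then [0] else [1]) \<rhd> (\<lambda>z.
     if z = [1] then solve P w n L Q S K (2 * (d + 1)) col
     else solve P w n L Q 0 1 (2 * h) (\<lambda>_. 0)))))"

global_interpretation mst: three_stage search_prog seed_prog work_prog
  defines mst_algorithm = mst.algorithm .

definition edge_colour :: "(nat \<Rightarrow> nat) \<Rightarrow> nat set \<Rightarrow> nat" where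
  "edge_colour \<omega> e = drawn (\<omega> (Min e)) (Max e)"

definition colour_seeds :: "wgraph \<Rightarrow> nat \<Rightarrow> (nat \<Rightarrow> nat) pmf" where
  "colour_seeds G K = Pi_pmf (nodes G) 0 (\<lambda>v. colour_seed v (nbrs G v) K)"

lemma num_colours_bounds: "0 < num_colours n h a" "num_colours n h a \<le> max_colours n a"
  using best_params(1)[of n a h] by (auto simp: admissible_def num_colours_def split: prod.splits)

section \<open>Rounds and success of the individual stages\<close>

context network
begin

definition ecc :: nat where
  "ecc = (LEAST d. nodes G \<subseteq> hop_ball (edges G) d leader)"

lemma ecc_le: "nodes G \<subseteq> hop_ball (edges G) d leader \<Longrightarrow> ecc \<le> d"
  unfolding ecc_def by (rule Least_le)

lemma cover_size: "nodes G \<subseteq> hop_ball (edges G) (size_of G) leader"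
proof -
  have comp: "component (edges G) leader = nodes G"
    using graph(2) leader_node component_nodes(1)[OF order_refl leader_node]
    by (auto simp: connects_def component_def)
  have "\<not> size_of G < card (hop_ball (edges G) (size_of G) leader)"
    using hop_ball_nodes[OF order_refl leader_node] finite_nodes by (simp add: card_mono not_less)
  then show ?thesis
    using hop_ball_growth[of "edges G" leader "size_of G"] comp finite_nodes by simp
qed

lemma cover_ecc: "nodes G \<subseteq> hop_ball (edges G) ecc leader"
  unfolding ecc_def by (rule LeastI) (rule cover_size)

lemma bitlen_pos: "0 < bitlen (size_of G)"
proof (rule ccontr)
  assume "\<not> 0 < bitlen (size_of G)"
  then have "size_of G < 1" using less_bitlen[of "size_of G"] by simp
  then show False using finite_nodes nodes_nonempty by (simp add: card_gt_0_iff)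
qed

definition id_bits :: nat where
  "id_bits = bitlen (Max (nodes G)) + 1"

lemma less_id_bits: "v \<in> nodes G \<Longrightarrow> v < 2 ^ id_bits"
proof -
  assume "v \<in> nodes G"
  then have "v \<le> Max (nodes G)" using finite_nodes by simp
  also have "\<dots> < 2 ^ bitlen (Max (nodes G))" by (rule less_bitlen)
  also have "\<dots> \<le> 2 ^ id_bits" by (simp add: id_bits_def)
  finally show ?thesis .
qed

lemma input_of_simps:
  "own_id (input_of G a v) = v" "{u. incident (input_of G a v) u \<noteq> None} = nbrs G v"
  "advice (input_of G a v) = a" "u \<in> nbrs G v \<Longrightarrow> the (incident (input_of G a v) u) = weight G {u, v}"
  by (auto simp: input_of_def nbrs_def)

lemma runs_search_fails:
  assumes "d < ecc"
  shows "runs G X (3 * d + 1) (\<lambda>v. search_prog (input_of G a v) d) (\<lambda>_. None)"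
proof -
  have "\<not> nodes G \<subseteq> hop_ball (edges G) d leader" using ecc_le assms by force
  then show ?thesis
    unfolding search_prog_def input_of_simps Let_def by (intro runs_bind_Ret[OF runs_elect]) simp
qed

text \<open>The rounds are 3 * ecc + 1 for the election, ecc + 1 for the tree, and 2 * ecc each for
  the number of nodes and the largest identifier.\<close>

lemma runs_search_succeeds:
  "\<exists>pl. placed ecc pl \<and> runs G X (8 * ecc + 2) (\<lambda>v. search_prog (input_of G a v) ecc)
    (\<lambda>v. Some (pl v, size_of G, id_bits))"
proof -
  obtain pl where pl: "runs G X (ecc + 1) (\<lambda>v. find_place v (nbrs G v) leader ecc) pl" "placed ecc pl"
    using runs_find_place[OF cover_ecc] by blast
  interpret tree_network G X ecc pl by unfold_locales (rule pl(2))
  have tot: "runs G X (2 * ecc) (\<lambda>v. total (pl v) 1) (\<lambda>_. int (size_of G))"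
    using runs_total[of "\<lambda>_. 1"] X_card by simp
  have mx: "Min ((\<lambda>v. [- int v]) ` hop_ball (edges G) (2 * ecc) v) = [- int (Max (nodes G))]" if v: "v \<in> nodes G" for v
  proof -
    have B: "hop_ball (edges G) (2 * ecc) v = nodes G"
      using cover2[OF v] hop_ball_nodes(1)[OF order_refl v] by blast
    have "Max (nodes G) \<in> nodes G" using finite_nodes nodes_nonempty by simp
    moreover have "v \<le> Max (nodes G)" if "v \<in> nodes G" for v using finite_nodes that by simp
    ultimately show ?thesis unfolding B using finite_nodes by (intro Min_eqI) (auto simp: not_less[symmetric] le_less)
  qed
  have "runs G X (8 * ecc + 2) (\<lambda>v. search_prog (input_of G a v) ecc)
    (\<lambda>v. Some (pl v, size_of G, id_bits))"
    unfolding search_prog_def input_of_simps Let_def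
  proof (rule runs_bind_eq[OF runs_elect, where t' = "5 * ecc + 1"])
    have "runs G X (5 * ecc + 1) (\<lambda>v. find_place v (nbrs G v) leader ecc \<rhd>
        (\<lambda>P. total P 1 \<rhd> (\<lambda>n. fmin (2 * ecc) (nbrs G v) [- int v] \<rhd> (\<lambda>m.
     Ret (Some (P, nat n, bitlen (nat (- hd m)) + 1)))))) (\<lambda>v. Some (pl v, size_of G, id_bits))"
    proof (rule runs_bind_eq[OF pl(1), where t' = "4 * ecc"], rule runs_bind_eq[OF tot, where t' = "2 * ecc"],
        rule runs_bind_Ret[OF runs_fmin_nbrs])
      show "short X [- int v]" if "v \<in> nodes G" for v using X_nodes[OF that] by (simp add: short_def)
      show "Ret (Some (pl v, nat (int (size_of G)), bitlen (nat (- hd (Min ((\<lambda>v. [- int v]) `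
          hop_ball (edges G) (2 * ecc) v)))) + 1)) = Ret (Some (pl v, size_of G, id_bits))" if "v \<in> nodes G" for v
        using mx[OF that] by (simp add: id_bits_def)
    qed simp_all
    then show "runs G X (5 * ecc + 1) (\<lambda>v. case if nodes G \<subseteq> hop_ball (edges G) ecc leader then Some leader else None of
        None \<Rightarrow> Ret None
      | Some l \<Rightarrow> find_place v (nbrs G v) l ecc \<rhd> (\<lambda>P. total P 1 \<rhd> (\<lambda>n. fmin (2 * ecc) (nbrs G v) [- int v] \<rhd> (\<lambda>m.
     Ret (Some (P, nat n, bitlen (nat (- hd m)) + 1))))))
     (\<lambda>v. Some (pl v, size_of G, id_bits))"
      using cover_ecc by simp
  qed simp
  then show ?thesis using pl(2) by blast
qed

lemma edge_colour_col:
  assumes "v \<in> nodes G" "u \<in> nbrs G v"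
  shows "(if v < u then drawn (\<omega> v) u else nat (hd [if u < v then int (drawn (\<omega> u) v) else 0])) = edge_colour \<omega> {u, v}"
proof -
  have "u \<noteq> v" using assms(2) edge_irrefl[OF graph(1)] by (auto simp: nbrs_def)
  then show ?thesis by (auto simp: edge_colour_def min_def max_def)
qed

lemma drawn_less:
  assumes "\<omega> v \<in> set_pmf (colour_seed v (nbrs G v) K)" "u \<in> nbrs G v" "v < u" "0 < K"
  shows "drawn (\<omega> v) u < K"
proof -
  let ?A = "{u \<in> nbrs G v. v < u}"
  have fin: "finite ?A" using finite_nbrs by simp
  obtain f where f: "\<omega> v = encode_colours ?A f" "f \<in> set_pmf (Pi_pmf ?A 0 (\<lambda>_. pmf_of_set {..<K}))"
    using assms(1) by (auto simp: colour_seed_def)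
  have "{..<K} \<noteq> {}" using assms(4) by auto
  then have "f u < K" using f(2) fin assms(2,3) by (auto simp: set_Pi_pmf PiE_dflt_def set_pmf_of_set)
  then show ?thesis using f(1) fin assms(2,3) by (simp add: drawn_encode)
qed

definition small_classes :: "nat \<Rightarrow> nat \<Rightarrow> (nat \<Rightarrow> nat) set" where
  "small_classes K d = {\<omega>. \<forall>j < K. nodes G \<subseteq> hop_ball {e \<in> edges G. edge_colour \<omega> e = j} d leader}"

definition t_good :: "nat \<Rightarrow> nat" where
  "t_good a = (let n = size_of G; K = num_colours n ecc a; S = snd (best_params n ecc a); d = radius_bound n ecc K in
     1 + (d + 1) + 2 * ecc + solve_time ecc n (bitlen n) id_bits S K (2 * (d + 1)))"

definition t_bad :: "nat \<Rightarrow> nat" where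
  "t_bad a = (let n = size_of G; d = radius_bound n ecc (num_colours n ecc a) in
     1 + (d + 1) + 2 * ecc + solve_time ecc n (bitlen n) id_bits 0 1 (2 * ecc))"

text \<open>The result is the tree for every possible \<open>\<omega>\<close>; chance decides only
  between two running times, and the slow one can occur only if some class is too wide.\<close>

lemma runs_work:
  assumes "placed ecc pl"
    and \<omega>: "\<And>v. v \<in> nodes G \<Longrightarrow> \<omega> v \<in> set_pmf (colour_seed v (nbrs G v) (num_colours (size_of G) ecc a))"
  shows "\<exists>t. runs G X t (\<lambda>v. work_prog (input_of G a v) (pl v, size_of G, id_bits) (\<omega> v)) (\<lambda>v. {e \<in> mst_edges G. v \<in> e}) \<and>
    (t = t_good a \<or> t = t_bad a \<and> \<omega> \<notin> small_classes (num_colours (size_of G) ecc a)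
      (radius_bound (size_of G) ecc (num_colours (size_of G) ecc a)))"
proof -
  define n where "n = size_of G"
  define K where "K = num_colours n ecc a"
  define S where "S = snd (best_params n ecc a)"
  define d where "d = radius_bound n ecc K"
  define tokens where "tokens = (\<lambda>j. (j, [0 :: int])) ` {..<K}"
  define items where "items v = (if v = leader then tokens else {})" for v
  have K: "0 < K" unfolding K_def by (rule num_colours_bounds)
  have "0 < n" unfolding n_def using finite_nodes nodes_nonempty by (simp add: card_gt_0_iff)
  then have Kn: "K \<le> n" using num_colours_bounds(2)[of n ecc a] by (simp add: K_def max_colours_def)
  interpret tree_network G X ecc pl by unfold_locales (rule assms(1))
  interpret gossiping G X "edge_colour \<omega>" items
    by unfold_locales (auto simp: items_def tokens_def split: if_splits)
  interpret local_stage G X ecc pl S id_bits by unfold_locales (simp add: id_bits_def, rule less_id_bits)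
  define msg where "msg v u = [if v < u then int (drawn (\<omega> v) u) else 0]" for v u
  define col where "col v u = (if v < u then drawn (\<omega> v) u else nat (hd (received G msg v u)))" for v u
  have col: "col v u = edge_colour \<omega> {u, v}" if "v \<in> nodes G" "u \<in> nbrs G v" for u v
    using edge_colour_col[OF that, of \<omega>] received_nbr[OF that(2), of msg] by (simp only: col_def msg_def)
  have 1: "runs G X 1 (\<lambda>v. exch (msg v)) (received G msg)"
  proof (rule runs_exch)
    fix u v assume v: "{u, v} \<in> edges G" "v \<in> nodes G"
    have "int (drawn (\<omega> v) u) \<le> X" if "v < u"
    proof -
      have "drawn (\<omega> v) u < K"
        using \<omega>[OF v(2)] v(1) that K by (intro drawn_less) (auto simp: nbrs_def K_def n_def)
      then show ?thesis using Kn X_card by (simp add: n_def)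
    qed
    then show "short X (msg v u)" by (simp add: msg_def short_def)
  qed
  have 2: "runs G X (d + 1) (\<lambda>v. gossip (d + 1) (nb (pl v)) (col v) (if me (pl v) = tree_root (pl v) then tokens else {})) (known (d + 1))"
    by (rule runs_cong[OF runs_gossip[where col = col]]) (auto simp: col place_simps items_def)
  define ok where "ok \<longleftrightarrow> (\<forall>v \<in> nodes G. tokens \<subseteq> known (d + 1) v)"
  have flag: "Min ((\<lambda>v. if \<not> tokens \<subseteq> known (d + 1) v then [0] else [1 :: int]) ` hop_ball (edges G) (2 * ecc) v) =
      (if ok then [1] else [0])" if v: "v \<in> nodes G" for v
  proof -
    have "hop_ball (edges G) (2 * ecc) v = nodes G"
      using cover2[OF v] hop_ball_nodes(1)[OF order_refl v] by blast
    then show ?thesis unfolding Min_hop_ball_flag[OF order_refl v] ok_def by auto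
  qed
  have 3: "runs G X (2 * ecc) (\<lambda>v. fmin (2 * ecc) (nb (pl v)) (if \<not> tokens \<subseteq> known (d + 1) v then [0] else [1]))
      (\<lambda>_. if ok then [1] else [0])"
    by (rule runs_cong[OF runs_fmin_nbrs[where x = "\<lambda>v. if \<not> tokens \<subseteq> known (d + 1) v then [0] else [1]"]])
      (simp_all only: place_simps flag, simp)
  \<comment> \<open>A passed test is a proof: a token of colour j can have reached v only over at
    most d + 1 edges of this colour. Two nodes of a class are then within 2 * (d + 1) of each other
    through the leader.\<close>
  have token_ball: "nodes G \<subseteq> hop_ball {e \<in> edges G. edge_colour \<omega> e = j} (d + 1) leader" if "ok" "j < K" for j
  proof
    fix v assume v: "v \<in> nodes G"
    then have "(j, [0]) \<in> known (d + 1) v" using that by (auto simp: ok_def tokens_def)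
    from known_sound[OF v this] show "v \<in> hop_ball {e \<in> edges G. edge_colour \<omega> e = j} (d + 1) leader"
      by (auto simp: items_def colour_class_def split: if_splits)
  qed
  \<comment> \<open>Conversely, a class of radius \<open>d\<close> transports its only token in
    time; the count of one item accounts for the additional round.\<close>
  have ok: "ok" if "\<omega> \<in> small_classes K d"
    unfolding ok_def
  proof (intro ballI subsetI)
    fix v x assume v: "v \<in> nodes G" and "x \<in> tokens"
    then obtain j where j: "x = (j, [0])" "j < K" by (auto simp: tokens_def)
    have "items_of j \<subseteq> {[0]}" by (auto simp: items_def tokens_def split: if_splits)
    then have "finite (items_of j)" "card (items_of j) \<le> 1"
      using finite_subset card_mono[of "{[0 :: int]}" "items_of j"] by auto
    moreover have "(j, [0]) \<in> items leader" using j by (auto simp: items_def tokens_def)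
    moreover have "v \<in> hop_ball (colour_class j) d leader"
      using that j v by (auto simp: small_classes_def colour_class_def)
    ultimately show "x \<in> known (d + 1) v"
      using known_complete[of j 1 d "d + 1" "[0]" leader v] leader_node j by simp
  qed
  let ?w = "\<lambda>v u. the (incident (input_of G a v) u)"
  have w: "?w v u = weight G {u, v}" if "v \<in> nodes G" "u \<in> nbrs G v" for u v
    using that by (simp add: input_of_simps)
  define ts where "ts = (if ok then solve_time ecc n (bitlen n) id_bits S K (2 * (d + 1))
    else solve_time ecc n (bitlen n) id_bits 0 1 (2 * ecc))"
  have L: "size_of G < 2 ^ bitlen n" unfolding n_def by (rule less_bitlen)
  have 4: "runs G X ts (\<lambda>v. if (if ok then [1] else [0 :: int]) = [1]
      then solve (pl v) (?w v) n (bitlen n) id_bits S K (2 * (d + 1)) (col v)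
      else solve (pl v) (?w v) n (bitlen n) id_bits 0 1 (2 * ecc) (\<lambda>_. 0)) (\<lambda>v. {e \<in> mst_edges G. v \<in> e})"
  proof (cases ok)
    case True
    have classes: "v \<in> hop_ball {e \<in> edges G. edge_colour \<omega> e = j} (2 * (d + 1)) u"
      if "j < K" "u \<in> nodes G" "v \<in> nodes G" for j u v
    proof -
      have "leader \<in> hop_ball {e \<in> edges G. edge_colour \<omega> e = j} (d + 1) u"
        using token_ball[OF True that(1)] that(2) hop_ball_sym by blast
      moreover have "v \<in> hop_ball {e \<in> edges G. edge_colour \<omega> e = j} (d + 1) leader"
        using token_ball[OF True that(1)] that(3) by blast
      ultimately show ?thesis unfolding mult_2 by (rule hop_ball_trans)
    qed
    show ?thesis
      using runs_solve[OF w col L K classes] True by (simp add: ts_def n_def)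
  next
    case False
    interpret fb: local_stage G X ecc pl 0 id_bits by unfold_locales (simp add: id_bits_def, rule less_id_bits)
    have "runs G X (solve_time ecc (size_of G) (bitlen n) id_bits 0 1 (2 * ecc))
      (\<lambda>v. solve (pl v) (?w v) (size_of G) (bitlen n) id_bits 0 1 (2 * ecc) (\<lambda>_. 0)) (\<lambda>v. {e \<in> mst_edges G. v \<in> e})"
      using cover2 by (intro fb.runs_solve[where colour = "\<lambda>_. 0"] w L) auto
    then show ?thesis using False by (simp add: ts_def n_def)
  qed
  have "runs G X (1 + (d + 1) + 2 * ecc + ts) (\<lambda>v.
     exch (msg v) \<rhd> (\<lambda>r.
     gossip (d + 1) (nb (pl v)) (\<lambda>u. if v < u then drawn (\<omega> v) u else nat (hd (r u)))
       (if me (pl v) = tree_root (pl v) then tokens else {}) \<rhd> (\<lambda>I.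
     fmin (2 * ecc) (nb (pl v)) (if \<not> tokens \<subseteq> I then [0] else [1]) \<rhd> (\<lambda>z.
     if z = [1] then solve (pl v) (?w v) n (bitlen n) id_bits S K (2 * (d + 1))
         (\<lambda>u. if v < u then drawn (\<omega> v) u else nat (hd (r u)))
     else solve (pl v) (?w v) n (bitlen n) id_bits 0 1 (2 * ecc) (\<lambda>_. 0))))) (\<lambda>v. {e \<in> mst_edges G. v \<in> e})"
    apply (rule runs_bind_eq[OF 1, where t' = "d + 1 + 2 * ecc + ts"])
     apply (rule runs_bind_eq[OF 2[unfolded col_def[abs_def]], where t' = "2 * ecc + ts"])
      apply (rule runs_bind_eq[OF 3, where t' = ts])
       apply (rule 4[unfolded col_def[abs_def]])
      apply simp_all
    done
  then have "runs G X (1 + (d + 1) + 2 * ecc + ts)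
      (\<lambda>v. work_prog (input_of G a v) (pl v, size_of G, id_bits) (\<omega> v)) (\<lambda>v. {e \<in> mst_edges G. v \<in> e})"
    by (rule runs_cong) (simp_all add: work_prog_def Let_def place_simps input_of_simps
        n_def K_def S_def d_def tokens_def msg_def[abs_def] leader_node cong: if_cong)
  moreover have "1 + (d + 1) + 2 * ecc + ts = t_good a \<or>
      1 + (d + 1) + 2 * ecc + ts = t_bad a \<and> \<omega> \<notin> small_classes K d"
    using ok by (cases ok) (auto simp: ts_def t_good_def t_bad_def n_def K_def S_def d_def Let_def)
  ultimately show ?thesis unfolding K_def d_def n_def by blast
qed

definition t_prelim :: nat where
  "t_prelim = (\<Sum>d\<le>ecc. if d < ecc then 3 * d + 1 else 8 * ecc + 2)"

text \<open>The probabilistic analysis enters through the second claim only. The last one holds with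
  certainty and is meant for graphs that are too small for that analysis.\<close>

lemma mst_algorithm_run:
  fixes a :: nat
  assumes k: "2 * X + 2 \<le> 2 ^ k"
  defines "K \<equiv> num_colours (size_of G) ecc a"
  defines "d \<equiv> radius_bound (size_of G) ecc K"
  shows "H \<in> set_pmf (run mst_algorithm G a t) \<Longrightarrow> v \<in> nodes G \<Longrightarrow> (r, msgs) \<in> set (H v) \<Longrightarrow>
      length (msgs u) \<le> 8 * (2 * k + 1)"
    and "measure_pmf.prob (colour_seeds G K) (small_classes K d) \<le>
      measure_pmf.prob (run mst_algorithm G a (Suc t_prelim + t_good a)) {H. mst_computed mst_algorithm G a H}"
    and "measure_pmf.prob (run mst_algorithm G a (Suc t_prelim + max (t_good a) (t_bad a)))
      {H. mst_computed mst_algorithm G a H} = 1"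
proof -
  obtain pl where pl: "placed ecc pl" "runs G X (8 * ecc + 2) (\<lambda>v. search_prog (input_of G a v) ecc)
    (\<lambda>v. Some (pl v, size_of G, id_bits))" using runs_search_succeeds by blast
  interpret tree_network G X ecc pl by unfold_locales (rule pl(1))
  define W where "W \<omega> t \<longleftrightarrow> runs G X t (\<lambda>v. work_prog (input_of G a v) (pl v, size_of G, id_bits) (\<omega> v))
      (\<lambda>v. {e \<in> mst_edges G. v \<in> e}) \<and> (t = t_good a \<or> t = t_bad a \<and> \<omega> \<notin> small_classes K d)" for \<omega> t
  define t2 where "t2 \<omega> = (SOME t. W \<omega> t)" for \<omega>
  have seed: "seed_prog (input_of G a v) (pl v, size_of G, id_bits) = colour_seed v (nbrs G v) K" if "v \<in> nodes G" for v
    using that by (simp add: seed_prog_def place_simps input_of_simps K_def)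
  have W: "W \<omega> (t2 \<omega>)"
    if \<omega>: "\<And>v. v \<in> nodes G \<Longrightarrow> \<omega> v \<in> set_pmf (seed_prog (input_of G a v) (pl v, size_of G, id_bits))" for \<omega>
  proof -
    have "\<exists>t. W \<omega> t"
      unfolding W_def K_def d_def by (rule runs_work[OF pl(1)]) (use \<omega> seed in \<open>auto simp: K_def\<close>)
    then show ?thesis unfolding t2_def by (rule someI_ex)
  qed
  interpret run: three_stage_run search_prog seed_prog work_prog G a X k ecc
    "\<lambda>d. if d < ecc then 3 * d + 1 else 8 * ecc + 2" "\<lambda>v. (pl v, size_of G, id_bits)" t2 "max (t_good a) (t_bad a)"
  proof
    show "t2 \<omega> \<le> max (t_good a) (t_bad a)"
      if "\<And>v. v \<in> nodes G \<Longrightarrow> \<omega> v \<in> set_pmf (seed_prog (input_of G a v) (pl v, size_of G, id_bits))" for \<omega>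
      using W[OF that] by (auto simp: W_def)
    show "runs G X (t2 \<omega>) (\<lambda>v. work_prog (input_of G a v) (pl v, size_of G, id_bits) (\<omega> v)) (\<lambda>v. {e \<in> mst_edges G. v \<in> e})"
      if "\<And>v. v \<in> nodes G \<Longrightarrow> \<omega> v \<in> set_pmf (seed_prog (input_of G a v) (pl v, size_of G, id_bits))" for \<omega>
      using W[OF that] by (auto simp: W_def)
  qed (use graph k runs_search_fails pl(2) in auto)
  have seeds: "run.seeds = colour_seeds G K"
    unfolding run.seeds_def colour_seeds_def using seed by (intro Pi_pmf_cong finite_nodes) auto
  have ts: "run.t_search = t_prelim" by (simp add: run.t_search_def t_prelim_def)
  note [simp] = mst_algorithm_def[symmetric]
  show "length (msgs u) \<le> 8 * (2 * k + 1)"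
    if "H \<in> set_pmf (run mst_algorithm G a t)" "v \<in> nodes G" "(r, msgs) \<in> set (H v)"
    using run.run_within_bandwidth[of H t] that by (fastforce simp: run.within_bandwidth_def)
  have t2: "W \<omega> (t2 \<omega>)" if "\<omega> \<in> set_pmf (colour_seeds G K)" for \<omega>
    by (rule W, rule run.seeds_component) (use that seeds in auto)
  show "measure_pmf.prob (colour_seeds G K) (small_classes K d) \<le>
      measure_pmf.prob (run mst_algorithm G a (Suc t_prelim + t_good a)) {H. mst_computed mst_algorithm G a H}"
    by (rule run.prob_mst_computed[of "small_classes K d" "t_good a", unfolded seeds ts])
      (use t2 in \<open>fastforce simp: W_def\<close>)
  have "measure_pmf.prob (colour_seeds G K) UNIV \<le>
      measure_pmf.prob (run mst_algorithm G a (Suc t_prelim + max (t_good a) (t_bad a))) {H. mst_computed mst_algorithm G a H}"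
    by (rule run.prob_mst_computed[of UNIV "max (t_good a) (t_bad a)", unfolded seeds ts])
      (use t2 in \<open>fastforce simp: W_def\<close>)
  then show "measure_pmf.prob (run mst_algorithm G a (Suc t_prelim + max (t_good a) (t_bad a)))
      {H. mst_computed mst_algorithm G a H} = 1"
    using measure_pmf.prob_le_1[of "run mst_algorithm G a (Suc t_prelim + max (t_good a) (t_bad a))"]
    by (intro antisym) (auto simp: measure_pmf.prob_space)
qed

end

subsection \<open>Random colour classes\<close>

definition random_set :: "real \<Rightarrow> 'a set \<Rightarrow> 'a set pmf" where
  "random_set p A = map_pmf (\<lambda>b. {x \<in> A. b x}) (Pi_pmf A False (\<lambda>_. bernoulli_pmf p))"

lemma set_random_set: "X \<in> set_pmf (random_set p A) \<Longrightarrow> X \<subseteq> A"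
  by (auto simp: random_set_def)

lemma random_set_empty: "random_set p {} = return_pmf {}"
  by (simp add: random_set_def)

lemma random_set_insert:
  assumes "finite A" "x \<notin> A"
  shows "random_set p (insert x A) =
    bind_pmf (bernoulli_pmf p) (\<lambda>b. map_pmf (\<lambda>X. if b then insert x X else X) (random_set p A))"
proof -
  have "{y. (y = x \<or> y \<in> A) \<and> (f(x := b)) y} = (if b then insert x {y \<in> A. f y} else {y \<in> A. f y})" for b f
    using assms(2) by auto
  then show ?thesis
    using assms by (simp add: random_set_def Pi_pmf_insert' map_bind_pmf map_pmf_comp o_def map_pmf_def[symmetric]
        bind_return_pmf bind_assoc_pmf)
qed

lemma random_set_Un:
  assumes "finite A" "finite B" "A \<inter> B = {}"
  shows "random_set p (A \<union> B) = bind_pmf (random_set p A) (\<lambda>X. map_pmf (\<lambda>Y. X \<union> Y) (random_set p B))"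
  using assms(1,3)
proof (induction rule: finite_induct)
  case empty
  show ?case
    by (simp only: random_set_empty Un_empty_left bind_return_pmf, rule map_pmf_idI[symmetric]) simp
next
  case (insert x A)
  have "random_set p (insert x A \<union> B) =
      bind_pmf (bernoulli_pmf p) (\<lambda>b. map_pmf (\<lambda>X. if b then insert x X else X) (random_set p (A \<union> B)))"
    using insert assms(2) by (subst Un_insert_left, intro random_set_insert) auto
  also have "random_set p (A \<union> B) = bind_pmf (random_set p A) (\<lambda>X. map_pmf (\<lambda>Y. X \<union> Y) (random_set p B))"
    using insert by auto
  moreover have "(\<lambda>Y. (if b then insert x X else X) \<union> Y) = (\<lambda>Y. if b then insert x (X \<union> Y) else X \<union> Y)" for b X
    by auto
  ultimately show ?case
    using insert(1,2) by (simp add: random_set_insert map_bind_pmf bind_assoc_pmf bind_map_pmf map_pmf_comp)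
qed

lemma random_set_image:
  assumes "finite A" "inj_on h A"
  shows "random_set p (h ` A) = map_pmf ((`) h) (random_set p A)"
  using assms
proof (induction rule: finite_induct)
  case empty
  then show ?case by (simp add: random_set_empty)
next
  case (insert x A)
  then have "h x \<notin> h ` A" by auto
  then show ?case
    using insert
    by (simp add: random_set_insert map_bind_pmf map_pmf_comp if_distrib[of "\<lambda>X. h ` X"] cong: if_cong)
qed

text \<open>Coins of different nodes are independent, so the random subsets that the nodes draw from
  disjoint blocks make up a random subset of the union. The block of a node will be its edges to
  larger neighbours.\<close>

lemma random_set_blocks:
  assumes "finite V" "\<And>v. v \<in> V \<Longrightarrow> finite (B v)"
    and "\<And>u v. u \<in> V \<Longrightarrow> v \<in> V \<Longrightarrow> u \<noteq> v \<Longrightarrow> B u \<inter> B v = {}"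
    and "\<And>v. v \<in> V \<Longrightarrow> map_pmf (g v) (q v) = random_set p (B v)"
  shows "map_pmf (\<lambda>\<omega>. \<Union>v \<in> V. g v (\<omega> v)) (Pi_pmf V d q) = random_set p (\<Union>v \<in> V. B v)"
  using assms
proof (induction rule: finite_induct)
  case empty
  then show ?case by (simp add: random_set_empty)
next
  case (insert a V)
  have "(\<Union>v \<in> V. g v ((f(a := x)) v)) = (\<Union>v \<in> V. g v (f v))" for f x
    using insert.hyps(2) by (intro SUP_cong) auto
  then have "map_pmf (\<lambda>\<omega>. \<Union>v \<in> insert a V. g v (\<omega> v)) (Pi_pmf (insert a V) d q) =
      bind_pmf (q a) (\<lambda>x. map_pmf (\<lambda>Y. g a x \<union> Y) (map_pmf (\<lambda>\<omega>. \<Union>v \<in> V. g v (\<omega> v)) (Pi_pmf V d q)))"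
    using insert.hyps
    by (simp add: Pi_pmf_insert' map_bind_pmf map_pmf_comp o_def) (simp add: map_pmf_def bind_assoc_pmf bind_return_pmf)
  also have "map_pmf (\<lambda>\<omega>. \<Union>v \<in> V. g v (\<omega> v)) (Pi_pmf V d q) = random_set p (\<Union>v \<in> V. B v)"
    using insert by auto
  also have "bind_pmf (q a) (\<lambda>x. map_pmf (\<lambda>Y. g a x \<union> Y) (random_set p (\<Union>v \<in> V. B v))) =
      bind_pmf (map_pmf (g a) (q a)) (\<lambda>X. map_pmf (\<lambda>Y. X \<union> Y) (random_set p (\<Union>v \<in> V. B v)))"
    by (simp add: bind_map_pmf)
  also have "\<dots> = random_set p (B a \<union> (\<Union>v \<in> V. B v))"
  proof -
    have "finite (B a)" "finite (\<Union>v \<in> V. B v)" using insert.hyps(1) insert.prems(1) by auto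
    moreover have "B a \<inter> B v = {}" if "v \<in> V" for v
      using insert.hyps(2) that by (intro insert.prems(2)) auto
    then have "B a \<inter> (\<Union>v \<in> V. B v) = {}" by blast
    moreover have "map_pmf (g a) (q a) = random_set p (B a)" by (rule insert.prems(3)) simp
    ultimately show ?thesis by (simp only: random_set_Un)
  qed
  finally show ?case by simp
qed

text \<open>Two independent samples both miss an element with probability (1 - p) * (1 - q). This
  allows one sample to be split into successive rounds.\<close>

lemma random_set_or:
  assumes "finite A" "0 \<le> p" "p \<le> 1" "0 \<le> q" "q \<le> 1"
  shows "random_set (1 - (1 - p) * (1 - q)) A =
    bind_pmf (random_set p A) (\<lambda>X. map_pmf (\<lambda>Y. X \<union> Y) (random_set q A))"
proof -
  have ge: "0 \<le> 1 - (1 - p) * (1 - q)" "1 - (1 - p) * (1 - q) \<le> 1"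
    using assms mult_le_one[of "1 - p" "1 - q"] mult_nonneg_nonneg[of "1 - p" "1 - q"] by auto
  have bern: "bernoulli_pmf (1 - (1 - p) * (1 - q)) =
      bind_pmf (bernoulli_pmf p) (\<lambda>a. bind_pmf (bernoulli_pmf q) (\<lambda>b. return_pmf (a \<or> b)))"
  proof (rule pmf_eqI)
    show "pmf (bernoulli_pmf (1 - (1 - p) * (1 - q))) x =
      pmf (bind_pmf (bernoulli_pmf p) (\<lambda>a. bind_pmf (bernoulli_pmf q) (\<lambda>b. return_pmf (a \<or> b)))) x" for x
      using assms ge by (cases x) (auto simp: pmf_bind algebra_simps)
  qed
  have "Pi_pmf A False (\<lambda>_. bernoulli_pmf (1 - (1 - p) * (1 - q))) =
      bind_pmf (Pi_pmf A False (\<lambda>_. bernoulli_pmf p)) (\<lambda>f.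
        Pi_pmf A False (\<lambda>x. bind_pmf (bernoulli_pmf q) (\<lambda>b. return_pmf (f x \<or> b))))"
    unfolding bern by (rule Pi_pmf_bind[OF assms(1)])
  also have "\<dots> = bind_pmf (Pi_pmf A False (\<lambda>_. bernoulli_pmf p)) (\<lambda>f.
      bind_pmf (Pi_pmf A False (\<lambda>_. bernoulli_pmf q)) (\<lambda>g. return_pmf (\<lambda>x. if x \<in> A then f x \<or> g x else False)))"
    by (subst Pi_pmf_bind[OF assms(1), where d' = False]) (simp add: assms(1))
  finally have "random_set (1 - (1 - p) * (1 - q)) A = bind_pmf (Pi_pmf A False (\<lambda>_. bernoulli_pmf p)) (\<lambda>f.
      bind_pmf (Pi_pmf A False (\<lambda>_. bernoulli_pmf q)) (\<lambda>g.
        return_pmf {x \<in> A. if x \<in> A then f x \<or> g x else False}))"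
    by (simp add: random_set_def map_bind_pmf)
  moreover have "{x \<in> A. if x \<in> A then f x \<or> g x else False} = {x \<in> A. f x} \<union> {x \<in> A. g x}" for f g by auto
  ultimately show ?thesis by (simp add: random_set_def bind_map_pmf map_pmf_comp) (simp add: map_pmf_def)
qed

lemma prob_random_set_avoids:
  assumes "finite A" "B \<subseteq> A" "0 \<le> p" "p \<le> 1"
  shows "measure_pmf.prob (random_set p A) {X. X \<inter> B = {}} = (1 - p) ^ card B"
proof -
  have "measure_pmf.prob (random_set p A) {X. X \<inter> B = {}} =
      measure_pmf.prob (Pi_pmf A False (\<lambda>_. bernoulli_pmf p)) {b. {x \<in> A. b x} \<inter> B = {}}"
    by (simp add: random_set_def vimage_def)
  also have "{b. {x \<in> A. b x} \<inter> B = {}} = Pi A (\<lambda>x. if x \<in> B then {False} else UNIV)"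
    using assms(2) by (auto simp: Pi_def)
  also have "measure_pmf.prob (Pi_pmf A False (\<lambda>_. bernoulli_pmf p)) \<dots> =
      (\<Prod>x \<in> A. measure_pmf.prob (bernoulli_pmf p) (if x \<in> B then {False} else UNIV))"
    by (rule measure_Pi_pmf_Pi[OF assms(1)])
  also have "\<dots> = (\<Prod>x \<in> A. if x \<in> B then 1 - p else 1)"
    using assms(3,4) by (intro prod.cong) (auto simp: measure_pmf_single)
  also have "\<dots> = (1 - p) ^ card B"
    using assms(1,2) by (simp add: prod.If_cases Int_absorb1)
  finally show ?thesis .
qed

lemma prob_bind_le:
  assumes "\<And>x. x \<in> set_pmf M \<Longrightarrow> x \<notin> S \<Longrightarrow> measure_pmf.prob (f x) Q \<le> \<epsilon>" "0 \<le> \<epsilon>"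
  shows "measure_pmf.prob (bind_pmf M f) Q \<le> measure_pmf.prob M S + \<epsilon>"
proof -
  have "emeasure (measure_pmf (bind_pmf M f)) Q = (\<integral>\<^sup>+x. emeasure (measure_pmf (f x)) Q \<partial>measure_pmf M)" by simp
  also have "\<dots> \<le> (\<integral>\<^sup>+x. indicator S x + ennreal \<epsilon> \<partial>measure_pmf M)"
  proof (rule nn_integral_mono_AE, unfold AE_measure_pmf_iff, intro ballI)
    fix x assume x: "x \<in> set_pmf M"
    show "emeasure (measure_pmf (f x)) Q \<le> indicator S x + ennreal \<epsilon>"
    proof (cases "x \<in> S")
      case True
      have "emeasure (measure_pmf (f x)) Q \<le> 1" by (rule measure_pmf.emeasure_le_1)
      also have "\<dots> \<le> indicator S x + ennreal \<epsilon>" using True by simp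
      finally show ?thesis .
    next
      case False
      then show ?thesis using assms(1)[OF x] by (simp add: measure_pmf.emeasure_eq_measure ennreal_leI)
    qed
  qed
  also have "\<dots> = emeasure (measure_pmf M) S + ennreal \<epsilon>"
    by (subst nn_integral_add) (auto simp: measure_pmf.emeasure_space_1)
  finally show ?thesis
    using assms(2) by (simp add: measure_pmf.emeasure_eq_measure ennreal_plus[symmetric] del: ennreal_plus)
qed

lemma prob_UN_le:
  assumes "finite I" "S \<subseteq> (\<Union>i \<in> I. B i)" "\<And>i. i \<in> I \<Longrightarrow> measure_pmf.prob M (B i) \<le> \<epsilon>"
  shows "measure_pmf.prob M S \<le> real (card I) * \<epsilon>"
proof -
  have "measure_pmf.prob M S \<le> measure_pmf.prob M (\<Union>i \<in> I. B i)"
    using assms(2) by (intro measure_pmf.finite_measure_mono) auto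
  also have "\<dots> \<le> (\<Sum>i \<in> I. measure_pmf.prob M (B i))"
    using assms(1) by (intro measure_pmf.finite_measure_subadditive_finite) auto
  also have "\<dots> \<le> (\<Sum>i \<in> I. \<epsilon>)" using assms(3) by (rule sum_mono)
  finally show ?thesis by simp
qed

text \<open>Sampling with probability \<open>1 - (1 - p) ^ R\<close> amounts to \<open>R\<close> independent rounds of sampling with
  probability \<open>p\<close>; each round may use what has been sampled before.\<close>

lemma random_rounds:
  fixes Good :: "nat \<Rightarrow> 'a set \<Rightarrow> bool"
  assumes "finite A" "0 \<le> p" "p \<le> 1" "0 \<le> \<epsilon>" "Good 0 {}"
    and step: "\<And>r F. r < R \<Longrightarrow> F \<subseteq> A \<Longrightarrow> Good r F \<Longrightarrow>
      measure_pmf.prob (random_set p A) {X. X \<subseteq> A \<and> \<not> Good (Suc r) (F \<union> X)} \<le> \<epsilon>"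
  shows "measure_pmf.prob (random_set (1 - (1 - p) ^ R) A) {X. \<not> Good R X} \<le> real R * \<epsilon>"
  using step
proof (induction R)
  case 0
  have "bernoulli_pmf 0 = return_pmf False" by (rule pmf_eqI) (simp add: indicator_def split: split_indicator)
  then have "random_set 0 A = return_pmf {}" using assms(1) by (simp add: random_set_def)
  then show ?case using assms(5) by simp
next
  case (Suc R)
  let ?p = "1 - (1 - p) ^ R"
  have p: "0 \<le> ?p" "?p \<le> 1" using assms(2,3) by (auto intro: power_le_one)
  have "1 - (1 - p) ^ Suc R = 1 - (1 - ?p) * (1 - p)" by simp
  then have "random_set (1 - (1 - p) ^ Suc R) A =
      bind_pmf (random_set ?p A) (\<lambda>F. map_pmf (\<lambda>X. F \<union> X) (random_set p A))"
    using random_set_or[OF assms(1) p assms(2,3)] by (simp add: mult.commute)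
  moreover have "measure_pmf.prob (bind_pmf (random_set ?p A) (\<lambda>F. map_pmf (\<lambda>X. F \<union> X) (random_set p A))) {X. \<not> Good (Suc R) X} \<le>
      measure_pmf.prob (random_set ?p A) {X. \<not> Good R X} + \<epsilon>"
  proof (rule prob_bind_le[OF _ assms(4)])
    fix F assume F: "F \<in> set_pmf (random_set ?p A)" "F \<notin> {X. \<not> Good R X}"
    have "measure_pmf.prob (map_pmf (\<lambda>X. F \<union> X) (random_set p A)) {X. \<not> Good (Suc R) X} =
        measure_pmf.prob (random_set p A) {X. \<not> Good (Suc R) (F \<union> X)}" by (simp add: vimage_def)
    also have "\<dots> = measure_pmf.prob (random_set p A) {X. X \<subseteq> A \<and> \<not> Good (Suc R) (F \<union> X)}"
      using set_random_set[of _ p A] by (intro measure_pmf.finite_measure_eq_AE) (auto simp: AE_measure_pmf_iff)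
    also have "\<dots> \<le> \<epsilon>" using Suc.prems[of R F] set_random_set[OF F(1)] F(2) by simp
    finally show "measure_pmf.prob (map_pmf (\<lambda>X. F \<union> X) (random_set p A)) {X. \<not> Good (Suc R) X} \<le> \<epsilon>" .
  qed
  moreover have "measure_pmf.prob (random_set ?p A) {X. \<not> Good R X} \<le> real R * \<epsilon>"
    using Suc by simp
  ultimately show ?case by (simp add: algebra_simps)
qed

lemma random_set_uniform:
  assumes "finite A" "j < K"
  shows "map_pmf (\<lambda>f. {u \<in> A. f u = j}) (Pi_pmf A 0 (\<lambda>_. pmf_of_set {..<K})) = random_set (1 / real K) A"
  using assms(1)
proof (induction rule: finite_induct)
  case empty
  then show ?case by (simp add: random_set_empty)
next
  case (insert x A)
  have ne: "{..<K} \<noteq> {}" using assms(2) by auto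
  have bern: "map_pmf (\<lambda>y. y = j) (pmf_of_set {..<K}) = bernoulli_pmf (1 / real K)"
  proof (rule pmf_eqI)
    fix b
    have "measure_pmf.prob (pmf_of_set {..<K}) {j} = 1 / real K"
      using assms(2) ne by (simp add: measure_pmf_single)
    moreover have "measure_pmf.prob (pmf_of_set {..<K}) {y. y \<noteq> j} = 1 - measure_pmf.prob (pmf_of_set {..<K}) {j}"
      using measure_pmf.prob_compl[of "{j}" "pmf_of_set {..<K}"] by (simp add: Compl_eq_Diff_UNIV[symmetric] Collect_neg_eq)
    ultimately show "pmf (map_pmf (\<lambda>y. y = j) (pmf_of_set {..<K})) b = pmf (bernoulli_pmf (1 / real K)) b"
      using assms(2) by (cases b) (auto simp: pmf_map vimage_def)
  qed
  have "{u. (u = x \<or> u \<in> A) \<and> (f(x := y)) u = j} = (if y = j then insert x {u \<in> A. f u = j} else {u \<in> A. f u = j})" for f y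
    using insert.hyps(2) by auto
  then have "map_pmf (\<lambda>f. {u \<in> insert x A. f u = j}) (Pi_pmf (insert x A) 0 (\<lambda>_. pmf_of_set {..<K})) =
      bind_pmf (map_pmf (\<lambda>y. y = j) (pmf_of_set {..<K})) (\<lambda>b.
        map_pmf (\<lambda>X. if b then insert x X else X) (map_pmf (\<lambda>f. {u \<in> A. f u = j}) (Pi_pmf A 0 (\<lambda>_. pmf_of_set {..<K}))))"
    using insert.hyps
    by (simp add: Pi_pmf_insert' map_bind_pmf map_pmf_comp o_def bind_map_pmf)
      (simp add: map_pmf_def bind_assoc_pmf bind_return_pmf)
  then show ?case unfolding bern insert.IH using insert.hyps by (simp add: random_set_insert)
qed

context network
begin

text \<open>The distribution of a single class is all that the analysis uses; the dependence between
  different classes is absorbed by a union bound.\<close>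

lemma colour_class_distribution:
  assumes "j < K"
  shows "map_pmf (\<lambda>\<omega>. {e \<in> edges G. edge_colour \<omega> e = j}) (colour_seeds G K) = random_set (1 / real K) (edges G)"
proof -
  let ?A = "\<lambda>v. {u \<in> nbrs G v. v < u}"
  let ?B = "\<lambda>v. (\<lambda>u. {u, v}) ` ?A v"
  let ?g = "\<lambda>v r. (\<lambda>u. {u, v}) ` {u \<in> ?A v. drawn r u = j}"
  have fin: "finite (?A v)" for v using finite_nbrs by simp
  have inj: "inj_on (\<lambda>u. {u, v}) (?A v)" for v by (auto simp: inj_on_def doubleton_eq_iff)
  have edges: "edges G = (\<Union>v \<in> nodes G. ?B v)"
  proof (intro equalityI subsetI)
    fix e assume e: "e \<in> edges G"
    then obtain u v where "e = {u, v}" "u < v" "u \<in> nodes G" by (rule simple_graph_edge[OF graph(1)])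
    then show "e \<in> (\<Union>v \<in> nodes G. ?B v)" using e by (auto simp: nbrs_def insert_commute intro!: bexI[of _ u] image_eqI[of _ _ v])
  qed (auto simp: nbrs_def)
  have "map_pmf (\<lambda>\<omega>. \<Union>v \<in> nodes G. ?g v (\<omega> v)) (colour_seeds G K) = random_set (1 / real K) (\<Union>v \<in> nodes G. ?B v)"
    unfolding colour_seeds_def
  proof (rule random_set_blocks[OF finite_nodes])
    show "?B u \<inter> ?B v = {}" if "u \<noteq> v" for u v using that by (auto simp: doubleton_eq_iff)
    fix v assume "v \<in> nodes G"
    have "{u \<in> ?A v. drawn (encode_colours (?A v) f) u = j} = {u \<in> ?A v. f u = j}" for f
      using drawn_encode[OF fin, of _ v f] by auto
    then have "map_pmf (?g v) (colour_seed v (nbrs G v) K) =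
        map_pmf ((`) (\<lambda>u. {u, v})) (map_pmf (\<lambda>f. {u \<in> ?A v. f u = j}) (Pi_pmf (?A v) 0 (\<lambda>_. pmf_of_set {..<K})))"
      by (simp add: colour_seed_def map_pmf_comp)
    also have "\<dots> = random_set (1 / real K) (?B v)"
      unfolding random_set_uniform[OF fin assms] by (rule random_set_image[OF fin inj, symmetric])
    finally show "map_pmf (?g v) (colour_seed v (nbrs G v) K) = random_set (1 / real K) (?B v)" .
  qed (use fin in auto)
  moreover have "(\<Union>v \<in> nodes G. ?g v (\<omega> v)) = {e \<in> edges G. edge_colour \<omega> e = j}" for \<omega>
    unfolding edges by (auto simp: edge_colour_def)
  ultimately show ?thesis unfolding edges[symmetric] by simp
qed

end

text \<open>A set of at most s elements is described by s choices, each being an element of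
  \<open>V\<close> or nothing.\<close>

lemma card_small_subsets:
  assumes "finite V"
  shows "finite {U. U \<subseteq> V \<and> card U \<le> s}" "card {U. U \<subseteq> V \<and> card U \<le> s} \<le> (card V + 1) ^ s"
proof -
  show fin: "finite {U. U \<subseteq> V \<and> card U \<le> s}" for s using assms by simp
  show "card {U. U \<subseteq> V \<and> card U \<le> s} \<le> (card V + 1) ^ s"
  proof (induction s)
    case 0
    have "{U. U \<subseteq> V \<and> card U \<le> 0} \<subseteq> {{}}" using assms by (auto dest: finite_subset)
    then show ?case using card_mono[of "{{}}" "{U. U \<subseteq> V \<and> card U \<le> 0}"] by simp
  next
    case (Suc s)
    let ?A = "{U. U \<subseteq> V \<and> card U \<le> s}"
    let ?f = "\<lambda>(x, U). case x of None \<Rightarrow> U | Some a \<Rightarrow> insert a U"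
    have "{U. U \<subseteq> V \<and> card U \<le> Suc s} \<subseteq> ?f ` (insert None (Some ` V) \<times> ?A)"
    proof
      fix U assume U: "U \<in> {U. U \<subseteq> V \<and> card U \<le> Suc s}"
      show "U \<in> ?f ` (insert None (Some ` V) \<times> ?A)"
      proof (cases "card U \<le> s")
        case True
        then show ?thesis using U by (intro image_eqI[of _ _ "(None, U)"]) auto
      next
        case False
        then obtain a where "a \<in> U" by fastforce
        moreover have "finite U" using U assms finite_subset by blast
        ultimately show ?thesis using U
          by (intro image_eqI[of _ _ "(Some a, U - {a})"]) (auto simp: insert_absorb)
      qed
    qed
    then have "card {U. U \<subseteq> V \<and> card U \<le> Suc s} \<le> card (?f ` (insert None (Some ` V) \<times> ?A))"
      using assms fin[of s] by (intro card_mono) auto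
    also have "\<dots> \<le> card (insert None (Some ` V) \<times> ?A)" using assms fin[of s] by (intro card_image_le) auto
    also have "\<dots> = (card V + 1) * card ?A"
      using assms by (simp add: card_cartesian_product card_image)
    also have "\<dots> \<le> (card V + 1) * (card V + 1) ^ s" using Suc by (intro mult_left_mono) auto
    finally show ?case by simp
  qed
qed

section \<open>Sampling the edges of a highly connected graph\<close>

locale connected_network = network +
  fixes k :: nat
  assumes k_connected: "edge_connected k G" and k_pos: "0 < k"
begin

definition cut :: "nat set \<Rightarrow> nat set set" where
  "cut S = {e \<in> edges G. \<exists>x y. e = {x, y} \<and> x \<in> S \<and> y \<notin> S}"

lemma card_cut:
  assumes "S \<subseteq> nodes G" "S \<noteq> {}" "S \<noteq> nodes G"
  shows "k \<le> card (cut S)"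
proof (rule ccontr)
  assume "\<not> k \<le> card (cut S)"
  then have con: "connects (edges G - cut S) (nodes G)"
    using k_connected by (auto simp: edge_connected_def cut_def)
  obtain x y where xy: "x \<in> S" "y \<in> nodes G - S" using assms by blast
  then have "linked (edges G - cut S) x y" using con assms(1) by (auto simp: connects_def)
  from linked_crossing[OF this xy(1)] xy(2) show False by (auto simp: cut_def)
qed

lemma card_nbrs:
  assumes "v \<in> nodes G"
  shows "k \<le> card (nbrs G v)"
proof -
  have "size_of G \<ge> 2" using k_connected by (simp add: edge_connected_def)
  moreover have "size_of G = 1" if "{v} = nodes G" by (simp flip: that)
  ultimately have "{v} \<noteq> nodes G" by auto
  then have "k \<le> card (cut {v})" using assms by (intro card_cut) auto
  also have "cut {v} \<subseteq> (\<lambda>u. {u, v}) ` nbrs G v" by (auto simp: cut_def nbrs_def insert_commute)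
  then have "card (cut {v}) \<le> card ((\<lambda>u. {u, v}) ` nbrs G v)" using finite_nbrs by (intro card_mono) auto
  also have "\<dots> \<le> card (nbrs G v)" using finite_nbrs by (rule card_image_le)
  finally show ?thesis .
qed

text \<open>Only the components of the edges sampled so far matter, so at most n cuts enter the
  union bound. Each has at least \<open>k\<close> edges, and a new sample misses all of them with
  probability at most (1 - p) ^ k.\<close>

lemma prob_not_grown:
  assumes F: "F \<subseteq> edges G" "grown (nodes G) F m" and p: "0 \<le> p" "p \<le> 1"
  shows "measure_pmf.prob (random_set p (edges G)) {X. X \<subseteq> edges G \<and> \<not> grown (nodes G) (F \<union> X) (2 * m)}
    \<le> real (size_of G) * (1 - p) ^ k"
proof -
  let ?I = "{v \<in> nodes G. component F v \<noteq> nodes G}"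
  let ?M = "random_set p (edges G)"
  have "measure_pmf.prob ?M {X. X \<subseteq> edges G \<and> \<not> grown (nodes G) (F \<union> X) (2 * m)} \<le> real (card ?I) * (1 - p) ^ k"
  proof (rule prob_UN_le[where B = "\<lambda>v. {X. X \<inter> cut (component F v) = {}}"])
    show "finite ?I" using finite_nodes by simp
    show "{X. X \<subseteq> edges G \<and> \<not> grown (nodes G) (F \<union> X) (2 * m)} \<subseteq> (\<Union>v \<in> ?I. {X. X \<inter> cut (component F v) = {}})"
    proof (rule subsetI, rule ccontr)
      fix X assume X: "X \<in> {X. X \<subseteq> edges G \<and> \<not> grown (nodes G) (F \<union> X) (2 * m)}"
        and *: "X \<notin> (\<Union>v \<in> ?I. {X. X \<inter> cut (component F v) = {}})"
      have "grown (nodes G) (F \<union> X) (2 * m)"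
      proof (rule grown_double[OF finite_nodes _ _ F(2)])
        show "e \<subseteq> nodes G" if "e \<in> F \<union> X" for e using that F(1) X edge_subset_nodes by blast
        fix v assume "v \<in> nodes G" "component F v \<noteq> nodes G"
        then have "X \<inter> cut (component F v) \<noteq> {}" using * by auto
        then show "\<exists>x y. {x, y} \<in> F \<union> X \<and> x \<in> component F v \<and> y \<notin> component F v" by (auto simp: cut_def)
      qed simp
      then show False using X by simp
    qed
    fix v assume v: "v \<in> ?I"
    have "k \<le> card (cut (component F v))"
    proof (rule card_cut)
      show "component F v \<noteq> {}" using component_self by blast
    qed (use v component_nodes(1)[OF F(1), of v] in auto)
    then show "measure_pmf.prob ?M {X. X \<inter> cut (component F v) = {}} \<le> (1 - p) ^ k"
      using finite_edges[OF graph(1)] p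
      by (subst prob_random_set_avoids) (auto simp: cut_def intro!: power_decreasing)
  qed
  also have "\<dots> \<le> real (size_of G) * (1 - p) ^ k"
    using finite_nodes p by (intro mult_right_mono of_nat_mono card_mono) auto
  finally show ?thesis .
qed

lemma grown_connects:
  assumes F: "F \<subseteq> edges G" "grown (nodes G) F m" and m: "size_of G < m"
  shows "connects F (nodes G)"
  unfolding connects_def
proof (intro conjI ballI nodes_nonempty)
  fix u v assume uv: "u \<in> nodes G" "v \<in> nodes G"
  have "card (component F u) \<le> size_of G"
    using component_nodes(1)[OF F(1) uv(1)] finite_nodes by (intro card_mono)
  moreover have "component F u = nodes G \<or> m \<le> card (component F u)" using F(2) uv(1) by (simp add: grown_def)
  ultimately have "component F u = nodes G" using m by linarith
  then show "linked F u v" using uv(2) by (auto simp: component_def)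
qed

lemma lower_nbr:
  assumes "v \<in> nodes G" "v \<noteq> leader"
  shows "\<exists>u \<in> nbrs G v. depth u < depth v"
proof -
  have v: "v \<in> hop_ball (edges G) (depth v) leader"
    unfolding depth_def by (rule LeastI[of _ ecc]) (use cover_ecc assms(1) in blast)
  obtain m where m: "depth v = Suc m" using v assms(2) by (cases "depth v") auto
  have "v \<notin> hop_ball (edges G) m leader" using depth_le[of v m] m by auto
  then obtain w where "w \<in> hop_ball (edges G) m leader" "{w, v} \<in> edges G" using v m by auto
  then show ?thesis using depth_le[of w m] m by (intro bexI[of _ w]) (auto simp: nbrs_def)
qed

definition level_ok :: "nat \<Rightarrow> nat \<Rightarrow> nat set set \<Rightarrow> bool" where
  "level_ok \<rho> i F \<longleftrightarrow> connects F (nodes G) \<and>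
     (\<forall>v \<in> nodes G. \<exists>w \<in> nodes G. depth w \<le> ecc - i \<and> w \<in> hop_ball F \<rho> v)"

text \<open>The nodes of depth at most \<open>ecc - i\<close>, joined when they are near each other in \<open>F\<close>, form a
  connected graph. A ball of radius \<open>l\<close> in it contains either a node of smaller depth or more than
  \<open>l\<close> nodes of depth \<open>ecc - i\<close>, and one of the latter is likely to keep its edge to a node of
  smaller depth.\<close>

lemma prob_not_level_ok:
  assumes F: "F \<subseteq> edges G" "level_ok \<rho> i F" and i: "i < ecc" and p: "0 \<le> p" "p \<le> 1"
  shows "measure_pmf.prob (random_set p (edges G))
      {X. X \<subseteq> edges G \<and> \<not> level_ok (\<rho> + l * (2 * \<rho> + 1) + 1) (Suc i) (F \<union> X)}
    \<le> real (size_of G) * (1 - p) ^ l"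
proof -
  define W where "W = {w \<in> nodes G. depth w \<le> ecc - i}"
  \<comment> \<open>The auxiliary graph on \<open>W\<close>. If x and y are adjacent in
    \<open>F\<close> and each has a node of \<open>W\<close> within \<open>\<rho>\<close>, then
    these two nodes are at distance at most 2 * \<open>\<rho>\<close> + 1.\<close>
  define F' where "F' = {{x, y} |x y. x \<in> W \<and> y \<in> W \<and> y \<in> hop_ball F (2 * \<rho> + 1) x}"
  have F'_edge: "y \<in> hop_ball F (2 * \<rho> + 1) x \<and> x \<in> W \<and> y \<in> W" if e: "{x, y} \<in> F'" for x y
  proof -
    obtain a b where ab: "{x, y} = {a, b}" "a \<in> W" "b \<in> W" "b \<in> hop_ball F (2 * \<rho> + 1) a"
      using e unfolding F'_def mem_Collect_eq by (elim exE conjE) (rule that)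
    from hop_ball_sym[OF ab(4)] ab show ?thesis by (auto simp only: doubleton_eq_iff)
  qed
  have F'_ball: "hop_ball F' t w \<subseteq> hop_ball F (t * (2 * \<rho> + 1)) w" for t w
  proof (induction t)
    case (Suc t)
    show ?case
    proof
      fix u assume "u \<in> hop_ball F' (Suc t) w"
      then consider "u \<in> hop_ball F' t w" | x where "x \<in> hop_ball F' t w" "{x, u} \<in> F'" by auto
      then show "u \<in> hop_ball F (Suc t * (2 * \<rho> + 1)) w"
      proof cases
        case 1
        have "t * (2 * \<rho> + 1) \<le> Suc t * (2 * \<rho> + 1)" by simp
        then show ?thesis using 1 Suc hop_ball_mono by blast
      next
        case 2
        then have "u \<in> hop_ball F (t * (2 * \<rho> + 1) + (2 * \<rho> + 1)) w"
          using Suc F'_edge hop_ball_trans by blast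
        moreover have "t * (2 * \<rho> + 1) + (2 * \<rho> + 1) = Suc t * (2 * \<rho> + 1)" by simp
        ultimately show ?thesis by (simp only:)
      qed
    qed
  qed simp
  have leader_W: "leader \<in> W"
  proof -
    have "depth leader \<le> 0" by (rule depth_le) simp
    then show ?thesis using leader_node by (simp add: W_def)
  qed
  have near: "\<exists>w \<in> W. w \<in> hop_ball F \<rho> v" if "v \<in> nodes G" for v
    using F(2) that by (auto simp: level_ok_def W_def)
  have linked': "linked F' w leader" if w: "w \<in> W" for w
  proof -
    have "\<forall>y \<in> W. y \<in> hop_ball F \<rho> x \<longrightarrow> linked F' w y" if "linked F w x" for x
      using that
    proof (induction rule: linked_induct)
      case refl
      show ?case
      proof (intro ballI impI)
        fix y assume "y \<in> W" "y \<in> hop_ball F \<rho> w"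
        then have "y \<in> hop_ball F (2 * \<rho> + 1) w" using hop_ball_mono[of \<rho> "2 * \<rho> + 1" F w] by auto
        then show "linked F' w y" using w \<open>y \<in> W\<close> unfolding F'_def by (intro linked_edge) blast
      qed
    next
      case (step x y)
      have "x \<in> nodes G" using edge_subset_nodes F(1) step.hyps(2) by blast
      then obtain z where z: "z \<in> W" "z \<in> hop_ball F \<rho> x" using near by blast
      show ?case
      proof (intro ballI impI)
        fix u assume u: "u \<in> W" "u \<in> hop_ball F \<rho> y"
        have "y \<in> hop_ball F 1 x" using step.hyps(2) by (rule hop_ball_edge)
        then have "u \<in> hop_ball F (1 + \<rho>) x" using u(2) hop_ball_trans by blast
        then have "u \<in> hop_ball F (\<rho> + (1 + \<rho>)) z" using hop_ball_sym[OF z(2)] hop_ball_trans by blast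
        moreover have "\<rho> + (1 + \<rho>) = 2 * \<rho> + 1" by simp
        ultimately have "u \<in> hop_ball F (2 * \<rho> + 1) z" by (simp only:)
        then have "linked F' z u" using z(1) u(1) unfolding F'_def by (intro linked_edge) blast
        then show "linked F' w u" using step.IH z linked_trans by blast
      qed
    qed
    moreover have "linked F w leader" using F(2) w leader_node by (auto simp: level_ok_def connects_def W_def)
    ultimately show ?thesis using leader_W by auto
  qed
  have W_ball: "hop_ball F' t w \<subseteq> W" if "w \<in> W" for t w
    using that F'_edge by (induction t) auto
  define centre where "centre v = (SOME w. w \<in> W \<and> w \<in> hop_ball F \<rho> v)" for v
  have centre: "centre v \<in> W \<and> centre v \<in> hop_ball F \<rho> v" if "v \<in> nodes G" for v
    unfolding centre_def by (rule someI_ex) (use near[OF that] in blast)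
  define par where "par v = (SOME u. u \<in> nbrs G v \<and> depth u < depth v)" for v
  have par: "par v \<in> nbrs G v \<and> depth (par v) < depth v" if "v \<in> nodes G" "v \<noteq> leader" for v
    unfolding par_def by (rule someI_ex) (use lower_nbr[OF that] in blast)
  let ?Z = "\<lambda>v. hop_ball F' l (centre v)"
  let ?B = "\<lambda>v. (\<lambda>z. {par z, z}) ` ?Z v"
  let ?I = "{v \<in> nodes G. \<forall>z \<in> ?Z v. \<not> depth z \<le> ecc - Suc i}"
  let ?\<rho> = "\<rho> + l * (2 * \<rho> + 1) + 1"
  have reach: "z \<in> hop_ball F (\<rho> + l * (2 * \<rho> + 1)) v" if "v \<in> nodes G" "z \<in> ?Z v" for v z
    using centre[OF that(1)] F'_ball[of l "centre v"] that(2) hop_ball_trans by blast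
  have I: "z \<in> nodes G \<and> depth z = ecc - i \<and> z \<noteq> leader" if "v \<in> ?I" "z \<in> ?Z v" for v z
  proof -
    have "z \<in> W" using that centre[of v] W_ball by blast
    moreover have "\<not> depth z \<le> ecc - Suc i" using that by blast
    moreover have "depth leader \<le> 0" by (rule depth_le) simp
    ultimately show ?thesis using i by (auto simp: W_def)
  qed
  have "measure_pmf.prob (random_set p (edges G)) {X. X \<subseteq> edges G \<and> \<not> level_ok ?\<rho> (Suc i) (F \<union> X)}
      \<le> real (card ?I) * (1 - p) ^ l"
  proof (rule prob_UN_le[where B = "\<lambda>v. {X. X \<inter> ?B v = {}}"])
    show "finite ?I" using finite_nodes by simp
    show "{X. X \<subseteq> edges G \<and> \<not> level_ok ?\<rho> (Suc i) (F \<union> X)} \<subseteq> (\<Union>v \<in> ?I. {X. X \<inter> ?B v = {}})"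
    proof (rule subsetI, rule ccontr)
      fix X assume X: "X \<in> {X. X \<subseteq> edges G \<and> \<not> level_ok ?\<rho> (Suc i) (F \<union> X)}"
        and *: "X \<notin> (\<Union>v \<in> ?I. {X. X \<inter> ?B v = {}})"
      have "\<exists>w \<in> nodes G. depth w \<le> ecc - Suc i \<and> w \<in> hop_ball (F \<union> X) ?\<rho> v" if v: "v \<in> nodes G" for v
      proof (cases "v \<in> ?I")
        case True
        then obtain z where z: "z \<in> ?Z v" "{par z, z} \<in> X" using * by auto
        note Iz = I[OF True z(1)]
        note pz = par[of z]
        have "z \<in> hop_ball (F \<union> X) (\<rho> + l * (2 * \<rho> + 1)) v"
          using reach[OF v z(1)] hop_ball_mono_edges[of F "F \<union> X"] by blast
        moreover have "par z \<in> hop_ball (F \<union> X) 1 z"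
          using z(2) by (intro hop_ball_edge) (simp add: insert_commute)
        ultimately have "par z \<in> hop_ball (F \<union> X) ?\<rho> v" by (rule hop_ball_trans)
        moreover have "par z \<in> nodes G" "depth (par z) \<le> ecc - Suc i"
          using pz Iz nbrs_subset[of z] by auto
        ultimately show ?thesis by blast
      next
        case False
        then obtain z where z: "z \<in> ?Z v" "depth z \<le> ecc - Suc i" using v by auto
        have "z \<in> nodes G" using z(1) centre[OF v] W_ball[of "centre v" l] by (auto simp: W_def)
        moreover have "z \<in> hop_ball (F \<union> X) (\<rho> + l * (2 * \<rho> + 1)) v"
          using reach[OF v z(1)] hop_ball_mono_edges[of F "F \<union> X"] by blast
        then have "z \<in> hop_ball (F \<union> X) ?\<rho> v"
          using hop_ball_mono[of "\<rho> + l * (2 * \<rho> + 1)" ?\<rho>] by auto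
        ultimately show ?thesis using z(2) by blast
      qed
      moreover have "connects (F \<union> X) (nodes G)"
        using F(2) linked_mono[of F "F \<union> X"] by (auto simp: level_ok_def connects_def)
      ultimately show False using X by (auto simp: level_ok_def)
    qed
    fix v assume v: "v \<in> ?I"
    then have cv: "centre v \<in> W" using centre[of v] by blast
    have fin: "finite (component F' (centre v))"
    proof (rule finite_subset)
      show "component F' (centre v) \<subseteq> W"
      proof
        fix u assume "u \<in> component F' (centre v)"
        then obtain t where "u \<in> hop_ball F' t (centre v)" using linked_hop_ball unfolding component_def by blast
        then show "u \<in> W" using W_ball[OF cv] by blast
      qed
      show "finite W" using finite_nodes by (simp add: W_def)
    qed
    have "leader \<in> component F' (centre v)" using linked'[OF cv] by (simp add: component_def)
    moreover have "leader \<notin> ?Z v" using I[OF v] by blast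
    \<comment> \<open>The ball misses the leader, which lies in the same component, so it is still
      growing at radius \<open>l\<close>.\<close>
    ultimately have "l < card (?Z v)" using hop_ball_growth[OF fin, of l] by blast
    \<comment> \<open>All nodes of the ball have the same depth and their parents a smaller one, so
      no edge is counted twice.\<close>
    moreover have "inj_on (\<lambda>z. {par z, z}) (?Z v)"
    proof (rule inj_onI)
      fix y z assume yz: "y \<in> ?Z v" "z \<in> ?Z v" "{par y, y} = {par z, z}"
      note y = I[OF v yz(1)] and z = I[OF v yz(2)]
      have "depth (par z) < depth z" using par z by blast
      then have "y \<noteq> par z" using y z by auto
      then show "y = z" using yz(3) by auto
    qed
    ultimately have "l \<le> card (?B v)" by (simp add: card_image)
    moreover have "?B v \<subseteq> edges G" using I[OF v] par by (auto simp: nbrs_def)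
    ultimately show "measure_pmf.prob (random_set p (edges G)) {X. X \<inter> ?B v = {}} \<le> (1 - p) ^ l"
      using finite_edges[OF graph(1)] p by (subst prob_random_set_avoids) (auto intro!: power_decreasing)
  qed
  also have "\<dots> \<le> real (size_of G) * (1 - p) ^ l"
    using finite_nodes p by (intro mult_right_mono of_nat_mono card_mono) auto
  finally show ?thesis .
qed

text \<open>The threshold k / 4 ensures that a smaller ball, together with equally many other nodes,
  absorbs at most half of the \<open>k\<close> neighbours of each of its nodes.\<close>

definition ball_ok :: "nat \<Rightarrow> nat set set \<Rightarrow> bool" where
  "ball_ok i F \<longleftrightarrow> connects F (nodes G) \<and>
     (\<forall>v \<in> nodes G. 2 ^ i \<le> card (hop_ball F i v) \<or> k \<le> 4 * card (hop_ball F i v))"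

definition cut_avoiding :: "nat set \<Rightarrow> nat set \<Rightarrow> nat set set" where
  "cut_avoiding S U = {e \<in> edges G. \<exists>x y. e = {x, y} \<and> x \<in> S \<and> y \<notin> S \<union> U}"

text \<open>The minimum degree is used node by node: at most 2 * card S of the \<open>k\<close>
  neighbours of a node of \<open>S\<close> lie in \<open>S\<close> or \<open>U\<close>, and an edge
  that leaves \<open>S\<close> has only one end in it.\<close>

lemma card_cut_avoiding:
  assumes "S \<subseteq> nodes G" "U \<subseteq> nodes G" "card U \<le> card S"
  shows "card S * (k - 2 * card S) \<le> card (cut_avoiding S U)"
proof -
  let ?N = "\<lambda>x. nbrs G x - (S \<union> U)"
  have fin: "finite S" "finite U" using assms finite_nodes finite_subset by blast+
  have "card (S \<union> U) \<le> 2 * card S" using card_Un_le[of S U] assms(3) by linarith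
  then have N: "k - 2 * card S \<le> card (?N x)" if "x \<in> S" for x
    using card_nbrs[of x] that assms(1) diff_card_le_card_Diff[of "S \<union> U" "nbrs G x"] fin by fastforce
  have "card S * (k - 2 * card S) = (\<Sum>x \<in> S. k - 2 * card S)" by simp
  also have "\<dots> \<le> (\<Sum>x \<in> S. card (?N x))" using N by (rule sum_mono)
  also have "\<dots> = card (SIGMA x:S. ?N x)" using fin finite_nbrs by simp
  also have "\<dots> = card ((\<lambda>(x, y). {x, y}) ` (SIGMA x:S. ?N x))"
    by (rule card_image[symmetric]) (auto simp: inj_on_def doubleton_eq_iff)
  also have "\<dots> \<le> card (cut_avoiding S U)"
    using finite_edges[OF graph(1)]
    by (intro card_mono) (auto simp: cut_avoiding_def nbrs_def insert_commute)
  finally show ?thesis .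
qed

text \<open>A ball \<open>S\<close> that does not double gains a set \<open>U\<close> of at most \<open>card S\<close> nodes, and none of the edges
  from \<open>S\<close> to the complement of \<open>S \<union> U\<close> is sampled. There are about \<open>n ^ card S\<close> such sets \<open>U\<close>, but
  at least \<open>card S * k / 2\<close> such edges.\<close>

lemma prob_not_ball_ok:
  assumes F: "F \<subseteq> edges G" "ball_ok i F" and p: "0 \<le> p" "p \<le> 1"
    and small: "real (size_of G + 1) * exp (- p * real k / 2) \<le> 1"
  shows "measure_pmf.prob (random_set p (edges G)) {X. X \<subseteq> edges G \<and> \<not> ball_ok (Suc i) (F \<union> X)}
    \<le> real (size_of G) * (real (size_of G + 1) * exp (- p * real k / 2))"
proof -
  let ?q = "real (size_of G + 1) * exp (- p * real k / 2)"
  let ?S = "\<lambda>v. hop_ball F i v"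
  let ?I = "{v \<in> nodes G. 4 * card (?S v) < k}"
  let ?Us = "\<lambda>v. {U. U \<subseteq> nodes G \<and> card U \<le> card (?S v)}"
  let ?M = "random_set p (edges G)"
  note S = hop_ball_nodes[OF F(1)]
  have "measure_pmf.prob ?M {X. X \<subseteq> edges G \<and> \<not> ball_ok (Suc i) (F \<union> X)} \<le> real (card ?I) * ?q"
  proof (rule prob_UN_le[where B = "\<lambda>v. {X. \<exists>U \<in> ?Us v. X \<inter> cut_avoiding (?S v) U = {}}"])
    show "finite ?I" using finite_nodes by simp
    show "{X. X \<subseteq> edges G \<and> \<not> ball_ok (Suc i) (F \<union> X)} \<subseteq> (\<Union>v \<in> ?I. {X. \<exists>U \<in> ?Us v. X \<inter> cut_avoiding (?S v) U = {}})"
    proof (rule subsetI, rule ccontr)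
      fix X assume X: "X \<in> {X. X \<subseteq> edges G \<and> \<not> ball_ok (Suc i) (F \<union> X)}"
        and *: "X \<notin> (\<Union>v \<in> ?I. {X. \<exists>U \<in> ?Us v. X \<inter> cut_avoiding (?S v) U = {}})"
      have FX: "F \<union> X \<subseteq> edges G" using F X by auto
      have "2 ^ Suc i \<le> card (hop_ball (F \<union> X) (Suc i) v) \<or> k \<le> 4 * card (hop_ball (F \<union> X) (Suc i) v)"
        if v: "v \<in> nodes G" for v
      proof -
        let ?T = "hop_ball (F \<union> X) (Suc i) v"
        have T: "?T \<subseteq> nodes G" "finite ?T" by (fact hop_ball_nodes[OF FX v])+
        have ST: "?S v \<subseteq> ?T" using hop_ball_mono_edges[of F "F \<union> X" i v] by auto
        then have le: "card (?S v) \<le> card ?T" using T(2) by (rule card_mono[rotated])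
        show ?thesis
        proof (cases "v \<in> ?I")
          case False
          then show ?thesis using v le by auto
        next
          case True
          then have S2: "2 ^ i \<le> card (?S v)" using F(2) by (auto simp: ball_ok_def)
          let ?U = "?T - ?S v"
          have avoid: "X \<inter> cut_avoiding (?S v) ?U = {}"
          proof (rule ccontr)
            assume "X \<inter> cut_avoiding (?S v) ?U \<noteq> {}"
            then obtain x y where xy: "{x, y} \<in> X" "x \<in> ?S v" "y \<notin> ?S v" "y \<notin> ?T" by (auto simp: cut_avoiding_def)
            then have "x \<in> hop_ball (F \<union> X) i v" using hop_ball_mono_edges[of F "F \<union> X" i v] by auto
            then show False using xy by auto
          qed
          have "\<not> card ?U \<le> card (?S v)"
          proof
            assume "card ?U \<le> card (?S v)"
            then have "?U \<in> ?Us v" using T by auto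
            then show False using * True avoid by blast
          qed
          moreover have "card ?U = card ?T - card (?S v)" using ST T(2) by (meson card_Diff_subset finite_subset)
          ultimately have "2 * card (?S v) < card ?T" by linarith
          then show ?thesis using S2 by (simp del: hop_ball.simps)
        qed
      qed
      moreover have "connects (F \<union> X) (nodes G)"
        using F(2) linked_mono[of F "F \<union> X"] by (auto simp: ball_ok_def connects_def)
      ultimately show False using X by (auto simp: ball_ok_def)
    qed
    fix v assume v: "v \<in> ?I"
    let ?s = "card (?S v)"
    have s: "0 < ?s" "4 * ?s < k" using v S[of v] by (auto simp: card_gt_0_iff)
    have "measure_pmf.prob ?M {X. \<exists>U \<in> ?Us v. X \<inter> cut_avoiding (?S v) U = {}} \<le> real (card (?Us v)) * exp (- p * real k / 2) ^ ?s"
    proof (rule prob_UN_le[where B = "\<lambda>U. {X. X \<inter> cut_avoiding (?S v) U = {}}"])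
      show "finite (?Us v)" by (rule card_small_subsets(1)[OF finite_nodes])
      fix U assume U: "U \<in> ?Us v"
      let ?C = "cut_avoiding (?S v) U"
      have "real ?s * (real k / 2) \<le> real ?s * real (k - 2 * ?s)" using s(2) by (intro mult_left_mono) auto
      also have "\<dots> \<le> real (card ?C)"
        using card_cut_avoiding[of "?S v" U] v S[of v] U by (metis (mono_tags, lifting) mem_Collect_eq of_nat_le_iff of_nat_mult)
      finally have C: "real ?s * (real k / 2) \<le> real (card ?C)" .
      have "measure_pmf.prob ?M {X. X \<inter> ?C = {}} = (1 - p) ^ card ?C"
        using finite_edges[OF graph(1)] p by (intro prob_random_set_avoids) (auto simp: cut_avoiding_def)
      also have "\<dots> \<le> exp (- p) ^ card ?C" using p exp_ge_add_one_self[of "- p"] by (intro power_mono) auto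
      also have "\<dots> = exp (- p * real (card ?C))" by (simp add: exp_of_nat_mult[symmetric] mult.commute)
      also have "\<dots> \<le> exp (- p * (real ?s * (real k / 2)))" using mult_left_mono[OF C p(1)] by simp
      also have "\<dots> = exp (- p * real k / 2) ^ ?s" by (simp add: exp_of_nat_mult[symmetric])
      finally show "measure_pmf.prob ?M {X. X \<inter> ?C = {}} \<le> exp (- p * real k / 2) ^ ?s" .
    qed auto
    also have "\<dots> \<le> real ((size_of G + 1) ^ ?s) * exp (- p * real k / 2) ^ ?s"
      using card_small_subsets(2)[OF finite_nodes] by (intro mult_right_mono of_nat_mono) auto
    \<comment> \<open>Each node of the ball costs a factor n + 1 for the choice of \<open>U\<close>
      and gains a factor exp (- p * k / 2). As the product is at most 1, a ball of a single node is
      the worst case.\<close>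
    also have "\<dots> = ?q ^ ?s" by (simp add: power_mult_distrib)
    also have "\<dots> \<le> ?q ^ 1" using s small by (intro power_decreasing) auto
    finally show "measure_pmf.prob ?M {X. \<exists>U \<in> ?Us v. X \<inter> cut_avoiding (?S v) U = {}} \<le> ?q" by simp
  qed
  also have "\<dots> \<le> real (size_of G) * ?q"
    using finite_nodes by (intro mult_right_mono of_nat_mono card_mono) auto
  finally show ?thesis .
qed

text \<open>A packing argument: nodes whose distances from the leader are different multiples of 2 *
  r + 1 have disjoint balls of radius \<open>r\<close>, each with at least k / 4 nodes. So there are
  at most 4 * n / k such multiples up to the distance of any node.\<close>

lemma cover_of_large_balls:
  assumes F: "F \<subseteq> edges G" "connects F (nodes G)"
    and large: "\<And>v. v \<in> nodes G \<Longrightarrow> k \<le> 4 * card (hop_ball F r v)"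
  shows "nodes G \<subseteq> hop_ball F (4 * size_of G div k * (2 * r + 1)) leader"
proof
  fix v assume v: "v \<in> nodes G"
  define dist where "dist u = (LEAST t. u \<in> hop_ball F t leader)" for u
  have dist_le: "dist u \<le> t" if "u \<in> hop_ball F t leader" for u t unfolding dist_def using that by (rule Least_le)
  have in_dist: "u \<in> hop_ball F (dist u) leader" if "u \<in> nodes G" for u
  proof -
    have "linked F leader u" using F(2) that leader_node by (auto simp: connects_def)
    then show ?thesis using linked_hop_ball unfolding dist_def by (metis LeastI_ex)
  qed
  \<comment> \<open>Every distance up to that of v is attained, namely along a shortest path from
    the leader to v.\<close>
  have levels: "\<exists>u \<in> nodes G. dist u = t - s" if "s \<le> t" "t = dist v" for s t
    using that
  proof (induction s)
    case 0
    then show ?case using v by auto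
  next
    case (Suc s)
    then obtain u where u: "u \<in> nodes G" "dist u = Suc (t - Suc s)" by (auto simp: Suc_diff_Suc)
    have "u \<notin> hop_ball F (t - Suc s) leader" using dist_le[of u "t - Suc s"] u(2) by auto
    moreover have "u \<in> hop_ball F (Suc (t - Suc s)) leader" using in_dist[OF u(1)] u(2) by simp
    ultimately obtain w where w: "w \<in> hop_ball F (t - Suc s) leader" "{w, u} \<in> F" by auto
    have wn: "w \<in> nodes G" using hop_ball_nodes(1)[OF F(1) leader_node] w(1) by blast
    have "u \<in> hop_ball F (Suc (dist w)) leader" using in_dist[OF wn] w(2) by auto
    then have "dist u \<le> Suc (dist w)" by (rule dist_le)
    then show ?case using u(2) dist_le[OF w(1)] wn by (intro bexI[of _ w]) auto
  qed
  define m where "m = dist v div (2 * r + 1)"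
  define x where "x j = (SOME u. u \<in> nodes G \<and> dist u = j * (2 * r + 1))" for j
  have x: "x j \<in> nodes G \<and> dist (x j) = j * (2 * r + 1)" if "j \<le> m" for j
  proof -
    have "j * (2 * r + 1) \<le> m * (2 * r + 1)" using that by (rule mult_right_mono) simp
    also have "\<dots> \<le> dist v" unfolding m_def by (rule div_times_less_eq_dividend)
    finally have "\<exists>u \<in> nodes G. dist u = j * (2 * r + 1)"
      using levels[of "dist v - j * (2 * r + 1)" "dist v"] by auto
    then have "\<exists>u. u \<in> nodes G \<and> dist u = j * (2 * r + 1)" by blast
    then show ?thesis unfolding x_def by (rule someI_ex)
  qed
  have near: "dist y \<le> dist z + r" if "z \<in> nodes G" "y \<in> hop_ball F r z" for y z
    using hop_ball_trans[OF in_dist[OF that(1)] that(2)] by (rule dist_le)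
  have disj: "hop_ball F r (x i) \<inter> hop_ball F r (x j) = {}" if "i \<le> m" "j \<le> m" "i < j" for i j
  proof (rule ccontr)
    assume "hop_ball F r (x i) \<inter> hop_ball F r (x j) \<noteq> {}"
    then obtain y where y: "y \<in> hop_ball F r (x i)" "y \<in> hop_ball F r (x j)" by blast
    have yn: "y \<in> nodes G" using hop_ball_nodes(1)[OF F(1)] x[OF that(1)] y(1) by blast
    have "dist (x j) \<le> dist (x i) + r + r"
      using near[OF _ y(1)] near[OF yn hop_ball_sym[OF y(2)]] x[OF that(1)] by fastforce
    then have "j * (2 * r + 1) \<le> i * (2 * r + 1) + 2 * r" using x[OF that(1)] x[OF that(2)] by simp
    moreover have "(i + 1) * (2 * r + 1) \<le> j * (2 * r + 1)" using that(3) by (intro mult_right_mono) auto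
    ultimately show False by simp
  qed
  have "(m + 1) * k = (\<Sum>j \<le> m. k)" by simp
  also have "\<dots> \<le> (\<Sum>j \<le> m. 4 * card (hop_ball F r (x j)))" using large x by (intro sum_mono) auto
  also have "\<dots> = 4 * card (\<Union>j \<le> m. hop_ball F r (x j))"
  proof -
    have "card (\<Union>j \<le> m. hop_ball F r (x j)) = (\<Sum>j \<le> m. card (hop_ball F r (x j)))"
    proof (rule card_UN_disjoint)
      show "\<forall>i \<in> {..m}. \<forall>j \<in> {..m}. i \<noteq> j \<longrightarrow> hop_ball F r (x i) \<inter> hop_ball F r (x j) = {}"
      proof (intro ballI impI)
        fix i j assume "i \<in> {..m}" "j \<in> {..m}" "i \<noteq> j"
        then show "hop_ball F r (x i) \<inter> hop_ball F r (x j) = {}"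
          using disj[of i j] disj[of j i] by (cases "i < j") auto
      qed
      show "\<forall>i \<in> {..m}. finite (hop_ball F r (x i))" using hop_ball_nodes(2)[OF F(1)] x by auto
    qed simp
    then show ?thesis by (simp add: sum_distrib_left)
  qed
  also have "\<dots> \<le> 4 * size_of G"
    using hop_ball_nodes(1)[OF F(1)] x finite_nodes by (intro mult_left_mono card_mono) blast+
  finally have "m + 1 \<le> 4 * size_of G div k" using k_pos by (simp add: less_eq_div_iff_mult_less_eq)
  then have "(m + 1) * (2 * r + 1) \<le> 4 * size_of G div k * (2 * r + 1)" by (rule mult_right_mono) simp
  moreover have "dist v \<le> (m + 1) * (2 * r + 1)"
    unfolding m_def using dividend_less_div_times[of "2 * r + 1" "dist v"] by (simp add: algebra_simps)
  ultimately show "v \<in> hop_ball F (4 * size_of G div k * (2 * r + 1)) leader"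
    using in_dist[OF v] hop_ball_mono[of "dist v" "4 * size_of G div k * (2 * r + 1)" F leader] by auto
qed

lemma grown_empty: "grown (nodes G) {} 1"
  by (simp add: grown_def component_def linked_empty)

text \<open>The first \<open>L\<close> rounds connect the sample, since 2 ^ L exceeds n. Each of the
  remaining \<open>ecc\<close> rounds lowers by one the depth that is reachable nearby, until only
  the leader is left.\<close>

lemma prob_large_radius_levels:
  assumes p: "0 \<le> p" "p \<le> 1"
  defines "n \<equiv> size_of G"
  defines "L \<equiv> bitlen n"
  shows "measure_pmf.prob (random_set (1 - (1 - p) ^ (L + ecc)) (edges G))
      {X. \<not> nodes G \<subseteq> hop_ball X ((2 * l + 2) ^ ecc) leader}
    \<le> real (L + ecc) * (real n * ((1 - p) ^ k + (1 - p) ^ l))"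
proof -
  \<comment> \<open>One level turns the radius \<open>\<rho>\<close> into (2 * l + 1) *
    \<open>\<rho>\<close> + l + 1. Starting from 0, this is dominated by (2 * l + 2) ^ i -
    1.\<close>
  define \<rho> where "\<rho> i = (2 * l + 2) ^ i - 1" for i :: nat
  define Good where "Good r F \<longleftrightarrow> (if r < L then grown (nodes G) F (2 ^ r) else level_ok (\<rho> (r - L)) (r - L) F)" for r F
  let ?\<epsilon> = "real n * ((1 - p) ^ k + (1 - p) ^ l)"
  have L: "0 < L" unfolding L_def n_def by (rule bitlen_pos)
  have nL: "n < 2 ^ L" unfolding L_def by (rule less_bitlen)
  have q: "0 \<le> (1 - p) ^ k" "0 \<le> (1 - p) ^ l" using p by auto
  have "measure_pmf.prob (random_set (1 - (1 - p) ^ (L + ecc)) (edges G)) {X. \<not> Good (L + ecc) X} \<le> real (L + ecc) * ?\<epsilon>"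
  proof (rule random_rounds[OF finite_edges[OF graph(1)] p])
    show "0 \<le> ?\<epsilon>" using q by simp
    show "Good 0 {}" using L grown_empty by (simp add: Good_def)
    fix r F assume r: "r < L + ecc" and F: "F \<subseteq> edges G" "Good r F"
    show "measure_pmf.prob (random_set p (edges G)) {X. X \<subseteq> edges G \<and> \<not> Good (Suc r) (F \<union> X)} \<le> ?\<epsilon>"
    proof (cases "r < L")
      case True
      have "Good (Suc r) (F \<union> X)" if X: "X \<subseteq> edges G" and g: "grown (nodes G) (F \<union> X) (2 * 2 ^ r)" for X
      proof (cases "Suc r < L")
        case False
        then have "Suc r = L" using True by simp
        then have "grown (nodes G) (F \<union> X) (2 ^ L)" using g by auto
        then have "connects (F \<union> X) (nodes G)"
          using grown_connects[of "F \<union> X" "2 ^ L"] nL F(1) X by (simp add: n_def)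
        moreover have "depth v \<le> ecc" if "v \<in> nodes G" for v using cover_ecc that by (intro depth_le) auto
        ultimately show ?thesis using \<open>Suc r = L\<close> by (auto simp: Good_def level_ok_def \<rho>_def)
      qed (use g in \<open>simp add: Good_def\<close>)
      then have "measure_pmf.prob (random_set p (edges G)) {X. X \<subseteq> edges G \<and> \<not> Good (Suc r) (F \<union> X)} \<le>
          measure_pmf.prob (random_set p (edges G)) {X. X \<subseteq> edges G \<and> \<not> grown (nodes G) (F \<union> X) (2 * 2 ^ r)}"
        by (intro measure_pmf.finite_measure_mono) auto
      also have "\<dots> \<le> real n * (1 - p) ^ k"
        unfolding n_def using F(2) True by (intro prob_not_grown[OF F(1) _ p]) (simp add: Good_def)
      also have "\<dots> \<le> ?\<epsilon>" using q by (intro mult_left_mono) auto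
      finally show ?thesis .
    next
      case False
      define i where "i = r - L"
      have i: "i < ecc" "Suc r - L = Suc i" using r False by (auto simp: i_def)
      have ok: "level_ok (\<rho> i) i F" using F(2) False by (simp add: Good_def i_def)
      have "1 \<le> (2 * l + 2) ^ i" by simp
      then obtain m where m: "(2 * l + 2) ^ i = Suc m" by (cases "(2 * l + 2) ^ i") auto
      have le: "\<rho> i + l * (2 * \<rho> i + 1) + 1 \<le> \<rho> (Suc i)"
        unfolding \<rho>_def power_Suc m by (simp add: algebra_simps)
      have "Good (Suc r) (F \<union> X)" if "level_ok (\<rho> i + l * (2 * \<rho> i + 1) + 1) (Suc i) (F \<union> X)" for X
      proof -
        have "level_ok (\<rho> (Suc i)) (Suc i) (F \<union> X)"
          using that hop_ball_mono[OF le, of "F \<union> X"] unfolding level_ok_def by blast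
        then show ?thesis using False i(2) by (simp add: Good_def)
      qed
      then have "measure_pmf.prob (random_set p (edges G)) {X. X \<subseteq> edges G \<and> \<not> Good (Suc r) (F \<union> X)} \<le>
          measure_pmf.prob (random_set p (edges G)) {X. X \<subseteq> edges G \<and> \<not> level_ok (\<rho> i + l * (2 * \<rho> i + 1) + 1) (Suc i) (F \<union> X)}"
        by (intro measure_pmf.finite_measure_mono) auto
      also have "\<dots> \<le> real n * (1 - p) ^ l"
        unfolding n_def by (rule prob_not_level_ok[OF F(1) ok i(1) p])
      also have "\<dots> \<le> ?\<epsilon>" using q by (intro mult_left_mono) auto
      finally show ?thesis .
    qed
  qed
  moreover have "nodes G \<subseteq> hop_ball X ((2 * l + 2) ^ ecc) leader" if good: "Good (L + ecc) X" for X
  proof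
    fix v assume v: "v \<in> nodes G"
    obtain w where w: "w \<in> nodes G" "depth w \<le> 0" "w \<in> hop_ball X (\<rho> ecc) v"
      using good v by (auto simp: Good_def level_ok_def)
    have "w = leader" using lower_nbr[OF w(1)] w(2) by auto
    then have "v \<in> hop_ball X (\<rho> ecc) leader" using hop_ball_sym[OF w(3)] by simp
    then show "v \<in> hop_ball X ((2 * l + 2) ^ ecc) leader"
      using hop_ball_mono[of "\<rho> ecc" "(2 * l + 2) ^ ecc" X leader] by (auto simp: \<rho>_def)
  qed
  then have "measure_pmf.prob (random_set (1 - (1 - p) ^ (L + ecc)) (edges G)) {X. \<not> nodes G \<subseteq> hop_ball X ((2 * l + 2) ^ ecc) leader}
      \<le> measure_pmf.prob (random_set (1 - (1 - p) ^ (L + ecc)) (edges G)) {X. \<not> Good (L + ecc) X}"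
    by (intro measure_pmf.finite_measure_mono) auto
  ultimately show ?thesis by linarith
qed

text \<open>The first \<open>L\<close> rounds connect the sample and the next \<open>L\<close>
  rounds let the balls double. As 2 ^ L exceeds n, every ball of radius \<open>L\<close> must then
  have stopped at k / 4 nodes or more, and the packing argument applies.\<close>

lemma prob_large_radius_balls:
  assumes p: "0 \<le> p" "p \<le> 1"
  defines "n \<equiv> size_of G"
  defines "L \<equiv> bitlen n"
  assumes small: "real (n + 1) * exp (- p * real k / 2) \<le> 1"
  shows "measure_pmf.prob (random_set (1 - (1 - p) ^ (L + L)) (edges G))
      {X. \<not> nodes G \<subseteq> hop_ball X (4 * n div k * (2 * L + 1)) leader}
    \<le> real (L + L) * (real n * ((1 - p) ^ k + real (n + 1) * exp (- p * real k / 2)))"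
proof -
  define Good where "Good r F \<longleftrightarrow> (if r < L then grown (nodes G) F (2 ^ r) else ball_ok (r - L) F)" for r F
  let ?b = "real (n + 1) * exp (- p * real k / 2)"
  let ?\<epsilon> = "real n * ((1 - p) ^ k + ?b)"
  have L: "0 < L" unfolding L_def n_def by (rule bitlen_pos)
  have nL: "n < 2 ^ L" unfolding L_def by (rule less_bitlen)
  have q: "0 \<le> (1 - p) ^ k" "0 \<le> ?b" using p by auto
  have "measure_pmf.prob (random_set (1 - (1 - p) ^ (L + L)) (edges G)) {X. \<not> (X \<subseteq> edges G \<and> Good (L + L) X)} \<le> real (L + L) * ?\<epsilon>"
  proof (rule random_rounds[where Good = "\<lambda>r X. X \<subseteq> edges G \<and> Good r X", OF finite_edges[OF graph(1)] p])
    show "0 \<le> ?\<epsilon>" using q by (intro mult_nonneg_nonneg add_nonneg_nonneg) auto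
    show "{} \<subseteq> edges G \<and> Good 0 {}" using L grown_empty by (simp add: Good_def)
    fix r F assume r: "r < L + L" and F: "F \<subseteq> edges G" "F \<subseteq> edges G \<and> Good r F"
    show "measure_pmf.prob (random_set p (edges G)) {X. X \<subseteq> edges G \<and> \<not> (F \<union> X \<subseteq> edges G \<and> Good (Suc r) (F \<union> X))} \<le> ?\<epsilon>"
    proof (cases "r < L")
      case True
      have "Good (Suc r) (F \<union> X)" if X: "X \<subseteq> edges G" and g: "grown (nodes G) (F \<union> X) (2 * 2 ^ r)" for X
      proof (cases "Suc r < L")
        case False
        then have "Suc r = L" using True by simp
        then have "grown (nodes G) (F \<union> X) (2 ^ L)" using g by auto
        then have "connects (F \<union> X) (nodes G)"
          using grown_connects[of "F \<union> X" "2 ^ L"] nL F(1) X by (simp add: n_def)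
        then show ?thesis using \<open>Suc r = L\<close> by (auto simp: Good_def ball_ok_def)
      qed (use g in \<open>simp add: Good_def\<close>)
      then have "measure_pmf.prob (random_set p (edges G)) {X. X \<subseteq> edges G \<and> \<not> (F \<union> X \<subseteq> edges G \<and> Good (Suc r) (F \<union> X))} \<le>
          measure_pmf.prob (random_set p (edges G)) {X. X \<subseteq> edges G \<and> \<not> grown (nodes G) (F \<union> X) (2 * 2 ^ r)}"
        using F(1) by (intro measure_pmf.finite_measure_mono) auto
      also have "\<dots> \<le> real n * (1 - p) ^ k"
        unfolding n_def using F(2) True by (intro prob_not_grown[OF F(1) _ p]) (simp add: Good_def)
      also have "\<dots> \<le> ?\<epsilon>" using q by (intro mult_left_mono) linarith+
      finally show ?thesis .
    next
      case False
      define i where "i = r - L"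
      have i: "Suc r - L = Suc i" using False by (simp add: i_def)
      have ok: "ball_ok i F" using F(2) False by (simp add: Good_def i_def)
      have "measure_pmf.prob (random_set p (edges G)) {X. X \<subseteq> edges G \<and> \<not> (F \<union> X \<subseteq> edges G \<and> Good (Suc r) (F \<union> X))} \<le>
          measure_pmf.prob (random_set p (edges G)) {X. X \<subseteq> edges G \<and> \<not> ball_ok (Suc i) (F \<union> X)}"
        using F(1) False i by (intro measure_pmf.finite_measure_mono) (auto simp: Good_def)
      also have "\<dots> \<le> real n * ?b"
        unfolding n_def by (rule prob_not_ball_ok[OF F(1) ok p small[unfolded n_def]])
      also have "\<dots> \<le> ?\<epsilon>" using q by (intro mult_left_mono) linarith+
      finally show ?thesis .
    qed
  qed
  moreover have "nodes G \<subseteq> hop_ball X (4 * n div k * (2 * L + 1)) leader" if X: "X \<subseteq> edges G" "Good (L + L) X" for X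
  proof -
    have ok: "ball_ok L X" using X(2) by (simp add: Good_def)
    have "k \<le> 4 * card (hop_ball X L v)" if v: "v \<in> nodes G" for v
    proof -
      have "card (hop_ball X L v) \<le> n"
        unfolding n_def using hop_ball_nodes(1)[OF X(1) v] finite_nodes by (intro card_mono)
      then have "\<not> 2 ^ L \<le> card (hop_ball X L v)" using nL by linarith
      then show ?thesis using ok v by (auto simp: ball_ok_def)
    qed
    then show ?thesis unfolding n_def using ok by (intro cover_of_large_balls[OF X(1)]) (auto simp: ball_ok_def)
  qed
  then have "measure_pmf.prob (random_set (1 - (1 - p) ^ (L + L)) (edges G)) {X. \<not> nodes G \<subseteq> hop_ball X (4 * n div k * (2 * L + 1)) leader}
      \<le> measure_pmf.prob (random_set (1 - (1 - p) ^ (L + L)) (edges G)) {X. \<not> (X \<subseteq> edges G \<and> Good (L + L) X)}"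
    by (intro measure_pmf.finite_measure_mono) auto
  ultimately show ?thesis by linarith
qed

end

text \<open>A colour class is a sample of rate 1 / K, to be split into \<open>R\<close> equal
  rounds. By Bernoulli's inequality the rate of one round is still at least 1 / (K * R).\<close>

lemma sampling_rate:
  assumes "2 \<le> K" "0 < R"
  obtains p :: real where "0 \<le> p" "p \<le> 1" "1 - (1 - p) ^ R = 1 / real K" "1 / (real K * real R) \<le> p"
proof -
  define x where "x = 1 - 1 / real K"
  have x: "0 \<le> x" "x \<le> 1" using assms by (auto simp: x_def)
  define p where "p = 1 - root R x"
  have "(1 - p) ^ R = x" using x assms by (simp add: p_def)
  moreover have "1 / (real K * real R) \<le> p"
  proof -
    have KR: "1 \<le> real K * real R" using assms by (metis Suc_leI mult_le_mono of_nat_1 of_nat_le_iff of_nat_mult nat_mult_1 one_le_numeral order_trans One_nat_def)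
    have "1 + real R * (- (1 / (real K * real R))) \<le> (1 + (- (1 / (real K * real R)))) ^ R"
      using KR by (intro Bernoulli_inequality) auto
    then have "x \<le> (1 - 1 / (real K * real R)) ^ R" using assms by (simp add: x_def)
    then have "root R x \<le> root R ((1 - 1 / (real K * real R)) ^ R)" using assms by simp
    also have "\<dots> = 1 - 1 / (real K * real R)" using assms KR by (intro real_root_power_cancel) auto
    finally show ?thesis by (simp add: p_def)
  qed
  moreover have "0 \<le> p" "p \<le> 1" using x assms by (auto simp: p_def)
  ultimately show ?thesis using that[of p] by (simp add: x_def)
qed

lemma power_le_exp:
  assumes "0 \<le> p" "p \<le> 1" "c \<le> p * real m"
  shows "(1 - p) ^ m \<le> exp (- c)"
proof -
  have "(1 - p) ^ m \<le> exp (- p) ^ m" using assms exp_ge_add_one_self[of "- p"] by (intro power_mono) auto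
  also have "\<dots> = exp (- (p * real m))" by (simp add: exp_of_nat_mult[symmetric] mult.commute)
  also have "\<dots> \<le> exp (- c)" using assms by simp
  finally show ?thesis .
qed

lemma less_exp_bitlen: "real n < exp (real (bitlen n))"
proof -
  have "real n < 2 ^ bitlen n" using less_bitlen[of n] by (metis of_nat_less_iff of_nat_numeral of_nat_power)
  also have "(2 :: real) ^ bitlen n \<le> exp 1 ^ bitlen n" using exp_ge_add_one_self[of 1] by (intro power_mono) auto
  also have "\<dots> = exp (real (bitlen n))" by (simp add: exp_of_nat_mult[symmetric])
  finally show ?thesis .
qed

lemma exp_bitlen_le:
  assumes "0 < n"
  shows "exp (- (real m * real (bitlen n))) \<le> 1 / real n ^ m"
proof -
  have "real n ^ m \<le> exp (real (bitlen n)) ^ m" using less_exp_bitlen[of n] by (intro power_mono) auto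
  also have "\<dots> = exp (real m * real (bitlen n))" by (simp add: exp_of_nat_mult[symmetric])
  finally show ?thesis using assms by (simp add: exp_minus inverse_eq_divide frac_le)
qed

section \<open>Success probability of a random colouring\<close>

context connected_network
begin

text \<open>The two radius bounds together fail for one class with probability at most (8 * L + 2 *
  ecc) / n ^ 3, which \<open>large\<close> reduces to 1 / n ^ 2, and there are at most n
  classes.\<close>

lemma prob_small_classes:
  defines "n \<equiv> size_of G"
  defines "L \<equiv> bitlen n"
  assumes K: "2 \<le> K" "K \<le> n" "10 * K * (2 * L + ecc) * L \<le> k" and large: "8 * L + 2 * ecc \<le> n"
  shows "1 - 1 / real n \<le> measure_pmf.prob (colour_seeds G K) (small_classes K (radius_bound n ecc K))"
proof -
  let ?M = "colour_seeds G K"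
  let ?r = "random_set (1 / real K) (edges G)"
  let ?c = "\<lambda>\<omega> j. {e \<in> edges G. edge_colour \<omega> e = j}"
  \<comment> \<open>A sampling round has rate at least 1 / (K * (L + ecc)), so \<open>l\<close>
    independent trials all fail with probability at most exp (- 4 * L), which is at most 1 / n ^
    4.\<close>
  define l where "l = 4 * K * (L + ecc) * L"
  let ?d1 = "15 * L * (n div K + 1)" and ?d2 = "(2 * l + 2) ^ ecc"
  have L: "0 < L" unfolding L_def n_def by (rule bitlen_pos)
  have n: "0 < n" using K by simp
  have d: "radius_bound n ecc K = min ?d1 ?d2" by (simp add: radius_bound_def L_def l_def ac_simps)
  have K0: "0 < real K" using K by simp
  have "real (10 * K * (2 * L + ecc) * L) \<le> real k" using K(3) by (simp only: of_nat_le_iff)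
  then have k: "10 * real K * (2 * real L + real ecc) * real L \<le> real k" by simp
  have "measure_pmf.prob ?r {X. \<not> nodes G \<subseteq> hop_ball X ?d2 leader} \<le> real (L + ecc) * (real n * (2 / real n ^ 4))"
  proof -
    obtain p where p: "0 \<le> p" "p \<le> 1" "1 - (1 - p) ^ (L + ecc) = 1 / real K" "1 / (real K * real (L + ecc)) \<le> p"
      by (rule sampling_rate[OF K(1), of "L + ecc"]) (use L in auto)
    have "real K * real (L + ecc) > 0" using K0 L by simp
    moreover have "real l = (4 * real L) * (real K * real (L + ecc))" by (simp add: l_def)
    ultimately have "4 * real L = 1 / (real K * real (L + ecc)) * real l"
      by (metis less_irrefl mult.commute nonzero_mult_div_cancel_right times_divide_eq_right mult.right_neutral)
    also have "\<dots> \<le> p * real l" using p(4) by (intro mult_right_mono) auto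
    finally have 1: "(1 - p) ^ l \<le> exp (- (4 * real L))" by (intro power_le_exp[OF p(1,2)])
    have "l \<le> k"
    proof -
      have "l \<le> 10 * K * (2 * L + ecc) * L" unfolding l_def by (intro mult_mono) auto
      then show ?thesis using K(3) by simp
    qed
    then have "(1 - p) ^ k \<le> (1 - p) ^ l" using p by (intro power_decreasing) auto
    then have "(1 - p) ^ k + (1 - p) ^ l \<le> 2 / real n ^ 4"
      using 1 exp_bitlen_le[OF n, of 4] by (simp add: L_def)
    then have "real (L + ecc) * (real n * ((1 - p) ^ k + (1 - p) ^ l)) \<le> real (L + ecc) * (real n * (2 / real n ^ 4))"
      by (intro mult_left_mono) auto
    then show ?thesis
      using prob_large_radius_levels[OF p(1,2), of l] unfolding n_def[symmetric] L_def[symmetric] p(3) by linarith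
  qed
  moreover have "measure_pmf.prob ?r {X. \<not> nodes G \<subseteq> hop_ball X ?d1 leader} \<le> real (L + L) * (real n * (3 / real n ^ 4))"
  proof -
    obtain p where p: "0 \<le> p" "p \<le> 1" "1 - (1 - p) ^ (L + L) = 1 / real K" "1 / (real K * real (L + L)) \<le> p"
      by (rule sampling_rate[OF K(1), of "L + L"]) (use L in auto)
    have "20 * real K * real L * real L \<le> real k"
    proof -
      have "20 * real K * real L * real L \<le> 10 * real K * (2 * real L + real ecc) * real L"
        using K0 by (simp add: algebra_simps)
      then show ?thesis using k by linarith
    qed
    then have "10 * real L \<le> 1 / (real K * real (L + L)) * real k" using K0 L by (simp add: field_simps)
    also have "\<dots> \<le> p * real k" using p(4) by (intro mult_right_mono) auto
    finally have pk: "10 * real L \<le> p * real k" .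
    \<comment> \<open>The halved exponent is still 5 * L, one more than the target n ^ 4 asks for;
      the surplus compensates for the factor n + 1.\<close>
    have "exp (- p * real k / 2) \<le> exp (- (5 * real L))" using pk by simp
    also have "\<dots> \<le> 1 / real n ^ 5" using exp_bitlen_le[OF n, of 5] by (simp add: L_def)
    finally have 5: "exp (- p * real k / 2) \<le> 1 / real n ^ 5" .
    have "real (n + 1) * exp (- p * real k / 2) \<le> (2 * real n) * (1 / real n ^ 5)"
      using 5 n by (intro mult_mono) auto
    also have "\<dots> = 2 / real n ^ 4" using n by (simp add: field_simps eval_nat_numeral)
    finally have b: "real (n + 1) * exp (- p * real k / 2) \<le> 2 / real n ^ 4" .
    have "2 \<le> real n ^ 4"
    proof -
      have "(2 :: real) ^ 4 \<le> real n ^ 4" using K by (intro power_mono) auto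
      then show ?thesis by simp
    qed
    then have "2 / real n ^ 4 \<le> 1" by (simp add: divide_le_eq)
    with b have small: "real (n + 1) * exp (- p * real k / 2) \<le> 1" by (rule order_trans)
    have "(1 - p) ^ k \<le> exp (- (4 * real L))" using pk by (intro power_le_exp[OF p(1,2)]) linarith
    also have "\<dots> \<le> 1 / real n ^ 4" using exp_bitlen_le[OF n, of 4] by (simp add: L_def)
    finally have "(1 - p) ^ k + real (n + 1) * exp (- p * real k / 2) \<le> 3 / real n ^ 4" using b by simp
    then have "real (L + L) * (real n * ((1 - p) ^ k + real (n + 1) * exp (- p * real k / 2))) \<le>
        real (L + L) * (real n * (3 / real n ^ 4))" by (intro mult_left_mono) auto
    then have le: "measure_pmf.prob ?r {X. \<not> nodes G \<subseteq> hop_ball X (4 * n div k * (2 * L + 1)) leader}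
        \<le> real (L + L) * (real n * (3 / real n ^ 4))"
      using prob_large_radius_balls[OF p(1,2)] small unfolding n_def[symmetric] L_def[symmetric] p(3) by linarith
    have "K * 1 \<le> K * (10 * ((2 * L + ecc) * L))" using L by (intro mult_left_mono) auto
    then have "K \<le> k" using K(3) by (simp add: algebra_simps)
    \<comment> \<open>The factor 4 comes from balls of k / 4 nodes, and 3 * L bounds 2 * L + 1; the
      constant 15 of \<open>radius_bound\<close> has room for their product.\<close>
    have "4 * n div k * (2 * L + 1) \<le> 4 * (n div K + 1) * (3 * L)"
    proof (rule mult_mono)
      have "4 * n div k \<le> 4 * n div K" using \<open>K \<le> k\<close> K(1) by (intro div_le_mono2) auto
      also have "\<dots> \<le> 4 * (n div K + 1)"
      proof -
        have "n < (n div K + 1) * K" using K(1) dividend_less_div_times[of K n] by simp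
        then have "4 * n \<le> (4 * (n div K + 1)) * K" by (simp add: algebra_simps)
        then have "4 * n div K \<le> (4 * (n div K + 1)) * K div K" by (rule div_le_mono)
        also have "\<dots> = 4 * (n div K + 1)" using K(1) by (intro nonzero_mult_div_cancel_right) simp
        finally show ?thesis .
      qed
      finally show "4 * n div k \<le> 4 * (n div K + 1)" .
    qed (use L in auto)
    also have "\<dots> \<le> ?d1" by (simp add: algebra_simps)
    finally have mono: "hop_ball X (4 * n div k * (2 * L + 1)) leader \<subseteq> hop_ball X ?d1 leader" for X by (rule hop_ball_mono)
    have "measure_pmf.prob ?r {X. \<not> nodes G \<subseteq> hop_ball X ?d1 leader} \<le>
        measure_pmf.prob ?r {X. \<not> nodes G \<subseteq> hop_ball X (4 * n div k * (2 * L + 1)) leader}"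
      by (rule measure_pmf.finite_measure_mono) (use mono in blast, simp)
    then show ?thesis using le by linarith
  qed
  moreover have "measure_pmf.prob ?r {X. \<not> nodes G \<subseteq> hop_ball X (min ?d1 ?d2) leader} \<le>
      measure_pmf.prob ?r {X. \<not> nodes G \<subseteq> hop_ball X ?d1 leader} + measure_pmf.prob ?r {X. \<not> nodes G \<subseteq> hop_ball X ?d2 leader}"
  proof -
    have "measure_pmf.prob ?r {X. \<not> nodes G \<subseteq> hop_ball X (min ?d1 ?d2) leader} \<le>
        measure_pmf.prob ?r ({X. \<not> nodes G \<subseteq> hop_ball X ?d1 leader} \<union> {X. \<not> nodes G \<subseteq> hop_ball X ?d2 leader})"
      by (intro measure_pmf.finite_measure_mono) (auto simp: min_def split: if_splits)
    then show ?thesis using measure_Un_le[of "{X. \<not> nodes G \<subseteq> hop_ball X ?d1 leader}" ?r "{X. \<not> nodes G \<subseteq> hop_ball X ?d2 leader}"]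
      by simp
  qed
  ultimately have one: "measure_pmf.prob ?r {X. \<not> nodes G \<subseteq> hop_ball X (min ?d1 ?d2) leader} \<le>
      (8 * real L + 2 * real ecc) / real n ^ 3"
    using n by (simp add: field_simps eval_nat_numeral)
  have "measure_pmf.prob ?M (- small_classes K (min ?d1 ?d2)) \<le> real (card {..<K}) * ((8 * real L + 2 * real ecc) / real n ^ 3)"
  proof (rule prob_UN_le[where B = "\<lambda>j. {\<omega>. \<not> nodes G \<subseteq> hop_ball (?c \<omega> j) (min ?d1 ?d2) leader}"])
    show "- small_classes K (min ?d1 ?d2) \<subseteq> (\<Union>j<K. {\<omega>. \<not> nodes G \<subseteq> hop_ball (?c \<omega> j) (min ?d1 ?d2) leader})"
      by (auto simp: small_classes_def)
    fix j assume "j \<in> {..<K}"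
    then have "?r = map_pmf (\<lambda>\<omega>. ?c \<omega> j) ?M" using colour_class_distribution[of j K] by simp
    then show "measure_pmf.prob ?M {\<omega>. \<not> nodes G \<subseteq> hop_ball (?c \<omega> j) (min ?d1 ?d2) leader} \<le> (8 * real L + 2 * real ecc) / real n ^ 3"
      using one by (simp add: vimage_def)
  qed simp
  also have "\<dots> \<le> real n * (real n / real n ^ 3)"
  proof -
    have "real (8 * L + 2 * ecc) \<le> real n" using large by (simp only: of_nat_le_iff)
    then have "8 * real L + 2 * real ecc \<le> real n" by simp
    then show ?thesis using K(2) by (intro mult_mono divide_right_mono) auto
  qed
  also have "\<dots> = 1 / real n" using n by (simp add: eval_nat_numeral)
  finally show ?thesis
    using measure_pmf.prob_compl[of "small_classes K (min ?d1 ?d2)" ?M] d by (simp add: Compl_eq_Diff_UNIV)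
qed

text \<open>With one colour the class is the whole graph, so the radius is at most
  \<open>ecc\<close> regardless of \<open>k\<close>. This covers the case that \<open>k\<close> is
  too small for two colours.\<close>

lemma prob_small_classes_1:
  "measure_pmf.prob (colour_seeds G 1) (small_classes 1 (radius_bound (size_of G) ecc 1)) = 1"
proof -
  let ?d = "radius_bound (size_of G) ecc 1"
  have "bernoulli_pmf 1 = return_pmf True" by (rule pmf_eqI) (simp add: indicator_def split: split_indicator)
  then have "random_set 1 (edges G) = return_pmf (edges G)"
    using finite_edges[OF graph(1)] by (simp add: random_set_def)
  then have dist: "map_pmf (\<lambda>\<omega>. {e \<in> edges G. edge_colour \<omega> e = 0}) (colour_seeds G 1) = return_pmf (edges G)"
    using colour_class_distribution[of 0 1] by simp
  have "ecc \<le> ?d"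
  proof -
    have "ecc \<le> size_of G" using cover_size by (rule ecc_le)
    also have "1 * size_of G \<le> 15 * bitlen (size_of G) * (size_of G + 1)"
      using bitlen_pos by (intro mult_le_mono) auto
    then have "size_of G \<le> 15 * bitlen (size_of G) * (size_of G + 1)" by simp
    finally have 1: "ecc \<le> 15 * bitlen (size_of G) * (size_of G div 1 + 1)" by simp
    have "ecc < 2 ^ ecc" by (rule less_exp)
    also have "\<dots> \<le> (8 * 1 * (bitlen (size_of G) + ecc) * bitlen (size_of G) + 2) ^ ecc" by (intro power_mono) auto
    finally show ?thesis using 1 by (simp add: radius_bound_def)
  qed
  then have cov: "nodes G \<subseteq> hop_ball (edges G) ?d leader" using cover_ecc hop_ball_mono by blast
  have "small_classes 1 ?d = (\<lambda>\<omega>. {e \<in> edges G. edge_colour \<omega> e = 0}) -` {X. nodes G \<subseteq> hop_ball X ?d leader}"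
    by (auto simp: small_classes_def)
  then have "measure_pmf.prob (colour_seeds G 1) (small_classes 1 ?d) =
      measure_pmf.prob (map_pmf (\<lambda>\<omega>. {e \<in> edges G. edge_colour \<omega> e = 0}) (colour_seeds G 1)) {X. nodes G \<subseteq> hop_ball X ?d leader}"
    by simp
  also have "\<dots> = 1" unfolding dist using cov by simp
  finally show ?thesis .
qed

end

subsection \<open>The number of rounds\<close>

text \<open>The three summands account for the growth of the fragments, for the simulated Boruvka
  steps, and for everything else.\<close>

definition time_const :: "nat \<Rightarrow> nat \<Rightarrow> nat" where
  "time_const B D = 2 * B * (16 * B + 4 * B * D + 3) + (8 * B + 3) + (4 * D + 6 + (D + 1) * (8 * D + 2))"

text \<open>The fourth power of \<open>L\<close> arises because there are at most 2 * B * L ^ 2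
  local phases, and the flooding time within each is again proportional to their number.\<close>

lemma total_time_le:
  assumes L: "1 \<le> L" and Q: "Q \<le> B * L" and h: "h \<le> D" and K: "1 \<le> K"
  shows "Suc ((h + 1) * (8 * h + 2)) + (1 + (d + 1) + 2 * h + solve_time h n L Q S K ds) \<le>
    time_const B D * L ^ 4 * ((S + 1) + n div (K * (S + 1)) + d + ds)"
proof -
  define m where "m = n div (K * (S + 1))"
  define c where "c = (S + 1) + m + d + ds"
  define p where "p = 2 * Q * L"
  have c: "1 \<le> c" "S + 1 \<le> c" "m + ds \<le> c" "d \<le> c" by (auto simp: c_def)
  have p: "p \<le> 2 * B * L ^ 2" using mult_right_mono[OF Q, of "2 * L"] by (simp add: p_def power2_eq_square algebra_simps)
  have pow: "L \<le> L ^ 4" "L ^ 2 \<le> L ^ 4" "L ^ 3 \<le> L ^ 4" "1 \<le> L ^ 4" "L \<le> L ^ 2" "1 \<le> L ^ 2"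
    using L power_increasing[of 1 4 L] power_increasing[of 2 4 L] power_increasing[of 3 4 L]
      power_increasing[of 0 4 L] power_increasing[of 1 2 L] power_increasing[of 0 2 L] by auto
  have div: "(n div (S + 1) + 1) div K \<le> m + 1"
  proof -
    have "(n div (S + 1) + 1) div K \<le> (n div (S + 1) + K) div K" using K by (intro div_le_mono) simp
    also have "\<dots> = n div (S + 1) div K + 1" using K by simp
    also have "n div (S + 1) div K = m" unfolding m_def by (simp add: div_mult2_eq[symmetric] mult.commute)
    finally show ?thesis .
  qed
  have T: "2 * (p * (2 * S + 1)) \<le> 4 * p * c"
  proof -
    have "2 * (p * (2 * S + 1)) \<le> 2 * (p * (2 * c))" using c(2) by (intro mult_left_mono) auto
    then show ?thesis by simp
  qed
  have "4 * Q * h \<le> 4 * B * D * L ^ 2"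
  proof -
    have "Q * h \<le> (B * L) * D" using Q h by (rule mult_le_mono)
    also have "\<dots> \<le> B * D * L ^ 2" using pow(5) by (simp add: mult.assoc mult.commute mult_le_mono)
    finally show ?thesis by simp
  qed
  then have inner: "8 * p + 4 * Q * h + 3 \<le> (16 * B + 4 * B * D + 3) * L ^ 2"
    using p pow(6) by (simp add: algebra_simps)
  have first: "p * (S + 2 * (2 * (p * (2 * S + 1))) + 2 * Q * (2 * h) + 2) \<le> c * (2 * B * (16 * B + 4 * B * D + 3) * L ^ 4)"
  proof -
    have "4 * Q * h \<le> 4 * Q * h * c" using c(1) by simp
    then have "S + 2 * (2 * (p * (2 * S + 1))) + 2 * Q * (2 * h) + 2 \<le> c * (8 * p + 4 * Q * h + 3)"
    proof -
      have "c * (8 * p + 4 * Q * h + 3) = 2 * (4 * p * c) + 4 * Q * h * c + 3 * c" by (simp add: algebra_simps)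
      then show ?thesis using \<open>4 * Q * h \<le> 4 * Q * h * c\<close> T c(1,2) by linarith
    qed
    also have "\<dots> \<le> c * ((16 * B + 4 * B * D + 3) * L ^ 2)" using inner by (rule mult_left_mono) simp
    finally have "p * (S + 2 * (2 * (p * (2 * S + 1))) + 2 * Q * (2 * h) + 2) \<le>
        (2 * B * L ^ 2) * (c * ((16 * B + 4 * B * D + 3) * L ^ 2))" using p by (intro mult_le_mono)
    also have "\<dots> = c * (2 * B * (16 * B + 4 * B * D + 3) * (L ^ 2 * L ^ 2))" by (simp only: ac_simps)
    also have "L ^ 2 * L ^ 2 = L ^ 4" by (simp flip: power_add)
    finally show ?thesis .
  qed
  have last: "L * (2 * (p * (2 * S + 1)) + ((n div (S + 1) + 1) div K + 1 + ds)) \<le> c * ((8 * B + 3) * L ^ 4)"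
  proof -
    have "2 * (p * (2 * S + 1)) + ((n div (S + 1) + 1) div K + 1 + ds) \<le> c * (4 * p + 3)"
      using T div c(1,3) by (simp add: algebra_simps)
    also have "\<dots> \<le> c * ((8 * B + 3) * L ^ 2)"
      using p pow(6) by (intro mult_left_mono) (auto simp: algebra_simps)
    finally have "L * (2 * (p * (2 * S + 1)) + ((n div (S + 1) + 1) div K + 1 + ds)) \<le> L ^ 2 * (c * ((8 * B + 3) * L ^ 2))"
      using pow(5) by (intro mult_le_mono)
    also have "\<dots> = c * ((8 * B + 3) * (L ^ 2 * L ^ 2))" by (simp only: ac_simps)
    also have "L ^ 2 * L ^ 2 = L ^ 4" by (simp flip: power_add)
    finally show ?thesis .
  qed
  have rest: "Suc ((h + 1) * (8 * h + 2)) + (1 + (d + 1) + 2 * h) + (1 + (2 * h + 1)) \<le>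
      c * ((4 * D + 6 + (D + 1) * (8 * D + 2)) * L ^ 4)"
  proof -
    have "(h + 1) * (8 * h + 2) \<le> (D + 1) * (8 * D + 2)" using h by (intro mult_le_mono) auto
    then have "Suc ((h + 1) * (8 * h + 2)) + (1 + (d + 1) + 2 * h) + (1 + (2 * h + 1)) \<le> d + (4 * D + 5 + (D + 1) * (8 * D + 2))"
      using h by linarith
    also have "\<dots> \<le> c * 1 + c * (4 * D + 5 + (D + 1) * (8 * D + 2))"
      using c(1,4) by (intro add_mono) auto
    also have "\<dots> = c * (4 * D + 6 + (D + 1) * (8 * D + 2))" by (simp add: algebra_simps)
    also have "\<dots> \<le> c * ((4 * D + 6 + (D + 1) * (8 * D + 2)) * L ^ 4)"
      using pow(4) by (intro mult_left_mono) (metis mult.right_neutral mult_le_mono2, simp)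
    finally show ?thesis .
  qed
  have "Suc ((h + 1) * (8 * h + 2)) + (1 + (d + 1) + 2 * h + solve_time h n L Q S K ds) \<le>
      c * (2 * B * (16 * B + 4 * B * D + 3) * L ^ 4) + c * ((8 * B + 3) * L ^ 4) +
      c * ((4 * D + 6 + (D + 1) * (8 * D + 2)) * L ^ 4)"
    using first last rest unfolding solve_time_def Let_def p_def[symmetric] by linarith
  also have "\<dots> = time_const B D * L ^ 4 * c" by (simp only: time_const_def algebra_simps)
  finally show ?thesis by (simp only: c_def m_def)
qed

text \<open>Four powers of the bit length come from \<open>max_colours\<close>, the fifth from the
  quality of \<open>a\<close>. If rounding leaves a single colour, then \<open>k\<close> itself is
  at most \<alpha> times the fifth power.\<close>

lemma colours_bound:
  fixes \<alpha> :: real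
  defines "L \<equiv> \<lambda>n. real (bitlen n)"
  assumes k: "0 < k" "k \<le> n" and \<alpha>: "0 < \<alpha>" and a: "real k \<le> \<alpha> * L n * real a"
  shows "real n / real (max_colours n a) \<le> (1 + 2 * \<alpha>) * L n ^ 5 * (real n / real k)"
proof -
  have n: "1 \<le> n" using k by simp
  have L: "1 \<le> L n"
  proof -
    have "bitlen n \<noteq> 0" using less_bitlen[of n] n by (metis less_one not_less power_0)
    then show ?thesis by (simp add: L_def)
  qed
  have nk: "1 \<le> real n / real k" using k by simp
  have L5: "1 \<le> L n ^ 5" using L by (rule one_le_power)
  have le: "2 * \<alpha> * L n ^ 5 * (real n / real k) \<le> (1 + 2 * \<alpha>) * L n ^ 5 * (real n / real k)"
    using L L5 nk by (intro mult_right_mono) auto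
  define q where "q = a div bitlen n ^ 4"
  have aq: "real a < (real q + 1) * L n ^ 4"
  proof -
    have "a < (q + 1) * bitlen n ^ 4"
      unfolding q_def using L by (simp add: L_def dividend_less_div_times)
    then have "real a < real ((q + 1) * bitlen n ^ 4)" by (simp only: of_nat_less_iff)
    then show ?thesis by (simp add: L_def algebra_simps)
  qed
  have kq: "real k \<le> \<alpha> * L n ^ 5 * (real q + 1)"
  proof -
    have "real k \<le> \<alpha> * L n * ((real q + 1) * L n ^ 4)"
      using a aq \<alpha> L by (intro order_trans[OF a] mult_left_mono) auto
    also have "\<dots> = \<alpha> * L n ^ 5 * (real q + 1)" by (simp add: algebra_simps eval_nat_numeral)
    finally show ?thesis .
  qed
  show ?thesis
  proof (cases "q = 0")
    case True
    then have "max_colours n a = 1" by (simp add: max_colours_def q_def)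
    moreover have "real n = real k * (real n / real k)" using k by simp
    moreover have "\<dots> \<le> \<alpha> * L n ^ 5 * (real n / real k)" using kq True nk by (intro mult_right_mono) auto
    moreover have "\<dots> \<le> 2 * \<alpha> * L n ^ 5 * (real n / real k)" using \<alpha> L L5 nk by (intro mult_right_mono) auto
    ultimately show ?thesis using le by simp
  next
    case False
    then have q: "1 \<le> q" by simp
    then have M: "max_colours n a = min n q" using n by (simp add: max_colours_def q_def[symmetric])
    show ?thesis
    proof (cases "n \<le> q")
      case True
      have "1 * 1 \<le> ((1 + 2 * \<alpha>) * L n ^ 5) * (real n / real k)"
        using nk L5 \<alpha> mult_mono[of 1 "1 + 2 * \<alpha>" 1 "L n ^ 5"] by (intro mult_mono) auto
      then show ?thesis using M True n by (simp add: min_def)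
    next
      case False
      have "\<alpha> * L n ^ 5 * (real q + 1) \<le> \<alpha> * L n ^ 5 * (2 * real q)"
        using q \<alpha> L5 L by (intro mult_left_mono) auto
      then have "real k \<le> 2 * \<alpha> * L n ^ 5 * real q" using kq by simp
      then have "real n / real q \<le> 2 * \<alpha> * L n ^ 5 * (real n / real k)"
        using q k by (simp add: field_simps)
      then show ?thesis using M False le by (simp add: min_def)
    qed
  qed
qed

text \<open>By minimality it suffices to evaluate the cost at one admissible pair for each bound.
  The second pair is tuned to \<open>h\<close> instead of \<open>D\<close>; this does no harm, since
  h / (2 * h + 1) increases with h.\<close>

lemma best_cost_bound:
  fixes \<alpha> :: real
  defines "L \<equiv> \<lambda>n. real (bitlen n)"
  assumes k: "0 < k" "k \<le> n" and \<alpha>: "0 < \<alpha>" and a: "real k \<le> \<alpha> * L n * real a"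
    and h: "h \<le> D" "h \<le> D0"
  shows "real (cost n h (best_params n h a)) \<le> (32 * (1 + 2 * \<alpha>) + 6 + (10 * (1 + real D0)) ^ D0) * L n ^ (6 + 2 * D0) *
    min (sqrt (real n / real k) + real n powr (real D / (2 * real D + 1))) (real n / real k)"
proof -
  let ?C = "32 * (1 + 2 * \<alpha>) + 6 + (10 * (1 + real D0)) ^ D0"
  have n: "1 \<le> n" using k by simp
  have L: "1 \<le> L n"
  proof -
    have "bitlen n \<noteq> 0" using less_bitlen[of n] n by (metis less_one not_less power_0)
    then show ?thesis by (simp add: L_def)
  qed
  define M where "M = max_colours n a"
  have M: "1 \<le> M" "M \<le> n" using n by (auto simp: M_def max_colours_def)
  have nM: "real n / real M \<le> (1 + 2 * \<alpha>) * L n ^ 5 * (real n / real k)"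
    using colours_bound[OF k \<alpha> a[unfolded L_def]] unfolding L_def M_def .
  have Lp: "1 \<le> L n ^ i" for i using L by (rule one_le_power)
  have Lmono: "L n ^ i \<le> L n ^ (6 + 2 * D0)" if "i \<le> 6 + 2 * D0" for i using L that by (rule power_increasing[rotated])
  have C: "0 \<le> ?C" "32 * (1 + 2 * \<alpha>) \<le> ?C" "3 * (1 + 2 * \<alpha>) \<le> ?C" "6 + (10 * (1 + real D0)) ^ D0 \<le> ?C"
    using \<alpha> by (auto intro: add_nonneg_nonneg)
  have A: "real (cost n h (best_params n h a)) \<le> ?C * L n ^ (6 + 2 * D0) * (real n / real k)"
  proof -
    have "cost n h (best_params n h a) \<le> cost n h (M, 0)"
      using M by (intro best_params(2)) (auto simp: admissible_def M_def)
    also have "\<dots> \<le> 1 + n div M + 15 * bitlen n * (n div M + 1)" by (simp add: cost_def radius_bound_def)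
    finally have "real (cost n h (best_params n h a)) \<le> real (1 + n div M + 15 * bitlen n * (n div M + 1))"
      by (simp only: of_nat_le_iff)
    also have "\<dots> = 1 + real (n div M) + 15 * L n * (real (n div M) + 1)" by (simp add: L_def algebra_simps)
    also have "\<dots> \<le> L n * (real n / real M) + L n * (real n / real M) + 15 * L n * (real n / real M + real n / real M)"
    proof -
      have x: "real (n div M) \<le> real n / real M" "1 \<le> real n / real M" using M by (auto simp: of_nat_div_le_of_nat le_divide_eq_1)
      have "1 * 1 \<le> L n * (real n / real M)" using L x by (intro mult_mono) auto
      moreover have "1 * (real n / real M) \<le> L n * (real n / real M)" using L x by (intro mult_right_mono) auto
      moreover have "15 * L n * (real (n div M) + 1) \<le> 15 * L n * (real n / real M + real n / real M)"
        using L x by (intro mult_left_mono add_mono) auto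
      ultimately show ?thesis using x by linarith
    qed
    also have "\<dots> = 32 * L n * (real n / real M)" by (simp add: algebra_simps)
    also have "\<dots> \<le> 32 * L n * ((1 + 2 * \<alpha>) * L n ^ 5 * (real n / real k))" using nM L by (intro mult_left_mono) auto
    also have "\<dots> = 32 * (1 + 2 * \<alpha>) * L n ^ 6 * (real n / real k)" by (simp add: algebra_simps eval_nat_numeral)
    also have "\<dots> \<le> ?C * L n ^ (6 + 2 * D0) * (real n / real k)"
      using C Lmono[of 6] Lp by (intro mult_right_mono mult_mono) auto
    finally show ?thesis .
  qed
  have B: "real (cost n h (best_params n h a)) \<le> ?C * L n ^ (6 + 2 * D0) *
      (sqrt (real n / real k) + real n powr (real D / (2 * real D + 1)))"
  proof -
    \<comment> \<open>The ideal number of colours, for which r ^ h = sqrt (n / r); both sides equal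
      \<open>y\<close> below.\<close>
    define r where "r = real n powr (1 / (2 * real h + 1))"
    define y where "y = real n powr (real h / (2 * real h + 1))"
    define Y where "Y = real n powr (real D / (2 * real D + 1))"
    have r: "1 \<le> r" unfolding r_def using n by (intro ge_one_powr_ge_zero) auto
    have y: "r ^ h = y" unfolding r_def y_def using n by (simp add: powr_realpow[symmetric] powr_powr)
    have yY: "y \<le> Y"
    proof -
      have "real h / (2 * real h + 1) \<le> real D / (2 * real D + 1)" using h(1) by (simp add: frac_le_eq divide_le_0_iff field_simps)
      then show ?thesis unfolding y_def Y_def using n by (intro powr_mono) auto
    qed
    have y1: "1 \<le> y" unfolding y_def using n by (intro ge_one_powr_ge_zero) auto
    define f where "f = nat \<lfloor>r\<rfloor>"
    have f: "1 \<le> f" "real f \<le> r" "r \<le> 2 * real f"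
    proof -
      show "1 \<le> f" using r by (simp add: f_def le_nat_floor)
      show "real f \<le> r" using r by (simp add: f_def)
      have "r < real f + 1" using r by (simp add: f_def)
      then show "r \<le> 2 * real f" using \<open>1 \<le> f\<close> by linarith
    qed
    define K where "K = min M f"
    have K: "1 \<le> K" "K \<le> M" "real K \<le> r" using M f by (auto simp: K_def)
    define s where "s = sqrt (real n / real K)"
    have nK: "1 \<le> real n / real K" using K M by simp
    have s1: "1 \<le> s" unfolding s_def using nK by simp
    have s2: "s * s = real n / real K" unfolding s_def using nK by simp
    define S where "S = nat \<lfloor>s\<rfloor>"
    have S: "real S \<le> s" "s \<le> real S + 1" using s1 by (auto simp: S_def)
    have "cost n h (best_params n h a) \<le> cost n h (K, S)"
      using K by (intro best_params(2)) (auto simp: admissible_def M_def)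
    also have "\<dots> \<le> (S + 1) + n div (K * (S + 1)) + (8 * K * (bitlen n + h) * bitlen n + 2) ^ h"
      by (simp add: cost_def radius_bound_def)
    finally have "real (cost n h (best_params n h a)) \<le>
        real ((S + 1) + n div (K * (S + 1)) + (8 * K * (bitlen n + h) * bitlen n + 2) ^ h)"
      by (simp only: of_nat_le_iff)
    also have "\<dots> = real S + 1 + real (n div (K * (S + 1))) + (8 * real K * (L n + real h) * L n + 2) ^ h"
      by (simp add: L_def add.commute)
    also have "\<dots> \<le> 3 * s + (10 * (1 + real D0)) ^ D0 * L n ^ (2 * D0) * y"
    proof -
      have "real (n div (K * (S + 1))) \<le> real n / real (K * (S + 1))" by (rule of_nat_div_le_of_nat)
      also have "\<dots> = s * s / (real S + 1)" unfolding s2 by (simp add: field_simps)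
      also have "\<dots> \<le> s * s / s" using S s1 by (intro divide_left_mono) auto
      also have "\<dots> = s" using s1 by simp
      finally have 1: "real (n div (K * (S + 1))) \<le> s" .
      have "8 * real K * (L n + real h) * L n + 2 \<le> 10 * (1 + real D0) * L n ^ 2 * real K"
      proof -
        have "real h * L n \<le> real D0 * L n ^ 2"
          using h(2) L self_le_power[of "L n" 2] by (intro mult_mono) auto
        then have "real K * (real h * L n) \<le> real K * (real D0 * L n ^ 2)" by (intro mult_left_mono) auto
        moreover have "1 * 1 \<le> real K * L n ^ 2" using K Lp[of 2] by (intro mult_mono) auto
        moreover have "0 \<le> real K * (real D0 * L n ^ 2)" by simp
        ultimately show ?thesis by (simp add: algebra_simps power2_eq_square)
      qed
      then have "(8 * real K * (L n + real h) * L n + 2) ^ h \<le> (10 * (1 + real D0) * L n ^ 2 * real K) ^ h"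
        using L by (intro power_mono) auto
      also have "\<dots> = (10 * (1 + real D0) * L n ^ 2) ^ h * real K ^ h" by (simp only: power_mult_distrib)
      also have "\<dots> \<le> (10 * (1 + real D0) * L n ^ 2) ^ D0 * y"
      proof (rule mult_mono)
        have "1 * 1 \<le> (10 * (1 + real D0)) * L n ^ 2" using Lp[of 2] by (intro mult_mono) auto
        then show "(10 * (1 + real D0) * L n ^ 2) ^ h \<le> (10 * (1 + real D0) * L n ^ 2) ^ D0"
          using h(2) by (intro power_increasing) auto
        show "real K ^ h \<le> y" unfolding y[symmetric] using K(3) by (intro power_mono) auto
      qed (use L in auto)
      also have "\<dots> = (10 * (1 + real D0)) ^ D0 * L n ^ (2 * D0) * y" by (simp add: power_mult_distrib power_mult)
      finally show ?thesis using 1 S s1 by linarith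
    qed
    also have "\<dots> \<le> 3 * ((1 + 2 * \<alpha>) * L n ^ 5 * sqrt (real n / real k) + 2 * y) + (10 * (1 + real D0)) ^ D0 * L n ^ (2 * D0) * y"
    proof -
      \<comment> \<open>If \<open>M\<close> limits the number of colours, sqrt (n / K) is of order
        sqrt (n / k) up to logarithms, otherwise of order \<open>y\<close>; the sum covers both
        cases.\<close>
      have "real n / real K \<le> real n / real M + real n / real f"
        by (cases "M \<le> f") (auto simp: K_def min_def)
      also have "real n / real f \<le> 2 * (real n / r)"
        using f r mult_right_mono[OF f(3), of "real n"] by (simp add: field_simps)
      also have "real n / r = y * y"
      proof -
        have "y * y * r = real n powr (real h / (2 * real h + 1) + real h / (2 * real h + 1) + 1 / (2 * real h + 1))"
          unfolding y_def r_def by (simp only: powr_add)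
        also have "real h / (2 * real h + 1) + real h / (2 * real h + 1) + 1 / (2 * real h + 1) = 1"
          by (simp add: add_divide_distrib[symmetric])
        finally show ?thesis using r n by (simp add: field_simps)
      qed
      finally have "s \<le> sqrt ((1 + 2 * \<alpha>) * L n ^ 5 * (real n / real k) + 2 * (y * y))"
        unfolding s_def using nM by (intro real_sqrt_le_mono) linarith
      also have "\<dots> \<le> sqrt ((1 + 2 * \<alpha>) * L n ^ 5 * (real n / real k)) + sqrt (2 * (y * y))"
        using \<alpha> L y1 by (intro sqrt_add_le_add_sqrt) auto
      finally have split: "s \<le> sqrt ((1 + 2 * \<alpha>) * L n ^ 5 * (real n / real k)) + sqrt (2 * (y * y))" .
      have root1: "sqrt ((1 + 2 * \<alpha>) * L n ^ 5 * (real n / real k)) \<le> (1 + 2 * \<alpha>) * L n ^ 5 * sqrt (real n / real k)"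
      proof -
        let ?u = "(1 + 2 * \<alpha>) * L n ^ 5"
        have u: "1 * 1 \<le> ?u" using \<alpha> Lp[of 5] by (intro mult_mono) auto
        then have "sqrt ?u \<le> sqrt (?u * ?u)" by (intro real_sqrt_le_mono) (auto intro: mult_left_le_one_le mult_right_mono simp: mult_le_cancel_left1)
        then have "sqrt ?u \<le> ?u" using u by simp
        then show ?thesis by (simp only: real_sqrt_mult) (intro mult_right_mono, auto)
      qed
      have root2: "sqrt (2 * (y * y)) \<le> 2 * y"
        using y1 by (intro real_le_lsqrt) (auto simp: power2_eq_square)
      have "s \<le> (1 + 2 * \<alpha>) * L n ^ 5 * sqrt (real n / real k) + 2 * y"
        using split add_mono[OF root1 root2] by (rule order_trans)
      then show ?thesis by (intro add_right_mono mult_left_mono) auto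
    qed
    also have "\<dots> = 3 * (1 + 2 * \<alpha>) * L n ^ 5 * sqrt (real n / real k) +
        (6 + (10 * (1 + real D0)) ^ D0 * L n ^ (2 * D0)) * y" by (simp add: algebra_simps)
    also have "\<dots> \<le> ?C * L n ^ (6 + 2 * D0) * sqrt (real n / real k) + ?C * L n ^ (6 + 2 * D0) * Y"
    proof (rule add_mono)
      show "3 * (1 + 2 * \<alpha>) * L n ^ 5 * sqrt (real n / real k) \<le> ?C * L n ^ (6 + 2 * D0) * sqrt (real n / real k)"
        using C Lmono[of 5] L \<alpha> by (intro mult_right_mono mult_mono) auto
      have "(6 + (10 * (1 + real D0)) ^ D0 * L n ^ (2 * D0)) \<le> 6 * L n ^ (6 + 2 * D0) + (10 * (1 + real D0)) ^ D0 * L n ^ (6 + 2 * D0)"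
        using Lp[of "6 + 2 * D0"] Lmono[of "2 * D0"] by (intro add_mono mult_left_mono) auto
      also have "\<dots> = (6 + (10 * (1 + real D0)) ^ D0) * L n ^ (6 + 2 * D0)" by (simp add: algebra_simps)
      also have "\<dots> \<le> ?C * L n ^ (6 + 2 * D0)" using C(4) L by (intro mult_right_mono) auto
      finally show "(6 + (10 * (1 + real D0)) ^ D0 * L n ^ (2 * D0)) * y \<le> ?C * L n ^ (6 + 2 * D0) * Y"
        using yY y1 C L by (intro mult_mono) auto
    qed
    finally show ?thesis unfolding Y_def by (simp add: algebra_simps)
  qed
  show ?thesis
  proof (cases "sqrt (real n / real k) + real n powr (real D / (2 * real D + 1)) \<le> real n / real k")
    case True
    then show ?thesis using B by (simp add: min_def)
  next
    case False
    then show ?thesis using A by (simp add: min_def)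
  qed
qed

section \<open>Comparison with the diameter and time bounds for all graphs\<close>

lemma relpow_hop_ball: "(v, u) \<in> adjacency F ^^ t \<Longrightarrow> u \<in> hop_ball F t v"
proof (induction t arbitrary: u)
  case (Suc t)
  then obtain w where "(v, w) \<in> adjacency F ^^ t" "(w, u) \<in> adjacency F" by auto
  then have "w \<in> hop_ball F t v" "u \<in> hop_ball F 1 w"
    using Suc.IH hop_ball_edge[of w u F] by (auto simp: adjacency_def)
  from hop_ball_trans[OF this] show ?case by simp
qed simp

lemma bitlen_lower: "0 < n \<Longrightarrow> 2 ^ (bitlen n - 1) \<le> n"
  using bitlen_le[of n "bitlen n - 1"] less_bitlen[of n] by (cases "bitlen n") (auto simp: not_less[symmetric])

lemma bitlen_le_log: "0 < n \<Longrightarrow> real (bitlen n) \<le> log 2 (real n) + 1"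
proof -
  assume n: "0 < n"
  have "log 2 (real (2 ^ (bitlen n - 1))) \<le> log 2 (real n)"
    using bitlen_lower[OF n] n by (subst log_le_cancel_iff) (auto simp del: of_nat_power)
  then show ?thesis by (simp add: log_nat_power)
qed

text \<open>Used with m = L - 1, where 2 ^ m is a lower bound for n, to obtain 10 * L \<le>
  n.\<close>

lemma linear_le_exponential: "8 \<le> m \<Longrightarrow> 10 * Suc m \<le> 2 ^ m" for m :: nat
  by (induction m rule: dec_induct) auto

context network
begin

lemma ecc_le_hop_diameter: "ecc \<le> hop_diameter G"
proof (rule ecc_le, rule subsetI)
  fix v assume v: "v \<in> nodes G"
  let ?l = "hop_dist G leader v"
  have "(leader, v) \<in> (adjacency (edges G))\<^sup>*" using graph(2) leader_node v by (simp add: connects_def)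
  then have "(leader, v) \<in> adjacency (edges G) ^^ ?l"
    unfolding hop_dist_def by (rule LeastI_ex[OF rtrancl_imp_relpow])
  then have "v \<in> hop_ball (edges G) ?l leader" by (rule relpow_hop_ball)
  moreover have "?l \<le> hop_diameter G"
    unfolding hop_diameter_def using finite_nodes leader_node v by (intro Max_ge) auto
  ultimately show "v \<in> hop_ball (edges G) (hop_diameter G) leader" using hop_ball_mono by blast
qed

lemma t_prelim_le: "t_prelim \<le> (ecc + 1) * (8 * ecc + 2)"
  using sum_bounded_above[of "{..ecc}" "\<lambda>d. if d < ecc then 3 * d + 1 else 8 * ecc + 2" "8 * ecc + 2"]
  by (simp add: t_prelim_def)

lemma id_bits_le:
  assumes "\<And>v. v \<in> nodes G \<Longrightarrow> v \<le> size_of G ^ b"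
  shows "id_bits \<le> (b + 2) * bitlen (size_of G)"
proof -
  let ?L = "bitlen (size_of G)"
  have "Max (nodes G) \<le> size_of G ^ b" using assms finite_nodes nodes_nonempty by simp
  also have "\<dots> \<le> (2 ^ ?L) ^ b" using less_bitlen[of "size_of G"] by (intro power_mono) auto
  also have "\<dots> < 2 ^ (?L * b + 1)" by (simp add: power_mult[symmetric])
  finally have "bitlen (Max (nodes G)) \<le> ?L * b + 1" by (rule bitlen_le)
  then show ?thesis using bitlen_pos by (simp add: id_bits_def algebra_simps)
qed

lemma good_time_le:
  assumes "id_bits \<le> B * bitlen (size_of G)" "ecc \<le> D0"
  shows "Suc t_prelim + t_good a \<le>
    time_const B D0 * bitlen (size_of G) ^ 4 * (5 * cost (size_of G) ecc (best_params (size_of G) ecc a))"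
proof -
  define n where "n = size_of G"
  define L where "L = bitlen n"
  define K where "K = num_colours n ecc a"
  define S where "S = snd (best_params n ecc a)"
  define d where "d = radius_bound n ecc K"
  have cost: "cost n ecc (best_params n ecc a) = (S + 1) + n div (K * (S + 1)) + d"
    by (simp add: cost_def K_def S_def d_def num_colours_def split: prod.splits)
  have "Suc t_prelim + t_good a \<le> Suc ((ecc + 1) * (8 * ecc + 2)) +
      (1 + (d + 1) + 2 * ecc + solve_time ecc n L id_bits S K (2 * (d + 1)))"
    using t_prelim_le unfolding t_good_def Let_def by (simp add: n_def L_def K_def S_def d_def)
  also have "\<dots> \<le> time_const B D0 * L ^ 4 * ((S + 1) + n div (K * (S + 1)) + d + 2 * (d + 1))"
    using assms bitlen_pos num_colours_bounds(1)[of n ecc a]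
    by (intro total_time_le) (auto simp: n_def L_def K_def)
  also have "\<dots> \<le> time_const B D0 * L ^ 4 * (5 * cost n ecc (best_params n ecc a))"
    unfolding cost by (intro mult_left_mono) simp_all
  finally show ?thesis by (simp only: L_def n_def)
qed

lemma best_cost_le:
  "cost n h (best_params n h a) \<le> 1 + n + 15 * bitlen n * (n + 1)"
proof -
  have "cost n h (best_params n h a) \<le> cost n h (1, 0)"
    by (rule best_params(2)) (simp add: admissible_def max_colours_def)
  also have "\<dots> \<le> 1 + n + 15 * bitlen n * (n + 1)" by (simp add: cost_def radius_bound_def)
  finally show ?thesis .
qed

lemma max_time_le:
  assumes "id_bits \<le> B * bitlen (size_of G)" "ecc \<le> D0"
  shows "Suc t_prelim + max (t_good a) (t_bad a) \<le> time_const B D0 * bitlen (size_of G) ^ 4 *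
    (5 * (1 + size_of G + 15 * bitlen (size_of G) * (size_of G + 1)) + 2 * D0)"
proof -
  define n where "n = size_of G"
  define L where "L = bitlen n"
  define K where "K = num_colours n ecc a"
  define d where "d = radius_bound n ecc K"
  define z where "z = 1 + n + 15 * L * (n + 1)"
  have z: "cost n ecc (best_params n ecc a) \<le> z" unfolding z_def L_def by (rule best_cost_le)
  then have d: "d \<le> z" by (simp add: cost_def K_def d_def num_colours_def split: prod.splits)
  have "Suc t_prelim + t_bad a \<le> Suc ((ecc + 1) * (8 * ecc + 2)) +
      (1 + (d + 1) + 2 * ecc + solve_time ecc n L id_bits 0 1 (2 * ecc))"
    using t_prelim_le unfolding t_bad_def Let_def by (simp add: n_def L_def K_def d_def)
  also have "\<dots> \<le> time_const B D0 * L ^ 4 * ((0 + 1) + n div (1 * (0 + 1)) + d + 2 * ecc)"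
    using assms bitlen_pos by (intro total_time_le) (auto simp: n_def L_def)
  also have "\<dots> \<le> time_const B D0 * L ^ 4 * (5 * z + 2 * D0)"
    using d assms(2) by (intro mult_left_mono) (auto simp: z_def)
  finally have bad: "Suc t_prelim + t_bad a \<le> time_const B D0 * L ^ 4 * (5 * z + 2 * D0)" .
  have "Suc t_prelim + t_good a \<le> time_const B D0 * L ^ 4 * (5 * cost n ecc (best_params n ecc a))"
    using good_time_le[OF assms] by (simp only: n_def L_def)
  also have "\<dots> \<le> time_const B D0 * L ^ 4 * (5 * z + 2 * D0)"
    using z by (intro mult_left_mono) auto
  finally show ?thesis using bad by (auto simp: max_def z_def L_def n_def)
qed

end

text \<open>Beyond this bit length \<open>L\<close>, the 8 gives 10 * L \<le> 2 ^ (L - 1),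
  \<open>D\<close> bounds the eccentricity by \<open>L\<close>, and the last entry lets the spare
  logarithm of \<open>max_colours\<close> absorb 30 * \<alpha>.\<close>

definition threshold :: "real \<Rightarrow> nat \<Rightarrow> nat" where
  "threshold \<alpha> D = max 8 (max D (nat \<lceil>30 * \<alpha>\<rceil>))"

definition small_time :: "nat \<Rightarrow> nat \<Rightarrow> nat \<Rightarrow> nat" where
  "small_time B D l = time_const B D * l ^ 4 * (5 * (1 + 2 ^ l + 15 * l * (2 ^ l + 1)) + 2 * D)"

text \<open>The second summand pays for graphs whose bit length is at most the threshold; their
  worst-case time is bounded by a constant.\<close>

definition round_const :: "real \<Rightarrow> nat \<Rightarrow> nat \<Rightarrow> real" where
  "round_const \<alpha> B D = 5 * real (time_const B D) * (32 * (1 + 2 * \<alpha>) + 6 + (10 * (1 + real D)) ^ D) +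
     real (small_time B D (threshold \<alpha> D))"

context connected_network
begin

lemma k_le_size: "k \<le> size_of G"
proof -
  have "k \<le> card (nbrs G leader)" using leader_node by (rule card_nbrs)
  also have "\<dots> \<le> size_of G" using finite_nodes graph(1)
    by (intro card_mono) (auto simp: nbrs_def simple_graph_def)
  finally show ?thesis .
qed

text \<open>From K * L ^ 4 \<le> a \<le> \<alpha> * L * k follows K * L ^ 3 \<le> \<alpha> * k, and
  30 * \<alpha> \<le> L turns this into 30 * K * L ^ 2 \<le> k. As \<open>ecc\<close> is at most
  \<open>L\<close>, this is what \<open>prob_small_classes\<close> demands of two or more
  colours.\<close>

lemma prob_small_classes_num_colours:
  fixes \<alpha> :: real
  defines "n \<equiv> size_of G"
  defines "L \<equiv> bitlen n"
  assumes \<alpha>: "0 < \<alpha>" and a: "real a \<le> \<alpha> * real L * real k" and D: "ecc \<le> D" and large: "threshold \<alpha> D < L"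
  shows "1 - 1 / real n \<le> measure_pmf.prob (colour_seeds G (num_colours n ecc a))
    (small_classes (num_colours n ecc a) (radius_bound n ecc (num_colours n ecc a)))"
proof -
  define K where "K = num_colours n ecc a"
  have K: "0 < K" "K \<le> max_colours n a" unfolding K_def by (rule num_colours_bounds)+
  have L: "9 \<le> L" "ecc \<le> L" "30 * \<alpha> \<le> real L"
    using large D by (auto simp: threshold_def max_def split: if_splits; linarith)+
  show ?thesis
  proof (cases "2 \<le> K")
    case True
    have KL: "K \<le> n" "K \<le> a div L ^ 4" using K(2) True by (auto simp: max_colours_def L_def)
    have "0 < n" using K(1) KL(1) by simp
    have "8 * L + 2 * ecc \<le> 10 * L" using L(2) by simp
    also have "\<dots> \<le> 2 ^ (L - 1)" using L(1) linear_le_exponential[of "L - 1"] by simp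
    also have "\<dots> \<le> n" unfolding L_def using \<open>0 < n\<close> by (rule bitlen_lower)
    finally have big: "8 * L + 2 * ecc \<le> n" .
    have "K * L ^ 4 \<le> a" using mult_right_mono[OF KL(2), of "L ^ 4"] by (meson div_times_less_eq_dividend le_trans zero_le)
    then have "real (K * L ^ 4) \<le> real a" by (simp only: of_nat_le_iff)
    then have "(real K * real L ^ 3) * real L \<le> (\<alpha> * real k) * real L" using a by (simp add: eval_nat_numeral algebra_simps)
    then have 1: "real K * real L ^ 3 \<le> \<alpha> * real k" using L(1) by (simp add: mult_le_cancel_right)
    have "\<alpha> * (30 * real K * real L ^ 2) = real K * real L ^ 2 * (30 * \<alpha>)" by simp
    also have "\<dots> \<le> real K * real L ^ 2 * real L" using L(3) by (rule mult_left_mono) simp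
    also have "\<dots> \<le> \<alpha> * real k" using 1 by (simp add: eval_nat_numeral algebra_simps)
    finally have "30 * real K * real L ^ 2 \<le> real k" using \<alpha> by (rule mult_left_le_imp_le)
    then have "real (30 * K * L ^ 2) \<le> real k" by simp
    then have "30 * K * L ^ 2 \<le> k" by (simp only: of_nat_le_iff)
    moreover have "10 * K * (2 * L + ecc) * L \<le> 10 * K * (2 * L + L) * L" using L(2) by (intro mult_right_mono mult_left_mono) auto
    moreover have "10 * K * (2 * L + L) * L = 30 * K * L ^ 2" by (simp add: power2_eq_square)
    ultimately have "10 * K * (2 * L + ecc) * L \<le> k" by linarith
    from prob_small_classes[OF True KL(1)[unfolded n_def] this[unfolded L_def n_def] big[unfolded L_def n_def]]
    show ?thesis by (simp only: n_def K_def)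
  next
    case False
    then have "K = 1" using K(1) by simp
    show ?thesis unfolding K_def[symmetric] \<open>K = 1\<close> unfolding n_def prob_small_classes_1 by simp
  qed
qed

text \<open>Above the threshold the good time is reached with high probability: four powers of
  \<open>L\<close> stem from the running time and the others from the cost. Below it the worst-case
  time is a constant, which the bound exceeds because its other factors are at least 1.\<close>

lemma mst_algorithm_time:
  fixes \<alpha> :: real
  defines "n \<equiv> size_of G"
  defines "L \<equiv> real (bitlen n)"
  assumes \<alpha>: "0 < \<alpha>" and a: "real a \<le> \<alpha> * L * real k" "real k \<le> \<alpha> * L * real a"
    and D: "hop_diameter G \<le> D0" and ids: "\<And>v. v \<in> nodes G \<Longrightarrow> v \<le> n ^ b"
    and X: "2 * X + 2 \<le> 2 ^ l"
  shows "computes_mst_within mst_algorithm G a (round_const \<alpha> (b + 2) D0 * L ^ (10 + 2 * D0) *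
      min (sqrt (real n / real k) + real n powr (real (hop_diameter G) / (2 * real (hop_diameter G) + 1))) (real n / real k))
    (1 - 1 / real n)"
proof -
  let ?D = "hop_diameter G" and ?T = "time_const (b + 2) D0"
  let ?m = "min (sqrt (real n / real k) + real n powr (real ?D / (2 * real ?D + 1))) (real n / real k)"
  let ?Z = "32 * (1 + 2 * \<alpha>) + 6 + (10 * (1 + real D0)) ^ D0"
  have kn: "k \<le> n" unfolding n_def by (rule k_le_size)
  have n: "1 \<le> n" using kn k_pos by simp
  have L: "1 \<le> L" unfolding L_def n_def using bitlen_pos by simp
  have h: "ecc \<le> ?D" "ecc \<le> D0" using ecc_le_hop_diameter D by auto
  have Q: "id_bits \<le> (b + 2) * bitlen (size_of G)" using ids unfolding n_def by (rule id_bits_le)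
  have nk: "1 \<le> real n / real k" using kn k_pos by simp
  have m: "1 \<le> ?m"
  proof -
    have "1 \<le> sqrt (real n / real k)" using nk by simp
    moreover have "0 \<le> real n powr (real ?D / (2 * real ?D + 1))" by simp
    ultimately have "1 \<le> sqrt (real n / real k) + real n powr (real ?D / (2 * real ?D + 1))" by linarith
    then show ?thesis using nk by (rule min.boundedI)
  qed
  have Lp: "1 \<le> L ^ (10 + 2 * D0)" using L by (rule one_le_power)
  have Z: "0 \<le> ?Z" using \<alpha> by (auto intro!: add_nonneg_nonneg)
  have split: "round_const \<alpha> (b + 2) D0 * L ^ (10 + 2 * D0) * ?m =
      5 * real ?T * ?Z * L ^ (10 + 2 * D0) * ?m + real (small_time (b + 2) D0 (threshold \<alpha> D0)) * (L ^ (10 + 2 * D0) * ?m)"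
    by (simp add: round_const_def algebra_simps)
  show ?thesis
  proof (cases "threshold \<alpha> D0 < bitlen n")
    case True
    let ?c = "cost n ecc (best_params n ecc a)"
    have "real (Suc t_prelim + t_good a) \<le> real (?T * bitlen n ^ 4 * (5 * ?c))"
      using good_time_le[OF Q h(2)] unfolding n_def of_nat_le_iff .
    also have "\<dots> = 5 * real ?T * L ^ 4 * real ?c" by (simp add: L_def)
    also have "\<dots> \<le> 5 * real ?T * L ^ 4 * (?Z * L ^ (6 + 2 * D0) * ?m)"
      using best_cost_bound[OF k_pos kn \<alpha> a(2)[unfolded L_def] h] L unfolding L_def[symmetric]
      by (intro mult_left_mono) auto
    also have "\<dots> = 5 * real ?T * ?Z * (L ^ 4 * L ^ (6 + 2 * D0)) * ?m" by (simp only: ac_simps)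
    also have "L ^ 4 * L ^ (6 + 2 * D0) = L ^ (10 + 2 * D0)" by (simp flip: power_add)
    also have "5 * real ?T * ?Z * L ^ (10 + 2 * D0) * ?m \<le> round_const \<alpha> (b + 2) D0 * L ^ (10 + 2 * D0) * ?m"
      unfolding split using m Lp by simp
    finally have "real (Suc t_prelim + t_good a) \<le> round_const \<alpha> (b + 2) D0 * L ^ (10 + 2 * D0) * ?m" .
    moreover have "1 - 1 / real n \<le>
        measure_pmf.prob (run mst_algorithm G a (Suc t_prelim + t_good a)) {H. mst_computed mst_algorithm G a H}"
      using prob_small_classes_num_colours[OF \<alpha> a(1)[unfolded L_def n_def] h(2) True[unfolded n_def]]
        mst_algorithm_run(2)[OF X, of a] unfolding n_def by (rule order_trans)
    ultimately show ?thesis unfolding computes_mst_within_def by blast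
  next
    case False
    define l0 where "l0 = threshold \<alpha> D0"
    have Ll: "bitlen n \<le> l0" using False by (simp add: l0_def)
    have nl: "n \<le> 2 ^ l0"
      using less_imp_le[OF less_bitlen[of n]] by (rule order_trans) (intro power_increasing Ll, simp)
    have "Suc t_prelim + max (t_good a) (t_bad a) \<le> ?T * bitlen n ^ 4 * (5 * (1 + n + 15 * bitlen n * (n + 1)) + 2 * D0)"
      unfolding n_def by (rule max_time_le[OF Q h(2)])
    also have "\<dots> \<le> small_time (b + 2) D0 l0"
      unfolding small_time_def using Ll nl
      by (intro mult_le_mono add_le_mono power_mono order_refl) auto
    finally have "real (Suc t_prelim + max (t_good a) (t_bad a)) \<le> real (small_time (b + 2) D0 l0)" by (simp only: of_nat_le_iff)
    also have "\<dots> \<le> real (small_time (b + 2) D0 l0) * (L ^ (10 + 2 * D0) * ?m)"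
      using mult_left_mono[OF mult_mono[OF Lp m], of "real (small_time (b + 2) D0 l0)"] Lp by simp
    also have "\<dots> \<le> round_const \<alpha> (b + 2) D0 * L ^ (10 + 2 * D0) * ?m"
      unfolding split l0_def using m Lp Z by (simp only: le_add_same_cancel2) (intro mult_nonneg_nonneg, auto)
    finally have "real (Suc t_prelim + max (t_good a) (t_bad a)) \<le> round_const \<alpha> (b + 2) D0 * L ^ (10 + 2 * D0) * ?m" .
    moreover have "1 - 1 / real n \<le> measure_pmf.prob (run mst_algorithm G a (Suc t_prelim + max (t_good a) (t_bad a)))
        {H. mst_computed mst_algorithm G a H}"
      unfolding mst_algorithm_run(3)[OF X] by simp
    ultimately show ?thesis unfolding computes_mst_within_def by blast
  qed
qed

lemma mst_algorithm_bandwidth: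
  assumes X: "2 * X + 2 \<le> 2 ^ l" and l: "real (8 * (2 * l + 1)) \<le> B * log 2 (real (size_of G))"
  shows "respects_bandwidth B mst_algorithm G a"
  unfolding respects_bandwidth_def
proof (intro allI ballI, clarify)
  fix t H v r msgs u
  assume "H \<in> set_pmf (run mst_algorithm G a t)" "v \<in> nodes G" "(r, msgs) \<in> set (H v)"
  from mst_algorithm_run(1)[OF X this, of u] have "real (length (msgs u)) \<le> real (8 * (2 * l + 1))"
    by (simp only: of_nat_le_iff)
  then show "real (length (msgs u)) \<le> B * log 2 (real (size_of G))" using l by (rule order_trans)
qed

end

theorem theorem1p6:
  shows "\<exists>A :: congest_algorithm. \<exists>c :: real. c > 0 \<and>
    (\<forall>(D0 :: nat) (c0 :: real) (\<alpha> :: real) (b :: nat). c0 > 0 \<longrightarrow>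
      (\<exists>(B :: real) (C :: real) (p :: nat).
        \<forall>(G :: wgraph) (k :: nat) (a :: nat) (D :: nat) (n :: nat).
          simple_graph G \<and> n = size_of G \<and> poly_bounded b G \<and>
          edge_connected k G \<and> real k \<ge> c0 * ln (real n) \<and>
          D = hop_diameter G \<and> D \<le> D0 \<and>
          approximates (\<alpha> * ln (real n)) a k
          \<longrightarrow>
          respects_bandwidth B A G a \<and>
          computes_mst_within A G a
            (C * ln (real n) ^ p *
              min (sqrt (real n / real k) + real n powr (real D / (2 * real D + 1)))
                  (real n / real k))
            (1 - 1 / real n powr c)))"
proof (rule exI[of _ mst_algorithm], rule exI[of _ 1], intro conjI allI impI)
  fix D0 b :: nat and c0 \<alpha> :: real
  assume c0: "0 < c0"
  \<comment> \<open>\<open>?B\<close> is twice 16 * (b + 1) + 56, since the bit length of n is at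
    most 2 * log 2 n. The power of 3 in \<open>?C\<close> replaces the bit length by 3 * ln n, which
    is possible because ln 2 is at least 2 / 3.\<close>
  let ?B = "32 * (real b + 1) + 112" and ?C = "round_const \<alpha> (b + 2) D0 * 3 ^ (10 + 2 * D0)"
  show "\<exists>B C p. \<forall>G k a D n. simple_graph G \<and> n = size_of G \<and> poly_bounded b G \<and>
          edge_connected k G \<and> real k \<ge> c0 * ln (real n) \<and> D = hop_diameter G \<and> D \<le> D0 \<and>
          approximates (\<alpha> * ln (real n)) a k \<longrightarrow>
          respects_bandwidth B mst_algorithm G a \<and>
          computes_mst_within mst_algorithm G a (C * ln (real n) ^ p *
              min (sqrt (real n / real k) + real n powr (real D / (2 * real D + 1))) (real n / real k))
            (1 - 1 / real n powr 1)"
  proof (rule exI[of _ ?B], rule exI[of _ ?C], rule exI[of _ "10 + 2 * D0"], intro allI impI, elim conjE)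
    fix G k a D n
    assume G: "simple_graph G" "n = size_of G" "poly_bounded b G" "edge_connected k G"
      and k: "c0 * ln (real n) \<le> real k" and D: "D = hop_diameter G" "D \<le> D0"
      and ap: "approximates (\<alpha> * ln (real n)) a k"
    define L where "L = bitlen n"
    \<comment> \<open>L * (b + 1) bits suffice for n ^ b and for n separately; three more bits make
      room for 2 * X + 2 with X = n ^ b + n.\<close>
    define l where "l = L * (b + 1) + 3"
    have n2: "2 \<le> n" using G by (simp add: edge_connected_def)
    then have ln_pos: "0 < ln (real n)" by simp
    have "0 < c0 * ln (real n)" using c0 ln_pos by simp
    then have k_pos: "0 < k" using k by linarith
    have nL: "n < 2 ^ L" unfolding L_def by (rule less_bitlen)
    have "connects (edges G) (nodes G)"
      using G(4) k_pos unfolding edge_connected_def by (metis Diff_empty card.empty empty_subsetI)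
    then interpret connected_network G "int n ^ b + int n" k
      by unfold_locales (use G k_pos in \<open>auto simp: poly_bounded_def intro: add_increasing2 simp flip: of_nat_power\<close>)
    have X: "2 * (int n ^ b + int n) + 2 \<le> 2 ^ l"
    proof -
      have "n ^ b \<le> (2 ^ L) ^ b" using nL by (intro power_mono) auto
      also have "\<dots> \<le> 2 ^ (L * (b + 1))" by (simp add: power_mult[symmetric])
      finally have "n ^ b \<le> 2 ^ (L * (b + 1))" .
      moreover have "n \<le> 2 ^ (L * (b + 1))"
        using less_imp_le[OF nL] by (rule order_trans) (intro power_increasing, simp_all)
      moreover have "(1 :: nat) \<le> 2 ^ (L * (b + 1))" by simp
      moreover have "2 * (x + y) + 2 \<le> 8 * z" if "x \<le> z" "y \<le> z" "1 \<le> z" for x y z :: nat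
        using that by simp
      ultimately have "2 * (n ^ b + n) + 2 \<le> 8 * 2 ^ (L * (b + 1))" by blast
      also have "\<dots> = 2 ^ l" by (simp add: l_def power_add)
      finally have "int (2 * (n ^ b + n) + 2) \<le> int (2 ^ l)" by (simp only: of_nat_le_iff)
      then show ?thesis by simp
    qed
    have L1: "1 \<le> real L" using bitlen_pos G(2) by (simp add: L_def)
    have log1: "1 \<le> log 2 (real n)" using n2 by (simp add: le_log_iff)
    have Llog: "real L \<le> 2 * log 2 (real n)" using bitlen_le_log[of n] n2 log1 unfolding L_def by linarith
    have Lln: "real L \<le> 3 * ln (real n)"
    proof -
      have "2 / 3 * log 2 (real n) \<le> ln 2 * log 2 (real n)"
        using ln2_ge_two_thirds log1 by (intro mult_right_mono) auto
      also have "\<dots> = ln (real n)" by (simp add: log_def)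
      finally show ?thesis using Llog by simp
    qed
    have lnL: "ln (real n) \<le> real L"
      using less_exp_bitlen[of n] n2 by (metis L_def less_imp_le ln_exp ln_less_cancel_iff exp_gt_zero less_le_trans of_nat_0_less_iff pos2)
    have \<alpha>: "0 < \<alpha>"
    proof (rule ccontr)
      assume "\<not> 0 < \<alpha>"
      then have "\<alpha> * (ln (real n) * real a) \<le> 0" using ln_pos by (intro mult_nonpos_nonneg) auto
      then show False using ap k_pos by (simp add: approximates_def mult.assoc)
    qed
    have a: "real a \<le> \<alpha> * real L * real k" "real k \<le> \<alpha> * real L * real a"
      using ap lnL \<alpha> unfolding approximates_def
      by (meson mult_left_mono mult_right_mono less_imp_le of_nat_0_le_iff order_trans)+
    have "real (8 * (2 * l + 1)) = 16 * (real b + 1) * real L + 56" by (simp add: l_def algebra_simps)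
    also have "\<dots> \<le> (16 * (real b + 1) + 56) * real L" using L1 by (simp add: algebra_simps)
    also have "\<dots> \<le> (16 * (real b + 1) + 56) * (2 * log 2 (real n))" using Llog by (intro mult_left_mono) auto
    finally have "real (8 * (2 * l + 1)) \<le> ?B * log 2 (real (size_of G))" by (simp add: G(2) algebra_simps)
    from mst_algorithm_bandwidth[OF X this] have bw: "respects_bandwidth ?B mst_algorithm G a" .
    let ?m = "min (sqrt (real n / real k) + real n powr (real D / (2 * real D + 1))) (real n / real k)"
    have "computes_mst_within mst_algorithm G a (round_const \<alpha> (b + 2) D0 * real L ^ (10 + 2 * D0) * ?m) (1 - 1 / real n)"
      using mst_algorithm_time[OF \<alpha> a[unfolded L_def G(2)] D(2)[unfolded D(1)], of b l] X G
      by (simp add: L_def D(1) poly_bounded_def)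
    moreover have "round_const \<alpha> (b + 2) D0 * real L ^ (10 + 2 * D0) * ?m \<le> ?C * ln (real n) ^ (10 + 2 * D0) * ?m"
    proof -
      have "real L ^ (10 + 2 * D0) \<le> (3 * ln (real n)) ^ (10 + 2 * D0)" using Lln by (intro power_mono) auto
      also have "\<dots> = 3 ^ (10 + 2 * D0) * ln (real n) ^ (10 + 2 * D0)" by (rule power_mult_distrib)
      finally have "round_const \<alpha> (b + 2) D0 * real L ^ (10 + 2 * D0) \<le>
          round_const \<alpha> (b + 2) D0 * (3 ^ (10 + 2 * D0) * ln (real n) ^ (10 + 2 * D0))"
        using \<alpha> by (intro mult_left_mono) (auto simp: round_const_def intro!: add_nonneg_nonneg)
      then show ?thesis by (intro mult_right_mono) (auto simp: mult.assoc)
    qed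
    ultimately have "computes_mst_within mst_algorithm G a (?C * ln (real n) ^ (10 + 2 * D0) * ?m) (1 - 1 / real n powr 1)"
      unfolding computes_mst_within_def using n2 by (force intro: order_trans)
    with bw show "respects_bandwidth ?B mst_algorithm G a \<and>
        computes_mst_within mst_algorithm G a (?C * ln (real n) ^ (10 + 2 * D0) * ?m) (1 - 1 / real n powr 1)" by blast
  qed
qed simp

end
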